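(* Let $k\geqslant1$ and let $\chi^{\vec\lambda}_{\mathcal{U}_k}$ be the irreducible character of $\mathcal{U}_k$ indexed by $\vec\lambda\in I_k$, i.e. the character of $W^{\vec\lambda}_{\mathcal{U}_k}$. For $\vec\mu\in I_k$, let $d_{\vec\mu}\in\mathcal{U}_k$ be any element with $\mathsf{cycletype}(d_{\vec\mu})=\vec\mu$. Then $$\chi^{\vec\lambda}_{\mathcal{U}_k}(d_{\vec\mu})=\big\langle \mathbf{s}_{\vec\lambda}[\mathbf{E}],\ \mathbf{p}_{\vec\mu}[\mathbf{X}]\big\rangle .$$ As a consequence, $$\phi_{\mathcal{U}_k}\big(\chi^{\vec\lambda}_{\mathcal{U}_k}\big)=\mathbf{s}_{\vec\lambda}[\mathbf{E}].$$
   Context: **The monoid.** $[k]=\{1,\dots,k\}$, $[\overline{k}]=\{\overline1,\dots,\overline k\}$, $\overline{\overline a}=a$, $\overline{B}=\{\overline a:a\in B\}$. $\mathcal{U}_k$ is the set of uniform block permutations: set partitions $d$ of $[k]\cup[\overline k]$ with $|B\cap[k]|=|B\cap[\overline k]|$ for every block $B$. $\mathsf{top}(d)$ has blocks $B\cap[k]$, $\mathsf{bot}(d)$ has blocks $\overline{B}\cap[k]$; $d$ is also viewed as the bijection $\mathsf{top}(d)\to\mathsf{bot}(d)$, $B\cap[k]\mapsto\overline B\cap[k]$. Product $dd'$: stack the two-row diagram of $d$ on top of that of $d'$, identify bottom vertex $\overline i$ of $d$ with top vertex $i$ of $d'$, take connected components, delete the middle vertices; $\mathcal{U}_k$ is a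 finite monoid. For a set partition $\pi$ of $[k]$, $e_\pi=\{A\cup\overline A:A\in\pi\}$ (these are all the idempotents), $G_{e_\pi}=\{d:\mathsf{top}(d)=\mathsf{bot}(d)=\pi\}$ is a group with identity $e_\pi$ permuting the blocks of each size, and $\mathsf{type}(\pi)$ is the partition of block sizes. **Indices.** $I_k=\{(\lambda^{(1)},\dots,\lambda^{(k)}):\lambda^{(i)}\text{ partitions},\ \sum_i i|\lambda^{(i)}|=k\}$; $\overrightarrow{\mathsf{type}}(\vec\lambda)=(1^{a_1}\cdots k^{a_k})$, $a_i=|\lambda^{(i)}|$. For $\lambda=(1^{a_1}\cdots k^{a_k})\vdash k$, $\pi_\lambda$ is the set partition into blocks of consecutive integers whose sizes, from left to right, are $a_1$ ones, then $a_2$ twos, etc.; $G_\lambda=G_{e_{\pi_\lambda}}\simeq\mathfrak{S}_{a_1}\times\cdots\times\mathfrak{S}_{a_k}$. **Cycle type.** For $x\in\mathcal{U}_k$, $x^\omega$ is the unique idempotent among the positive powers of $x$, and $x^{\omega+1}=x^\omega x\in G_{x^\omega}$. If $x^\omega=e_\pi$, then $\mathsf{cycletype}(x)=(\mu^{(1)},\dots,\mu^{(k)})$ where $\mu^{(i)}$ is the cycle type of the permutation induced by $x^{\omega+1}$ on the blocks of $\pi$ of size $i$. **Irreducible modules.** With $\lambda=\overrightarrow{\mathsf{type}}(\vec\lambda)$, $V^{\vec\lambda}_{G_\lambda}$ is the irreducible $G_\lambda$-representation that is the tensor product of the Specht modules indexed by $\lambda^{(i)}$ for the symmetric group on the blocks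 of size $i$ of $\pi_\lambda$. $L_\lambda=\{d:\mathsf{bot}(d)=\pi_\lambda\}$, with $m\odot\ell=m\ell$ if $m\ell\in L_\lambda$ and $0$ otherwise, and $W^{\vec\lambda}_{\mathcal{U}_k}=\mathbb{C}L_\lambda\otimes_{\mathbb{C}G_\lambda}V^{\vec\lambda}_{G_\lambda}$ with $d\cdot(\ell\otimes v)=(d\odot\ell)\otimes v$. **Symmetric functions.** $\mathbf X=X_1,X_2,\dots$ are alphabets; $\mathsf{Sym}^*_{\mathbf X}=\mathbb{C}[p_i[X_j]:i,j\geqslant1]$ with $\deg p_i[X_j]=ij$, and $\mathsf{Sym}^*_{\mathbf X,k}$ is its degree $k$ part. For a partition $\mu=(1^{a_1}\cdots r^{a_r})$, $p_\mu[X_j]=\prod_i p_i[X_j]^{a_i}$ and $z_\mu=\prod_i i^{a_i}a_i!$; $\mathbf p_{\vec\mu}[\mathbf X]=\prod_i p_{\mu^{(i)}}[X_i]$, $\mathbf z_{\vec\mu}=\prod_i z_{\mu^{(i)}}$. The scalar product is $\langle\mathbf p_{\vec\lambda}[\mathbf X],\mathbf p_{\vec\mu}[\mathbf X]\rangle=\mathbf z_{\vec\mu}$ if $\vec\lambda=\vec\mu$ and $0$ otherwise. For $r\geqslant1$, $$E_r=\sum_{\vec\mu\in I_r}\frac{\mathbf p_{\vec\mu}[\mathbf X]}{\mathbf z_{\vec\mu}}=\sum_{(1^{a_1}\cdots r^{a_r})\vdash r}s_{a_1}[X_1]\cdots s_{a_r}[X_r],$$ with $s_a$ the Schur function of a one-row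 partition. Plethysm: for $A\in\mathsf{Sym}^*_{\mathbf X}$, $p_m[A]$ is obtained from $A$ (written in power sums) by replacing each $p_r[X_i]$ with $p_{mr}[X_i]$, and $f[A]$ for a symmetric function $f$ is obtained by writing $f$ as a polynomial in the $p_m$ and replacing $p_m$ by $p_m[A]$. Finally $\mathbf s_{\vec\lambda}[\mathbf E]=s_{\lambda^{(1)}}[E_1]s_{\lambda^{(2)}}[E_2]\cdots s_{\lambda^{(k)}}[E_k]$. **Frobenius map.** A class function on $\mathcal{U}_k$ is a function $\mathcal{U}_k\to\mathbb{C}$ constant on elements of equal cycle type (characters are class functions). For a class function $\psi$, $\phi_{\mathcal{U}_k}(\psi)=\sum_{\vec\mu\in I_k}\psi(d_{\vec\mu})\,\mathbf p_{\vec\mu}[\mathbf X]/\mathbf z_{\vec\mu}\in\mathsf{Sym}^*_{\mathbf X,k}$. *)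

theory Defs
  imports
    "HOL-Library.Poly_Mapping"
    "HOL-Library.Multiset"
    "HOL-Library.Disjoint_Sets"
    "HOL-Library.FuncSet"
    "HOL-Combinatorics.Permutations"
    "HOL-Combinatorics.Orbits"
    "HOL-Algebra.Group"
    "Jordan_Normal_Form.Determinant"
begin

section \<open>Partitions and multipartitions\<close>

text \<open>An integer partition is the multiset of its (positive) parts.\<close>

definition is_partition :: "nat multiset \<Rightarrow> bool" where
  "is_partition \<mu> \<longleftrightarrow> 0 \<notin># \<mu>"

definition partitions :: "nat \<Rightarrow> nat multiset set" where
  "partitions n = {\<mu>. is_partition \<mu> \<and> \<Sum>\<^sub># \<mu> = n}"

text \<open>The parts in weakly decreasing order; \<open>parts \<mu> ! r\<close> is the part of index \<open>r + 1\<close>.\<close>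

definition parts :: "nat multiset \<Rightarrow> nat list" where
  "parts \<mu> = rev (sorted_list_of_multiset \<mu>)"

definition z_part :: "nat multiset \<Rightarrow> nat" where
  "z_part \<mu> = (\<Prod>i\<in>set_mset \<mu>. i ^ count \<mu> i * fact (count \<mu> i))"

text \<open>A \<open>k\<close>-tuple of partitions is a function on \<open>nat\<close> that is the empty partition outside
  \<open>{1..k}\<close>; this makes tuples extensional. \<open>mparts k\<close> is the index set $I_k$.\<close>

definition mparts :: "nat \<Rightarrow> (nat \<Rightarrow> nat multiset) set" where
  "mparts k = {\<Lambda>. (\<forall>i. is_partition (\<Lambda> i)) \<and> (\<forall>i. i \<notin> {1..k} \<longrightarrow> \<Lambda> i = {#})
     \<and> (\<Sum>i=1..k. i * \<Sum>\<^sub># (\<Lambda> i)) = k}"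

definition vec_type :: "nat \<Rightarrow> (nat \<Rightarrow> nat multiset) \<Rightarrow> nat multiset" where
  "vec_type k \<Lambda> = (\<Sum>i=1..k. replicate_mset (\<Sum>\<^sub># (\<Lambda> i)) i)"

definition z_vec :: "nat \<Rightarrow> (nat \<Rightarrow> nat multiset) \<Rightarrow> nat" where
  "z_vec k \<mu> = (\<Prod>i=1..k. z_part (\<mu> i))"

text \<open>A sum over an infinite set is \<open>0\<close> in HOL; the sums over \<open>partitions n\<close> and \<open>mparts k\<close>
  below are genuine.\<close>

lemma finite_partitions: "finite (partitions n)"
proof -
  have sz: "size \<mu> \<le> \<Sum>\<^sub># \<mu>" if "0 \<notin># \<mu>" for \<mu> :: "nat multiset"
    using that by (induction \<mu>) auto
  have "partitions n \<subseteq> mset ` {xs. set xs \<subseteq> {..n} \<and> length xs \<le> n}"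
  proof
    fix \<mu> assume \<mu>: "\<mu> \<in> partitions n"
    obtain xs where xs: "\<mu> = mset xs" by (metis ex_mset)
    have "set xs \<subseteq> {..n}"
      using \<mu> xs by (auto simp: partitions_def member_le_sum_list sum_mset_sum_list)
    moreover have "length xs \<le> n"
      using \<mu> xs sz[of \<mu>] by (auto simp: partitions_def is_partition_def)
    ultimately show "\<mu> \<in> mset ` {xs. set xs \<subseteq> {..n} \<and> length xs \<le> n}"
      using xs by blast
  qed
  then show ?thesis
    by (rule finite_subset) (intro finite_imageI finite_lists_length_le finite_atMost)
qed

lemma finite_mparts: "finite (mparts k)"
proof -
  have "mparts k \<subseteq> {\<Lambda>. \<forall>i. (i \<in> {1..k} \<longrightarrow> \<Lambda> i \<in> (\<Union>n\<le>k. partitions n))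
          \<and> (i \<notin> {1..k} \<longrightarrow> \<Lambda> i = {#})}"
  proof (intro subsetI CollectI allI conjI impI)
    fix \<Lambda> i assume \<Lambda>: "\<Lambda> \<in> mparts k" and i: "i \<in> {1..k}"
    have "i * \<Sum>\<^sub># (\<Lambda> i) \<le> (\<Sum>i=1..k. i * \<Sum>\<^sub># (\<Lambda> i))"
      using i by (intro member_le_sum) auto
    moreover have "\<Sum>\<^sub># (\<Lambda> i) \<le> i * \<Sum>\<^sub># (\<Lambda> i)"
      using mult_le_mono1[of 1 i "\<Sum>\<^sub># (\<Lambda> i)"] i by (simp del: sum_mset_distrib_left)
    ultimately have "\<Sum>\<^sub># (\<Lambda> i) \<le> k"
      using \<Lambda> by (auto simp: mparts_def)
    then show "\<Lambda> i \<in> (\<Union>n\<le>k. partitions n)"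
      using \<Lambda> by (auto simp: mparts_def partitions_def)
  qed (auto simp: mparts_def)
  then show ?thesis
    by (rule finite_subset) (intro finite_set_of_finite_funs, auto intro: finite_partitions)
qed

section \<open>The monoid of uniform block permutations\<close>

text \<open>The vertex \<open>i\<close> of the top row is \<open>Inl i\<close>, the vertex \<open>i\<close>-bar of the bottom row is \<open>Inr i\<close>.
  For a block \<open>B\<close>, the set \<open>Inl -` B\<close> is the intersection of \<open>B\<close> with $[k]$, and \<open>Inr -` B\<close> is
  the intersection of B-bar with $[k]$; the block itself is \<open>(Inl -` B) <+> (Inr -` B)\<close>.\<close>

type_synonym diagram = "(nat + nat) set set"

definition ubp :: "nat \<Rightarrow> diagram set" where
  "ubp k = {d. partition_on ({1..k} <+> {1..k}) d \<and>
               (\<forall>B\<in>d. card (Inl -` B) = card (Inr -` B))}"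

definition ubp_top :: "diagram \<Rightarrow> nat set set" where
  "ubp_top d = (\<lambda>B. Inl -` B) ` d"

definition ubp_bot :: "diagram \<Rightarrow> nat set set" where
  "ubp_bot d = (\<lambda>B. Inr -` B) ` d"

definition block_map :: "diagram \<Rightarrow> nat set \<Rightarrow> nat set" where
  "block_map d A = (THE C. A <+> C \<in> d)"

definition ubp_idem :: "nat set set \<Rightarrow> diagram" where
  "ubp_idem \<pi> = (\<lambda>A. A <+> A) ` \<pi>"

text \<open>The stacked diagram has vertices \<open>(row, i)\<close> with rows 0 (top of \<open>d\<close>), 1 (bottom of \<open>d\<close>
  identified with the top of \<open>d'\<close>) and 2 (bottom of \<open>d'\<close>).\<close>

definition upper_pos :: "nat + nat \<Rightarrow> nat \<times> nat" where
  "upper_pos = case_sum (\<lambda>i. (0, i)) (\<lambda>i. (1, i))"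

definition lower_pos :: "nat + nat \<Rightarrow> nat \<times> nat" where
  "lower_pos = case_sum (\<lambda>i. (1, i)) (\<lambda>i. (2, i))"

definition outer_pos :: "nat + nat \<Rightarrow> nat \<times> nat" where
  "outer_pos = case_sum (\<lambda>i. (0, i)) (\<lambda>i. (2, i))"

definition stack_edges :: "diagram \<Rightarrow> diagram \<Rightarrow> ((nat \<times> nat) \<times> (nat \<times> nat)) set" where
  "stack_edges d d' = (\<Union>B\<in>d. upper_pos ` B \<times> upper_pos ` B) \<union>
                      (\<Union>B\<in>d'. lower_pos ` B \<times> lower_pos ` B)"

definition ubp_mult :: "diagram \<Rightarrow> diagram \<Rightarrow> diagram" where
  "ubp_mult d d' =
     (\<lambda>C. outer_pos -` C) ` (Field (stack_edges d d') // (stack_edges d d')\<^sup>*) - {{}}"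

definition ubp_monoid :: "nat \<Rightarrow> diagram monoid" where
  "ubp_monoid k = \<lparr>carrier = ubp k, mult = ubp_mult, one = ubp_idem ((\<lambda>i. {i}) ` {1..k})\<rparr>"

text \<open>\<open>omega_power k x\<close> is the unique idempotent among the positive powers of \<open>x\<close>.\<close>

definition omega_power :: "nat \<Rightarrow> diagram \<Rightarrow> diagram" where
  "omega_power k x =
     (THE e. (\<exists>n::nat. n \<ge> 1 \<and> e = x [^]\<^bsub>ubp_monoid k\<^esub> n) \<and> ubp_mult e e = e)"

definition perm_cycle_type :: "('a \<Rightarrow> 'a) \<Rightarrow> 'a set \<Rightarrow> nat multiset" where
  "perm_cycle_type f X = image_mset card (mset_set (orbit f ` X))"

definition cycletype :: "nat \<Rightarrow> diagram \<Rightarrow> nat \<Rightarrow> nat multiset" where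
  "cycletype k x i =
     (let e = omega_power k x
      in perm_cycle_type (block_map (ubp_mult e x)) {A \<in> ubp_top e. card A = i})"

text \<open>\<open>std_set_partition \<alpha>\<close> is the set partition $\pi_\alpha$ into intervals whose lengths,
  from left to right, are the parts of \<open>\<alpha>\<close> in increasing order.\<close>

definition std_set_partition :: "nat multiset \<Rightarrow> nat set set" where
  "std_set_partition \<alpha> =
     (let xs = sorted_list_of_multiset \<alpha>
      in (\<lambda>j. {sum_list (take j xs) <.. sum_list (take (Suc j) xs)}) ` {..<length xs})"

definition max_subgroup :: "nat \<Rightarrow> nat set set \<Rightarrow> diagram set" where
  "max_subgroup k \<pi> = {d \<in> ubp k. ubp_top d = \<pi> \<and> ubp_bot d = \<pi>}"

section \<open>Free vector spaces, tensor products and traces\<close>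

text \<open>\<open>'a \<Rightarrow>\<^sub>0 complex\<close> is the complex vector space with basis \<open>'a\<close>; all vector spaces below are
  subspaces of such spaces, or quotients of subspaces.\<close>

definition smul :: "complex \<Rightarrow> ('a \<Rightarrow>\<^sub>0 complex) \<Rightarrow> ('a \<Rightarrow>\<^sub>0 complex)" where
  "smul c v = Poly_Mapping.map ((*) c) v"

lemma lookup_smul [simp]: "Poly_Mapping.lookup (smul c v) x = c * Poly_Mapping.lookup v x"
  by (simp add: smul_def Poly_Mapping.map.rep_eq when_def)

global_interpretation free: vector_space smul
  by standard (auto intro!: poly_mapping_eqI simp: lookup_add algebra_simps)

abbreviation basis_vec :: "'a \<Rightarrow> ('a \<Rightarrow>\<^sub>0 complex)" where
  "basis_vec x \<equiv> Poly_Mapping.single x 1"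

definition lin_ext :: "('a \<Rightarrow> ('b \<Rightarrow>\<^sub>0 complex)) \<Rightarrow> ('a \<Rightarrow>\<^sub>0 complex) \<Rightarrow> ('b \<Rightarrow>\<^sub>0 complex)" where
  "lin_ext F v = (\<Sum>x\<in>Poly_Mapping.keys v. smul (Poly_Mapping.lookup v x) (F x))"

text \<open>Pure tensors, under the identification of $\mathbb{C}A \otimes \mathbb{C}B$ with
  $\mathbb{C}(A \times B)$, respectively of a tensor product over \<open>i = 1, \<dots>, k\<close> of spaces
  $\mathbb{C}A_i$ with the space freely spanned by the (extensional) tuples.\<close>

definition tensor :: "('a \<Rightarrow>\<^sub>0 complex) \<Rightarrow> ('b \<Rightarrow>\<^sub>0 complex) \<Rightarrow> ('a \<times> 'b \<Rightarrow>\<^sub>0 complex)" where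
  "tensor u v =
     (\<Sum>x\<in>Poly_Mapping.keys u. \<Sum>y\<in>Poly_Mapping.keys v. Poly_Mapping.single (x, y) (Poly_Mapping.lookup u x * Poly_Mapping.lookup v y))"

definition tensor_fam :: "nat \<Rightarrow> (nat \<Rightarrow> ('a \<Rightarrow>\<^sub>0 complex)) \<Rightarrow> ((nat \<Rightarrow> 'a) \<Rightarrow>\<^sub>0 complex)" where
  "tensor_fam k v =
     (\<Sum>T\<in>Pi\<^sub>E {1..k} (\<lambda>i. Poly_Mapping.keys (v i)). Poly_Mapping.single T (\<Prod>i=1..k. Poly_Mapping.lookup (v i) (T i)))"

text \<open>\<open>basis_mod S N B\<close>: the cosets \<open>b + N\<close>, for \<open>b \<in> B\<close>, are distinct and form a (finite) basis
  of the quotient space \<open>S/N\<close>. \<open>trace_mod S N T\<close> is the trace of the endomorphism of \<open>S/N\<close>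
  induced by a linear map \<open>T\<close> with \<open>T ` S \<subseteq> S\<close> and \<open>T ` N \<subseteq> N\<close>.\<close>

definition is_coords_mod ::
    "('a \<Rightarrow>\<^sub>0 complex) set \<Rightarrow> ('a \<Rightarrow>\<^sub>0 complex) set \<Rightarrow> ('a \<Rightarrow>\<^sub>0 complex) \<Rightarrow>
     (('a \<Rightarrow>\<^sub>0 complex) \<Rightarrow> complex) \<Rightarrow> bool" where
  "is_coords_mod N B v c \<longleftrightarrow> (\<forall>b. b \<notin> B \<longrightarrow> c b = 0) \<and> v - (\<Sum>b\<in>B. smul (c b) b) \<in> N"

definition basis_mod ::
    "('a \<Rightarrow>\<^sub>0 complex) set \<Rightarrow> ('a \<Rightarrow>\<^sub>0 complex) set \<Rightarrow> ('a \<Rightarrow>\<^sub>0 complex) set \<Rightarrow> bool" where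
  "basis_mod S N B \<longleftrightarrow> finite B \<and> B \<subseteq> S \<and> (\<forall>v\<in>S. \<exists>!c. is_coords_mod N B v c)"

definition trace_mod ::
    "('a \<Rightarrow>\<^sub>0 complex) set \<Rightarrow> ('a \<Rightarrow>\<^sub>0 complex) set \<Rightarrow>
     (('a \<Rightarrow>\<^sub>0 complex) \<Rightarrow> ('a \<Rightarrow>\<^sub>0 complex)) \<Rightarrow> complex" where
  "trace_mod S N T =
     (let B = SOME B. basis_mod S N B
      in \<Sum>b\<in>B. (THE c. is_coords_mod N B (T b) c) b)"

section \<open>Specht modules\<close>

definition cells :: "nat multiset \<Rightarrow> (nat \<times> nat) set" where
  "cells \<alpha> = {(r, c). r < length (parts \<alpha>) \<and> c < parts \<alpha> ! r}"

text \<open>A tableau of shape \<open>\<alpha>\<close> on a set \<open>X\<close> with \<open>card X = \<Sum>\<^sub># \<alpha>\<close> is a bijection from the cells to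
  \<open>X\<close>. Its tabloid (class modulo row equivalence) is the list of the sets of entries of its rows.\<close>

definition tableaux :: "nat multiset \<Rightarrow> 'a set \<Rightarrow> (nat \<times> nat \<Rightarrow> 'a) set" where
  "tableaux \<alpha> X = {t. bij_betw t (cells \<alpha>) X}"

definition tabloid :: "nat multiset \<Rightarrow> (nat \<times> nat \<Rightarrow> 'a) \<Rightarrow> 'a set list" where
  "tabloid \<alpha> t = map (\<lambda>r. t ` {x \<in> cells \<alpha>. fst x = r}) [0..<length (parts \<alpha>)]"

definition column_group :: "nat multiset \<Rightarrow> 'a set \<Rightarrow> (nat \<times> nat \<Rightarrow> 'a) \<Rightarrow> ('a \<Rightarrow> 'a) set" where
  "column_group \<alpha> X t =
     {\<sigma>. \<sigma> permutes X \<and>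
         (\<forall>c. \<sigma> ` t ` {x \<in> cells \<alpha>. snd x = c} = t ` {x \<in> cells \<alpha>. snd x = c})}"

definition polytabloid :: "nat multiset \<Rightarrow> 'a set \<Rightarrow> (nat \<times> nat \<Rightarrow> 'a) \<Rightarrow> ('a set list \<Rightarrow>\<^sub>0 complex)" where
  "polytabloid \<alpha> X t =
     (\<Sum>\<sigma>\<in>column_group \<alpha> X t. smul (of_int (sign \<sigma>)) (basis_vec (tabloid \<alpha> (\<sigma> \<circ> t))))"

definition specht :: "nat multiset \<Rightarrow> 'a set \<Rightarrow> ('a set list \<Rightarrow>\<^sub>0 complex) set" where
  "specht \<alpha> X = free.span (polytabloid \<alpha> X ` tableaux \<alpha> X)"

section \<open>The irreducible modules and their characters\<close>

definition std_pi :: "nat \<Rightarrow> (nat \<Rightarrow> nat multiset) \<Rightarrow> nat set set" where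
  "std_pi k \<Lambda> = std_set_partition (vec_type k \<Lambda>)"

text \<open>\<open>V_mod k \<Lambda>\<close> is the tensor product, over \<open>i = 1, \<dots>, k\<close>, of the Specht modules for the
  symmetric groups on the blocks of size \<open>i\<close>.\<close>

definition V_mod :: "nat \<Rightarrow> (nat \<Rightarrow> nat multiset) \<Rightarrow> ((nat \<Rightarrow> nat set set list) \<Rightarrow>\<^sub>0 complex) set" where
  "V_mod k \<Lambda> = free.span (tensor_fam k `
     {v. \<forall>i\<in>{1..k}. v i \<in> specht (\<Lambda> i) {A \<in> std_pi k \<Lambda>. card A = i}})"

text \<open>In the product \<open>g g'\<close> the diagram \<open>g\<close> is on top, so \<open>block_map (ubp_mult g g')\<close> is
  \<open>block_map g' \<circ> block_map g\<close>. Hence the left action of a group element \<open>g\<close> on tabloids relabels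
  the blocks by the inverse of the top-to-bottom bijection \<open>block_map g\<close>.\<close>

definition G_act :: "nat \<Rightarrow> diagram \<Rightarrow>
    ((nat \<Rightarrow> nat set set list) \<Rightarrow>\<^sub>0 complex) \<Rightarrow> ((nat \<Rightarrow> nat set set list) \<Rightarrow>\<^sub>0 complex)" where
  "G_act k g = lin_ext (\<lambda>T. basis_vec
     (\<lambda>i\<in>{1..k}. map (\<lambda>R. inv_into (ubp_top g) (block_map g) ` R) (T i)))"

definition L_class :: "nat \<Rightarrow> nat set set \<Rightarrow> diagram set" where
  "L_class k \<pi> = {d \<in> ubp k. ubp_bot d = \<pi>}"

text \<open>The module $W$ is the quotient of \<open>W_num\<close>, the tensor product over the complex numbers of
  $\mathbb{C}L_\lambda$ and $V$, by the subspace \<open>W_rel\<close> of the relations that define the tensor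
  product over $\mathbb{C}G_\lambda$.\<close>

definition W_num :: "nat \<Rightarrow> (nat \<Rightarrow> nat multiset) \<Rightarrow>
    (diagram \<times> (nat \<Rightarrow> nat set set list) \<Rightarrow>\<^sub>0 complex) set" where
  "W_num k \<Lambda> = free.span
     {tensor (basis_vec l) v | l v. l \<in> L_class k (std_pi k \<Lambda>) \<and> v \<in> V_mod k \<Lambda>}"

definition W_rel :: "nat \<Rightarrow> (nat \<Rightarrow> nat multiset) \<Rightarrow>
    (diagram \<times> (nat \<Rightarrow> nat set set list) \<Rightarrow>\<^sub>0 complex) set" where
  "W_rel k \<Lambda> = free.span
     {tensor (basis_vec (ubp_mult l g)) v - tensor (basis_vec l) (G_act k g v) | l g v.
        l \<in> L_class k (std_pi k \<Lambda>) \<and> g \<in> max_subgroup k (std_pi k \<Lambda>) \<and> v \<in> V_mod k \<Lambda>}"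

definition W_act :: "nat \<Rightarrow> (nat \<Rightarrow> nat multiset) \<Rightarrow> diagram \<Rightarrow>
    (diagram \<times> (nat \<Rightarrow> nat set set list) \<Rightarrow>\<^sub>0 complex) \<Rightarrow>
    (diagram \<times> (nat \<Rightarrow> nat set set list) \<Rightarrow>\<^sub>0 complex)" where
  "W_act k \<Lambda> d = lin_ext (\<lambda>(l, T).
     if ubp_mult d l \<in> L_class k (std_pi k \<Lambda>) then basis_vec (ubp_mult d l, T) else 0)"

definition ubp_char :: "nat \<Rightarrow> (nat \<Rightarrow> nat multiset) \<Rightarrow> diagram \<Rightarrow> complex" where
  "ubp_char k \<Lambda> d = trace_mod (W_num k \<Lambda>) (W_rel k \<Lambda>) (W_act k \<Lambda> d)"

section \<open>Symmetric functions\<close>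

text \<open>\<open>('v \<Rightarrow>\<^sub>0 nat) \<Rightarrow>\<^sub>0 complex\<close> is the polynomial ring with variables \<open>'v\<close>. In \<open>sym\<close> the variable
  \<open>m\<close> is the power sum $p_m$; in \<open>symX\<close> the variable \<open>(i, j)\<close> is $p_i[X_j]$. (The variables with
  an index 0 are not used.)\<close>

type_synonym 'v cpoly = "('v \<Rightarrow>\<^sub>0 nat) \<Rightarrow>\<^sub>0 complex"
type_synonym sym = "nat cpoly"
type_synonym symX = "(nat \<times> nat) cpoly"

definition Var :: "'v \<Rightarrow> 'v cpoly" where
  "Var x = Poly_Mapping.single (Poly_Mapping.single x 1) 1"

definition subst :: "('v \<Rightarrow> 'w cpoly) \<Rightarrow> 'v cpoly \<Rightarrow> 'w cpoly" where
  "subst h f = (\<Sum>m\<in>Poly_Mapping.keys f. smul (Poly_Mapping.lookup f m) (\<Prod>x\<in>Poly_Mapping.keys m. h x ^ Poly_Mapping.lookup m x))"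

definition power_sum :: "nat multiset \<Rightarrow> sym" where
  "power_sum \<mu> = (\<Prod>m\<in>#\<mu>. Var m)"

text \<open>Schur functions by the Jacobi--Trudi determinant in the complete homogeneous symmetric
  functions, which are \<open>0\<close> in negative degrees and otherwise
  $h_n = \sum_{\mu \vdash n} p_\mu / z_\mu$.\<close>

definition complete_hom :: "int \<Rightarrow> sym" where
  "complete_hom n =
     (if n < 0 then 0
      else \<Sum>\<mu>\<in>partitions (nat n). smul (1 / of_nat (z_part \<mu>)) (power_sum \<mu>))"

definition schur :: "nat multiset \<Rightarrow> sym" where
  "schur \<alpha> =
     (let l = length (parts \<alpha>)
      in det (mat l l (\<lambda>(i, j). complete_hom (int (parts \<alpha> ! i) - int i + int j))))"

lemma schur_one_row: "a > 0 \<Longrightarrow> schur {#a#} = complete_hom (int a)"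
  by (simp add: schur_def parts_def det_single)

definition pX :: "nat \<Rightarrow> (nat \<Rightarrow> nat multiset) \<Rightarrow> symX" where
  "pX k \<mu> = (\<Prod>j=1..k. \<Prod>i\<in>#\<mu> j. Var (i, j))"

text \<open>The bilinear form is given on monomials: the monomial $\prod_{i,j} p_i[X_j]^{a_{ij}}$ is
  $\mathbf{p}_{\vec\mu}[\mathbf{X}]$, where $a_{ij}$ is the multiplicity of the part $i$ in
  $\mu^{(j)}$, and $\prod_{i,j} i^{a_{ij}} a_{ij}!$ is $\mathbf{z}_{\vec\mu}$; see
  \<open>scalar_pX\<close> below.\<close>

definition scalar :: "symX \<Rightarrow> symX \<Rightarrow> complex" where
  "scalar f g = (\<Sum>m\<in>Poly_Mapping.keys f \<inter> Poly_Mapping.keys g. Poly_Mapping.lookup f m * Poly_Mapping.lookup g m *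
     of_nat (\<Prod>(i, j)\<in>Poly_Mapping.keys m. i ^ Poly_Mapping.lookup m (i, j) * fact (Poly_Mapping.lookup m (i, j))))"

definition pleth_p :: "nat \<Rightarrow> symX \<Rightarrow> symX" where
  "pleth_p m A = subst (\<lambda>(r, i). Var (m * r, i)) A"

definition pleth :: "sym \<Rightarrow> symX \<Rightarrow> symX" where
  "pleth f A = subst (\<lambda>m. pleth_p m A) f"

definition E_fun :: "nat \<Rightarrow> symX" where
  "E_fun r = (\<Sum>\<mu>\<in>mparts r. smul (1 / of_nat (z_vec r \<mu>)) (pX r \<mu>))"

definition schur_E :: "nat \<Rightarrow> (nat \<Rightarrow> nat multiset) \<Rightarrow> symX" where
  "schur_E k \<Lambda> = (\<Prod>i=1..k. pleth (schur (\<Lambda> i)) (E_fun i))"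

text \<open>The Frobenius map, for class functions; \<open>SOME\<close> picks an element of each cycle type.\<close>

definition frobenius_map :: "nat \<Rightarrow> (diagram \<Rightarrow> complex) \<Rightarrow> symX" where
  "frobenius_map k \<psi> = (\<Sum>\<mu>\<in>mparts k.
     smul (\<psi> (SOME d. d \<in> ubp k \<and> cycletype k d = \<mu>) / of_nat (z_vec k \<mu>)) (pX k \<mu>))"

lemma prod_Var:
  fixes \<mu> :: "nat \<Rightarrow> nat multiset"
  shows "finite J \<Longrightarrow> (\<Prod>j\<in>J. \<Prod>i\<in>#\<mu> j. Var (i, j)) =
     Poly_Mapping.single (\<Sum>j\<in>J. \<Sum>i\<in>#\<mu> j. Poly_Mapping.single (i, j) (1::nat)) (1::complex)"
proof (induction J rule: finite_induct)
  case (insert j J)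
  have "(\<Prod>i\<in>#M. Var (i, j)) =
     Poly_Mapping.single (\<Sum>i\<in>#M. Poly_Mapping.single (i, j) (1::nat)) (1::complex)"
    for M :: "nat multiset"
    by (induction M) (auto simp: Var_def mult_single)
  then show ?case
    using insert by (simp add: mult_single)
qed simp

lemma scalar_pX:
  assumes "\<mu> \<in> mparts k" "\<nu> \<in> mparts k"
  shows "scalar (pX k \<mu>) (pX k \<nu>) = (if \<mu> = \<nu> then of_nat (z_vec k \<mu>) else 0)"
proof -
  define M where "M = (\<lambda>\<mu> :: nat \<Rightarrow> nat multiset. \<Sum>j\<in>{1..k}. \<Sum>i\<in>#\<mu> j. Poly_Mapping.single (i, j) (1::nat))"
  have inner: "Poly_Mapping.lookup (\<Sum>i\<in>#N. Poly_Mapping.single (i, j) (1::nat)) (a, b) =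
      (if b = j then count N a else 0)" for N j a and b :: nat
    by (induction N) (auto simp: lookup_add lookup_single when_def)
  have lk: "Poly_Mapping.lookup (M \<mu>) (a, b) = (if b \<in> {1..k} then count (\<mu> b) a else 0)" for \<mu> a b
    unfolding M_def lookup_sum inner by simp
  have pX_eq: "pX k \<mu> = Poly_Mapping.single (M \<mu>) 1" for \<mu>
    unfolding pX_def M_def by (rule prod_Var) simp
  have inj: "\<mu> = \<nu>" if eq: "M \<mu> = M \<nu>"
  proof (intro ext multiset_eqI)
    fix j i
    show "count (\<mu> j) i = count (\<nu> j) i"
    proof (cases "j \<in> {1..k}")
      case True
      have "Poly_Mapping.lookup (M \<mu>) (i, j) = Poly_Mapping.lookup (M \<nu>) (i, j)"
        by (simp only: eq)
      with True show ?thesis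
        by (simp add: lk)
    next
      case False
      with assms show ?thesis
        by (simp add: mparts_def)
    qed
  qed
  have keys_M: "Poly_Mapping.keys (M \<mu>) = (\<lambda>(j, i). (i, j)) ` (SIGMA j:{1..k}. set_mset (\<mu> j))"
    by (auto simp: in_keys_iff lk image_iff split: if_splits)
  have "(\<Prod>(i, j)\<in>Poly_Mapping.keys (M \<mu>). i ^ Poly_Mapping.lookup (M \<mu>) (i, j) * fact (Poly_Mapping.lookup (M \<mu>) (i, j))) =
        (\<Prod>(j, i)\<in>(SIGMA j:{1..k}. set_mset (\<mu> j)). i ^ count (\<mu> j) i * fact (count (\<mu> j) i))"
    unfolding keys_M
    by (subst prod.reindex) (auto simp: inj_on_def lk intro!: prod.cong)
  also have "\<dots> = z_vec k \<mu>"
    unfolding z_vec_def z_part_def by (subst prod.Sigma) auto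
  finally have z: "(\<Prod>(i, j)\<in>Poly_Mapping.keys (M \<mu>). i ^ Poly_Mapping.lookup (M \<mu>) (i, j) * fact (Poly_Mapping.lookup (M \<mu>) (i, j)))
    = z_vec k \<mu>" .
  show ?thesis
  proof (cases "\<mu> = \<nu>")
    case True
    then show ?thesis
      using z by (simp add: scalar_def pX_eq)
  next
    case False
    then have "M \<mu> \<noteq> M \<nu>"
      using inj by blast
    then show ?thesis
      using False by (simp add: scalar_def pX_eq)
  qed
qed

end

theory Submission
 imports Defs "HOL-Combinatorics.Cycles"
begin

text \<open>Both sides of the character formula are the same sum over set partitions.

  For a partition \<open>\<alpha>\<close> let \<open>psi' \<alpha> X g\<close> be the alternating sum, over permutations \<open>w\<close> of the row
  indices, of the number of ordered set partitions of \<open>X\<close> with block sizes \<open>\<alpha>\<^sub>i - i + w i\<close> whose blocks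
  are all mapped to themselves by \<open>g\<close>. This is the Jacobi--Trudi determinant evaluated in permutation
  characters, and it is the character of the Specht module (\<open>chi_psi\<close>). No classification of the
  irreducible characters is used for this: the alternating sum has norm 1 (\<open>psi_norm\<close>), the Specht
  character is real and has norm 1 (\<open>schur_norm\<close>), their inner product is 1 (\<open>chi_psi_inner\<close>), and
  two real functions with these properties are equal.

  The module side. A diagram is determined by the relation \<open>Rd\<close> between unions of parts of its top
  and unions of parts of its bottom, and the product of diagrams is the composition of these
  relations (\<open>Rd_mult\<close>). A family of vectors of \<open>W\<close> with dual functionals, indexed by the tops
  \<open>\<rho>\<close> of the diagrams with bottom $\pi_\lambda$ and by a basis of \<open>V\<close>, computes the trace of \<open>d\<close>:
  only those \<open>\<rho>\<close> contribute whose blocks are permuted by \<open>d\<close>, and each contributes the product of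
  the \<open>psi'\<close> at the permutations of the blocks of each size (\<open>ubp_char_fixparts\<close>). Such a \<open>\<rho>\<close> is a
  coarsening of the blocks of $d^\omega$ that is stable under $d^{\omega+1}$, so the character is a
  sum over the stable set partitions of the set \<open>Y\<close> of these blocks (\<open>ubp_char_sm\<close>).

  The symmetric function side. Let \<open>\<sigma>\<close> be the permutation of \<open>Y\<close> and weigh a block by its size.
  Pairing a symmetric function with the power sum product of the cycle type of \<open>\<sigma>\<close> on a stable
  subset \<open>Z\<close> of \<open>Y\<close> gives a function \<open>phi\<close> of \<open>Z\<close>, and a product of symmetric functions becomes a
  convolution over the splittings of \<open>Z\<close> into two stable subsets (\<open>phi_mult\<close>). Newton's recursion
  for the complete symmetric functions then shows that $h_n[E_i]$ counts the stable set partitions of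
  \<open>Z\<close> into \<open>n\<close> parts of weight \<open>i\<close> (\<open>phi_h\<close>), and the Jacobi--Trudi determinant turns this into the
  same sum of products of \<open>psi'\<close> (\<open>scalar_schur_E\<close>).

  The second assertion follows from the first one because $\mathbf{s}_{\vec\lambda}[\mathbf{E}]$ is
  homogeneous of degree \<open>k\<close>, hence is the sum of its orthogonal projections to the
  $\mathbf{p}_{\vec\mu}$ (\<open>schur_E_expand\<close>), and because each cycle type occurs (\<open>ex_cycletype\<close>).\<close>

abbreviation lookup where "lookup \<equiv> Poly_Mapping.lookup"
abbreviation keys where "keys \<equiv> Poly_Mapping.keys"
abbreviation pinv :: "('a => 'a) => 'a => 'a" where "pinv \<equiv> Hilbert_Choice.inv"

section \<open>Linear maps and traces on quotients\<close>

definition lin :: "(('a \<Rightarrow>\<^sub>0 complex) => ('b \<Rightarrow>\<^sub>0 complex)) => bool" where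
 "lin f \<longleftrightarrow> (\<forall>u v. f (u + v) = f u + f v) \<and> (\<forall>c v. f (smul c v) = smul c (f v))"

definition linf :: "(('a \<Rightarrow>\<^sub>0 complex) => complex) => bool" where
 "linf f \<longleftrightarrow> (\<forall>u v. f (u + v) = f u + f v) \<and> (\<forall>c v. f (smul c v) = c * f v)"

lemma smul_minus1: "smul (-1) v = - v"
 by (rule poly_mapping_eqI) simp

lemma linD:
 assumes "lin f"
 shows "f (u + v) = f u + f v" "f (smul c v) = smul c (f v)" "f 0 = 0" "f (- v) = - f v"
  "f (u - v) = f u - f v"
proof -
 show add: "f (u + v) = f u + f v" for u v using assms by (simp add: lin_def)
 show sc: "f (smul c v) = smul c (f v)" for c v using assms by (simp add: lin_def)
 show "f 0 = 0" using add[of 0 0] by simp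
 show neg: "f (- v) = - f v" for v using sc[of "-1" v] by (simp add: smul_minus1)
 show "f (u - v) = f u - f v" using add[of u "- v"] neg[of v] by simp
qed

lemma lin_sum: "lin f ==> f (sum g A) = (\<Sum>x\<in>A. f (g x))"
 by (induction A rule: infinite_finite_induct) (auto simp: linD)

lemma linfD:
 assumes "linf f"
 shows "f (u + v) = f u + f v" "f (smul c v) = c * f v" "f 0 = 0" "f (- v) = - f v"
  "f (u - v) = f u - f v"
proof -
 show add: "f (u + v) = f u + f v" for u v using assms by (simp add: linf_def)
 show sc: "f (smul c v) = c * f v" for c v using assms by (simp add: linf_def)
 show "f 0 = 0" using add[of 0 0] by simp
 show neg: "f (- v) = - f v" for v using sc[of "-1" v] by (simp add: smul_minus1)
 show "f (u - v) = f u - f v" using add[of u "- v"] neg[of v] by simp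
qed

lemma linf_sum: "linf f ==> f (sum g A) = (\<Sum>x\<in>A. f (g x))"
 by (induction A rule: infinite_finite_induct) (auto simp: linfD)

lemma lin_span:
 assumes "lin f" "free.subspace W" "\<And>x. x \<in> A ==> f x \<in> W" "v \<in> free.span A"
 shows "f v \<in> W"
 using assms(4)
proof (induction rule: free.span_induct_alt)
 case base
 then show ?case using assms by (simp add: linD free.subspace_0)
next
 case (step c x y)
 then show ?case using assms by (simp add: linD free.subspace_add free.subspace_scale)
qed

lemma lin_eq_on_span:
 assumes "lin f" "lin g" "\<And>x. x \<in> A ==> f x = g x" "v \<in> free.span A"
 shows "f v = g v"
 using assms(4)
proof (induction rule: free.span_induct_alt)
 case base
 then show ?case using assms by (simp add: linD)
next
 case (step c x y)
 then show ?case using assms by (simp add: linD)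
qed

lemma linf_zero_on_span:
 assumes "linf f" "\<And>x. x \<in> A ==> f x = 0" "v \<in> free.span A"
 shows "f v = 0"
 using assms(3)
proof (induction rule: free.span_induct_alt)
 case base
 then show ?case using assms by (simp add: linfD)
next
 case (step c x y)
 then show ?case using assms by (simp add: linfD)
qed

lemma lin_ext_superset:
 assumes "finite A" "keys v \<subseteq> A"
 shows "lin_ext F v = (\<Sum>x\<in>A. smul (lookup v x) (F x))"
 unfolding lin_ext_def
 by (rule sum.mono_neutral_left) (use assms in "auto simp: in_keys_iff")

lemma lin_lin_ext: "lin (lin_ext F)"
 unfolding lin_def
proof (intro conjI allI)
 fix u v :: "'a \<Rightarrow>\<^sub>0 complex" and c :: complex
 let ?A = "keys u \<union> keys v"
 have k: "keys (u + v) \<subseteq> ?A" by (rule keys_add)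
 show "lin_ext F (u + v) = lin_ext F u + lin_ext F v"
  by (subst (1 2 3) lin_ext_superset[of ?A])
   (use k in "auto simp: lookup_add sum.distrib free.scale_left_distrib")
 have k: "keys (smul c v) \<subseteq> keys v" by (auto simp: in_keys_iff)
 show "lin_ext F (smul c v) = smul c (lin_ext F v)"
  by (subst (1 2) lin_ext_superset[of "keys v"])
   (use k in "auto simp: free.scale_sum_right")
qed

lemma lin_ext_basis [simp]: "lin_ext F (basis_vec x) = F x"
 by (simp add: lin_ext_def)

text \<open>The scalar-valued counterpart of \<open>lin_ext\<close>.\<close>

definition fun_ext :: "('a => complex) => ('a \<Rightarrow>\<^sub>0 complex) => complex" where
 "fun_ext F v = (\<Sum>x\<in>keys v. lookup v x * F x)"

lemma fun_ext_superset:
 assumes "finite A" "keys v \<subseteq> A"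
 shows "fun_ext F v = (\<Sum>x\<in>A. lookup v x * F x)"
 unfolding fun_ext_def
 by (rule sum.mono_neutral_left) (use assms in "auto simp: in_keys_iff")

lemma linf_fun_ext: "linf (fun_ext F)"
 unfolding linf_def
proof (intro conjI allI)
 fix u v :: "'a \<Rightarrow>\<^sub>0 complex" and c :: complex
 let ?A = "keys u \<union> keys v"
 have k: "keys (u + v) \<subseteq> ?A" by (rule keys_add)
 show "fun_ext F (u + v) = fun_ext F u + fun_ext F v"
  by (subst (1 2 3) fun_ext_superset[of ?A])
   (use k in "auto simp: lookup_add sum.distrib ring_distribs")
 have k: "keys (smul c v) \<subseteq> keys v" by (auto simp: in_keys_iff)
 show "fun_ext F (smul c v) = c * fun_ext F v"
  by (subst (1 2) fun_ext_superset[of "keys v"])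
   (use k in "auto simp: sum_distrib_left mult_ac")
qed

lemma fun_ext_basis [simp]: "fun_ext F (basis_vec x) = F x"
 by (simp add: fun_ext_def)

lemma poly_mapping_expand:
 "v = (\<Sum>x\<in>keys v. smul (lookup v x) (basis_vec x))"
proof (rule poly_mapping_eqI)
 fix k
 have "(\<Sum>x\<in>keys v. lookup v x * (1 when x = k)) = (\<Sum>x\<in>keys v. if x = k then lookup v x else 0)"
  by (intro sum.cong) auto
 then show "lookup v k = lookup (\<Sum>x\<in>keys v. smul (lookup v x) (basis_vec x)) k"
  by (simp add: lookup_sum lookup_single in_keys_iff)
qed

lemma lin_eqI:
 assumes "lin f" "lin g" "\<And>x. f (basis_vec x) = g (basis_vec x)"
 shows "f = g"
proof
 fix v
 show "f v = g v"
  by (subst (1 2) poly_mapping_expand) (simp add: lin_sum linD assms)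
qed

lemma linf_eqI:
 assumes "linf f" "linf g" "\<And>x. f (basis_vec x) = g (basis_vec x)"
 shows "f = g"
proof
 fix v
 show "f v = g v"
  by (subst (1 2) poly_mapping_expand) (simp add: linf_sum linfD assms)
qed

text \<open>Vectors \<open>b j\<close> that generate \<open>S\<close> modulo \<open>N\<close>, with functionals \<open>f j\<close> dual to them, form a basis of
  \<open>S/N\<close>. The trace is defined through a chosen basis \<open>B\<close>; expressing each of the two bases in the other
  and exchanging the sums gives the same number.\<close>

lemma trace_mod_dual:
 fixes f :: "'j => ('a \<Rightarrow>\<^sub>0 complex) => complex"
 assumes N: "free.subspace N" and J: "finite J"
  and bS: "\<And>j. j \<in> J ==> b j \<in> S"
  and lf: "\<And>j. j \<in> J ==> linf (f j)"
  and fN: "\<And>j n. j \<in> J ==> n \<in> N ==> f j n = 0"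
  and delta: "\<And>i j. i \<in> J ==> j \<in> J ==> f i (b j) = (if i = j then 1 else 0)"
  and gen: "\<And>v. v \<in> S ==> v - (\<Sum>j\<in>J. smul (f j v) (b j)) \<in> N"
  and lT: "lin T" and TS: "\<And>v. v \<in> S ==> T v \<in> S" and TN: "\<And>n. n \<in> N ==> T n \<in> N"
 shows "trace_mod S N T = (\<Sum>j\<in>J. f j (T (b j)))"
proof -
 have inj: "inj_on b J"
 proof (rule inj_onI)
  fix i j assume ij: "i \<in> J" "j \<in> J" "b i = b j"
  then have "f i (b i) = f i (b j)" by simp
  then show "i = j" using delta[of i i] delta[of i j] ij by (auto split: if_splits)
 qed
 have "basis_mod S N (b ` J)"
  unfolding basis_mod_def
 proof (intro conjI ballI)
  fix v assume v: "v \<in> S"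
  \<comment> \<open>the coordinates of \<open>v\<close> modulo \<open>N\<close> are the values of the dual functionals\<close>
  let ?c = "\<lambda>x. if x \<in> b ` J then f (the_inv_into J b x) v else 0"
  show "\<exists>!c. is_coords_mod N (b ` J) v c"
  proof (rule ex1I[of _ ?c])
   have "(\<Sum>x\<in>b ` J. smul (?c x) x) = (\<Sum>j\<in>J. smul (f j v) (b j))"
    by (subst sum.reindex[OF inj]) (auto simp: the_inv_into_f_f[OF inj] intro!: sum.cong)
   then show "is_coords_mod N (b ` J) v ?c"
    using gen[OF v] by (auto simp: is_coords_mod_def)
  next
   fix c assume c: "is_coords_mod N (b ` J) v c"
   then have n: "v - (\<Sum>j\<in>J. smul (c (b j)) (b j)) \<in> N"
    by (simp add: is_coords_mod_def sum.reindex[OF inj])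
   have "c (b i) = f i v" if i: "i \<in> J" for i
   proof -
    have "0 = f i v - (\<Sum>j\<in>J. c (b j) * f i (b j))"
     using fN[OF i n] lf[OF i] by (simp add: linfD linf_sum)
    also have "(\<Sum>j\<in>J. c (b j) * f i (b j)) = (\<Sum>j\<in>J. if i = j then c (b j) else 0)"
     by (intro sum.cong) (auto simp: delta i)
    also have "... = c (b i)" using J i by simp
    finally show ?thesis by simp
   qed
   then show "c = ?c"
    using c by (auto simp: is_coords_mod_def the_inv_into_f_f[OF inj] fun_eq_iff)
  qed
 qed (use J bS in auto)
 define B where "B = (SOME B. basis_mod S N B)"
 have "basis_mod S N B" unfolding B_def by (rule someI) fact
 then have fB: "finite B" and BS: "B \<subseteq> S" and uniq: "\<And>v. v \<in> S ==> \<exists>!c. is_coords_mod N B v c"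
  by (auto simp: basis_mod_def)
 define c where "c = (\<lambda>v. THE c. is_coords_mod N B v c)"
 have c: "is_coords_mod N B v (c v)" if "v \<in> S" for v
  unfolding c_def using theI'[OF uniq[OF that]] .
 have c_eq: "c v = d" if "v \<in> S" "is_coords_mod N B v d" for v d
  using uniq[OF that(1)] c[OF that(1)] that(2) by auto
 have cT: "c w x = (\<Sum>j\<in>J. f j w * c (b j) x)" if w: "w \<in> S" for w x
 proof -
  have "is_coords_mod N B w (\<lambda>x. \<Sum>j\<in>J. f j w * c (b j) x)"
   unfolding is_coords_mod_def
  proof (intro conjI allI impI)
   fix x assume "x \<notin> B"
   then show "(\<Sum>j\<in>J. f j w * c (b j) x) = 0"
    using c[OF bS] by (intro sum.neutral) (auto simp: is_coords_mod_def)
  next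
   have "(\<Sum>x\<in>B. smul (\<Sum>j\<in>J. f j w * c (b j) x) x) = (\<Sum>j\<in>J. smul (f j w) (\<Sum>x\<in>B. smul (c (b j) x) x))"
    by (simp add: free.scale_sum_left free.scale_sum_right) (rule sum.swap)
   then have "w - (\<Sum>x\<in>B. smul (\<Sum>j\<in>J. f j w * c (b j) x) x) =
    (w - (\<Sum>j\<in>J. smul (f j w) (b j))) + (\<Sum>j\<in>J. smul (f j w) (b j - (\<Sum>x\<in>B. smul (c (b j) x) x)))"
    by (simp add: free.scale_right_diff_distrib sum_subtractf)
   also have "... \<in> N"
    using c[OF bS] gen[OF w]
    by (intro free.subspace_add free.subspace_sum free.subspace_scale N) (auto simp: is_coords_mod_def)
   finally show "w - (\<Sum>x\<in>B. smul (\<Sum>j\<in>J. f j w * c (b j) x) x) \<in> N" .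
  qed
  from c_eq[OF w this] show ?thesis by simp
 qed
 have "f j (T (b j)) = (\<Sum>x\<in>B. c (b j) x * f j (T x))" if j: "j \<in> J" for j
 proof -
  have "b j - (\<Sum>x\<in>B. smul (c (b j) x) x) \<in> N" using c[OF bS[OF j]] by (simp add: is_coords_mod_def)
  from fN[OF j TN[OF this]] show ?thesis
   by (simp add: linD[OF lT] lin_sum[OF lT] linfD[OF lf[OF j]] linf_sum[OF lf[OF j]])
 qed
 then have "(\<Sum>j\<in>J. f j (T (b j))) = (\<Sum>j\<in>J. \<Sum>x\<in>B. c (b j) x * f j (T x))" by simp
 also have "... = (\<Sum>x\<in>B. \<Sum>j\<in>J. c (b j) x * f j (T x))" by (rule sum.swap)
 also have "... = (\<Sum>x\<in>B. c (T x) x)"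
  by (intro sum.cong refl) (use TS BS in "auto simp: cT mult.commute")
 finally show ?thesis
  unfolding trace_mod_def Let_def B_def[symmetric] c_def by simp
qed

text \<open>The functionals are defined on the whole space, by extending a basis of the span; so they can be
  applied to vectors outside of the span.\<close>

lemma dual_family_exists:
 fixes P :: "('a \<Rightarrow>\<^sub>0 complex) set"
 assumes "finite F" "P \<subseteq> free.span F"
 obtains B f where "B \<subseteq> P" "finite B" "free.span B = free.span P"
  "\<And>b. linf (f b)" "\<And>b b'. b \<in> B ==> b' \<in> B ==> f b b' = (if b = b' then 1 else 0)"
  "\<And>v. v \<in> free.span P ==> v = (\<Sum>b\<in>B. smul (f b v) b)"
proof -
 obtain B where B: "B \<subseteq> P" "free.independent B" "P \<subseteq> free.span B"
  using free.maximal_independent_subset[of P] by metis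
 have fB: "finite B"
  using free.independent_span_bound[OF assms(1) B(2)] B(1) assms(2) by auto
 have sp: "free.span B = free.span P"
  using B by (metis free.span_mono free.span_minimal free.subspace_span subset_antisym)
 define X where "X = free.extend_basis B"
 have X: "free.independent X" "B \<subseteq> X" "free.span X = UNIV"
  unfolding X_def using B(2) by (auto simp: free.independent_extend_basis free.extend_basis_superset free.span_extend_basis)
 define f where "f = (\<lambda>b v. free.representation X v b)"
 have "linf (f b)" for b
  unfolding linf_def f_def using X
  by (auto simp: free.representation_add free.representation_scale)
 moreover have "f b b' = (if b = b' then 1 else 0)" if "b \<in> B" "b' \<in> B" for b b'
  using X that by (auto simp: f_def free.representation_basis)
 moreover have "v = (\<Sum>b\<in>B. smul (f b v) b)" if v: "v \<in> free.span P" for v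
 proof -
  have "free.representation X v = free.representation B v"
   using free.representation_extend[OF X(1), of v B] v sp X by auto
  then show ?thesis
   using free.sum_representation_eq[OF B(2), of v B] v sp fB by (simp add: f_def)
 qed
 ultimately show ?thesis using that B(1) fB sp by blast
qed

section \<open>Ordered set partitions fixed by a permutation\<close>

text \<open>Lists of disjoint sets with union \<open>X\<close> and prescribed sizes; the tabloids of shape \<open>\<alpha>\<close> are those
  with the sizes \<open>parts \<alpha>\<close>. Sizes are integers, so that the entries \<open>\<alpha>\<^sub>i - i + w i\<close> of a
  Jacobi--Trudi determinant can be used directly: a negative size admits no set.\<close>

fun otab :: "int list => 'a set => 'a set list set" where
 "otab [] X = (if X = {} then {[]} else {})"
| "otab (a # as) X = (\<Union>Z\<in>{Z. Z \<subseteq> X \<and> int (card Z) = a}. (#) Z ` otab as (X - Z))"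

text \<open>The value at \<open>g\<close> of the permutation character on \<open>otab as X\<close>, by recursion on the first block
  (see \<open>mchar_card\<close>).\<close>

fun mchar :: "int list => 'a set => ('a => 'a) => int" where
 "mchar [] X g = (if X = {} then 1 else 0)"
| "mchar (a # as) X g = (\<Sum>Z | Z \<subseteq> X \<and> g ` Z = Z \<and> int (card Z) = a. mchar as (X - Z) g)"

lemma finite_otab: "finite X ==> finite (otab as X)"
 by (induction as arbitrary: X) auto

lemma mchar_card:
 "finite X ==> mchar as X g = int (card {T \<in> otab as X. \<forall>W\<in>set T. g ` W = W})"
proof (induction as arbitrary: X)
 case Nil
 have "{T \<in> otab [] X. \<forall>W\<in>set T. g ` W = W} = (if X = {} then {[]} else {})" by auto
 then show ?case by simp
next
 case (Cons a as)
 let ?I = "{Z. Z \<subseteq> X \<and> g ` Z = Z \<and> int (card Z) = a}"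
 have eq: "{T \<in> otab (a # as) X. \<forall>W\<in>set T. g ` W = W} =
   (\<Union>Z\<in>?I. (#) Z ` {T \<in> otab as (X - Z). \<forall>W\<in>set T. g ` W = W})"
  unfolding otab.simps
  apply (rule Set.set_eqI, rule iffI)
   apply clarify
   apply (rename_tac Z T)
   apply (rule_tac a=Z in UN_I)
   apply simp
   apply simp
  apply clarify
  apply (rename_tac Z T)
  apply (rule, rule_tac a=Z in UN_I)
   apply simp
   apply simp
  apply simp
  done
 have "card (\<Union>Z\<in>?I. (#) Z ` {T \<in> otab as (X - Z). \<forall>W\<in>set T. g ` W = W}) =
   (\<Sum>Z\<in>?I. card ((#) Z ` {T \<in> otab as (X - Z). \<forall>W\<in>set T. g ` W = W}))"
  by (rule card_UN_disjoint) (use Cons.prems in "auto simp: finite_otab")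
 also have "... = (\<Sum>Z\<in>?I. card {T \<in> otab as (X - Z). \<forall>W\<in>set T. g ` W = W})"
  by (intro sum.cong refl card_image) simp
 finally show ?case unfolding eq using Cons by simp
qed

lemma mchar_cong:
 "(\<And>x. x \<in> X ==> g x = h x) ==> mchar as X g = mchar as X h"
proof (induction as arbitrary: X)
 case (Cons a as)
 have "g ` Z = h ` Z" if "Z \<subseteq> X" for Z using Cons.prems that by (intro image_cong) auto
 then have eq: "{Z. Z \<subseteq> X \<and> g ` Z = Z \<and> int (card Z) = a} = {Z. Z \<subseteq> X \<and> h ` Z = Z \<and> int (card Z) = a}" by (metis (no_types, lifting))
 show ?case unfolding mchar.simps eq by (intro sum.cong refl Cons.IH) (use Cons.prems in auto)
qed auto

lemma mchar_zero: "finite X ==> sum_list as \<noteq> int (card X) ==> mchar as X g = 0"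
proof (induction as arbitrary: X)
 case (Cons a as)
 show ?case unfolding mchar.simps
 proof (intro sum.neutral ballI)
  fix Z assume Z: "Z \<in> {Z. Z \<subseteq> X \<and> g ` Z = Z \<and> int (card Z) = a}"
  then have "finite Z" "card Z \<le> card X" using Cons.prems(1) by (auto intro: finite_subset card_mono)
  then have "card (X - Z) + card Z = card X"
   using Z by (simp add: card_Diff_subset)
  moreover have "a = int (card Z)" using Z by simp
  ultimately have "sum_list as \<noteq> int (card (X - Z))" using Cons.prems(2) by simp
  then show "mchar as (X - Z) g = 0" using Cons.IH[of "X - Z"] Cons.prems(1) by simp
 qed
qed auto

lemma mchar_neg: "a \<in> set as ==> a < 0 ==> mchar as X g = 0"
proof (induction as arbitrary: X)
 case (Cons b as)
 show ?case unfolding mchar.simps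
  by (rule sum.neutral) (use Cons in fastforce)
qed simp

lemma mchar_inv:
 assumes "g permutes Y"
 shows "mchar as X (pinv g) = mchar as X g"
proof (induction as arbitrary: X)
 case (Cons a as)
 have "pinv g ` Z = Z \<longleftrightarrow> g ` Z = Z" for Z
  by (metis assms bij_image_Collect_eq image_inv_f_f permutes_inj permutes_surj image_f_inv_f)
 then show ?case using Cons by simp
qed auto

text \<open>A permutation that maps \<open>Z\<close> to itself is a pair of permutations of \<open>Z\<close> and of its complement.\<close>

lemma perm_split:
 fixes F :: "('a => 'a) => 'b::comm_monoid_add"
 assumes X: "finite X" "Z \<subseteq> X"
 shows "(\<Sum>g | g permutes X \<and> g ` Z = Z. F g) = (\<Sum>g1 | g1 permutes Z. \<Sum>g2 | g2 permutes (X - Z). F (g1 \<circ> g2))"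
proof -
 have "(\<Sum>g1 | g1 permutes Z. \<Sum>g2 | g2 permutes (X - Z). F (g1 \<circ> g2)) =
   (\<Sum>(g1, g2)\<in>{g1. g1 permutes Z} \<times> {g2. g2 permutes (X - Z)}. F (g1 \<circ> g2))"
  by (simp add: sum.cartesian_product)
 also have "... = (\<Sum>g | g permutes X \<and> g ` Z = Z. F g)"
 proof (rule sum.reindex_bij_witness[where j = "\<lambda>(g1, g2). g1 \<circ> g2" and i = "\<lambda>g. (perm_restrict g Z, perm_restrict g (X - Z))"])
  fix p assume "p \<in> {g1. g1 permutes Z} \<times> {g2. g2 permutes (X - Z)}"
  then obtain g1 g2 where p: "p = (g1, g2)" "g1 permutes Z" "g2 permutes (X - Z)" by auto
  have a: "g1 x = x" if "x \<notin> Z" for x using p that by (auto simp: permutes_def)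
  have b: "g2 x = x" if "x \<notin> X - Z" for x using p(3) that unfolding permutes_def by blast
  have c: "g2 x \<in> X - Z" if "x \<in> X - Z" for x using p(3) that by (metis permutes_in_image)
  have d: "g1 x \<in> Z" if "x \<in> Z" for x using p(2) that by (metis permutes_in_image)
  show "(\<lambda>g. (perm_restrict g Z, perm_restrict g (X - Z))) ((\<lambda>(g1, g2). g1 \<circ> g2) p) = p"
   unfolding p using a b c d by (auto simp: fun_eq_iff perm_restrict_def)
  have "g1 permutes X" "g2 permutes X" using p X by (auto intro: permutes_subset)
  then have "(g1 \<circ> g2) permutes X" by (rule permutes_compose[rotated])
  moreover have "(g1 \<circ> g2) ` Z = g1 ` Z" using b by (auto simp: image_comp intro!: image_cong)
  moreover have "g1 ` Z = Z" using p(2) by (rule permutes_image)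
  ultimately show "(\<lambda>(g1, g2). g1 \<circ> g2) p \<in> {g. g permutes X \<and> g ` Z = Z}" by (simp add: p)
  show "F ((\<lambda>(g1, g2). g1 \<circ> g2) p) = (case p of (g1, g2) => F (g1 \<circ> g2))" by (simp add: p)
 next
  fix g assume g: "g \<in> {g. g permutes X \<and> g ` Z = Z}"
  then have inj: "inj g" by (auto intro: permutes_inj)
  have gX: "g ` (X - Z) = X - Z"
   using g inj by (auto simp: image_set_diff permutes_image)
  have "bij_betw g Z Z" using g inj by (auto simp: bij_betw_def intro: inj_on_subset)
  then have 1: "perm_restrict g Z permutes Z"
   by (intro bij_imp_permutes) (auto simp: perm_restrict_def cong: bij_betw_cong)
  have "bij_betw g (X - Z) (X - Z)" using gX inj by (auto simp: bij_betw_def intro: inj_on_subset)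
  then have "bij_betw (perm_restrict g (X - Z)) (X - Z) (X - Z)"
   by (subst bij_betw_cong[of _ _ g]) (auto simp: perm_restrict_def)
  then have 2: "perm_restrict g (X - Z) permutes (X - Z)"
   by (rule bij_imp_permutes) (auto simp: perm_restrict_def)
  show "(perm_restrict g Z, perm_restrict g (X - Z)) \<in> {g1. g1 permutes Z} \<times> {g2. g2 permutes (X - Z)}"
   using 1 2 by simp
  have "g x = x" if "x \<notin> X" for x using g that by (auto simp: permutes_def)
  then show "(case (perm_restrict g Z, perm_restrict g (X - Z)) of (g1, g2) => g1 \<circ> g2) = g"
   using gX X by (auto simp: fun_eq_iff perm_restrict_def)
 qed
 finally show ?thesis by simp
qed

text \<open>By Burnside's lemma: the symmetric group acts transitively on the ordered set partitions of given sizes.\<close>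

lemma sum_mchar:
 "finite X ==> sum_list as = int (card X) ==> \<forall>a\<in>set as. a \<ge> 0 ==> (\<Sum>g | g permutes X. mchar as X g) = fact (card X)"
proof (induction as arbitrary: X)
 case Nil
 then have "X = {}" by simp
 then show ?case by (auto simp: permutes_empty)
next
 case (Cons a as)
 let ?P = "{Z. Z \<subseteq> X \<and> int (card Z) = a}"
 have fP: "finite ?P" "finite {g. g permutes X}" using Cons.prems by (auto simp: finite_permutations)
 have "(\<Sum>g | g permutes X. mchar (a # as) X g) =
   (\<Sum>g | g permutes X. \<Sum>Z\<in>?P. if g ` Z = Z then mchar as (X - Z) g else 0)"
  using fP by (intro sum.cong refl) (auto simp: sum.If_cases intro!: sum.cong)
 also have "... = (\<Sum>Z\<in>?P. \<Sum>g | g permutes X. if g ` Z = Z then mchar as (X - Z) g else 0)"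
  by (rule sum.swap)
 also have "... = (\<Sum>Z\<in>?P. fact (nat a) * fact (card X - nat a))"
 proof (intro sum.cong refl)
  fix Z assume Z: "Z \<in> ?P"
  have fZ: "finite Z" using Z Cons.prems finite_subset by auto
  have cZ: "card (X - Z) = card X - nat a" "card Z = nat a" using Z Cons.prems(1) fZ by (auto simp: card_Diff_subset)
  have "card Z \<le> card X" using Z Cons.prems(1) by (auto intro: card_mono)
  have "(\<Sum>g | g permutes X. if g ` Z = Z then mchar as (X - Z) g else 0) = (\<Sum>g | g permutes X \<and> g ` Z = Z. mchar as (X - Z) g)"
   using fP by (auto simp: sum.If_cases intro!: sum.cong)
  also have "... = (\<Sum>g1 | g1 permutes Z. \<Sum>g2 | g2 permutes (X - Z). mchar as (X - Z) (g1 \<circ> g2))"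
   by (rule perm_split) (use Z Cons.prems in auto)
  also have "... = (\<Sum>g1 | g1 permutes Z. \<Sum>g2 | g2 permutes (X - Z). mchar as (X - Z) g2)"
  proof (intro sum.cong refl mchar_cong)
   fix g1 g2 x assume "g1 \<in> {g1. g1 permutes Z}" "g2 \<in> {g2. g2 permutes (X - Z)}" "x \<in> X - Z"
   then have "g2 x \<notin> Z" by (metis Diff_iff mem_Collect_eq permutes_in_image)
   then show "(g1 \<circ> g2) x = g2 x" using `g1 \<in> _` by (auto simp: permutes_def)
  qed
  also have "(\<Sum>g2 | g2 permutes (X - Z). mchar as (X - Z) g2) = fact (card (X - Z))"
   by (rule Cons.IH) (use Cons.prems Z cZ `card Z \<le> card X` in "auto simp: of_nat_diff")
  finally show "(\<Sum>g | g permutes X. if g ` Z = Z then mchar as (X - Z) g else 0) = fact (nat a) * fact (card X - nat a)"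
   using cZ fZ by (simp add: card_permutations)
 qed
 also have "... = int (card ?P) * (fact (nat a) * fact (card X - nat a))" by simp
 also have "?P = {Z. Z \<subseteq> X \<and> card Z = nat a}" using Cons.prems by auto
 also have "card ... = card X choose (nat a)" by (rule n_subsets) fact
 also have "int (card X choose (nat a)) * (fact (nat a) * fact (card X - nat a)) = fact (card X)"
 proof -
  have "sum_list as \<ge> 0" using Cons.prems by (intro sum_list_nonneg) auto
  then have le: "nat a \<le> card X" using Cons.prems by auto
  have "int (fact (nat a) * fact (card X - nat a) * (card X choose nat a)) = int (fact (card X))"
   using binomial_fact_lemma[OF le] by presburger
  then show ?thesis by (simp add: algebra_simps)
 qed
 finally show ?case .
qed

text \<open>Compositions of length \<open>l\<close> with entries bounded by \<open>n\<close>, extended by zero so that they are determined by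
  their first \<open>l\<close> values.\<close>

definition box :: "nat => nat => (nat => nat) set" where
 "box l n = {\<beta>. (\<forall>i\<ge>l. \<beta> i = 0) \<and> (\<forall>i<l. \<beta> i \<le> n)}"

lemma finite_box: "finite (box l n)"
proof -
 have "box l n \<subseteq> {f. \<forall>x. (x \<in> {..<l} \<longrightarrow> f x \<in> {..n}) \<and> (x \<notin> {..<l} \<longrightarrow> f x = 0)}" by (auto simp: box_def)
 then show ?thesis by (rule finite_subset) (intro finite_set_of_finite_funs, auto)
qed

lemma sum_box_Suc:
 "(\<Sum>\<beta>\<in>box (Suc l) n. F \<beta>) = (\<Sum>b\<le>n. \<Sum>\<beta>\<in>box l n. F (case_nat b \<beta>))"
proof -
 have "(\<Sum>b\<le>n. \<Sum>\<beta>\<in>box l n. F (case_nat b \<beta>)) = (\<Sum>(b, \<beta>)\<in>{..n} \<times> box l n. F (case_nat b \<beta>))"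
  by (simp add: sum.cartesian_product)
 also have "... = (\<Sum>\<beta>\<in>box (Suc l) n. F \<beta>)"
  by (rule sum.reindex_bij_witness[where j = "\<lambda>(b, \<beta>). case_nat b \<beta>" and i = "\<lambda>\<beta>. (\<beta> 0, \<lambda>i. \<beta> (Suc i))"])
   (auto simp: box_def fun_eq_iff split: nat.splits)
 finally show ?thesis by simp
qed

text \<open>An ordered set partition that is fixed by \<open>g\<close> is cut by the invariant set \<open>Z\<close> into two fixed ones;
  \<open>\<beta>\<close> records the sizes inside \<open>Z\<close>.\<close>

lemma mchar_split:
 assumes "finite X" "Z \<subseteq> X" "g ` Z = Z" "g ` (X - Z) = X - Z" "card X \<le> n"
 shows "mchar (map \<alpha> [0..<l]) X g =
  (\<Sum>\<beta>\<in>box l n. mchar (map (\<lambda>i. int (\<beta> i)) [0..<l]) Z g * mchar (map (\<lambda>i. \<alpha> i - int (\<beta> i)) [0..<l]) (X - Z) g)"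
 using assms
proof (induction l arbitrary: X Z \<alpha>)
 case 0
 have "box 0 n = {\<lambda>_. 0}" by (auto simp: box_def)
 then show ?case using 0 by auto
next
 case (Suc l)
 have inj: "inj_on g X"
 proof -
  have "g ` X = X" using Suc.prems by (metis Diff_partition image_Un)
  then show ?thesis using Suc.prems(1) by (simp add: eq_card_imp_inj_on)
 qed
 have gdiff: "g ` (A - W) = A - W" if "W \<subseteq> A" "A \<subseteq> X" "g ` A = A" "g ` W = W" for A W
  using that inj by (metis inj_on_image_set_diff Diff_subset subset_trans)
 let ?I = "\<lambda>X. {W. W \<subseteq> X \<and> g ` W = W}"
 let ?\<alpha>' = "\<lambda>i. \<alpha> (Suc i)"
 have fin: "finite (?I Z)" "finite (?I (X - Z))" "finite (?I X)"
  using Suc.prems by (auto intro: finite_subset[of _ "Pow X"])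
 let ?F = "\<lambda>W1 W2 \<beta>. mchar (map (\<lambda>i. int (\<beta> i)) [0..<l]) (Z - W1) g * mchar (map (\<lambda>i. ?\<alpha>' i - int (\<beta> i)) [0..<l]) (X - Z - W2) g"
 have "mchar (map \<alpha> [0..<Suc l]) X g = (\<Sum>W | W \<subseteq> X \<and> g ` W = W \<and> int (card W) = \<alpha> 0. mchar (map ?\<alpha>' [0..<l]) (X - W) g)"
  by (simp only: map_upt_Suc mchar.simps)
 also have "... = (\<Sum>W\<in>?I X. if int (card W) = \<alpha> 0 then mchar (map ?\<alpha>' [0..<l]) (X - W) g else 0)"
  using fin by (auto simp: sum.If_cases intro!: sum.cong)
 also have "... = (\<Sum>(W1, W2)\<in>?I Z \<times> ?I (X - Z).
   if int (card W1) + int (card W2) = \<alpha> 0 then \<Sum>\<beta>\<in>box l n. ?F W1 W2 \<beta> else 0)"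
 proof (rule sum.reindex_bij_witness[where i = "\<lambda>(W1, W2). W1 \<union> W2" and j = "\<lambda>W. (W \<inter> Z, W - Z)"])
  fix W assume W: "W \<in> ?I X"
  show "(case (W \<inter> Z, W - Z) of (W1, W2) => W1 \<union> W2) = W" by auto
  have 1: "g ` (W \<inter> Z) = W \<inter> Z"
   using W Suc.prems inj_on_image_Int[OF inj, of W Z] by simp
  have 2: "g ` (W - Z) = W - Z"
  proof -
   have "W - Z = W - (W \<inter> Z)" by auto
   then show ?thesis using gdiff[of "W \<inter> Z" W] W 1 by simp
  qed
  show "(W \<inter> Z, W - Z) \<in> ?I Z \<times> ?I (X - Z)" using W 1 2 by (simp add: Diff_mono)
  have fW: "finite W" using W Suc.prems finite_subset by auto
  have "card W = card (W \<inter> Z) + card (W - Z)"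
   using fW by (metis card_Int_Diff)
  moreover have "mchar (map ?\<alpha>' [0..<l]) (X - W) g = (\<Sum>\<beta>\<in>box l n. ?F (W \<inter> Z) (W - Z) \<beta>)"
  proof -
   have e: "X - W - (Z - W) = X - Z - (W - Z)" "Z - W = Z - (W \<inter> Z)" by auto
   have "mchar (map ?\<alpha>' [0..<l]) (X - W) g = (\<Sum>\<beta>\<in>box l n. mchar (map (\<lambda>i. int (\<beta> i)) [0..<l]) (Z - W) g * mchar (map (\<lambda>i. ?\<alpha>' i - int (\<beta> i)) [0..<l]) (X - W - (Z - W)) g)"
   proof (rule Suc.IH)
    show "finite (X - W)" using Suc.prems by auto
    show "Z - W \<subseteq> X - W" using Suc.prems by auto
    have "g ` (Z - W \<inter> Z) = Z - W \<inter> Z" by (rule gdiff) (use 1 Suc.prems in auto)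
    then show "g ` (Z - W) = Z - W" by (simp add: e)
    have "g ` ((X - Z) - (W - Z)) = (X - Z) - (W - Z)" by (rule gdiff) (use 2 W Suc.prems in auto)
    then show "g ` (X - W - (Z - W)) = X - W - (Z - W)" unfolding e(1) .
    have "card (X - W) \<le> card X" using Suc.prems by (intro card_mono) auto
    then show "card (X - W) \<le> n" using Suc.prems by simp
   qed
   from this[unfolded e(1), unfolded e(2)] show ?thesis .
  qed
  ultimately show "(case (W \<inter> Z, W - Z) of (W1, W2) =>
    if int (card W1) + int (card W2) = \<alpha> 0 then \<Sum>\<beta>\<in>box l n. ?F W1 W2 \<beta> else 0) =
   (if int (card W) = \<alpha> 0 then mchar (map ?\<alpha>' [0..<l]) (X - W) g else 0)" by simp
 qed (use Suc.prems in auto)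
 also have "... = (\<Sum>W1\<in>?I Z. \<Sum>b\<le>n. if b = card W1 then \<Sum>W2\<in>?I (X - Z).
   (if int b + int (card W2) = \<alpha> 0 then \<Sum>\<beta>\<in>box l n. ?F W1 W2 \<beta> else 0) else 0)"
 proof -
  have "card W1 \<le> n" if "W1 \<in> ?I Z" for W1
   using that Suc.prems by (metis (mono_tags, lifting) card_mono le_trans mem_Collect_eq subset_trans)
  then show ?thesis
   by (auto simp: sum.cartesian_product[symmetric] intro!: sum.cong)
 qed
 also have "... = (\<Sum>b\<le>n. \<Sum>W1\<in>?I Z. if b = card W1 then \<Sum>W2\<in>?I (X - Z).
   (if int b + int (card W2) = \<alpha> 0 then \<Sum>\<beta>\<in>box l n. ?F W1 W2 \<beta> else 0) else 0)"
  by (rule sum.swap)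
 also have "... = (\<Sum>b\<le>n. \<Sum>\<beta>\<in>box l n. (\<Sum>W1 | W1 \<subseteq> Z \<and> g ` W1 = W1 \<and> int (card W1) = int b. mchar (map (\<lambda>i. int (\<beta> i)) [0..<l]) (Z - W1) g)
   * (\<Sum>W2 | W2 \<subseteq> X - Z \<and> g ` W2 = W2 \<and> int (card W2) = \<alpha> 0 - int b. mchar (map (\<lambda>i. ?\<alpha>' i - int (\<beta> i)) [0..<l]) (X - Z - W2) g))"
 proof (intro sum.cong refl)
  fix b
  let ?A = "{W1. W1 \<subseteq> Z \<and> g ` W1 = W1 \<and> int (card W1) = int b}"
  let ?B = "{W2. W2 \<subseteq> X - Z \<and> g ` W2 = W2 \<and> int (card W2) = \<alpha> 0 - int b}"
  have "(\<Sum>W1\<in>?I Z. if b = card W1 then \<Sum>W2\<in>?I (X - Z).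
    (if int b + int (card W2) = \<alpha> 0 then \<Sum>\<beta>\<in>box l n. ?F W1 W2 \<beta> else 0) else 0)
   = (\<Sum>W1\<in>?A. \<Sum>W2\<in>?B. \<Sum>\<beta>\<in>box l n. ?F W1 W2 \<beta>)"
   using fin by (auto simp: sum.If_cases intro!: sum.cong)
  also have "... = (\<Sum>W1\<in>?A. \<Sum>\<beta>\<in>box l n. \<Sum>W2\<in>?B. ?F W1 W2 \<beta>)"
   by (intro sum.cong refl sum.swap)
  also have "... = (\<Sum>\<beta>\<in>box l n. \<Sum>W1\<in>?A. \<Sum>W2\<in>?B. ?F W1 W2 \<beta>)"
   by (rule sum.swap)
  also have "... = (\<Sum>\<beta>\<in>box l n. (\<Sum>W1\<in>?A. mchar (map (\<lambda>i. int (\<beta> i)) [0..<l]) (Z - W1) g) * (\<Sum>W2\<in>?B. mchar (map (\<lambda>i. ?\<alpha>' i - int (\<beta> i)) [0..<l]) (X - Z - W2) g))"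
   by (simp add: sum_product)
  finally show "(\<Sum>W1\<in>?I Z. if b = card W1 then \<Sum>W2\<in>?I (X - Z).
    (if int b + int (card W2) = \<alpha> 0 then \<Sum>\<beta>\<in>box l n. ?F W1 W2 \<beta> else 0) else 0) = ..." .
 qed
 also have "... = (\<Sum>\<beta>\<in>box (Suc l) n. mchar (map (\<lambda>i. int (\<beta> i)) [0..<Suc l]) Z g * mchar (map (\<lambda>i. \<alpha> i - int (\<beta> i)) [0..<Suc l]) (X - Z) g)"
  unfolding sum_box_Suc map_upt_Suc mchar.simps by simp
 finally show ?case .
qed

section \<open>Alternating sums of permutation characters\<close>

definition comps :: "nat => nat => (nat => nat) set" where
 "comps l m = {\<beta>. (\<forall>i\<ge>l. \<beta> i = 0) \<and> (\<Sum>i<l. \<beta> i) = m}"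

lemma comps_box: "m \<le> n ==> comps l m \<subseteq> box l n"
proof
 fix \<beta> assume "m \<le> n" "\<beta> \<in> comps l m"
 moreover have "\<beta> i \<le> (\<Sum>i<l. \<beta> i)" if "i < l" for i
  using that by (intro member_le_sum) auto
 ultimately show "\<beta> \<in> box l n" by (force simp: comps_def box_def)
qed

lemma finite_comps: "finite (comps l m)"
 using comps_box[of m m] finite_box finite_subset by blast

text \<open>The number of nonnegative integer matrices with column sums \<open>\<alpha>\<close> and row sums \<open>\<mu>\<close>, the rows being
  split off one at a time.\<close>

fun Ncount :: "nat => (nat => int) => nat list => int" where
 "Ncount l \<alpha> [] = (if \<forall>i<l. \<alpha> i = 0 then 1 else 0)"
| "Ncount l \<alpha> (m # \<mu>) = (\<Sum>\<beta>\<in>comps l m. Ncount l (\<lambda>i. \<alpha> i - int (\<beta> i)) \<mu>)"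

text \<open>The inner product of two permutation characters is the number of orbits on pairs of ordered set
  partitions; an orbit is described by the matrix of the sizes of the intersections. The proof splits
  off the blocks of the second factor one at a time, with \<open>mchar_split\<close>.\<close>

lemma sum_mchar_mchar:
 assumes "finite X" "sum_list \<mu> = card X"
 shows "(\<Sum>g | g permutes X. mchar (map \<alpha> [0..<l]) X g * mchar (map int \<mu>) X g) = fact (card X) * Ncount l \<alpha> \<mu>"
 using assms
proof (induction \<mu> arbitrary: X \<alpha>)
 case Nil
 then have X: "X = {}" by simp
 have "mchar (map \<alpha> [0..<l]) {} g = (if \<forall>i<l. \<alpha> i = 0 then 1 else 0)" for g :: "'a => 'a"
 proof (induction l arbitrary: \<alpha>)
  case (Suc l)
  have e: "{Z. Z \<subseteq> {} \<and> g ` Z = Z \<and> int (card Z) = \<alpha> 0} = (if \<alpha> 0 = 0 then {{}} else {})" by auto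
  have "(\<forall>i<Suc l. \<alpha> i = 0) \<longleftrightarrow> \<alpha> 0 = 0 \<and> (\<forall>i<l. \<alpha> (Suc i) = 0)"
   using less_Suc_eq_0_disj by auto
  then show ?case unfolding map_upt_Suc mchar.simps e using Suc[of "\<lambda>i. \<alpha> (Suc i)"] by simp
 qed simp
 then show ?case unfolding X by (auto simp: permutes_empty)
next
 case (Cons m \<mu>)
 let ?P = "{Z. Z \<subseteq> X \<and> card Z = m}"
 let ?mc = "\<lambda>\<alpha> X g. mchar (map \<alpha> [0..<l]) X g"
 have fP: "finite ?P" "finite {g. g permutes X}" using Cons.prems by (auto simp: finite_permutations)
 have mle: "m \<le> card X" using Cons.prems by simp
 have "(\<Sum>g | g permutes X. ?mc \<alpha> X g * mchar (map int (m # \<mu>)) X g) =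
   (\<Sum>g | g permutes X. \<Sum>Z\<in>?P. if g ` Z = Z then ?mc \<alpha> X g * mchar (map int \<mu>) (X - Z) g else 0)"
 proof (rule sum.cong[OF refl])
  fix g
  have e: "{Z. Z \<subseteq> X \<and> g ` Z = Z \<and> int (card Z) = int m} = {Z \<in> ?P. g ` Z = Z}" by auto
  show "?mc \<alpha> X g * mchar (map int (m # \<mu>)) X g = (\<Sum>Z\<in>?P. if g ` Z = Z then ?mc \<alpha> X g * mchar (map int \<mu>) (X - Z) g else 0)"
   unfolding list.map mchar.simps e sum_distrib_left using fP by (intro sum.inter_filter)
 qed
 also have "... = (\<Sum>Z\<in>?P. \<Sum>g | g permutes X. if g ` Z = Z then ?mc \<alpha> X g * mchar (map int \<mu>) (X - Z) g else 0)"
  by (rule sum.swap)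
 also have "... = (\<Sum>Z\<in>?P. fact m * fact (card X - m) * Ncount l \<alpha> (m # \<mu>))"
 proof (rule sum.cong[OF refl])
  fix Z assume Z: "Z \<in> ?P"
  have fZ: "finite Z" using Z Cons.prems(1) by (auto intro: finite_subset)
  have cZ: "card (X - Z) = card X - m" using Z Cons.prems(1) fZ by (simp add: card_Diff_subset)
  let ?A = "{g. g permutes Z}" and ?B = "{g. g permutes (X - Z)}"
  let ?t = "\<lambda>g. ?mc \<alpha> X g * mchar (map int \<mu>) (X - Z) g"
  have "(\<Sum>g | g permutes X. if g ` Z = Z then ?t g else 0) = (\<Sum>g\<in>{g \<in> {g. g permutes X}. g ` Z = Z}. ?t g)"
   using fP by (intro sum.inter_filter[symmetric])
  also have "{g \<in> {g. g permutes X}. g ` Z = Z} = {g. g permutes X \<and> g ` Z = Z}" by auto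
  also have "(\<Sum>g | g permutes X \<and> g ` Z = Z. ?t g) = (\<Sum>g1\<in>?A. \<Sum>g2\<in>?B. ?t (g1 \<circ> g2))"
   by (rule perm_split) (use Z Cons.prems in auto)
  also have "... = (\<Sum>g1\<in>?A. \<Sum>g2\<in>?B. \<Sum>\<beta>\<in>box l (card X). ?mc (\<lambda>i. int (\<beta> i)) Z g1 * (?mc (\<lambda>i. \<alpha> i - int (\<beta> i)) (X - Z) g2 * mchar (map int \<mu>) (X - Z) g2))"
  proof (intro sum.cong refl)
   fix g1 g2 assume g: "g1 \<in> ?A" "g2 \<in> ?B"
   have 1: "(g1 \<circ> g2) x = g2 x" "g2 x \<in> X - Z" if "x \<in> X - Z" for x
   proof -
    show "g2 x \<in> X - Z" using g that by (metis mem_Collect_eq permutes_in_image)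
    then show "(g1 \<circ> g2) x = g2 x" using g by (auto simp: permutes_def)
   qed
   have 2: "(g1 \<circ> g2) x = g1 x" if "x \<in> Z" for x
   proof -
    have "g2 x = x" using g(2) that by (simp add: permutes_def)
    then show ?thesis by simp
   qed
   have im: "(g1 \<circ> g2) ` Z = Z" "(g1 \<circ> g2) ` (X - Z) = X - Z"
   proof -
    have "(g1 \<circ> g2) ` Z = g1 ` Z" by (rule image_cong[OF refl 2])
    also have "... = Z" using g by (simp add: permutes_image)
    finally show "(g1 \<circ> g2) ` Z = Z" .
    have "(g1 \<circ> g2) ` (X - Z) = g2 ` (X - Z)" by (rule image_cong[OF refl 1(1)])
    also have "... = X - Z" using g by (simp add: permutes_image)
    finally show "(g1 \<circ> g2) ` (X - Z) = X - Z" .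
   qed
   have "?mc \<alpha> X (g1 \<circ> g2) = (\<Sum>\<beta>\<in>box l (card X). ?mc (\<lambda>i. int (\<beta> i)) Z (g1 \<circ> g2) * ?mc (\<lambda>i. \<alpha> i - int (\<beta> i)) (X - Z) (g1 \<circ> g2))"
    by (rule mchar_split) (use Z Cons.prems im in auto)
   moreover have "?mc (\<lambda>i. int (\<beta> i)) Z (g1 \<circ> g2) = ?mc (\<lambda>i. int (\<beta> i)) Z g1" for \<beta>
    by (rule mchar_cong) (rule 2)
   moreover have "mchar as (X - Z) (g1 \<circ> g2) = mchar as (X - Z) g2" for as
    by (rule mchar_cong) (rule 1)
   ultimately show "?t (g1 \<circ> g2) = (\<Sum>\<beta>\<in>box l (card X). ?mc (\<lambda>i. int (\<beta> i)) Z g1 * (?mc (\<lambda>i. \<alpha> i - int (\<beta> i)) (X - Z) g2 * mchar (map int \<mu>) (X - Z) g2))"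
    by (simp only: sum_distrib_right mult.assoc)
  qed
  also have "... = (\<Sum>g1\<in>?A. \<Sum>\<beta>\<in>box l (card X). \<Sum>g2\<in>?B. ?mc (\<lambda>i. int (\<beta> i)) Z g1 * (?mc (\<lambda>i. \<alpha> i - int (\<beta> i)) (X - Z) g2 * mchar (map int \<mu>) (X - Z) g2))"
   by (intro sum.cong refl sum.swap)
  also have "... = (\<Sum>\<beta>\<in>box l (card X). \<Sum>g1\<in>?A. \<Sum>g2\<in>?B. ?mc (\<lambda>i. int (\<beta> i)) Z g1 * (?mc (\<lambda>i. \<alpha> i - int (\<beta> i)) (X - Z) g2 * mchar (map int \<mu>) (X - Z) g2))"
   by (rule sum.swap)
  also have "... = (\<Sum>\<beta>\<in>box l (card X). (\<Sum>g1\<in>?A. ?mc (\<lambda>i. int (\<beta> i)) Z g1) * (fact (card X - m) * Ncount l (\<lambda>i. \<alpha> i - int (\<beta> i)) \<mu>))"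
  proof (rule sum.cong[OF refl])
   fix \<beta>
   have "(\<Sum>g2\<in>?B. ?mc (\<lambda>i. \<alpha> i - int (\<beta> i)) (X - Z) g2 * mchar (map int \<mu>) (X - Z) g2) = fact (card (X - Z)) * Ncount l (\<lambda>i. \<alpha> i - int (\<beta> i)) \<mu>"
    by (rule Cons.IH) (use Cons.prems cZ in auto)
   then show "(\<Sum>g1\<in>?A. \<Sum>g2\<in>?B. ?mc (\<lambda>i. int (\<beta> i)) Z g1 * (?mc (\<lambda>i. \<alpha> i - int (\<beta> i)) (X - Z) g2 * mchar (map int \<mu>) (X - Z) g2)) = (\<Sum>g1\<in>?A. ?mc (\<lambda>i. int (\<beta> i)) Z g1) * (fact (card X - m) * Ncount l (\<lambda>i. \<alpha> i - int (\<beta> i)) \<mu>)"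
    by (simp only: sum_distrib_left[symmetric] sum_distrib_right[symmetric] cZ)
  qed
  also have "... = (\<Sum>\<beta>\<in>comps l m. fact m * (fact (card X - m) * Ncount l (\<lambda>i. \<alpha> i - int (\<beta> i)) \<mu>))"
  proof (rule sum.mono_neutral_cong_right)
   show "finite (box l (card X))" by (rule finite_box)
   show "comps l m \<subseteq> box l (card X)" by (rule comps_box[OF mle])
   have sl: "sum_list (map (\<lambda>i. int (\<beta> i)) [0..<l]) = int (\<Sum>i<l. \<beta> i)" for \<beta>
    by (simp add: interv_sum_list_conv_sum_set_nat lessThan_atLeast0)
   show "\<forall>\<beta>\<in>box l (card X) - comps l m. (\<Sum>g1\<in>?A. ?mc (\<lambda>i. int (\<beta> i)) Z g1) * (fact (card X - m) * Ncount l (\<lambda>i. \<alpha> i - int (\<beta> i)) \<mu>) = 0"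
   proof
    fix \<beta> assume "\<beta> \<in> box l (card X) - comps l m"
    then have "(\<Sum>i<l. \<beta> i) \<noteq> m" by (auto simp: box_def comps_def)
    then have "?mc (\<lambda>i. int (\<beta> i)) Z g = 0" for g
     using fZ Z by (intro mchar_zero) (simp_all add: sl del: of_nat_sum)
    then show "(\<Sum>g1\<in>?A. ?mc (\<lambda>i. int (\<beta> i)) Z g1) * (fact (card X - m) * Ncount l (\<lambda>i. \<alpha> i - int (\<beta> i)) \<mu>) = 0"
     by simp
   qed
   fix \<beta> assume "\<beta> \<in> comps l m"
   then have "(\<Sum>g1\<in>?A. ?mc (\<lambda>i. int (\<beta> i)) Z g1) = fact (card Z)"
    using Z fZ by (intro sum_mchar) (auto simp: comps_def sl simp del: of_nat_sum)
   then show "(\<Sum>g1\<in>?A. ?mc (\<lambda>i. int (\<beta> i)) Z g1) * (fact (card X - m) * Ncount l (\<lambda>i. \<alpha> i - int (\<beta> i)) \<mu>) = fact m * (fact (card X - m) * Ncount l (\<lambda>i. \<alpha> i - int (\<beta> i)) \<mu>)"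
    using Z by simp
  qed
  finally show "(\<Sum>g | g permutes X. if g ` Z = Z then ?t g else 0) = fact m * fact (card X - m) * Ncount l \<alpha> (m # \<mu>)"
   by (simp add: sum_distrib_left mult.assoc)
 qed
 also have "... = int (card ?P) * (fact m * fact (card X - m) * Ncount l \<alpha> (m # \<mu>))" by simp
 also have "card ?P = card X choose m" using Cons.prems(1) by (rule n_subsets)
 also have "int (card X choose m) * (fact m * fact (card X - m) * Ncount l \<alpha> (m # \<mu>)) = fact (card X) * Ncount l \<alpha> (m # \<mu>)"
 proof -
  have "int (fact m * fact (card X - m) * (card X choose m)) = int (fact (card X))"
   using binomial_fact_lemma[OF mle] by presburger
  then have "fact m * fact (card X - m) * int (card X choose m) = fact (card X)" by simp
  then show ?thesis by (metis mult.assoc mult.commute)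
 qed
 finally show ?case .
qed

text \<open>The inner product of the alternating sum for \<open>a\<close> (with entries \<open>a i = \<nu>\<^sub>i - i\<close>) with the
  permutation character of sizes \<open>\<mu>\<close>; see \<open>psi_norm\<close>. For a strictly decreasing \<open>a\<close> it is a Kostka
  number, or 0 if the shape has a negative entry. It is antisymmetric in \<open>a\<close> (\<open>Gam_swap\<close>).\<close>

definition Gam :: "nat => (nat => int) => nat list => int" where
 "Gam l a \<mu> = (\<Sum>w | w permutes {0..<l}. sign w * Ncount l (\<lambda>i. a i + int (w i)) \<mu>)"

lemma Ncount_neg: "i < l ==> \<alpha> i < 0 ==> Ncount l \<alpha> \<mu> = 0"
proof (induction \<mu> arbitrary: \<alpha>)
 case (Cons m \<mu>)
 show ?case unfolding Ncount.simps by (rule sum.neutral) (use Cons in auto)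
qed auto

lemma comps_comp: "s permutes {0..<l} ==> \<beta> \<in> comps l m ==> \<beta> \<circ> s \<in> comps l m"
proof -
 assume s: "s permutes {0..<l}" and b: "\<beta> \<in> comps l m"
 have "sum (\<lambda>i. \<beta> (s i)) {0..<l} = sum \<beta> {0..<l}"
  using sum.permute[OF s, of \<beta>] by (simp add: comp_def)
 moreover have "s i = i" if "i \<ge> l" for i using s that by (simp add: permutes_def)
 ultimately show ?thesis using b by (auto simp: comps_def lessThan_atLeast0)
qed

lemma Ncount_perm: "s permutes {0..<l} ==> Ncount l (\<lambda>i. \<alpha> (s i)) \<mu> = Ncount l \<alpha> \<mu>"
proof (induction \<mu> arbitrary: \<alpha>)
 case Nil
 have "(\<forall>i<l. \<alpha> (s i) = 0) \<longleftrightarrow> (\<forall>i\<in>s ` {0..<l}. \<alpha> i = 0)" by auto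
 also have "s ` {0..<l} = {0..<l}" using Nil by (rule permutes_image)
 finally show ?case by simp
next
 case (Cons m \<mu>)
 have "(\<Sum>\<beta>\<in>comps l m. Ncount l (\<lambda>i. \<alpha> (s i) - int (\<beta> i)) \<mu>) = (\<Sum>\<beta>\<in>comps l m. Ncount l (\<lambda>i. \<alpha> i - int (\<beta> i)) \<mu>)"
 proof (rule sum.reindex_bij_witness[where j = "\<lambda>\<beta>. \<beta> \<circ> pinv s" and i = "\<lambda>\<beta>. \<beta> \<circ> s"])
  fix \<beta> assume b: "\<beta> \<in> comps l m"
  show "(\<beta> \<circ> pinv s) \<circ> s = \<beta>" "(\<beta> \<circ> s) \<circ> pinv s = \<beta>"
   using Cons.prems by (auto simp: fun_eq_iff permutes_inverses)
  show "\<beta> \<circ> pinv s \<in> comps l m" "\<beta> \<circ> s \<in> comps l m"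
   using b Cons.prems permutes_inv by (blast intro: comps_comp)+
  show "Ncount l (\<lambda>i. \<alpha> i - int ((\<beta> \<circ> pinv s) i)) \<mu> = Ncount l (\<lambda>i. \<alpha> (s i) - int (\<beta> i)) \<mu>"
   using Cons.IH[of "\<lambda>i. \<alpha> i - int ((\<beta> \<circ> pinv s) i)"] Cons.prems by (simp add: permutes_inverses)
 qed
 then show ?case by simp
qed

lemma Gam_swap:
 assumes "i < l" "j < l" "i \<noteq> j"
 shows "Gam l (\<lambda>k. a (transpose i j k)) \<mu> = - Gam l a \<mu>"
proof -
 let ?s = "transpose i j"
 have s: "?s permutes {0..<l}" using assms by (intro permutes_swap_id) auto
 have "Gam l (\<lambda>k. a (?s k)) \<mu> = (\<Sum>w | w permutes {0..<l}. - (sign w * Ncount l (\<lambda>i. a i + int (w i)) \<mu>))"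
  unfolding Gam_def
 proof (rule sum.reindex_bij_witness[where j = "\<lambda>w. w \<circ> ?s" and i = "\<lambda>w. w \<circ> ?s"])
  fix w assume w: "w \<in> {w. w permutes {0..<l}}"
  show "(w \<circ> ?s) \<circ> ?s = w" "(w \<circ> ?s) \<circ> ?s = w" by (auto simp: fun_eq_iff)
  show "w \<circ> ?s \<in> {w. w permutes {0..<l}}" "w \<circ> ?s \<in> {w. w permutes {0..<l}}"
   using w s by (auto intro: permutes_compose)
  have "permutation w" using w by (auto intro: permutation_permutes[THEN iffD2])
  then have sg: "sign (w \<circ> ?s) = - sign w"
   using assms by (simp add: sign_compose sign_swap_id permutation_swap_id)
  have "Ncount l (\<lambda>k. a (?s k) + int (w k)) \<mu> = Ncount l (\<lambda>k. a (?s k) + int ((w \<circ> ?s) (?s k))) \<mu>" by simp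
  also have "... = Ncount l (\<lambda>k. a k + int ((w \<circ> ?s) k)) \<mu>" by (rule Ncount_perm[OF s])
  finally show "- (sign (w \<circ> ?s) * Ncount l (\<lambda>i. a i + int ((w \<circ> ?s) i)) \<mu>) = sign w * Ncount l (\<lambda>k. a (?s k) + int (w k)) \<mu>"
   by (simp add: sg)
 qed
 then show ?thesis by (simp add: Gam_def sum_negf)
qed

lemma Gam_Cons: "Gam l a (m # \<mu>) = (\<Sum>\<beta>\<in>comps l m. Gam l (\<lambda>i. a i - int (\<beta> i)) \<mu>)"
 unfolding Gam_def Ncount.simps sum_distrib_left
 by (subst sum.swap) (simp add: algebra_simps)

text \<open>Removing \<open>\<beta>\<close> from the shape leaves a horizontal strip unless \<open>\<beta>\<close> is bad at some row: then row \<open>i\<close>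
  becomes shorter than row \<open>i + 1\<close> was before the removal (in the shifted coordinates \<open>a\<close>).\<close>

definition bad :: "nat => (nat => int) => (nat => nat) => nat => bool" where
 "bad l a \<beta> i \<longleftrightarrow> Suc i < l \<and> a i - int (\<beta> i) \<le> a (Suc i)"

definition strips :: "nat => (nat => int) => nat => (nat => nat) set" where
 "strips l a m = {\<beta> \<in> comps l m. \<forall>i. \<not> bad l a \<beta> i}"

text \<open>Exchanging the rows \<open>i\<close> and \<open>i + 1\<close> after the removal, at the first bad row. This is an involution on the
  bad \<open>\<beta>\<close> that changes the sign of the corresponding term.\<close>

definition swp :: "nat => (nat => int) => (nat => nat) => (nat => nat)" where
 "swp l a \<beta> = (let i = (LEAST i. bad l a \<beta> i); d = nat (a i - a (Suc i)) in \<beta>(i := \<beta> (Suc i) + d, Suc i := \<beta> i - d))"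

text \<open>The Pieri rule: in the sum over all ways to remove \<open>m\<close> cells, the terms that are not horizontal strips
  cancel in pairs under \<open>swp\<close>.\<close>

lemma Gam_strips:
 assumes dec: "\<And>i. Suc i < l ==> a (Suc i) < a i"
 shows "Gam l a (m # \<mu>) = (\<Sum>\<beta>\<in>strips l a m. Gam l (\<lambda>i. a i - int (\<beta> i)) \<mu>)"
proof -
 let ?B = "{\<beta> \<in> comps l m. \<exists>i. bad l a \<beta> i}"
 let ?F = "\<lambda>\<beta>. Gam l (\<lambda>i. a i - int (\<beta> i)) \<mu>"
 have key: "swp l a \<beta> \<in> ?B \<and> swp l a (swp l a \<beta>) = \<beta> \<and> ?F (swp l a \<beta>) = - ?F \<beta>" if b: "\<beta> \<in> ?B" for \<beta>
 proof -
  define i where "i = (LEAST i. bad l a \<beta> i)"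
  have bi: "bad l a \<beta> i" unfolding i_def using b by (auto intro: LeastI_ex)
  have least: "\<not> bad l a \<beta> j" if "j < i" for j using that not_less_Least unfolding i_def by blast
  have il: "Suc i < l" using bi by (simp add: bad_def)
  define d where "d = nat (a i - a (Suc i))"
  have d: "int d = a i - a (Suc i)" using dec[OF il] by (simp add: d_def)
  have dle: "d \<le> \<beta> i" using bi d by (simp add: bad_def)
  define \<gamma> where "\<gamma> = swp l a \<beta>"
  have \<gamma>: "\<gamma> = \<beta>(i := \<beta> (Suc i) + d, Suc i := \<beta> i - d)"
   by (simp add: \<gamma>_def swp_def Let_def i_def[symmetric] d_def[symmetric])
  have "bad l a \<gamma> i" using il by (simp add: bad_def \<gamma> d)
  moreover have "\<not> bad l a \<gamma> j" if "j < i" for j using least[OF that] that by (simp add: bad_def \<gamma>)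
  ultimately have Lg: "(LEAST i. bad l a \<gamma> i) = i"
   by (intro Least_equality) (auto simp: not_less[symmetric])
  have "swp l a \<gamma> = \<gamma>(i := \<gamma> (Suc i) + d, Suc i := \<gamma> i - d)"
   by (simp add: swp_def Let_def Lg d_def[symmetric])
  also have "... = \<beta>" using dle by (auto simp: \<gamma> fun_eq_iff)
  finally have "swp l a \<gamma> = \<beta>" .
  have sm: "(\<Sum>k<l. \<gamma> k) = (\<Sum>k<l. \<beta> k)"
  proof -
   have e: "{..<l} = insert i (insert (Suc i) ({..<l} - {i, Suc i}))" using il by auto
   show ?thesis
    by (subst (1 2) e, subst (1 2) sum.insert, simp, simp, subst (1 2) sum.insert, simp, simp)
     (use dle in "auto simp: \<gamma> intro!: sum.cong")
  qed
  have "\<gamma> \<in> comps l m" using b il sm by (auto simp: comps_def \<gamma>)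
  have "(\<lambda>k. a k - int (\<gamma> k)) = (\<lambda>k. (\<lambda>k. a k - int (\<beta> k)) (transpose i (Suc i) k))"
   using d dle by (auto simp: fun_eq_iff \<gamma> transpose_def)
  then have "?F \<gamma> = - ?F \<beta>" using Gam_swap[of i l "Suc i" "\<lambda>k. a k - int (\<beta> k)" \<mu>] il by simp
  then show ?thesis using `\<gamma> \<in> comps l m` `bad l a \<gamma> i` `swp l a \<gamma> = \<beta>` unfolding \<gamma>_def[symmetric] by blast
 qed
 have "(\<Sum>\<beta>\<in>?B. ?F \<beta>) = (\<Sum>\<beta>\<in>?B. - ?F \<beta>)"
  by (rule sum.reindex_bij_witness[where i = "swp l a" and j = "swp l a"]) (use key in auto)
 then have 0: "(\<Sum>\<beta>\<in>?B. ?F \<beta>) = 0" by (simp add: sum_negf)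
 have "comps l m = strips l a m \<union> ?B" by (auto simp: strips_def)
 then have "(\<Sum>\<beta>\<in>comps l m. ?F \<beta>) = (\<Sum>\<beta>\<in>strips l a m. ?F \<beta>) + (\<Sum>\<beta>\<in>?B. ?F \<beta>)"
  by (subst sum.union_disjoint[symmetric]) (use finite_comps in "auto simp: strips_def")
 then show ?thesis using 0 by (simp add: Gam_Cons)
qed

lemma dec_mono:
 assumes "\<And>i. Suc i < l ==> a (Suc i) < (a i :: int)" "i \<le> j" "j < l"
 shows "a j + int j \<le> a i + int i"
 using assms(2,3)
proof (induction j rule: dec_induct)
 case (step n)
 then show ?case using assms(1)[of n] by simp
qed simp

lemma Gam_nonneg:
 assumes dec: "\<And>i. Suc i < l ==> a (Suc i) < a i" and nz: "Gam l a \<mu> \<noteq> 0" and i: "i < l"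
 shows "a i + int i \<ge> 0"
proof (rule ccontr)
 assume "\<not> a i + int i \<ge> 0"
 have "a (l - 1) + int (l - 1) \<le> a i + int i" using i by (intro dec_mono dec) auto
 then have neg: "a (l - 1) + int (l - 1) < 0" using `\<not> a i + int i \<ge> 0` by simp
 have "Ncount l (\<lambda>i. a i + int (w i)) \<mu> = 0" if w: "w permutes {0..<l}" for w
 proof (rule Ncount_neg)
  show "l - 1 < l" using i by simp
  have "w (l - 1) < l" using permutes_in_image[OF w, of "l - 1"] i by simp
  then show "a (l - 1) + int (w (l - 1)) < 0" using neg by linarith
 qed
 then show False using nz by (simp add: Gam_def)
qed

text \<open>The total number of cells in the first \<open>c\<close> columns decreases by at most \<open>c\<close> when a horizontal strip is
  removed: each column loses at most one cell. The terms for the first and the last row are those that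
  the telescoping leaves over.\<close>

lemma strip_telescope:
 fixes \<nu> \<nu>' :: "nat => nat"
 assumes "\<And>i. Suc i < l ==> \<nu> (Suc i) \<le> \<nu>' i" "l > 0"
 shows "(\<Sum>i<l. min (\<nu> i) c) + min (\<nu>' (l - 1)) c \<le> (\<Sum>i<l. min (\<nu>' i) c) + min (\<nu> 0) c"
 using assms
proof (induction l)
 case (Suc l)
 show ?case
 proof (cases "l = 0")
  case False
  then have "\<nu> l \<le> \<nu>' (l - 1)" using Suc.prems(1)[of "l - 1"] by simp
  then have "min (\<nu> l) c \<le> min (\<nu>' (l - 1)) c" by simp
  moreover have "(\<Sum>i<l. min (\<nu> i) c) + min (\<nu>' (l - 1)) c \<le> (\<Sum>i<l. min (\<nu>' i) c) + min (\<nu> 0) c"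
   using Suc False by simp
  ultimately show ?thesis by simp
 qed simp
qed simp

lemma strip_dom:
 fixes \<nu> \<nu>' \<beta> :: "nat => nat"
 assumes "\<And>i. Suc i < l ==> \<nu> (Suc i) \<le> \<nu>' i" "\<And>i. i < l ==> \<nu> i = \<nu>' i + \<beta> i"
 shows "(\<Sum>i<l. \<beta> i) - c + (\<Sum>i<l. \<nu>' i - c) \<le> (\<Sum>i<l. \<nu> i - c)"
proof (cases "l = 0")
 case False
 have e: "(\<Sum>i<l. f i) = (\<Sum>i<l. f i - c) + (\<Sum>i<l. min (f i) c)" for f :: "nat => nat"
  by (subst sum.distrib[symmetric]) (auto intro!: sum.cong)
 have "(\<Sum>i<l. \<nu> i) = (\<Sum>i<l. \<nu>' i) + (\<Sum>i<l. \<beta> i)"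
  using assms(2) by (simp add: sum.distrib[symmetric])
 moreover have "(\<Sum>i<l. min (\<nu> i) c) \<le> (\<Sum>i<l. min (\<nu>' i) c) + c"
  using strip_telescope[of l \<nu> \<nu>' c, OF assms(1)] False by simp
 moreover have "(\<Sum>i<l. \<nu>' i - c) \<le> (\<Sum>i<l. \<nu> i - c)"
  using assms(2) by (intro sum_mono) auto
 ultimately show ?thesis using e[of \<nu>] e[of \<nu>'] by linarith
qed simp

text \<open>A Kostka number can only be nonzero if the shape dominates the content. Dominance is expressed by the
  numbers of cells beyond the first \<open>c\<close> columns, for all \<open>c\<close>; this form survives the removal of a
  horizontal strip without any sorting.\<close>

lemma Gam_dom:
 assumes "\<And>i. Suc i < l ==> a (Suc i) < a i" "Gam l a \<mu> \<noteq> 0"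
 shows "(\<Sum>x\<leftarrow>\<mu>. x - c) \<le> (\<Sum>i<l. nat (a i + int i) - c)"
 using assms
proof (induction \<mu> arbitrary: a)
 case (Cons m \<mu>)
 have "(\<Sum>\<beta>\<in>strips l a m. Gam l (\<lambda>i. a i - int (\<beta> i)) \<mu>) \<noteq> 0"
  using Cons.prems by (simp add: Gam_strips)
 then obtain \<beta> where b: "\<beta> \<in> strips l a m" "Gam l (\<lambda>i. a i - int (\<beta> i)) \<mu> \<noteq> 0"
  by (meson sum.neutral)
 have nb: "a (Suc i) < a i - int (\<beta> i)" if "Suc i < l" for i using b that by (force simp: strips_def bad_def)
 have dec': "a (Suc i) - int (\<beta> (Suc i)) < a i - int (\<beta> i)" if "Suc i < l" for i using nb[OF that] by linarith
 have nn: "a i - int (\<beta> i) + int i \<ge> 0" if "i < l" for i using Gam_nonneg[OF dec' b(2) that] .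
 have "(\<Sum>x\<leftarrow>\<mu>. x - c) \<le> (\<Sum>i<l. nat (a i - int (\<beta> i) + int i) - c)" by (rule Cons.IH[OF dec' b(2)])
 moreover have "(\<Sum>i<l. \<beta> i) - c + (\<Sum>i<l. nat (a i - int (\<beta> i) + int i) - c) \<le> (\<Sum>i<l. nat (a i + int i) - c)"
 proof (rule strip_dom)
  fix i assume i: "Suc i < l"
  show "nat (a (Suc i) + int (Suc i)) \<le> nat (a i - int (\<beta> i) + int i)" using nb[OF i] by linarith
 next
  fix i assume i: "i < l"
  show "nat (a i + int i) = nat (a i - int (\<beta> i) + int i) + \<beta> i" using nn[OF i] by linarith
 qed
 moreover have "(\<Sum>i<l. \<beta> i) = m" using b by (simp add: strips_def comps_def)
 ultimately show ?case by simp
qed simp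

text \<open>A Kostka number with content equal to the shape is 1. The largest remaining part has to be removed as
  a horizontal strip, and the only possibility is to shift every row to the next shorter one; so after
  \<open>j\<close> steps the shape is \<open>\<nu>\<close> without its first \<open>j\<close> rows.\<close>

lemma Gam_self_aux:
 fixes \<nu> :: "nat => nat"
 assumes anti: "\<And>i. \<nu> (Suc i) \<le> \<nu> i" and z: "\<And>i. i \<ge> l ==> \<nu> i = 0" and "j \<le> l"
 shows "Gam l (\<lambda>i. int (\<nu> (i + j)) - int i) (map \<nu> [j..<l]) = 1"
 using assms(3)
proof (induction j rule: inc_induct)
 case base
 have "Gam l (\<lambda>i. int (\<nu> (i + l)) - int i) [] = (\<Sum>w | w permutes {0..<l}. if w = id then 1 else 0)"
  unfolding Gam_def
 proof (intro sum.cong refl)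
  fix w assume "w \<in> {w. w permutes {0..<l}}"
  then have "(\<forall>i<l. w i = i) \<longleftrightarrow> w = id" by (auto simp: permutes_def fun_eq_iff)
  then show "sign w * Ncount l (\<lambda>i. int (\<nu> (i + l)) - int i + int (w i)) [] = (if w = id then 1 else 0)"
   by (auto simp: z sign_id)
 qed
 also have "... = 1" by (subst sum.delta) (auto simp: finite_permutations permutes_id)
 finally show ?case by simp
next
 case (step j)
 let ?a = "\<lambda>i. int (\<nu> (i + j)) - int i"
 let ?\<beta> = "\<lambda>i. \<nu> (i + j) - \<nu> (Suc (i + j))"
 have dec: "?a (Suc i) < ?a i" for i using anti[of "i + j"] by simp
 have tele: "(\<Sum>i<n. \<nu> (i + j) - \<nu> (Suc (i + j))) + \<nu> (n + j) = \<nu> j" for n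
 proof (induction n)
  case (Suc n)
  then show ?case using anti[of "n + j"] by simp
 qed simp
 have bs: "?\<beta> \<in> strips l ?a (\<nu> j)"
  using tele[of l] z anti by (auto simp: strips_def comps_def bad_def)
 have uniq: "Gam l (\<lambda>i. ?a i - int (\<beta> i)) (map \<nu> [Suc j..<l]) = 0" if b: "\<beta> \<in> strips l ?a (\<nu> j)" "\<beta> \<noteq> ?\<beta>" for \<beta>
 proof (rule ccontr)
  assume nz: "Gam l (\<lambda>i. ?a i - int (\<beta> i)) (map \<nu> [Suc j..<l]) \<noteq> 0"
  have nb: "?a (Suc i) < ?a i - int (\<beta> i)" if "Suc i < l" for i using b that by (force simp: strips_def bad_def)
  have dec': "?a (Suc i) - int (\<beta> (Suc i)) < ?a i - int (\<beta> i)" if "Suc i < l" for i using nb[OF that] by linarith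
  have nn: "?a i - int (\<beta> i) + int i \<ge> 0" if "i < l" for i using Gam_nonneg[OF dec' nz that] .
  have le: "\<beta> i \<le> ?\<beta> i" if "i < l" for i
  proof (cases "Suc i < l")
   case True
   then show ?thesis using nb[OF True] by simp
  next
   case False
   then have "\<nu> (Suc (i + j)) = 0" using that by (intro z) auto
   then show ?thesis using nn[OF that] by simp
  qed
  have sums: "(\<Sum>i<l. \<beta> i) = (\<Sum>i<l. ?\<beta> i)" using b bs by (simp add: strips_def comps_def)
  have "\<beta> i = ?\<beta> i" for i
  proof (cases "i < l")
   case True
   show ?thesis
   proof (rule ccontr)
    assume "\<beta> i \<noteq> ?\<beta> i"
    then have "(\<Sum>i<l. \<beta> i) < (\<Sum>i<l. ?\<beta> i)"
     using le True by (intro sum_strict_mono_ex1) (auto intro!: bexI[of _ i] simp: order_less_le)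
    then show False using sums by simp
   qed
  next
   case False
   then have "\<beta> i = 0" "?\<beta> i = 0" using b(1) bs unfolding strips_def comps_def by auto
   then show ?thesis by simp
  qed
  then show False using b by auto
 qed
 have "[j..<l] = j # [Suc j..<l]" using step by (simp add: upt_conv_Cons)
 then have "Gam l ?a (map \<nu> [j..<l]) = (\<Sum>\<beta>\<in>strips l ?a (\<nu> j). Gam l (\<lambda>i. ?a i - int (\<beta> i)) (map \<nu> [Suc j..<l]))"
  using Gam_strips[of l ?a, OF dec] by simp
 also have "... = (\<Sum>\<beta>\<in>{?\<beta>}. Gam l (\<lambda>i. ?a i - int (\<beta> i)) (map \<nu> [Suc j..<l]))"
  by (rule sum.mono_neutral_right) (use bs uniq finite_comps in "auto simp: strips_def")
 also have "... = Gam l (\<lambda>i. int (\<nu> (i + Suc j)) - int i) (map \<nu> [Suc j..<l])"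
  using anti by (simp add: of_nat_diff)
 finally show ?case using step by simp
qed

text \<open>The Jacobi--Trudi determinant in permutation characters: \<open>\<nu>\<^sub>i - i + w i\<close> is the index of the complete
  symmetric function at the matrix position \<open>(i, w i)\<close>.\<close>

definition psi :: "nat => (nat => nat) => 'a set => ('a => 'a) => int" where
 "psi l \<nu> X g = (\<Sum>w | w permutes {0..<l}. sign w * mchar (map (\<lambda>i. int (\<nu> i) - int i + int (w i)) [0..<l]) X g)"

text \<open>The contents that occur in the determinant for \<open>w \<noteq> id\<close> are strictly larger than \<open>\<nu>\<close> in the dominance
  order. At the first index \<open>i\<close> that is moved, \<open>w i > i\<close>, so that row \<open>i\<close> exceeds the length
  \<open>\<nu>\<^sub>i\<close>, while no other row loses cells beyond the first \<open>\<nu>\<^sub>i\<close> columns.\<close>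

lemma alt_dominates:
 fixes \<nu> :: "nat => nat"
 assumes anti: "\<And>i. \<nu> (Suc i) \<le> \<nu> i" and w: "w permutes {0..<l}" "w \<noteq> id"
 obtains c where "(\<Sum>i<l. \<nu> i - c) < (\<Sum>i<l. nat (int (\<nu> i) - int i + int (w i)) - c)"
proof -
 define i where "i = (LEAST i. w i \<noteq> i)"
 have ex: "\<exists>i. w i \<noteq> i" using w by (auto simp: fun_eq_iff)
 have i: "w i \<noteq> i" unfolding i_def using ex by (rule LeastI_ex)
 have least: "w j = j" if "j < i" for j using that not_less_Least unfolding i_def by blast
 have "i < l" using w i by (metis atLeastLessThan_iff le0 permutes_def)
 have "i < w i"
 proof (rule ccontr)
  assume "\<not> i < w i"
  then have "w i < i" using i by simp
  then have "w (w i) = w i" by (rule least)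
  then show False using i permutes_inj[OF w(1)] by (auto dest: injD)
 qed
 have antim: "\<nu> k \<le> \<nu> j" if "j \<le> k" for j k using that by (rule lift_Suc_antimono_le[of \<nu>, OF anti])
 have "(\<Sum>j<l. \<nu> j - \<nu> i) < (\<Sum>j<l. nat (int (\<nu> j) - int j + int (w j)) - \<nu> i)"
 proof (rule sum_strict_mono_ex1)
  show "\<forall>j\<in>{..<l}. \<nu> j - \<nu> i \<le> nat (int (\<nu> j) - int j + int (w j)) - \<nu> i"
  proof
   fix j
   show "\<nu> j - \<nu> i \<le> nat (int (\<nu> j) - int j + int (w j)) - \<nu> i"
    using least[of j] antim[of i j] by (cases "j < i") auto
  qed
  show "\<exists>j\<in>{..<l}. \<nu> j - \<nu> i < nat (int (\<nu> j) - int j + int (w j)) - \<nu> i"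
   using `i < l` `i < w i` by (intro bexI[of _ i]) auto
 qed simp
 then show ?thesis by (rule that)
qed

text \<open>Expand one factor. The term of \<open>w\<close> is a Kostka number for the shape \<open>\<nu>\<close>, which vanishes for \<open>w \<noteq> id\<close>
  by \<open>Gam_dom\<close> and \<open>alt_dominates\<close> and is 1 for \<open>w = id\<close>.\<close>

lemma psi_norm:
 fixes \<nu> :: "nat => nat"
 assumes fX: "finite X" and anti: "\<And>i. \<nu> (Suc i) \<le> \<nu> i" and z: "\<And>i. i \<ge> l ==> \<nu> i = 0" and sm: "(\<Sum>i<l. \<nu> i) = card X"
 shows "(\<Sum>g | g permutes X. psi l \<nu> X g * psi l \<nu> X g) = fact (card X)"
proof -
 let ?\<alpha> = "\<lambda>w i. int (\<nu> i) - int i + int (w i)"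
 let ?a = "\<lambda>i. int (\<nu> i) - int i"
 have dec: "?a (Suc i) < ?a i" for i using anti[of i] by simp
 have cross: "(\<Sum>g | g permutes X. psi l \<nu> X g * mchar (map (?\<alpha> w) [0..<l]) X g) = (if w = id then fact (card X) else 0)"
  if w: "w permutes {0..<l}" for w
 proof (cases "\<forall>i<l. ?\<alpha> w i \<ge> 0")
  case True
  define \<mu> where "\<mu> = map (\<lambda>i. nat (?\<alpha> w i)) [0..<l]"
  have eq: "map (?\<alpha> w) [0..<l] = map int \<mu>" using True by (simp add: \<mu>_def)
  have s0: "(\<Sum>i = 0..<l. int (w i)) = (\<Sum>i = 0..<l. int i)"
   using sum.permute[OF w, of int] by (simp add: comp_def)
  have "int (sum_list \<mu>) = (\<Sum>i = 0..<l. ?\<alpha> w i)"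
   unfolding \<mu>_def using True by (simp add: interv_sum_list_conv_sum_set_nat del: of_nat_sum) (auto intro!: sum.cong)
  also have "... = int (\<Sum>i<l. \<nu> i)" using s0 by (simp add: sum.distrib sum_subtractf lessThan_atLeast0)
  finally have sl: "sum_list \<mu> = card X" using sm by simp
  have "(\<Sum>g | g permutes X. psi l \<nu> X g * mchar (map int \<mu>) X g) =
    (\<Sum>v | v permutes {0..<l}. sign v * (\<Sum>g | g permutes X. mchar (map (?\<alpha> v) [0..<l]) X g * mchar (map int \<mu>) X g))"
   unfolding psi_def sum_distrib_left sum_distrib_right mult.assoc by (rule sum.swap)
  also have "... = fact (card X) * Gam l ?a \<mu>"
   unfolding Gam_def sum_mchar_mchar[OF fX sl] sum_distrib_left by (intro sum.cong refl) (simp only: mult_ac)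
  also have "Gam l ?a \<mu> = (if w = id then 1 else 0)"
  proof (cases "w = id")
   case True
   then have "\<mu> = map \<nu> [0..<l]" by (simp add: \<mu>_def)
   then show ?thesis using Gam_self_aux[of \<nu> l 0, OF anti z] True by simp
  next
   case False
   then obtain c where c: "(\<Sum>i<l. \<nu> i - c) < (\<Sum>i<l. nat (?\<alpha> w i) - c)"
    using alt_dominates[of \<nu> w l, OF anti w] by blast
   have e: "(\<Sum>x\<leftarrow>\<mu>. x - c) = (\<Sum>i<l. nat (?\<alpha> w i) - c)"
    by (simp add: \<mu>_def comp_def interv_sum_list_conv_sum_set_nat lessThan_atLeast0)
   have "Gam l ?a \<mu> = 0"
   proof (rule ccontr)
    assume "Gam l ?a \<mu> \<noteq> 0"
    from Gam_dom[of l ?a, OF dec this, of c] show False using c e by simp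
   qed
   then show ?thesis using False by simp
  qed
  finally show ?thesis using eq by simp
 next
  case False
  then obtain i where i: "i < l" "?\<alpha> w i < 0" by (auto simp: not_le)
  then have "mchar (map (?\<alpha> w) [0..<l]) X g = 0" for g
   by (intro mchar_neg[of "?\<alpha> w i"]) auto
  moreover have "w \<noteq> id" using i by auto
  ultimately show ?thesis by simp
 qed
 have "(\<Sum>g | g permutes X. psi l \<nu> X g * psi l \<nu> X g) =
   (\<Sum>w | w permutes {0..<l}. sign w * (\<Sum>g | g permutes X. psi l \<nu> X g * mchar (map (?\<alpha> w) [0..<l]) X g))"
  by (subst (2) psi_def, unfold sum_distrib_left, subst sum.swap) (simp add: mult_ac)
 also have "... = (\<Sum>w | w permutes {0..<l}. if w = id then fact (card X) else 0)"
  by (intro sum.cong refl) (auto simp: cross sign_id)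
 also have "... = fact (card X)" by (subst sum.delta) (auto simp: finite_permutations permutes_id)
 finally show ?thesis .
qed

section \<open>Tableaux and tabloids\<close>

text \<open>The permutation module on tabloids, without any restriction on \<open>g\<close> or on the list of sets.\<close>

definition act :: "('a => 'a) => ('a set list \<Rightarrow>\<^sub>0 complex) => ('a set list \<Rightarrow>\<^sub>0 complex)" where
 "act g = lin_ext (\<lambda>T. basis_vec (map ((`) g) T))"

lemma lin_act: "lin (act g)"
 by (simp add: act_def lin_lin_ext)

lemma act_basis [simp]: "act g (basis_vec T) = basis_vec (map ((`) g) T)"
 by (simp add: act_def)

lemma lin_comp: "lin f ==> lin g ==> lin (\<lambda>v. f (g v))"
 by (simp add: lin_def)

lemma linf_comp: "linf f ==> lin g ==> linf (\<lambda>v. f (g v))"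
 by (simp add: lin_def linf_def)

lemma lin_smul: "lin f ==> lin (\<lambda>v. smul c (f v))"
 by (simp add: lin_def free.scale_right_distrib mult.commute)

lemma lin_sum_fun: "(\<And>x. x \<in> A ==> lin (f x)) ==> lin (\<lambda>v. \<Sum>x\<in>A. f x v)"
 by (simp add: lin_def sum.distrib free.scale_sum_right)

lemma lin_rank1: "linf f ==> lin (\<lambda>v. smul (f v) u)"
 by (simp add: lin_def linf_def free.scale_left_distrib)

lemma act_act: "act g (act h v) = act (g \<circ> h) v"
proof -
 have im: "(`) g \<circ> (`) h = (`) (g \<circ> h)" by (auto simp: fun_eq_iff)
 have "(\<lambda>v. act g (act h v)) = act (g \<circ> h)"
  by (rule lin_eqI) (simp_all add: lin_act lin_comp im)
 then show ?thesis by metis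
qed

lemma act_id: "act id v = v"
proof -
 have "act id = (\<lambda>v. v)"
  by (rule lin_eqI[OF lin_act]) (auto simp: lin_def)
 then show ?thesis by metis
qed

lemma otabD:
 assumes "T \<in> otab as X"
 shows "length T = length as" "\<And>i. i < length as ==> int (card (T ! i)) = as ! i"
  "\<And>i j. i < length as ==> j < length as ==> i \<noteq> j ==> T ! i \<inter> T ! j = {}" "\<Union>(set T) = X"
proof -
 have "length T = length as \<and> (\<forall>i<length as. int (card (T ! i)) = as ! i) \<and>
   (\<forall>i<length as. \<forall>j<length as. i \<noteq> j \<longrightarrow> T ! i \<inter> T ! j = {}) \<and> \<Union>(set T) = X"
  using assms
 proof (induction as arbitrary: T X)
  case Nil
  then show ?case by (auto split: if_splits)
 next
  case (Cons a as)
  then obtain Z T' where Z: "Z \<subseteq> X" "int (card Z) = a" "T' \<in> otab as (X - Z)" "T = Z # T'" by auto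
  note IH = Cons.IH[OF Z(3)]
  have sub: "T' ! i \<subseteq> X - Z" if "i < length as" for i
   using IH that by (metis Union_upper nth_mem)
  show ?case
  proof (intro conjI allI impI)
   show "length T = length (a # as)" using IH Z by simp
   show "\<Union>(set T) = X" using IH Z by auto
  next
   fix i assume "i < length (a # as)"
   then show "int (card (T ! i)) = (a # as) ! i" using IH Z by (cases i) auto
  next
   fix i j assume ij: "i < length (a # as)" "j < length (a # as)" "i \<noteq> j"
   show "T ! i \<inter> T ! j = {}"
   proof (cases i)
    case 0
    then obtain j' where "j = Suc j'" using ij by (cases j) auto
    then show ?thesis using 0 sub[of j'] ij Z(4) by auto
   next
    case (Suc i')
    show ?thesis
    proof (cases j)
     case 0
     then show ?thesis using Suc sub[of i'] ij Z(4) by auto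
    next
     case (Suc j')
     then show ?thesis using `i = Suc i'` ij IH Z(4) by simp
    qed
   qed
  qed
 qed
 then show "length T = length as" "\<And>i. i < length as ==> int (card (T ! i)) = as ! i"
  "\<And>i j. i < length as ==> j < length as ==> i \<noteq> j ==> T ! i \<inter> T ! j = {}" "\<Union>(set T) = X" by blast+
qed

lemma otabI:
 assumes "length T = length as" "\<And>i. i < length as ==> int (card (T ! i)) = as ! i"
  "\<And>i j. i < length as ==> j < length as ==> i \<noteq> j ==> T ! i \<inter> T ! j = {}" "\<Union>(set T) = X"
 shows "T \<in> otab as X"
 using assms
proof (induction as arbitrary: T X)
 case (Cons a as)
 then obtain Z T' where T: "T = Z # T'" by (cases T) auto
 have dj: "T' ! i \<inter> Z = {}" if "i < length as" for i
  using Cons.prems(3)[of "Suc i" 0] that T by simp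
 have "T' \<in> otab as (X - Z)"
 proof (rule Cons.IH)
  show "length T' = length as" using Cons.prems T by simp
  show "int (card (T' ! i)) = as ! i" if "i < length as" for i using Cons.prems(2)[of "Suc i"] T that by simp
  show "T' ! i \<inter> T' ! j = {}" if "i < length as" "j < length as" "i \<noteq> j" for i j
   using Cons.prems(3)[of "Suc i" "Suc j"] T that by simp
  have "W \<inter> Z = {}" if "W \<in> set T'" for W
   using that dj `length T' = length as` by (metis in_set_conv_nth)
  then show "\<Union>(set T') = X - Z" using Cons.prems(4) T by fastforce
 qed
 moreover have "Z \<subseteq> X" using Cons.prems(4) T by auto
 moreover have "int (card Z) = a" using Cons.prems(2)[of 0] T by simp
 ultimately show ?case using T by auto
qed simp

text \<open>A partition \<open>\<alpha>\<close> and a set of matching size. \<open>nu\<close> is \<open>\<alpha>\<close> as a sequence, extended by zero, and \<open>l\<close> is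
  its length.\<close>

locale shape =
 fixes \<alpha> :: "nat multiset" and X :: "'a set"
 assumes fX: "finite X" and cX: "card X = \<Sum>\<^sub># \<alpha>"
begin

definition l :: nat where "l = length (parts \<alpha>)"
definition nu :: "nat => nat" where "nu i = (if i < l then parts \<alpha> ! i else 0)"
definition G :: "('a => 'a) set" where "G = {g. g permutes X}"

lemma finite_G: "finite G" using fX by (simp add: G_def finite_permutations)

lemma parts_nu: "parts \<alpha> = map nu [0..<l]"
 by (rule nth_equalityI) (auto simp: l_def nu_def)

lemma nu_anti: "nu (Suc i) \<le> nu i"
proof (cases "Suc i < l")
 case True
 have "sorted (rev (parts \<alpha>))" by (simp add: parts_def)
 then have "parts \<alpha> ! Suc i \<le> parts \<alpha> ! i"
  using True by (intro sorted_rev_nth_mono) (auto simp: l_def)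
 then show ?thesis using True by (simp add: nu_def)
qed (simp add: nu_def)

lemma nu_zero: "i \<ge> l ==> nu i = 0" by (simp add: nu_def)

lemma mset_parts: "mset (parts \<alpha>) = \<alpha>" by (simp add: parts_def)

lemma sum_nu: "(\<Sum>i<l. nu i) = card X"
proof -
 have "\<Sum>\<^sub># \<alpha> = sum_list (parts \<alpha>)" by (metis mset_parts sum_mset_sum_list)
 also have "... = (\<Sum>i<l. nu i)"
  by (subst parts_nu) (simp add: interv_sum_list_conv_sum_set_nat lessThan_atLeast0)
 finally show ?thesis using cX by simp
qed

lemma cells_eq: "cells \<alpha> = (SIGMA r:{..<l}. {..<nu r})"
 by (auto simp: cells_def nu_def l_def)

lemma finite_cells: "finite (cells \<alpha>)" by (simp add: cells_eq)

lemma card_cells: "card (cells \<alpha>) = card X" by (simp add: cells_eq sum_nu)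

abbreviation TB where "TB \<equiv> tableaux \<alpha> X"
abbreviation OT where "OT \<equiv> otab (map int (parts \<alpha>)) X"
abbreviation e where "e \<equiv> polytabloid \<alpha> X"
abbreviation C where "C \<equiv> column_group \<alpha> X"

lemma tab_bij: "t \<in> TB ==> bij_betw t (cells \<alpha>) X" by (simp add: tableaux_def)

lemma TB_nonempty: obtains t where "t \<in> TB"
 using finite_same_card_bij[OF finite_cells fX card_cells] by (auto simp: tableaux_def)

text \<open>The column in which \<open>x\<close> stands in the tableau \<open>t\<close>.\<close>

definition cl :: "(nat \<times> nat => 'a) => 'a => nat" where
 "cl t x = snd (the_inv_into (cells \<alpha>) t x)"

lemma cl_t [simp]: "t \<in> TB ==> y \<in> cells \<alpha> ==> cl t (t y) = snd y"
 using tab_bij[of t] by (simp add: cl_def the_inv_into_f_f bij_betw_def)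

lemma tabE: assumes "t \<in> TB" "x \<in> X" obtains y where "y \<in> cells \<alpha>" "x = t y"
 using tab_bij[OF assms(1)] assms(2) by (auto simp: bij_betw_def)

lemma colset: "t \<in> TB ==> t ` {x \<in> cells \<alpha>. snd x = c} = {x \<in> X. cl t x = c}"
 using tab_bij[of t] by (force simp: bij_betw_def elim: tabE)

lemma C_iff: assumes t: "t \<in> TB"
 shows "\<sigma> \<in> C t \<longleftrightarrow> \<sigma> permutes X \<and> (\<forall>x\<in>X. cl t (\<sigma> x) = cl t x)"
proof -
 have "(\<forall>c. \<sigma> ` {x \<in> X. cl t x = c} = {x \<in> X. cl t x = c}) \<longleftrightarrow> (\<forall>x\<in>X. cl t (\<sigma> x) = cl t x)" if s: "\<sigma> permutes X"
 proof
  assume H: "\<forall>c. \<sigma> ` {x \<in> X. cl t x = c} = {x \<in> X. cl t x = c}"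
  show "\<forall>x\<in>X. cl t (\<sigma> x) = cl t x"
  proof
   fix x assume "x \<in> X"
   then have "\<sigma> x \<in> \<sigma> ` {y \<in> X. cl t y = cl t x}" by blast
   also have "... = {y \<in> X. cl t y = cl t x}" using H by blast
   finally show "cl t (\<sigma> x) = cl t x" by simp
  qed
 next
  assume H: "\<forall>x\<in>X. cl t (\<sigma> x) = cl t x"
  show "\<forall>c. \<sigma> ` {x \<in> X. cl t x = c} = {x \<in> X. cl t x = c}"
  proof
   fix c
   show "\<sigma> ` {x \<in> X. cl t x = c} = {x \<in> X. cl t x = c}"
   proof (rule endo_inj_surj)
    show "finite {x \<in> X. cl t x = c}" using fX by simp
    show "\<sigma> ` {x \<in> X. cl t x = c} \<subseteq> {x \<in> X. cl t x = c}" using H permutes_in_image[OF s] by auto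
    show "inj_on \<sigma> {x \<in> X. cl t x = c}" using permutes_inj_on[OF s] .
   qed
  qed
 qed
 then show ?thesis unfolding column_group_def colset[OF t] by blast
qed

lemma C_group:
 assumes t: "t \<in> TB"
 shows "id \<in> C t" "\<sigma> \<in> C t ==> \<tau> \<in> C t ==> \<sigma> \<circ> \<tau> \<in> C t" "\<sigma> \<in> C t ==> pinv \<sigma> \<in> C t"
  "finite (C t)" "C t \<subseteq> G"
proof -
 show "id \<in> C t" by (simp add: C_iff[OF t] permutes_id)
 show "\<sigma> \<circ> \<tau> \<in> C t" if "\<sigma> \<in> C t" "\<tau> \<in> C t"
  using that by (auto simp: C_iff[OF t] permutes_compose permutes_in_image)
 show "pinv \<sigma> \<in> C t" if s: "\<sigma> \<in> C t"
 proof -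
  have p: "\<sigma> permutes X" using s by (simp add: C_iff[OF t])
  have "cl t (pinv \<sigma> x) = cl t x" if x: "x \<in> X" for x
  proof -
   have "pinv \<sigma> x \<in> X" using x permutes_in_image[OF permutes_inv[OF p]] by simp
   then have "cl t (\<sigma> (pinv \<sigma> x)) = cl t (pinv \<sigma> x)" using s by (simp add: C_iff[OF t])
   then show ?thesis using p by (simp add: permutes_inverses)
  qed
  then show ?thesis using p by (simp add: C_iff[OF t] permutes_inv)
 qed
 show "C t \<subseteq> G" by (auto simp: C_iff[OF t] G_def)
 then show "finite (C t)" using finite_G finite_subset by blast
qed

lemma sgn_comp: "\<sigma> \<in> G ==> \<tau> \<in> G ==> sign (\<sigma> \<circ> \<tau>) = sign \<sigma> * sign \<tau>"
 using fX by (intro sign_compose) (auto simp: G_def permutation_permutes)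

lemma sgn_inv: "\<sigma> \<in> G ==> sign (pinv \<sigma>) = sign \<sigma>"
 using fX by (intro sign_inverse) (auto simp: G_def permutation_permutes)

lemma sgn_sq: "(of_int (sign \<sigma>) :: complex) * of_int (sign \<sigma>) = 1"
 by (simp add: sign_def)

lemma G_group: "id \<in> G" "g \<in> G ==> h \<in> G ==> g \<circ> h \<in> G" "g \<in> G ==> pinv g \<in> G"
 by (auto simp: G_def permutes_id permutes_compose permutes_inv)

lemma G_inv: "g \<in> G ==> g \<circ> pinv g = id" "g \<in> G ==> pinv g \<circ> g = id"
 by (auto simp: G_def permutes_inv_o)

lemma G_reindex_left: "h \<in> G ==> (\<Sum>g\<in>G. F (h \<circ> g)) = (\<Sum>g\<in>G. F g)"
 by (rule sum.reindex_bij_witness[where j = "\<lambda>g. h \<circ> g" and i = "\<lambda>g. pinv h \<circ> g"])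
  (auto simp: G_group comp_assoc[symmetric] G_inv)

lemma tabloid_comp: "tabloid \<alpha> (g \<circ> t) = map ((`) g) (tabloid \<alpha> t)"
 by (simp add: tabloid_def image_comp)

lemma tab_comp: "g \<in> G ==> t \<in> TB ==> g \<circ> t \<in> TB"
 by (auto simp: tableaux_def G_def intro: bij_betw_trans permutes_imp_bij)

text \<open>The signed column sum of \<open>t\<close>, an element of the group algebra.\<close>

definition K :: "(nat \<times> nat => 'a) => ('a set list \<Rightarrow>\<^sub>0 complex) => ('a set list \<Rightarrow>\<^sub>0 complex)" where
 "K t u = (\<Sum>\<sigma>\<in>C t. smul (of_int (sign \<sigma>)) (act \<sigma> u))"

lemma lin_K: "lin (K t)"
 unfolding K_def by (intro lin_sum_fun lin_smul lin_act)

lemma e_K: "e t = K t (basis_vec (tabloid \<alpha> t))"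
 by (simp add: polytabloid_def K_def tabloid_comp)

lemma K_act: assumes t: "t \<in> TB" and q: "q \<in> C t"
 shows "K t (act q u) = smul (of_int (sign q)) (K t u)"
proof -
 have "K t (act q u) = (\<Sum>\<sigma>\<in>C t. smul (of_int (sign q)) (smul (of_int (sign (\<sigma> \<circ> q))) (act (\<sigma> \<circ> q) u)))"
  unfolding K_def
 proof (intro sum.cong refl)
  fix \<sigma> assume s: "\<sigma> \<in> C t"
  have "(of_int (sign \<sigma>) :: complex) = of_int (sign q) * of_int (sign (\<sigma> \<circ> q))"
   using s q C_group(5)[OF t] by (simp add: sgn_comp subset_iff mult.left_commute sgn_sq)
  then show "smul (of_int (sign \<sigma>)) (act \<sigma> (act q u)) = smul (of_int (sign q)) (smul (of_int (sign (\<sigma> \<circ> q))) (act (\<sigma> \<circ> q) u))"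
   by (simp add: act_act)
 qed
 also have "... = smul (of_int (sign q)) (\<Sum>\<sigma>\<in>C t. smul (of_int (sign (\<sigma> \<circ> q))) (act (\<sigma> \<circ> q) u))"
  by (rule free.scale_sum_right[symmetric])
 also have "(\<Sum>\<sigma>\<in>C t. smul (of_int (sign (\<sigma> \<circ> q))) (act (\<sigma> \<circ> q) u)) = K t u"
  unfolding K_def
  by (rule sum.reindex_bij_witness[where j = "\<lambda>\<sigma>. \<sigma> \<circ> q" and i = "\<lambda>\<sigma>. \<sigma> \<circ> pinv q"])
   (use C_group[OF t] q G_inv[of q] in "auto simp: comp_assoc")
 finally show ?thesis .
qed

lemma act_K: assumes t: "t \<in> TB" and q: "q \<in> C t"
 shows "act q (K t u) = smul (of_int (sign q)) (K t u)"
proof -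
 have "act q (K t u) = (\<Sum>\<sigma>\<in>C t. smul (of_int (sign q)) (smul (of_int (sign (q \<circ> \<sigma>))) (act (q \<circ> \<sigma>) u)))"
  unfolding K_def lin_sum[OF lin_act]
 proof (intro sum.cong refl)
  fix \<sigma> assume s: "\<sigma> \<in> C t"
  have "(of_int (sign \<sigma>) :: complex) = of_int (sign q) * of_int (sign (q \<circ> \<sigma>))"
   using s q C_group(5)[OF t] by (simp add: sgn_comp subset_iff mult.assoc[symmetric] sgn_sq)
  then show "act q (smul (of_int (sign \<sigma>)) (act \<sigma> u)) = smul (of_int (sign q)) (smul (of_int (sign (q \<circ> \<sigma>))) (act (q \<circ> \<sigma>) u))"
   by (simp add: act_act linD[OF lin_act])
 qed
 also have "... = smul (of_int (sign q)) (\<Sum>\<sigma>\<in>C t. smul (of_int (sign (q \<circ> \<sigma>))) (act (q \<circ> \<sigma>) u))"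
  by (rule free.scale_sum_right[symmetric])
 also have "(\<Sum>\<sigma>\<in>C t. smul (of_int (sign (q \<circ> \<sigma>))) (act (q \<circ> \<sigma>) u)) = K t u"
  unfolding K_def
  by (rule sum.reindex_bij_witness[where j = "\<lambda>\<sigma>. q \<circ> \<sigma>" and i = "\<lambda>\<sigma>. pinv q \<circ> \<sigma>"])
   (use C_group[OF t] q G_inv[of q] in "auto simp: comp_assoc[symmetric]")
 finally show ?thesis .
qed

lemma K_e: assumes t: "t \<in> TB"
 shows "K t (e t) = smul (of_nat (card (C t))) (e t)"
proof -
 have ae: "act q (e t) = smul (of_int (sign q)) (e t)" if "q \<in> C t" for q
  using act_K[OF t that, of "basis_vec (tabloid \<alpha> t)"] by (simp add: e_K)
 have "K t (e t) = (\<Sum>\<sigma>\<in>C t. e t)"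
  unfolding K_def[of t "e t"] by (intro sum.cong refl) (simp add: ae sgn_sq)
 also have "... = smul (of_nat (card (C t))) (e t)"
  by (rule poly_mapping_eqI) (simp add: lookup_sum)
 finally show ?thesis .
qed

lemma act_e: assumes t: "t \<in> TB" and g: "g \<in> G"
 shows "act g (e t) = e (g \<circ> t)"
proof -
 let ?i = "pinv g"
 have gt: "g \<circ> t \<in> TB" using t g by (rule tab_comp[rotated])
 have cl: "cl (g \<circ> t) (g x) = cl t x" if hx: "x \<in> X" for x
 proof -
  obtain y where y: "y \<in> cells \<alpha>" "x = t y" using tabE[OF t hx] .
  then show ?thesis using cl_t[OF gt y(1)] t by simp
 qed
 have gp: "g permutes X" using g by (simp add: G_def)
 have cl': "cl t (?i x) = cl (g \<circ> t) x" if "x \<in> X" for x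
  using cl[of "?i x"] that permutes_in_image[OF permutes_inv[OF gp]] permutes_inverses[OF gp] by simp
 have conj: "g \<circ> \<sigma> \<circ> ?i \<in> C (g \<circ> t)" if s: "\<sigma> \<in> C t" for \<sigma>
 proof -
  have sp: "\<sigma> permutes X" using s by (simp add: C_iff[OF t])
  have "cl (g \<circ> t) (g (\<sigma> (?i x))) = cl (g \<circ> t) x" if x: "x \<in> X" for x
  proof -
   have 1: "?i x \<in> X" using x permutes_in_image[OF permutes_inv[OF gp]] by simp
   then have 2: "\<sigma> (?i x) \<in> X" using permutes_in_image[OF sp] by simp
   show ?thesis using cl[OF 2] s 1 cl'[OF x] by (simp add: C_iff[OF t])
  qed
  then show ?thesis unfolding C_iff[OF gt] using gp sp by (auto intro!: permutes_compose permutes_inv)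
 qed
 have conj': "?i \<circ> \<sigma> \<circ> g \<in> C t" if s: "\<sigma> \<in> C (g \<circ> t)" for \<sigma>
 proof -
  have sp: "\<sigma> permutes X" using s by (simp add: C_iff[OF gt])
  have "cl t (?i (\<sigma> (g x))) = cl t x" if x: "x \<in> X" for x
  proof -
   have 1: "g x \<in> X" using x permutes_in_image[OF gp] by simp
   then have 2: "\<sigma> (g x) \<in> X" using permutes_in_image[OF sp] by simp
   show ?thesis using cl'[OF 2] s 1 cl[OF x] by (simp add: C_iff[OF gt])
  qed
  then show ?thesis unfolding C_iff[OF t] using gp sp by (auto intro!: permutes_compose permutes_inv)
 qed
 have "e (g \<circ> t) = (\<Sum>\<sigma>\<in>C t. smul (of_int (sign \<sigma>)) (act g (basis_vec (tabloid \<alpha> (\<sigma> \<circ> t)))))"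
  unfolding polytabloid_def
 proof (rule sum.reindex_bij_witness[where i = "\<lambda>\<sigma>. g \<circ> \<sigma> \<circ> ?i" and j = "\<lambda>\<sigma>. ?i \<circ> \<sigma> \<circ> g"])
  fix \<sigma> assume s: "\<sigma> \<in> C (g \<circ> t)"
  show "g \<circ> (?i \<circ> \<sigma> \<circ> g) \<circ> ?i = \<sigma>" using permutes_inverses[OF gp] by (simp add: fun_eq_iff)
  show "?i \<circ> \<sigma> \<circ> g \<in> C t" by (rule conj'[OF s])
  have sG: "\<sigma> \<in> G" using s C_group(5)[OF gt] by auto
  have "sign (?i \<circ> \<sigma> \<circ> g) = sign \<sigma> * (sign g * sign g)" using sG g by (simp add: sgn_comp G_group sgn_inv mult_ac)
  also have "... = sign \<sigma>" by (simp add: sign_def)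
  finally have "sign (?i \<circ> \<sigma> \<circ> g) = sign \<sigma>" .
  moreover have "g \<circ> (?i \<circ> \<sigma> \<circ> g \<circ> t) = \<sigma> \<circ> (g \<circ> t)" using permutes_inverses[OF gp] by (simp add: fun_eq_iff)
  ultimately show "smul (of_int (sign (?i \<circ> \<sigma> \<circ> g))) (act g (basis_vec (tabloid \<alpha> (?i \<circ> \<sigma> \<circ> g \<circ> t)))) =
    smul (of_int (sign \<sigma>)) (basis_vec (tabloid \<alpha> (\<sigma> \<circ> (g \<circ> t))))"
   by (simp add: tabloid_comp[symmetric] del: tabloid_comp)
 next
  fix \<sigma> assume s: "\<sigma> \<in> C t"
  show "?i \<circ> (g \<circ> \<sigma> \<circ> ?i) \<circ> g = \<sigma>" using permutes_inverses[OF gp] by (simp add: fun_eq_iff)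
  show "g \<circ> \<sigma> \<circ> ?i \<in> C (g \<circ> t)" by (rule conj[OF s])
 qed
 then show ?thesis by (simp add: polytabloid_def lin_sum[OF lin_act] linD[OF lin_act])
qed

lemma e_comp: "t \<in> TB ==> q \<in> C t ==> e (q \<circ> t) = smul (of_int (sign q)) (e t)"
 using act_e[of t q] act_K[of t q] C_group(5)[of t] by (auto simp: e_K)

lemma e_cong: assumes t: "t \<in> TB" and eq: "\<And>x. x \<in> cells \<alpha> ==> t' x = t x"
 shows "e t' = e t" "tabloid \<alpha> t' = tabloid \<alpha> t"
proof -
 have im: "(\<sigma> \<circ> t') ` {x \<in> cells \<alpha>. P x} = (\<sigma> \<circ> t) ` {x \<in> cells \<alpha>. P x}" for P and \<sigma> :: "'a => 'a"
  by (rule image_cong) (auto simp: eq)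
 have tb: "tabloid \<alpha> (\<sigma> \<circ> t') = tabloid \<alpha> (\<sigma> \<circ> t)" for \<sigma> :: "'a => 'a"
  unfolding tabloid_def im ..
 have "C t' = C t" unfolding column_group_def using im[of id] by simp
 then show "e t' = e t" by (simp add: polytabloid_def tb)
 show "tabloid \<alpha> t' = tabloid \<alpha> t" using tb[of id] by simp
qed

lemma tab_trans: assumes "t \<in> TB" "t' \<in> TB"
 obtains g where "g \<in> G" "\<And>x. x \<in> cells \<alpha> ==> t' x = g (t x)"
proof -
 define g where "g = (\<lambda>x. if x \<in> X then t' (the_inv_into (cells \<alpha>) t x) else x)"
 note b = tab_bij[OF assms(1)] tab_bij[OF assms(2)]
 have "bij_betw (t' \<circ> the_inv_into (cells \<alpha>) t) X X"
  using bij_betw_the_inv_into[OF b(1)] b(2) by (rule bij_betw_trans)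
 then have "bij_betw g X X" by (subst bij_betw_cong[of X g "t' \<circ> the_inv_into (cells \<alpha>) t"]) (auto simp: g_def)
 then have "g permutes X" by (rule bij_imp_permutes) (simp add: g_def)
 moreover have "t' x = g (t x)" if "x \<in> cells \<alpha>" for x
 proof -
  have "t x \<in> X" using b(1) that by (auto simp: bij_betw_def)
  then show ?thesis using that b(1) by (simp add: g_def the_inv_into_f_f bij_betw_def)
 qed
 ultimately show ?thesis using that by (auto simp: G_def)
qed

lemma row_nth: "t \<in> TB ==> i < l ==> tabloid \<alpha> t ! i = (\<lambda>c. t (i, c)) ` {..<nu i}"
 by (auto simp: tabloid_def l_def[symmetric] cells_eq)

lemma length_tabloid: "length (tabloid \<alpha> t) = l" by (simp add: tabloid_def l_def)

lemma tabloid_OT: assumes t: "t \<in> TB" shows "tabloid \<alpha> t \<in> OT"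
proof (rule otabI)
 have inj: "inj_on t (cells \<alpha>)" and im: "t ` cells \<alpha> = X" using tab_bij[OF t] by (auto simp: bij_betw_def)
 show "length (tabloid \<alpha> t) = length (map int (parts \<alpha>))" by (simp add: length_tabloid l_def)
 show "int (card (tabloid \<alpha> t ! i)) = map int (parts \<alpha>) ! i" if "i < length (map int (parts \<alpha>))" for i
 proof -
  have i: "i < l" using that by (simp add: l_def)
  have "inj_on (\<lambda>c. t (i, c)) {..<nu i}"
   using inj i by (auto simp: inj_on_def cells_eq)
  then show ?thesis using i by (simp add: row_nth[OF t] card_image nu_def l_def)
 qed
 show "tabloid \<alpha> t ! i \<inter> tabloid \<alpha> t ! j = {}" if "i < length (map int (parts \<alpha>))" "j < length (map int (parts \<alpha>))" "i \<noteq> j" for i j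
 proof -
  have ij: "i < l" "j < l" using that by (auto simp: l_def)
  have "t (i, c) \<noteq> t (j, c')" if "c < nu i" "c' < nu j" for c c'
   using inj_on_eq_iff[OF inj, of "(i, c)" "(j, c')"] that ij `i \<noteq> j` by (simp add: cells_eq)
  then show ?thesis using ij by (auto simp: row_nth[OF t])
 qed
 show "\<Union>(set (tabloid \<alpha> t)) = X"
  unfolding im[symmetric] tabloid_def by (auto simp: cells_eq l_def)
qed

text \<open>No two entries of a row of \<open>T\<close> stand in the same column of \<open>t\<close>. Here \<open>T\<close> may have any sizes, not only
  those of \<open>\<alpha>\<close>.\<close>

definition sep :: "(nat \<times> nat => 'a) => 'a set list => bool" where
 "sep t T \<longleftrightarrow> (\<forall>W\<in>set T. inj_on (cl t) W)"

definition Xc :: "(nat \<times> nat => 'a) => nat => 'a set" where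
 "Xc t c = {x \<in> X. c \<le> cl t x}"

lemma card_Xc: assumes t: "t \<in> TB" shows "card (Xc t c) = (\<Sum>i<l. nu i - c)"
proof -
 have "Xc t c = t ` (SIGMA r:{..<l}. {c..<nu r})"
 proof
  show "Xc t c \<subseteq> t ` (SIGMA r:{..<l}. {c..<nu r})"
  proof
   fix x assume x: "x \<in> Xc t c"
   then obtain y where y: "y \<in> cells \<alpha>" "x = t y" using tabE[OF t] by (auto simp: Xc_def)
   then have "y \<in> (SIGMA r:{..<l}. {c..<nu r})" using x t by (auto simp: Xc_def cells_eq)
   then show "x \<in> t ` (SIGMA r:{..<l}. {c..<nu r})" using y by blast
  qed
  show "t ` (SIGMA r:{..<l}. {c..<nu r}) \<subseteq> Xc t c"
  proof
   fix x assume "x \<in> t ` (SIGMA r:{..<l}. {c..<nu r})"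
   then obtain y where y: "y \<in> (SIGMA r:{..<l}. {c..<nu r})" "x = t y" by blast
   then have "y \<in> cells \<alpha>" "c \<le> snd y" by (auto simp: cells_eq)
   then show "x \<in> Xc t c" using y t tab_bij[OF t] by (auto simp: Xc_def bij_betw_def)
  qed
 qed
 moreover have "inj_on t (SIGMA r:{..<l}. {c..<nu r})"
  using tab_bij[OF t] by (auto simp: bij_betw_def cells_eq intro: inj_on_subset)
 ultimately show ?thesis by (simp add: card_image)
qed

lemma card_row_Xc: assumes "finite W" "inj_on (cl t) W" "W \<subseteq> X" shows "card W - c \<le> card (W \<inter> Xc t c)"
proof -
 have "card (W - Xc t c) \<le> card {..<c}"
  by (rule card_inj_on_le[of "cl t"]) (use assms in "auto simp: Xc_def intro: inj_on_subset")
 moreover have "card W = card (W \<inter> Xc t c) + card (W - Xc t c)" using assms by (intro card_Int_Diff)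
 ultimately show ?thesis by simp
qed

lemma sum_rows_Xc:
 assumes T: "T \<in> otab (map int \<mu>) X"
 shows "(\<Sum>i<length \<mu>. card (T ! i \<inter> Xc t c)) = card (Xc t c)"
proof -
 have len: "length T = length \<mu>" using otabD(1)[OF T] by simp
 have "Xc t c \<subseteq> \<Union>(set T)" using otabD(4)[OF T] by (auto simp: Xc_def)
 then have "Xc t c = (\<Union>i<length \<mu>. T ! i \<inter> Xc t c)" using len by (fastforce simp: in_set_conv_nth)
 moreover have "card (\<Union>i<length \<mu>. T ! i \<inter> Xc t c) = (\<Sum>i<length \<mu>. card (T ! i \<inter> Xc t c))"
 proof (rule card_UN_disjoint)
  show "\<forall>i\<in>{..<length \<mu>}. finite (T ! i \<inter> Xc t c)" using fX by (auto simp: Xc_def)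
  show "\<forall>i\<in>{..<length \<mu>}. \<forall>j\<in>{..<length \<mu>}. i \<noteq> j \<longrightarrow> T ! i \<inter> Xc t c \<inter> (T ! j \<inter> Xc t c) = {}"
   using otabD(3)[OF T] by fastforce
 qed simp
 ultimately show ?thesis by simp
qed

lemma row_sub: "T \<in> otab as X ==> W \<in> set T ==> W \<subseteq> X" using otabD(4)[of T as X] by blast

text \<open>Of a row of size \<open>x\<close> at most \<open>c\<close> entries stand in the first \<open>c\<close> columns of \<open>t\<close>, so at least
  \<open>x - c\<close> stand further right.\<close>

lemma sep_dom:
 assumes t: "t \<in> TB" and T: "T \<in> otab (map int \<mu>) X" and s: "sep t T"
 shows "(\<Sum>x\<leftarrow>\<mu>. x - c) \<le> (\<Sum>i<l. nu i - c)"
proof -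
 have len: "length T = length \<mu>" using otabD(1)[OF T] by simp
 have "(\<Sum>x\<leftarrow>\<mu>. x - c) = (\<Sum>i<length \<mu>. \<mu> ! i - c)"
  by (simp add: sum_list_sum_nth lessThan_atLeast0)
 also have "... \<le> (\<Sum>i<length \<mu>. card (T ! i \<inter> Xc t c))"
 proof (rule sum_mono)
  fix i assume i: "i \<in> {..<length \<mu>}"
  then have W: "T ! i \<in> set T" using len by simp
  have "card (T ! i) = \<mu> ! i" using otabD(2)[OF T, of i] i by simp
  then show "\<mu> ! i - c \<le> card (T ! i \<inter> Xc t c)"
   using card_row_Xc[of "T ! i" t c] row_sub[OF T W] s W fX finite_subset by (auto simp: sep_def)
 qed
 also have "... = (\<Sum>i<l. nu i - c)" using sum_rows_Xc[OF T] card_Xc[OF t] by simp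
 finally show ?thesis .
qed

text \<open>If the sizes are those of \<open>\<alpha>\<close>, equality holds in \<open>sep_dom\<close> for all \<open>c\<close>, so row \<open>i\<close> of \<open>T\<close> meets exactly
  the first \<open>nu i\<close> columns; sorting the entries of each column of \<open>t\<close> by the rows of \<open>T\<close> is a column
  permutation.\<close>

lemma sep_tabloid:
 assumes t: "t \<in> TB" and T: "T \<in> OT" and s: "sep t T"
 obtains q where "q \<in> C t" "T = tabloid \<alpha> (q \<circ> t)"
proof -
 have len: "length T = l" using otabD(1)[OF T] by (simp add: l_def)
 have cT: "card (T ! i) = nu i" if "i < l" for i using otabD(2)[OF T, of i] that by (simp add: nu_def l_def)
 have inj: "inj_on (cl t) (T ! i)" if "i < l" for i using s that len by (simp add: sep_def)
 have sub: "T ! i \<subseteq> X" if "i < l" for i using row_sub[OF T] that len by simp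
 have fin: "finite (T ! i)" if "i < l" for i using sub[OF that] fX finite_subset by blast
 have ge: "nu j - c \<le> card (T ! j \<inter> Xc t c)" if "j < l" for j c
  using card_row_Xc[OF fin[OF that] inj[OF that] sub[OF that]] cT[OF that] by simp
 have im: "cl t ` (T ! i) = {..<nu i}" if i: "i < l" for i
 proof (rule card_subset_eq)
  have "(\<Sum>j<l. card (T ! j \<inter> Xc t (nu i))) = (\<Sum>j<l. nu j - nu i)"
   using sum_rows_Xc[OF T] card_Xc[OF t] by (simp add: l_def)
  moreover have "(\<Sum>j<l. nu j - nu i) < (\<Sum>j<l. card (T ! j \<inter> Xc t (nu i)))" if "card (T ! i \<inter> Xc t (nu i)) \<noteq> 0"
   by (rule sum_strict_mono_ex1) (use ge i that in "auto intro!: bexI[of _ i]")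
  ultimately have "card (T ! i \<inter> Xc t (nu i)) = 0" by fastforce
  then have "T ! i \<inter> Xc t (nu i) = {}" using fin[OF i] by simp
  then show "cl t ` (T ! i) \<subseteq> {..<nu i}" using sub[OF i] by (auto simp: Xc_def not_le)
  show "card (cl t ` (T ! i)) = card {..<nu i}" using card_image[OF inj[OF i]] cT[OF i] by simp
 qed simp
 define t' where "t' = (\<lambda>(i, c). the_inv_into (T ! i) (cl t) c)"
 have t'1: "t' (i, c) \<in> T ! i" "cl t (t' (i, c)) = c" if "i < l" "c < nu i" for i c
 proof -
  have c: "c \<in> cl t ` (T ! i)" using im[OF that(1)] that(2) by simp
  show "t' (i, c) \<in> T ! i" using the_inv_into_into[OF inj[OF that(1)] c] by (auto simp: t'_def)
  show "cl t (t' (i, c)) = c" using f_the_inv_into_f[OF inj[OF that(1)] c] by (simp add: t'_def)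
 qed
 have row: "(\<lambda>c. t' (i, c)) ` {..<nu i} = T ! i" if i: "i < l" for i
 proof
  show "(\<lambda>c. t' (i, c)) ` {..<nu i} \<subseteq> T ! i" using t'1 i by auto
  show "T ! i \<subseteq> (\<lambda>c. t' (i, c)) ` {..<nu i}"
  proof
   fix x assume x: "x \<in> T ! i"
   have "t' (i, cl t x) = x" using the_inv_into_f_f[OF inj[OF i] x] by (simp add: t'_def)
   moreover have "cl t x < nu i" using im[OF i] x by auto
   ultimately show "x \<in> (\<lambda>c. t' (i, c)) ` {..<nu i}" by (metis imageI lessThan_iff)
  qed
 qed
 have "t' ` cells \<alpha> = X"
 proof -
  have "t' ` cells \<alpha> = (\<Union>i<l. (\<lambda>c. t' (i, c)) ` {..<nu i})" by (force simp: cells_eq)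
  also have "... = (\<Union>i<l. T ! i)" using row by simp
  also have "... = \<Union>(set T)" using len by (auto simp: set_conv_nth)
  finally show ?thesis using otabD(4)[OF T] by simp
 qed
 then have "bij_betw t' (cells \<alpha>) X"
  using card_cells finite_cells by (simp add: bij_betw_def eq_card_imp_inj_on)
 then have t': "t' \<in> TB" by (simp add: tableaux_def)
 obtain q where q: "q \<in> G" "\<And>x. x \<in> cells \<alpha> ==> t' x = q (t x)" using tab_trans[OF t t'] by blast
 have "cl t (q x) = cl t x" if hx: "x \<in> X" for x
 proof -
  obtain i c where y: "(i, c) \<in> cells \<alpha>" "x = t (i, c)" using tabE[OF t hx] by (metis surj_pair)
  then have "i < l" "c < nu i" by (auto simp: cells_eq)
  then show ?thesis using t'1(2)[of i c] q(2)[OF y(1)] y t by simp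
 qed
 then have "q \<in> C t" using q(1) by (simp add: C_iff[OF t] G_def)
 moreover have "T = tabloid \<alpha> (q \<circ> t)"
 proof -
  have "tabloid \<alpha> (q \<circ> t) = tabloid \<alpha> t'"
   by (rule e_cong(2)[OF t']) (simp add: q(2))
  also have "... = T"
   by (rule nth_equalityI) (simp_all add: length_tabloid len row_nth[OF t'] row)
  finally show ?thesis by simp
 qed
 ultimately show ?thesis using that by blast
qed

lemma not_sepE:
 assumes t: "t \<in> TB" and T: "T \<in> otab as X" and ns: "\<not> sep t T"
 obtains \<tau> where "\<tau> \<in> C t" "sign \<tau> = -1" "\<And>W. W \<in> set T ==> \<tau> ` W = W" "\<tau> \<circ> \<tau> = id"
proof -
 obtain W x y where W: "W \<in> set T" "x \<in> W" "y \<in> W" "x \<noteq> y" "cl t x = cl t y"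
  using ns by (auto simp: sep_def inj_on_def)
 let ?\<tau> = "transpose x y"
 have xy: "x \<in> X" "y \<in> X" using row_sub[OF T W(1)] W by auto
 have "?\<tau> permutes X" using xy by (intro permutes_swap_id) auto
 then have "?\<tau> \<in> C t" using W xy by (auto simp: C_iff[OF t] transpose_def)
 moreover have "sign ?\<tau> = -1" using W by (simp add: sign_swap_id)
 moreover have "?\<tau> ` V = V" if V: "V \<in> set T" for V
 proof (cases "V = W")
  case True
  then show ?thesis using W by simp
 next
  case False
  obtain i j where "i < length T" "j < length T" "T ! i = V" "T ! j = W" using V W by (metis in_set_conv_nth)
  then have "V \<inter> W = {}" using otabD(1,3)[OF T] False by metis
  then have "x \<notin> V" "y \<notin> V" using W by auto
  then show ?thesis by simp
 qed
 moreover have "?\<tau> \<circ> ?\<tau> = id" by simp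
 ultimately show ?thesis using that by blast
qed

lemma two_zero: "v = - v ==> v = (0 :: 'b \<Rightarrow>\<^sub>0 complex)"
proof (rule poly_mapping_eqI)
 fix k assume "v = - v"
 then have "lookup v k = lookup (- v) k" by simp
 then show "lookup v k = lookup 0 k" by simp
qed

text \<open>Either \<open>T\<close> comes from \<open>t\<close> by a column permutation, which only changes the sign, or a transposition in
  the column group fixes \<open>T\<close> and the signed sum cancels.\<close>

lemma K_basis:
 assumes t: "t \<in> TB" and T: "T \<in> OT"
 shows "\<exists>c. K t (basis_vec T) = smul c (e t)"
proof (cases "sep t T")
 case True
 then obtain q where q: "q \<in> C t" "T = tabloid \<alpha> (q \<circ> t)" using sep_tabloid[OF t T] by blast
 from K_act[OF t q(1), of "basis_vec (tabloid \<alpha> t)"]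
 have "K t (basis_vec T) = smul (of_int (sign q)) (e t)" by (simp add: q(2) tabloid_comp e_K)
 then show ?thesis ..
next
 case False
 then obtain \<tau> where \<tau>: "\<tau> \<in> C t" "sign \<tau> = -1" "\<And>W. W \<in> set T ==> \<tau> ` W = W" using not_sepE[OF t T] by metis
 have "act \<tau> (basis_vec T) = basis_vec T" using \<tau>(3) by (simp add: map_idI)
 then have "K t (basis_vec T) = - K t (basis_vec T)" using K_act[OF t \<tau>(1), of "basis_vec T"] \<tau>(2) by (simp add: smul_minus1)
 then have "K t (basis_vec T) = smul 0 (e t)" using two_zero by simp
 then show ?thesis ..
qed

lemma row_col_trivial:
 assumes t: "t \<in> TB" and q: "q \<in> C t" and eq: "map ((`) q) (tabloid \<alpha> t) = tabloid \<alpha> t"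
 shows "q = id"
proof -
 have qp: "q permutes X" using q by (simp add: C_iff[OF t])
 have inj: "inj_on t (cells \<alpha>)" using tab_bij[OF t] by (simp add: bij_betw_def)
 have "q x = x" if x: "x \<in> X" for x
 proof -
  obtain i c where y: "(i, c) \<in> cells \<alpha>" "x = t (i, c)" using tabE[OF t x] by (metis surj_pair)
  then have i: "i < l" "c < nu i" by (auto simp: cells_eq)
  have "q ` (tabloid \<alpha> t ! i) = tabloid \<alpha> t ! i" using eq i(1) by (metis length_tabloid nth_map)
  moreover have "x \<in> tabloid \<alpha> t ! i" using i y by (auto simp: row_nth[OF t])
  ultimately have "q x \<in> tabloid \<alpha> t ! i" by blast
  then obtain c' where c': "c' < nu i" "q x = t (i, c')" using i by (auto simp: row_nth[OF t])
  have "(i, c') \<in> cells \<alpha>" using c' i by (simp add: cells_eq)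
  then have "cl t (q x) = c'" using c' cl_t[OF t, of "(i, c')"] by simp
  moreover have "cl t (q x) = c" using q x y cl_t[OF t y(1)] by (simp add: C_iff[OF t])
  ultimately show ?thesis using c' y by simp
 qed
 then show ?thesis using qp by (auto simp: fun_eq_iff permutes_def)
qed

lemma lookup_basis: "lookup (basis_vec T) T' = (if T = T' then 1 else (0::complex))"
 by (simp add: lookup_single when_def)

lemma coeff_e: assumes t: "t \<in> TB" shows "lookup (e t) (tabloid \<alpha> t) = 1"
proof -
 have "lookup (e t) (tabloid \<alpha> t) = (\<Sum>\<sigma>\<in>C t. of_int (sign \<sigma>) * (if map ((`) \<sigma>) (tabloid \<alpha> t) = tabloid \<alpha> t then 1 else 0))"
  by (simp add: polytabloid_def lookup_sum lookup_basis tabloid_comp)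
 also have "... = (\<Sum>\<sigma>\<in>C t. if \<sigma> = id then 1 else 0)"
  by (intro sum.cong refl) (use row_col_trivial[OF t] in "auto simp: sign_id map_idI")
 also have "... = 1" using C_group[OF t] by simp
 finally show ?thesis .
qed

end

section \<open>The character of a Specht module\<close>

lemma (in shape) act_tabs: "g \<in> G ==> v \<in> specht \<alpha> X ==> act g v \<in> specht \<alpha> X"
 unfolding specht_def
 by (rule lin_span[OF lin_act free.subspace_span]) (auto simp: act_e intro!: free.span_base imageI tab_comp)

lemma (in shape) tabs_span: "polytabloid \<alpha> X ` tableaux \<alpha> X \<subseteq> free.span (basis_vec ` OT)"
proof
 fix v assume "v \<in> polytabloid \<alpha> X ` tableaux \<alpha> X"
 then obtain t where t: "t \<in> TB" "v = e t" by blast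
 show "v \<in> free.span (basis_vec ` OT)"
  unfolding t(2) polytabloid_def
  using C_group(5)[OF t(1)] by (intro free.span_sum free.span_scale free.span_base imageI tabloid_OT tab_comp t) auto
qed

text \<open>A basis \<open>B\<close> of polytabloids with a dual family of functionals. The character \<open>chi\<close> is defined with this
  basis; \<open>f\<close> is kept explicit because the module \<open>W\<close> is handled with the same functionals.\<close>

locale shape_basis = shape +
 fixes B :: "('a set list \<Rightarrow>\<^sub>0 complex) set" and f
 assumes BP: "B \<subseteq> polytabloid \<alpha> X ` tableaux \<alpha> X" and fB: "finite B"
  and lf: "\<And>b. linf (f b)"
  and delta: "\<And>b b'. b \<in> B ==> b' \<in> B ==> f b b' = (if b = b' then 1 else 0)"
  and expand: "\<And>v. v \<in> specht \<alpha> X ==> v = (\<Sum>b\<in>B. smul (f b v) b)"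

lemma (in shape) ex_basis: obtains B f where "shape_basis \<alpha> X B f"
proof (rule dual_family_exists[of "basis_vec ` OT" "polytabloid \<alpha> X ` tableaux \<alpha> X"])
 show "finite (basis_vec ` OT :: ('a set list \<Rightarrow>\<^sub>0 complex) set)" using finite_otab[OF fX] by simp
 show "polytabloid \<alpha> X ` tableaux \<alpha> X \<subseteq> free.span (basis_vec ` OT)" by (rule tabs_span)
 fix B and f :: "('a set list \<Rightarrow>\<^sub>0 complex) => ('a set list \<Rightarrow>\<^sub>0 complex) => complex"
 assume B: "B \<subseteq> polytabloid \<alpha> X ` tableaux \<alpha> X" "finite B"
  "\<And>b. linf (f b)" "\<And>b b'. b \<in> B ==> b' \<in> B ==> f b b' = (if b = b' then 1 else 0)"
  "\<And>v. v \<in> free.span (polytabloid \<alpha> X ` tableaux \<alpha> X) ==> v = (\<Sum>b\<in>B. smul (f b v) b)"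
 have "shape_basis \<alpha> X B f"
  by unfold_locales (use B in "auto simp: specht_def")
 then show ?thesis by (rule that)
qed

context shape_basis
begin

abbreviation S where "S \<equiv> specht \<alpha> X"
definition tr where "tr T = (\<Sum>b\<in>B. f b (T b))"
definition chi where "chi g = tr (act g)"

lemma BS: "b \<in> B ==> b \<in> S" using BP by (auto simp: specht_def intro: free.span_base)
lemma eS: "t \<in> TB ==> e t \<in> S" by (auto simp: specht_def intro: free.span_base)
lemma subS: "free.subspace S" by (simp add: specht_def)

lemma tr_cyclic:
 assumes "lin T" "lin U" "\<And>v. v \<in> S ==> T v \<in> S" "\<And>v. v \<in> S ==> U v \<in> S"
 shows "tr (\<lambda>v. T (U v)) = tr (\<lambda>v. U (T v))"
proof -
 have "f b (T (U b)) = (\<Sum>b'\<in>B. f b' (U b) * f b (T b'))" if "b \<in> B" for b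
 proof -
  have "T (U b) = T (\<Sum>b'\<in>B. smul (f b' (U b)) b')" using expand[of "U b"] assms BS that by simp
  then show ?thesis by (simp add: lin_sum assms linD linf_sum[OF lf] linfD[OF lf])
 qed
 moreover have "f b (U (T b)) = (\<Sum>b'\<in>B. f b' (T b) * f b (U b'))" if "b \<in> B" for b
 proof -
  have "U (T b) = U (\<Sum>b'\<in>B. smul (f b' (T b)) b')" using expand[of "T b"] assms BS that by simp
  then show ?thesis by (simp add: lin_sum assms linD linf_sum[OF lf] linfD[OF lf])
 qed
 ultimately have "tr (\<lambda>v. T (U v)) = (\<Sum>b\<in>B. \<Sum>b'\<in>B. f b' (U b) * f b (T b'))"
  "tr (\<lambda>v. U (T v)) = (\<Sum>b\<in>B. \<Sum>b'\<in>B. f b' (T b) * f b (U b'))" by (simp_all add: tr_def)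
 moreover have "(\<Sum>b\<in>B. \<Sum>b'\<in>B. f b' (U b) * f b (T b')) = (\<Sum>b'\<in>B. \<Sum>b\<in>B. f b' (U b) * f b (T b'))"
  by (rule sum.swap)
 ultimately show ?thesis by (simp only: mult.commute)
qed

subsection \<open>Averages over tabloid stabilisers\<close>

definition St where "St T = {g \<in> G. \<forall>W\<in>set T. g ` W = W}"

lemma fSt: "finite (St T)" using finite_G by (simp add: St_def)

lemma St_group: "h \<in> St T ==> g \<in> St T ==> g \<circ> h \<in> St T"
proof -
 assume h: "h \<in> St T" and g: "g \<in> St T"
 have "(g \<circ> h) ` W = W" if "W \<in> set T" for W
 proof -
  have "(g \<circ> h) ` W = g ` h ` W" by (rule image_comp[symmetric])
  also have "... = W" using h g that by (simp add: St_def)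
  finally show ?thesis .
 qed
 then show ?thesis using h g by (simp add: St_def G_group)
qed

lemma St_inv: "h \<in> St T ==> pinv h \<in> St T"
proof -
 assume h: "h \<in> St T"
 then have hp: "h permutes X" by (simp add: St_def G_def)
 have "pinv h ` W = W" if "W \<in> set T" for W
 proof -
  have "h ` W = W" using h that by (simp add: St_def)
  then have "pinv h ` W = pinv h ` h ` W" by simp
  also have "... = W" using hp by (simp add: image_image permutes_inverses)
  finally show ?thesis .
 qed
 then show ?thesis using h by (simp add: St_def G_group)
qed

definition av where "av T v = (\<Sum>g\<in>St T. act g v)"

lemma lin_av: "lin (av T)" unfolding av_def by (intro lin_sum_fun lin_act)

lemma av_act: "h \<in> St T ==> av T (act h v) = av T v"
 unfolding av_def act_act
proof (rule sum.reindex_bij_witness[where j = "\<lambda>g. g \<circ> h" and i = "\<lambda>g. g \<circ> pinv h"])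
 assume h: "h \<in> St T"
 then have hG: "h \<in> G" by (simp add: St_def)
 fix g assume g: "g \<in> St T"
 show "g \<circ> h \<circ> pinv h = g" "g \<circ> pinv h \<circ> h = g"
  by (simp_all only: comp_assoc G_inv[OF hG] comp_id)
 show "g \<circ> h \<in> St T" "g \<circ> pinv h \<in> St T"
  using St_group[OF h g] St_group[OF St_inv[OF h] g] by simp_all
 show "act (g \<circ> h) v = act (g \<circ> h) v" ..
qed

text \<open>A transposition in the column group of \<open>t\<close> that stabilises \<open>T\<close> changes the sign of \<open>e t\<close> but not the average.\<close>

lemma av_zero: assumes t: "t \<in> TB" and T: "T \<in> otab as X" and ns: "\<not> sep t T"
 shows "av T (e t) = 0"
proof -
 obtain \<tau> where \<tau>: "\<tau> \<in> C t" "sign \<tau> = -1" "\<And>W. W \<in> set T ==> \<tau> ` W = W" using not_sepE[OF t T ns] by metis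
 have "\<tau> \<in> St T" using \<tau> C_group(5)[OF t] by (auto simp: St_def)
 then have "av T (e t) = av T (act \<tau> (e t))" by (simp add: av_act)
 also have "act \<tau> (e t) = - e t" using act_K[OF t \<tau>(1), of "basis_vec (tabloid \<alpha> t)"] \<tau>(2) by (simp add: e_K smul_minus1)
 also have "av T (- e t) = - av T (e t)" by (rule linD(4)[OF lin_av])
 finally have "av T (e t) = - av T (e t)" .
 then show ?thesis by (rule two_zero)
qed

lemma tr_av: "(\<Sum>g\<in>St T. chi g) = tr (av T)"
 unfolding chi_def tr_def av_def linf_sum[OF lf] by (rule sum.swap)

text \<open>If the sizes \<open>\<mu>\<close> are not dominated by \<open>\<alpha>\<close>, no polytabloid survives the average: the character of the
  Specht module is orthogonal to that permutation character.\<close>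

lemma tr_av_zero:
 assumes T: "T \<in> otab (map int \<mu>) X" and c: "(\<Sum>i<l. nu i - c) < (\<Sum>x\<leftarrow>\<mu>. x - c)"
 shows "(\<Sum>g\<in>St T. chi g) = 0"
 unfolding tr_av tr_def
proof (intro sum.neutral ballI)
 fix b assume "b \<in> B"
 then obtain t where t: "t \<in> TB" "b = e t" using BP by blast
 have "\<not> sep t T" using sep_dom[OF t(1) T, of c] c by auto
 then show "f b (av T b) = 0" using av_zero[OF t(1) T] t(2) by (simp add: linfD[OF lf])
qed

lemma OT_tab: assumes "T \<in> OT" obtains t where "t \<in> TB" "tabloid \<alpha> t = T"
proof -
 have len: "length T = l" using otabD(1)[OF assms] by (simp add: l_def)
 have cT: "card (T ! i) = nu i" if "i < l" for i using otabD(2)[OF assms, of i] that by (simp add: nu_def l_def)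
 have fin: "finite (T ! i)" if "i < l" for i
  using row_sub[OF assms, of "T ! i"] that len fX finite_subset by fastforce
 have "\<exists>h. bij_betw h {..<nu i} (T ! i)" if "i < l" for i
  using ex_bij_betw_nat_finite[OF fin[OF that]] cT[OF that] by (simp add: lessThan_atLeast0)
 then obtain h where h: "\<And>i. i < l ==> bij_betw (h i) {..<nu i} (T ! i)" by metis
 define t where "t = (\<lambda>(i, c). h i c)"
 have row: "(\<lambda>c. t (i, c)) ` {..<nu i} = T ! i" if "i < l" for i
  using h[OF that] by (simp add: t_def bij_betw_def)
 have "t ` cells \<alpha> = X"
 proof -
  have "t ` cells \<alpha> = (\<Union>i<l. (\<lambda>c. t (i, c)) ` {..<nu i})" by (force simp: cells_eq)
  also have "... = (\<Union>i<l. T ! i)" using row by simp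
  also have "... = \<Union>(set T)" using len by (auto simp: set_conv_nth)
  finally show ?thesis using otabD(4)[OF assms] by simp
 qed
 then have "bij_betw t (cells \<alpha>) X"
  using card_cells finite_cells by (simp add: bij_betw_def eq_card_imp_inj_on)
 then have t: "t \<in> TB" by (simp add: tableaux_def)
 have "tabloid \<alpha> t = T" by (rule nth_equalityI) (simp_all add: length_tabloid len row_nth[OF t] row)
 then show ?thesis using that t by blast
qed

text \<open>For \<open>\<mu> = \<alpha>\<close> the average has rank one: it maps the Specht module to the line of the average of one
  polytabloid \<open>e t\<^sub>0\<close> whose tabloid is \<open>T\<close>, and the trace is found from the coefficient of \<open>T\<close>.\<close>

lemma tr_av_self:
 assumes T: "T \<in> OT"
 shows "(\<Sum>g\<in>St T. chi g) = of_nat (card (St T))"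
proof -
 obtain t0 where t0: "t0 \<in> TB" "tabloid \<alpha> t0 = T" using OT_tab[OF T] .
 define u where "u = av T (e t0)"
 have idSt: "id \<in> St T" by (simp add: St_def G_group)
 define n where "n = (of_nat (card (St T)) :: complex)"
 have n0: "n \<noteq> 0" using fSt idSt by (auto simp: n_def card_eq_0_iff)
 have lk: "lookup (act g v) T = lookup v T" if g: "g \<in> St T" for g v
 proof -
  have "(\<lambda>v. lookup (act g v) T) = (\<lambda>v. lookup v T)"
  proof (rule linf_eqI)
   have "linf (\<lambda>v :: 'a set list \<Rightarrow>\<^sub>0 complex. lookup v T)" by (simp add: linf_def lookup_add)
   then show "linf (\<lambda>v :: 'a set list \<Rightarrow>\<^sub>0 complex. lookup v T)" "linf (\<lambda>v. lookup (act g v) T)"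
    using linf_comp lin_act by blast+
   fix T'
   have "map ((`) g) T = T" using g by (simp add: St_def map_idI)
   moreover have "inj ((`) g)" using g by (auto simp: St_def G_def inj_image_eq_iff permutes_inj intro!: injI)
   ultimately have "map ((`) g) T' = T \<longleftrightarrow> T' = T" by (metis inj_map_eq_map)
   then show "lookup (act g (basis_vec T')) T = lookup (basis_vec T') T"
    by (simp add: lookup_basis)
  qed
  then show ?thesis by metis
 qed
 have lkav: "lookup (av T v) T = n * lookup v T" for v
  by (simp add: av_def lookup_sum lk n_def)
 have u1: "lookup u T = n" using coeff_e[OF t0(1)] t0(2) by (simp add: u_def lkav)
 \<comment> \<open>\<open>av T v = \<phi> v \<cdot> u\<close> on the Specht module, and \<open>\<phi> u\<close> is the size of the stabiliser\<close>
 define \<phi> where "\<phi> v = lookup (av T v) T / n" for v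
 have avS: "av T (e t) = smul (\<phi> (e t)) u" if t: "t \<in> TB" for t
 proof (cases "sep t T")
  case False
  then have "av T (e t) = 0" by (rule av_zero[OF t T])
  then show ?thesis by (simp add: \<phi>_def)
 next
  case True
  then obtain q where q: "q \<in> C t" "T = tabloid \<alpha> (q \<circ> t)" using sep_tabloid[OF t T] by blast
  have qG: "q \<in> G" using q C_group(5)[OF t] by auto
  obtain g where g: "g \<in> G" "\<And>x. x \<in> cells \<alpha> ==> (q \<circ> t) x = g (t0 x)"
   using tab_trans[OF t0(1) tab_comp[OF qG t]] by blast
  have gt: "g \<circ> t0 \<in> TB" using tab_comp[OF g(1) t0(1)] .
  have eq: "e (q \<circ> t) = e (g \<circ> t0)" "tabloid \<alpha> (q \<circ> t) = tabloid \<alpha> (g \<circ> t0)"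
   using e_cong[OF gt, of "q \<circ> t"] g(2) by auto
  have "map ((`) g) T = T" using eq(2) q(2) t0(2) by (simp add: tabloid_comp)
  then have "map ((`) g) T = map id T" by simp
  then have "\<forall>W\<in>set T. g ` W = id W" by (simp only: map_eq_conv)
  then have "g \<in> St T" using g(1) by (simp add: St_def)
  have "av T (e (q \<circ> t)) = u"
   using av_act[OF `g \<in> St T`, of "e t0"] by (simp add: eq act_e[OF t0(1) g(1), symmetric] u_def)
  then have qe: "smul (of_int (sign q)) (av T (e t)) = u"
   using e_comp[OF t q(1)] by (simp add: linD[OF lin_av])
  have "smul (of_int (sign q)) u = av T (e t)" unfolding qe[symmetric] by (simp add: sgn_sq)
  moreover have "\<phi> (e t) = of_int (sign q)"
   unfolding \<phi>_def calculation[symmetric] by (simp add: u1 n0)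
  ultimately show ?thesis by simp
 qed
 have linp: "linf \<phi>"
  by (simp add: linf_def \<phi>_def linD[OF lin_av] lookup_add add_divide_distrib)
 have "\<phi> (\<Sum>b\<in>B. smul (f b u) b) = \<phi> u"
 proof -
  have "u \<in> S" unfolding u_def av_def
   by (intro free.subspace_sum subS act_tabs eS t0) (auto simp: St_def)
  then show ?thesis using expand by metis
 qed
 then have "(\<Sum>b\<in>B. f b u * \<phi> b) = \<phi> u" by (simp add: linf_sum[OF linp] linfD[OF linp])
 moreover have "tr (av T) = (\<Sum>b\<in>B. f b u * \<phi> b)"
  unfolding tr_def
 proof (intro sum.cong refl)
  fix b assume "b \<in> B"
  then obtain t where t: "t \<in> TB" "b = e t" using BP by blast
  then have "av T b = smul (\<phi> b) u" using avS by simp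
  then show "f b (av T b) = f b u * \<phi> b" by (simp add: linfD[OF lf])
 qed
 moreover have "\<phi> u = n" using n0 by (simp add: \<phi>_def lkav u1)
 ultimately show ?thesis by (simp add: tr_av n_def)
qed

text \<open>Frobenius reciprocity: a permutation character is induced from the stabilisers.\<close>

lemma chi_mchar: "(\<Sum>g\<in>G. chi g * of_int (mchar as X g)) = (\<Sum>T\<in>otab as X. \<Sum>g\<in>St T. chi g)"
proof -
 have "(\<Sum>g\<in>G. chi g * of_int (mchar as X g)) = (\<Sum>g\<in>G. \<Sum>T\<in>otab as X. if \<forall>W\<in>set T. g ` W = W then chi g else 0)"
 proof (rule sum.cong[OF refl])
  fix g
  have "(\<Sum>T\<in>otab as X. if \<forall>W\<in>set T. g ` W = W then chi g else 0) = (\<Sum>T\<in>{T \<in> otab as X. \<forall>W\<in>set T. g ` W = W}. chi g)"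
   by (rule sum.inter_filter[symmetric]) (rule finite_otab[OF fX])
  then show "chi g * of_int (mchar as X g) = (\<Sum>T\<in>otab as X. if \<forall>W\<in>set T. g ` W = W then chi g else 0)"
   by (simp only: mchar_card[OF fX]) simp
 qed
 also have "... = (\<Sum>T\<in>otab as X. \<Sum>g\<in>G. if \<forall>W\<in>set T. g ` W = W then chi g else 0)" by (rule sum.swap)
 also have "... = (\<Sum>T\<in>otab as X. \<Sum>g\<in>St T. chi g)"
  unfolding St_def by (intro sum.cong refl sum.inter_filter[symmetric] finite_G)
 finally show ?thesis .
qed

lemma chi_mchar_self: "(\<Sum>g\<in>G. chi g * of_int (mchar (map int (parts \<alpha>)) X g)) = fact (card X)"
proof -
 have "(\<Sum>g\<in>G. chi g * of_int (mchar (map int (parts \<alpha>)) X g)) = of_nat (\<Sum>T\<in>OT. card (St T))"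
  by (simp add: chi_mchar tr_av_self)
 also have "(\<Sum>T\<in>OT. card (St T)) = (\<Sum>T\<in>OT. \<Sum>g\<in>G. if \<forall>W\<in>set T. g ` W = W then 1 else 0)"
 proof (rule sum.cong[OF refl])
  fix T
  have "(\<Sum>g\<in>G. if \<forall>W\<in>set T. g ` W = W then 1 else (0::nat)) = (\<Sum>g\<in>{g \<in> G. \<forall>W\<in>set T. g ` W = W}. 1)"
   by (rule sum.inter_filter[symmetric]) (rule finite_G)
  then show "card (St T) = (\<Sum>g\<in>G. if \<forall>W\<in>set T. g ` W = W then 1 else 0)" by (simp add: St_def)
 qed
 also have "... = (\<Sum>g\<in>G. \<Sum>T\<in>OT. if \<forall>W\<in>set T. g ` W = W then 1 else 0)" by (rule sum.swap)
 also have "... = (\<Sum>g\<in>G. card {T \<in> OT. \<forall>W\<in>set T. g ` W = W})"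
 proof (rule sum.cong[OF refl])
  fix g
  have "(\<Sum>T\<in>OT. if \<forall>W\<in>set T. g ` W = W then 1 else (0::nat)) = (\<Sum>T\<in>{T \<in> OT. \<forall>W\<in>set T. g ` W = W}. 1)"
   by (rule sum.inter_filter[symmetric]) (rule finite_otab[OF fX])
  then show "(\<Sum>T\<in>OT. if \<forall>W\<in>set T. g ` W = W then 1 else (0::nat)) = card {T \<in> OT. \<forall>W\<in>set T. g ` W = W}" by simp
 qed
 finally have "(\<Sum>g\<in>G. chi g * of_int (mchar (map int (parts \<alpha>)) X g)) = of_nat (\<Sum>g\<in>G. card {T \<in> OT. \<forall>W\<in>set T. g ` W = W})" .
 also have "... = of_int (\<Sum>g\<in>G. mchar (map int (parts \<alpha>)) X g)" by (simp add: mchar_card[OF fX])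
 also have "(\<Sum>g\<in>G. mchar (map int (parts \<alpha>)) X g) = fact (card X)"
 proof -
  have "sum_list (map int (parts \<alpha>)) = int (\<Sum>\<^sub># \<alpha>)"
   by (metis mset_parts sum_list_of_nat sum_mset_sum_list)
  then show ?thesis unfolding G_def using cX by (intro sum_mchar fX) auto
 qed
 finally show ?thesis by simp
qed

text \<open>By \<open>alt_dominates\<close>, the terms with \<open>w \<noteq> id\<close> are permutation characters to which \<open>tr_av_zero\<close> applies.\<close>

lemma chi_psi_inner: "(\<Sum>g\<in>G. chi g * of_int (psi l nu X g)) = fact (card X)"
proof -
 let ?\<alpha> = "\<lambda>w i. int (nu i) - int i + int (w i)"
 have cross: "(\<Sum>g\<in>G. chi g * of_int (mchar (map (?\<alpha> w) [0..<l]) X g)) = (if w = id then fact (card X) else 0)"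
  if w: "w permutes {0..<l}" for w
 proof (cases "w = id")
  case True
  then have "map (?\<alpha> w) [0..<l] = map int (parts \<alpha>)" by (subst parts_nu) simp
  then show ?thesis using True chi_mchar_self by simp
 next
  case False
  show ?thesis
  proof (cases "\<forall>i<l. ?\<alpha> w i \<ge> 0")
   case True
   define \<mu> where "\<mu> = map (\<lambda>i. nat (?\<alpha> w i)) [0..<l]"
   have eq: "map (?\<alpha> w) [0..<l] = map int \<mu>" using True by (simp add: \<mu>_def)
   obtain c where c: "(\<Sum>i<l. nu i - c) < (\<Sum>i<l. nat (?\<alpha> w i) - c)"
    using alt_dominates[of nu w l, OF nu_anti w False] by blast
   have "(\<Sum>x\<leftarrow>\<mu>. x - c) = (\<Sum>i<l. nat (?\<alpha> w i) - c)"
    by (simp add: \<mu>_def comp_def interv_sum_list_conv_sum_set_nat lessThan_atLeast0)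
   then show ?thesis unfolding eq chi_mchar using False c tr_av_zero[of _ \<mu> c] by simp
  next
   case False2: False
   then obtain i where i: "i < l" "?\<alpha> w i < 0" by (auto simp: not_le)
   then have "mchar (map (?\<alpha> w) [0..<l]) X g = 0" for g
    by (intro mchar_neg[of "?\<alpha> w i"]) auto
   then show ?thesis using False by simp
  qed
 qed
 have "(\<Sum>g\<in>G. chi g * of_int (psi l nu X g)) = (\<Sum>w | w permutes {0..<l}. of_int (sign w) * (\<Sum>g\<in>G. chi g * of_int (mchar (map (?\<alpha> w) [0..<l]) X g)))"
  unfolding psi_def of_int_sum of_int_mult sum_distrib_left
  by (subst sum.swap) (simp only: mult.left_commute)
 also have "... = (\<Sum>w | w permutes {0..<l}. if w = id then fact (card X) else 0)"
  by (intro sum.cong refl) (auto simp: cross sign_id)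
 also have "... = fact (card X)" by (subst sum.delta) (auto simp: finite_permutations permutes_id)
 finally show ?thesis .
qed

subsection \<open>Schur's lemma\<close>

text \<open>By \<open>K_e\<close>, \<open>\<Phi> (e t)\<close> is a multiple of \<open>\<Phi> (K t (e t)) = K t (\<Phi> (e t))\<close>, which is a multiple of \<open>e t\<close> by
  \<open>K_basis\<close>; the factor does not depend on \<open>t\<close> because the group is transitive on tableaux.\<close>

lemma endo_scalar:
 assumes lT: "lin \<Phi>" and TS: "\<And>v. v \<in> S ==> \<Phi> v \<in> S"
  and comm: "\<And>g v. g \<in> G ==> v \<in> S ==> \<Phi> (act g v) = act g (\<Phi> v)"
 obtains c where "\<And>v. v \<in> S ==> \<Phi> v = smul c v"
proof -
 obtain t0 where t0: "t0 \<in> TB" using TB_nonempty .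
 have "\<exists>c. K t0 u = smul c (e t0)" if u: "u \<in> free.span (basis_vec ` OT)" for u
  using u
 proof (induction rule: free.span_induct_alt)
  case base
  have "K t0 0 = smul 0 (e t0)" by (simp add: linD[OF lin_K])
  then show ?case ..
 next
  case (step c x y)
  then obtain c1 c2 where "K t0 x = smul c1 (e t0)" "K t0 y = smul c2 (e t0)" using K_basis[OF t0] by blast
  then have "K t0 (smul c x + y) = smul (c * c1 + c2) (e t0)" by (simp add: linD[OF lin_K] free.scale_left_distrib)
  then show ?case ..
 qed
 moreover have "S \<subseteq> free.span (basis_vec ` OT)"
  unfolding specht_def by (rule free.span_minimal[OF tabs_span free.subspace_span])
 ultimately obtain c' where c': "K t0 (\<Phi> (e t0)) = smul c' (e t0)" using TS[OF eS[OF t0]] by blast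
 have "K t0 (\<Phi> (e t0)) = \<Phi> (K t0 (e t0))"
  unfolding K_def lin_sum[OF lT] using C_group(5)[OF t0] comm eS[OF t0]
  by (intro sum.cong refl) (auto simp: linD[OF lT])
 also have "... = smul (of_nat (card (C t0))) (\<Phi> (e t0))" by (simp add: K_e[OF t0] linD[OF lT])
 finally have eq: "smul (of_nat (card (C t0))) (\<Phi> (e t0)) = smul c' (e t0)" using c' by simp
 have n0: "(of_nat (card (C t0)) :: complex) \<noteq> 0" using C_group[OF t0] by (auto simp: card_eq_0_iff)
 define c where "c = c' / of_nat (card (C t0))"
 have c: "\<Phi> (e t0) = smul c (e t0)"
 proof (rule poly_mapping_eqI)
  fix k
  have "lookup (smul (of_nat (card (C t0))) (\<Phi> (e t0))) k = lookup (smul c' (e t0)) k" by (simp only: eq)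
  then show "lookup (\<Phi> (e t0)) k = lookup (smul c (e t0)) k"
   using n0 by (simp add: c_def field_simps)
 qed
 have "\<Phi> v = smul c v" if "v \<in> S" for v
 proof (rule lin_eq_on_span[OF lT])
  show "lin (smul c)" by (simp add: lin_def free.scale_right_distrib mult.commute)
  show "v \<in> free.span (polytabloid \<alpha> X ` TB)" using that by (simp add: specht_def)
  fix x assume "x \<in> polytabloid \<alpha> X ` TB"
  then obtain t where t: "t \<in> TB" "x = e t" by blast
  obtain g where g: "g \<in> G" "\<And>x. x \<in> cells \<alpha> ==> t x = g (t0 x)" using tab_trans[OF t0 t(1)] by blast
  have "e t = e (g \<circ> t0)" using e_cong(1)[OF tab_comp[OF g(1) t0], of t] g(2) by simp
  then have x: "x = act g (e t0)" using act_e[OF t0 g(1)] t by simp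
  then show "\<Phi> x = smul c x" using comm[OF g(1) eS[OF t0]] c by (simp add: linD[OF lin_act])
 qed
 then show ?thesis by (rule that)
qed

text \<open>The orthogonality relation, from Schur's lemma: averaging a rank-one map over the group gives a scalar,
  which the trace determines.\<close>

lemma schur_norm: "(\<Sum>g\<in>G. chi g * chi (pinv g)) = fact (card X)"
proof -
 let ?i = "pinv :: ('a => 'a) => _"
 \<comment> \<open>the average of the rank-one map \<open>v \<mapsto> f q v \<cdot> p\<close>\<close>
 define \<Phi> where "\<Phi> p q v = (\<Sum>g\<in>G. smul (f q (act (?i g) v)) (act g p))" for p q v
 have lP: "lin (\<Phi> p q)" for p q
  unfolding \<Phi>_def by (intro lin_sum_fun lin_rank1 linf_comp[OF lf lin_act])
 have PS: "\<Phi> p q v \<in> S" if "p \<in> B" "v \<in> S" for p q v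
  unfolding \<Phi>_def using that by (intro free.subspace_sum free.subspace_scale subS act_tabs BS)
 have Pc: "\<Phi> p q (act h v) = act h (\<Phi> p q v)" if h: "h \<in> G" for p q h v
 proof -
  have "\<Phi> p q (act h v) = (\<Sum>g\<in>G. smul (f q (act (?i (h \<circ> g)) (act h v))) (act (h \<circ> g) p))"
   unfolding \<Phi>_def by (rule G_reindex_left[OF h, symmetric])
  also have "... = (\<Sum>g\<in>G. act h (smul (f q (act (?i g) v)) (act g p)))"
  proof (intro sum.cong refl)
   fix g assume g: "g \<in> G"
   have "?i (h \<circ> g) \<circ> h = ?i g \<circ> (?i h \<circ> h)"
    using g h by (simp add: G_def o_inv_distrib permutes_bij comp_assoc)
   also have "... = ?i g" using h by (simp add: G_inv)
   finally have "?i (h \<circ> g) \<circ> h = ?i g" .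
   then show "smul (f q (act (?i (h \<circ> g)) (act h v))) (act (h \<circ> g) p) = act h (smul (f q (act (?i g) v)) (act g p))"
    by (simp add: act_act linD[OF lin_act])
  qed
  also have "... = act h (\<Phi> p q v)" by (simp add: \<Phi>_def lin_sum[OF lin_act])
  finally show ?thesis .
 qed
 have "\<exists>c. \<forall>v\<in>S. \<Phi> p q v = smul c v" if p: "p \<in> B" for p q
  using endo_scalar[of "\<Phi> p q", OF lP PS[OF p] Pc] by metis
 then obtain c where c: "\<And>p q v. p \<in> B ==> v \<in> S ==> \<Phi> p q v = smul (c p q) v" by metis
 define N where "N = (of_nat (card B) :: complex)"
 have cN: "c p p * N = fact (card X)" if p: "p \<in> B" for p
 proof -
  have "tr (\<Phi> p p) = (\<Sum>b\<in>B. c p p)" unfolding tr_def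
   by (intro sum.cong refl) (simp add: c[OF p BS] linfD[OF lf] delta)
  then have 1: "tr (\<Phi> p p) = c p p * N" by (simp add: N_def)
  have "tr (\<Phi> p p) = (\<Sum>g\<in>G. \<Sum>b\<in>B. f p (act (?i g) b) * f b (act g p))"
   unfolding tr_def \<Phi>_def linf_sum[OF lf] linfD[OF lf] by (rule sum.swap)
  also have "... = (\<Sum>g\<in>G. 1)"
  proof (intro sum.cong refl)
   fix g assume g: "g \<in> G"
   have "f p p = f p (act (?i g) (act g p))" using g by (simp add: act_act G_inv act_id)
   also have "act g p = (\<Sum>b\<in>B. smul (f b (act g p)) b)" by (rule expand) (rule act_tabs[OF g BS[OF p]])
   also have "f p (act (?i g) ...) = (\<Sum>b\<in>B. f p (act (?i g) b) * f b (act g p))"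
    by (simp add: lin_sum[OF lin_act] linD[OF lin_act] linf_sum[OF lf] linfD[OF lf] mult.commute)
   finally show "(\<Sum>b\<in>B. f p (act (?i g) b) * f b (act g p)) = 1" using p by (simp add: delta)
  qed
  also have "... = fact (card X)" using fX by (simp add: G_def card_permutations)
  finally show ?thesis using 1 by simp
 qed
 have "(\<Sum>g\<in>G. chi g * chi (?i g)) = (\<Sum>g\<in>G. \<Sum>p\<in>B. \<Sum>q\<in>B. f p (act g p) * f q (act (?i g) q))"
  by (simp add: chi_def tr_def sum_product)
 also have "... = (\<Sum>p\<in>B. \<Sum>g\<in>G. \<Sum>q\<in>B. f p (act g p) * f q (act (?i g) q))" by (rule sum.swap)
 also have "... = (\<Sum>p\<in>B. \<Sum>q\<in>B. \<Sum>g\<in>G. f p (act g p) * f q (act (?i g) q))" by (intro sum.cong refl sum.swap)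
 also have "... = (\<Sum>p\<in>B. \<Sum>q\<in>B. f p (\<Phi> p q q))"
  by (simp add: \<Phi>_def linf_sum[OF lf] linfD[OF lf] mult.commute)
 also have "... = (\<Sum>p\<in>B. \<Sum>q\<in>B. if p = q then c p q else 0)"
  by (intro sum.cong refl) (simp add: c BS linfD[OF lf] delta)
 also have "... = (\<Sum>p\<in>B. c p p)" using fB by simp
 finally have 2: "(\<Sum>g\<in>G. chi g * chi (?i g)) = (\<Sum>p\<in>B. c p p)" .
 have "(\<Sum>p\<in>B. c p p) * N = (\<Sum>p\<in>B. fact (card X))"
  unfolding sum_distrib_right by (intro sum.cong refl cN)
 then have "(\<Sum>p\<in>B. c p p) * N = N * fact (card X)" by (simp add: N_def)
 moreover have "N \<noteq> 0"
 proof
  assume "N = 0"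
  then have "B = {}" using fB by (simp add: N_def)
  obtain t where t: "t \<in> TB" using TB_nonempty .
  have "e t = 0" using expand[OF eS[OF t]] `B = {}` by simp
  then show False using coeff_e[OF t] by simp
 qed
 ultimately show ?thesis using 2 by simp
qed

subsection \<open>Reality\<close>

definition cj :: "('a set list \<Rightarrow>\<^sub>0 complex) => ('a set list \<Rightarrow>\<^sub>0 complex)" where
 "cj v = Poly_Mapping.map cnj v"

lemma lookup_cj: "lookup (cj v) x = cnj (lookup v x)"
 by (simp add: cj_def Poly_Mapping.map.rep_eq when_def)

lemma cj_sum: "cj (sum g A) = (\<Sum>x\<in>A. cj (g x))"
 by (rule poly_mapping_eqI) (simp add: lookup_cj lookup_sum)

lemma cj_smul: "cj (smul c v) = smul (cnj c) (cj v)"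
 by (rule poly_mapping_eqI) (simp add: lookup_cj)

lemma cj_e: "cj (e t) = e t"
proof -
 have "cj (basis_vec T) = basis_vec T" for T
  by (rule poly_mapping_eqI) (simp add: lookup_cj lookup_basis)
 then show ?thesis by (simp add: polytabloid_def cj_sum cj_smul)
qed

text \<open>The polytabloids have real coefficients, so the matrix of a permutation in a basis of polytabloids is
  real.\<close>

lemma chi_real: assumes g: "g \<in> G" shows "chi g \<in> \<real>"
proof -
 have "cnj (f b (act g b)) = f b (act g b)" if b: "b \<in> B" for b
 proof -
  obtain t where t: "t \<in> TB" "b = e t" using BP b by blast
  define v where "v = act g b"
  have v: "v = e (g \<circ> t)" using act_e[OF t(1) g] t(2) by (simp add: v_def)
  have ex: "v = (\<Sum>b\<in>B. smul (f b v) b)" unfolding v by (rule expand) (rule eS[OF tab_comp[OF g t(1)]])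
  have cb: "cj b' = b'" if "b' \<in> B" for b' using BP that cj_e by blast
  have "v = cj v" by (simp add: v cj_e)
  also have "... = (\<Sum>b\<in>B. smul (cnj (f b v)) b)" by (subst ex) (simp add: cj_sum cj_smul cb)
  finally have "f b v = (\<Sum>b'\<in>B. cnj (f b' v) * f b b')" by (metis (no_types, lifting) linf_sum[OF lf] linfD(2)[OF lf] sum.cong)
  also have "... = (\<Sum>b'\<in>B. if b = b' then cnj (f b' v) else 0)" by (intro sum.cong refl) (simp add: delta b)
  also have "... = cnj (f b v)" using b fB by simp
  finally show ?thesis by (simp add: v_def)
 qed
 then show ?thesis unfolding chi_def tr_def by (intro sum_in_Reals) (metis Reals_cnj_iff)
qed

end

text \<open>A permutation is conjugate to its inverse: reverse each cycle. On the cycle of a chosen point \<open>r\<close>,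
  \<open>h\<close> maps \<open>g\<^sup>n r\<close> to \<open>g\<^sup>-\<^sup>n r\<close>.\<close>

lemma conj_inverse:
 assumes fX: "finite X" and g: "g permutes X"
 obtains h where "h permutes X" "h \<circ> g = pinv g \<circ> h"
proof -
 let ?i = "pinv g"
 have pg: "permutation g" using fX g by (auto simp: permutation_permutes)
 define r where "r x = (SOME y. y \<in> orbit g x)" for x
 have rin: "r x \<in> orbit g x" for x unfolding r_def by (rule someI) (rule orbit.base)
 have orb: "orbit g y = orbit g x" if "y \<in> orbit g x" for x y
  using that cyclic_on_orbit'[OF pg] orbit_cyclic_eq3 by metis
 have rg: "r (g x) = r x" for x unfolding r_def using permutation_orbit_step[OF pg] by metis
 have ex: "\<exists>n. (g ^^ n) (r x) = x" for x
 proof -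
  have "x \<in> orbit g x" by (rule permutation_self_in_orbit[OF pg])
  then have "x \<in> orbit g (r x)" using orb[OF rin[of x]] by simp
  then obtain n where "x = (g ^^ n) (r x)" by (auto simp: orbit_altdef)
  then show ?thesis by metis
 qed
 have gi: "?i (g x) = x" "g (?i x) = x" for x using g by (auto simp: permutes_inverses)
 have inj: "inj g" using g by (rule permutes_inj)
 have gn: "(g ^^ n) ((?i ^^ n) x) = x" for n x
 proof (induction n arbitrary: x)
  case (Suc n)
  then show ?case using gi by (simp add: funpow_swap1)
 qed simp
 have gn': "(?i ^^ n) ((g ^^ n) x) = x" for n x
 proof (induction n arbitrary: x)
  case (Suc n)
  have "(?i ^^ Suc n) ((g ^^ Suc n) x) = (?i ^^ n) (?i (g ((g ^^ n) x)))" by (simp add: funpow_swap1)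
  then show ?case using Suc gi by simp
 qed simp
 define h where "h x = (?i ^^ (SOME n. (g ^^ n) (r x) = x)) (r x)" for x
 have wd: "h x = (?i ^^ n) (r x)" if n: "(g ^^ n) (r x) = x" for n x
 proof -
  define m where "m = (SOME n. (g ^^ n) (r x) = x)"
  have m: "(g ^^ m) (r x) = x" unfolding m_def by (rule someI_ex[OF ex])
  define a where "a = r x"
  have eq: "(g ^^ m) a = (g ^^ n) a" using m n by (simp add: a_def)
  have "(?i ^^ m) a = (?i ^^ m) ((?i ^^ n) ((g ^^ n) a))" by (simp add: gn')
  also have "... = (?i ^^ n) ((?i ^^ m) ((g ^^ m) a))" by (simp add: eq funpow_add[symmetric, THEN fun_cong, unfolded comp_def] add.commute)
  also have "... = (?i ^^ n) a" by (simp add: gn')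
  finally show ?thesis by (simp add: h_def m_def[symmetric] a_def)
 qed
 have comm: "h (g x) = ?i (h x)" for x
 proof -
  obtain n where n: "(g ^^ n) (r x) = x" using ex by blast
  then have "(g ^^ Suc n) (r (g x)) = g x" by (simp add: rg)
  from wd[OF this] wd[OF n] show ?thesis by (simp add: rg)
 qed
 have hh: "h (h x) = x" for x
 proof -
  obtain n where n: "(g ^^ n) (r x) = x" using ex by blast
  have hx: "h x = (?i ^^ n) (r x)" by (rule wd[OF n])
  have "(g ^^ n) (h x) = r x" by (simp add: hx gn)
  moreover have "r ((g ^^ n) y) = r y" for y by (induction n) (auto simp: rg)
  ultimately have rr: "r (h x) = r x"
  proof -
   have "r (h x) = r (r x)" using `(g ^^ n) (h x) = r x` `\<And>y. r ((g ^^ n) y) = r y` by metis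
   also have "r (r x) = r x" unfolding r_def[of "r x"] orb[OF rin[of x]] by (simp add: r_def)
   finally show ?thesis .
  qed
  have "r x \<in> orbit g (h x)" using rin[of "h x"] rr by simp
  obtain m where m: "(g ^^ m) (r (h x)) = h x" using ex by blast
  have "h (h x) = (?i ^^ m) (r x)" using wd[OF m] rr by simp
  also have "... = (?i ^^ m) ((g ^^ n) (h x))" by (simp add: `(g ^^ n) (h x) = r x`)
  also have "... = (?i ^^ m) ((g ^^ n) ((g ^^ m) (r x)))" using m rr by simp
  also have "... = (?i ^^ m) ((g ^^ m) ((g ^^ n) (r x)))" by (simp add: funpow_add[symmetric, THEN fun_cong, unfolded comp_def] add.commute)
  also have "... = x" by (simp add: gn' n)
  finally show ?thesis .
 qed
 have hX: "h x = x" if "x \<notin> X" for x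
 proof -
  have "g x = x" using g that by (simp add: permutes_def)
  then have "orbit g x = {x}" by (simp add: orbit_eq_singleton_iff)
  then have "r x = x" using rin[of x] by simp
  then show ?thesis using wd[of 0 x] by simp
 qed
 have "bij h" using hh by (metis bijI' )
 then have "h permutes X" using hX by (simp add: permutes_def bij_iff)
 moreover have "h \<circ> g = ?i \<circ> h" using comm by auto
 ultimately show ?thesis using that by blast
qed

context shape_basis
begin

lemma chi_inv: assumes g: "g \<in> G" shows "chi (pinv g) = chi g"
proof -
 obtain h where h: "h permutes X" "h \<circ> g = pinv g \<circ> h"
  using conj_inverse[OF fX] g by (auto simp: G_def)
 let ?h = "pinv h"
 have hG: "h \<in> G" "?h \<in> G" using h by (auto simp: G_def permutes_inv)
 have gi: "pinv g = h \<circ> g \<circ> ?h" using h(2) G_inv(1)[OF hG(1)] by (simp add: comp_assoc)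
 have "chi (pinv g) = tr (\<lambda>v. act (h \<circ> g) (act ?h v))"
  by (simp add: chi_def tr_def act_act gi)
 also have "... = tr (\<lambda>v. act ?h (act (h \<circ> g) v))"
  by (rule tr_cyclic) (use hG g in "auto simp: lin_act act_tabs G_group")
 also have "... = chi g" using G_inv(2)[OF hG(1)] by (simp add: chi_def tr_def act_act comp_assoc[symmetric])
 finally show ?thesis .
qed

text \<open>The sum of \<open>(chi g - psi g)\<^sup>2\<close> over the group is \<open>n! - 2 n! + n! = 0\<close>, and the summands are squares of
  real numbers.\<close>

theorem chi_psi: assumes g: "g \<in> G" shows "chi g = of_int (psi l nu X g)"
proof -
 let ?p = "\<lambda>g. (of_int (psi l nu X g) :: complex)"
 have ps: "psi l nu X (pinv g) = psi l nu X g" if "g \<in> G" for g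
  using that mchar_inv[of g X] by (simp add: psi_def G_def)
 have "(\<Sum>g\<in>G. psi l nu X g * psi l nu X g) = fact (card X)"
  unfolding G_def by (rule psi_norm[OF fX nu_anti nu_zero sum_nu])
 then have 1: "(\<Sum>g\<in>G. ?p g * ?p g) = fact (card X)"
  by (metis (mono_tags, lifting) of_int_fact of_int_mult of_int_sum sum.cong)
 have 2: "(\<Sum>g\<in>G. chi g * chi g) = fact (card X)"
  using schur_norm by (simp add: chi_inv)
 have "(\<Sum>g\<in>G. (chi g - ?p g) * (chi g - ?p g)) = (\<Sum>g\<in>G. chi g * chi g) - 2 * (\<Sum>g\<in>G. chi g * ?p g) + (\<Sum>g\<in>G. ?p g * ?p g)"
  by (simp add: algebra_simps sum.distrib sum_subtractf sum_distrib_left)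
 also have "... = 0" using 1 2 chi_psi_inner by simp
 finally have z: "(\<Sum>g\<in>G. (chi g - ?p g) * (chi g - ?p g)) = 0" .
 define \<theta> where "\<theta> g = Re (chi g - ?p g)" for g
 have th: "chi g - ?p g = of_real (\<theta> g)" if "g \<in> G" for g
 proof -
  have "chi g - ?p g \<in> \<real>" using chi_real[OF that] by simp
  then show ?thesis by (simp add: \<theta>_def complex_is_Real_iff complex_eq_iff)
 qed
 have "of_real (\<Sum>g\<in>G. \<theta> g * \<theta> g) = (0::complex)"
  using z by (simp add: th)
 then have "(\<Sum>g\<in>G. \<theta> g * \<theta> g) = 0" by (simp only: of_real_eq_0_iff)
 then have "\<theta> g * \<theta> g = 0" using g finite_G by (subst (asm) sum_nonneg_eq_0_iff) auto
 then show ?thesis using th[OF g] by simp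
qed

end

section \<open>Power sums and weighted permutations\<close>

lemma smul_eq_mult: "smul c f = Poly_Mapping.single 0 c * (f :: 'v cpoly)"
 unfolding smul_def by (rule mult_map_scale_conv_mult)

lemma smul_mult_left: "smul c f * g = smul c (f * g :: 'v cpoly)"
 by (simp add: smul_eq_mult mult.assoc)

lemma smul_mult_right: "f * smul c g = smul c (f * g :: 'v cpoly)"
 by (simp add: smul_eq_mult mult.left_commute)

lemma basis_mult: "basis_vec a * basis_vec b = (basis_vec (a + b) :: 'v cpoly)"
 by (simp add: mult_single)

lemma cpoly_monomial_induct [case_names one Var]:
 assumes "P (1 :: 'v cpoly)" "\<And>x m. P (basis_vec m) ==> P (Var x * basis_vec m)"
 shows "P (basis_vec (m :: 'v \<Rightarrow>\<^sub>0 nat))"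
proof (induction "\<Sum>x\<in>keys m. lookup m x" arbitrary: m rule: less_induct)
 case less
 show ?case
 proof (cases "m = 0")
  case True
  then show ?thesis using assms(1) by simp
 next
  case False
  then obtain x where x: "x \<in> keys m" by (metis ex_in_conv keys_eq_empty)
  define m' where "m' = m - Poly_Mapping.single x 1"
  have lm: "lookup m y = (if y = x then 1 else 0) + lookup m' y" for y
   using x by (auto simp: m'_def lookup_minus lookup_single when_def in_keys_iff)
  have m: "m = Poly_Mapping.single x 1 + m'"
   by (rule poly_mapping_eqI) (simp add: lm lookup_add lookup_single when_def)
  have sub: "keys m' \<subseteq> keys m" by (auto simp: in_keys_iff lm)
  have "(\<Sum>x\<in>keys m'. lookup m' x) = (\<Sum>x\<in>keys m. lookup m' x)"
   by (rule sum.mono_neutral_left) (use sub in "auto simp: in_keys_iff")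
  also have "... < (\<Sum>x\<in>keys m. lookup m x)"
   by (rule sum_strict_mono_ex1) (use x in "auto simp: lm")
  finally have "P (basis_vec m')" by (rule less)
  then have "P (Var x * basis_vec m')" by (rule assms(2))
  then show ?thesis by (simp add: Var_def basis_mult m)
 qed
qed

text \<open>The polynomials are built up by multiplication with one variable at a time; for a product with a single
  variable, \<open>phi\<close> below has an obvious combinatorial meaning.\<close>

lemma cpoly_induct [case_names add smul one Var]:
 assumes add: "\<And>f g. P f ==> P g ==> P (f + g)" and smul: "\<And>c f. P f ==> P (smul c f)"
  and one: "P (1 :: 'v cpoly)" and Var: "\<And>x f. P f ==> P (Var x * f)"
 shows "P f"
proof -
 have P0: "P 0" using smul[OF one, of 0] by simp
 have b: "P (basis_vec m)" for m by (induction m rule: cpoly_monomial_induct) (auto intro: one Var)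
 have "P (\<Sum>m\<in>A. smul (c m) (basis_vec m))" if "finite A" for A c
  using that by (induction A rule: finite_induct) (auto intro: P0 add smul b)
 then show ?thesis by (subst poly_mapping_expand) simp
qed

text \<open>The value of a monomial under the substitution \<open>h\<close>, so that \<open>subst h\<close> is the linear extension of
  \<open>monval h\<close>.\<close>

definition monval :: "('v => 'w cpoly) => ('v \<Rightarrow>\<^sub>0 nat) => 'w cpoly" where
 "monval h m = (\<Prod>x\<in>keys m. h x ^ lookup m x)"

lemma subst_lin_ext: "subst h = lin_ext (monval h)"
 by (rule ext) (simp add: subst_def lin_ext_def monval_def)

lemma lin_subst: "lin (subst h)" by (simp add: subst_lin_ext lin_lin_ext)

lemma monval_superset:
 assumes "finite A" "keys m \<subseteq> A"
 shows "monval h m = (\<Prod>x\<in>A. h x ^ lookup m x)"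
 unfolding monval_def by (rule prod.mono_neutral_left) (use assms in "auto simp: in_keys_iff")

lemma monval_add: "monval h (m + m') = monval h m * monval h m'"
proof -
 let ?A = "keys m \<union> keys m'"
 have k: "keys (m + m') \<subseteq> ?A" by (rule keys_add)
 show ?thesis
  by (subst (1 2 3) monval_superset[of ?A]) (use k in "auto simp: lookup_add power_add prod.distrib")
qed

lemma lin_mult_left: "lin (\<lambda>v. f * (v :: 'v cpoly))"
 by (simp add: lin_def distrib_left smul_mult_right)

lemma subst_mult: "subst h (f * g) = subst h f * subst h g"
proof (induction f rule: cpoly_induct)
 case (add f g')
 then show ?case by (simp add: distrib_right linD[OF lin_subst])
next
 case (smul c f)
 then show ?case by (simp add: smul_mult_left linD[OF lin_subst])
next
 case one
 show ?case using lin_ext_basis[of "monval h" 0] by (simp add: subst_lin_ext monval_def)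
next
 case (Var x f)
 have *: "subst h (Var x * f) = h x * subst h f" for f
 proof -
  have "(\<lambda>f. subst h (Var x * f)) = (\<lambda>f. h x * subst h f)"
  proof (rule lin_eqI)
   show "lin (\<lambda>f. subst h (Var x * f))" by (rule lin_comp[OF lin_subst lin_mult_left])
   show "lin (\<lambda>f. h x * subst h f)" by (rule lin_comp[OF lin_mult_left lin_subst])
   fix m
   show "subst h (Var x * basis_vec m) = h x * subst h (basis_vec m)"
    by (simp add: Var_def basis_mult subst_lin_ext monval_add) (simp add: monval_def)
  qed
  then show ?thesis by metis
 qed
 show ?case using Var by (simp add: mult.assoc *)
qed

lemma subst_one: "subst h 1 = 1"
 using lin_ext_basis[of "monval h" 0] by (simp add: subst_lin_ext monval_def)

lemma subst_Var: "subst h (Var x) = h x"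
 by (simp add: Var_def subst_lin_ext) (simp add: monval_def)

lemma subst_prod: "subst h (prod f A) = (\<Prod>x\<in>A. subst h (f x))"
 by (induction A rule: infinite_finite_induct) (auto simp: subst_one subst_mult)

lemma of_int_smul: "of_int z * f = smul (of_int z) (f :: 'v cpoly)"
proof -
 have "(of_int z :: 'v cpoly) = Poly_Mapping.single 0 (of_int z)"
  by (metis single_of_int)
 then show ?thesis by (simp add: smul_eq_mult)
qed

text \<open>The norm of a monomial under \<open>scalar\<close>: for the monomial of $\mathbf{p}_{\vec\mu}$ this is
  $\mathbf{z}_{\vec\mu}$ (see \<open>z_vec_zz\<close>).\<close>

definition zz :: "(nat \<times> nat \<Rightarrow>\<^sub>0 nat) => nat" where
 "zz m = (\<Prod>(i, j)\<in>keys m. i ^ lookup m (i, j) * fact (lookup m (i, j)))"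

lemma zz_superset:
 assumes "finite A" "keys m \<subseteq> A"
 shows "zz m = (\<Prod>x\<in>A. fst x ^ lookup m x * fact (lookup m x))"
proof -
 have "zz m = (\<Prod>x\<in>keys m. fst x ^ lookup m x * fact (lookup m x))"
  unfolding zz_def by (intro prod.cong refl) auto
 also have "... = (\<Prod>x\<in>A. fst x ^ lookup m x * fact (lookup m x))"
  by (rule prod.mono_neutral_left) (use assms in "auto simp: in_keys_iff")
 finally show ?thesis .
qed

lemma zz_single_add: "zz (Poly_Mapping.single x 1 + m) = fst x * Suc (lookup m x) * zz m"
proof -
 let ?A = "insert x (keys m)"
 let ?t = "\<lambda>m x. fst x ^ lookup m x * fact (lookup m x) :: nat"
 have k: "keys (Poly_Mapping.single x 1 + m) \<subseteq> ?A"
  by (auto simp: in_keys_iff lookup_add lookup_single when_def split: if_splits)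
 have e: "?A = insert x (keys m - {x})" by auto
 have "zz (Poly_Mapping.single x 1 + m) = ?t (Poly_Mapping.single x 1 + m) x * (\<Prod>y\<in>keys m - {x}. ?t (Poly_Mapping.single x 1 + m) y)"
  by (subst zz_superset[OF _ k], simp, subst e, subst prod.insert) auto
 also have "(\<Prod>y\<in>keys m - {x}. ?t (Poly_Mapping.single x 1 + m) y) = (\<Prod>y\<in>keys m - {x}. ?t m y)"
  by (intro prod.cong refl) (auto simp: lookup_add lookup_single when_def)
 also have "?t (Poly_Mapping.single x 1 + m) x = fst x * Suc (lookup m x) * ?t m x"
  by (simp add: lookup_add lookup_single algebra_simps)
 also have "fst x * Suc (lookup m x) * ?t m x * (\<Prod>y\<in>keys m - {x}. ?t m y) = fst x * Suc (lookup m x) * zz m"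
 proof -
  have "zz m = ?t m x * (\<Prod>y\<in>keys m - {x}. ?t m y)"
   by (subst zz_superset[of ?A], simp, blast, subst e, subst prod.insert) auto
  then show ?thesis by simp
 qed
 finally show ?thesis .
qed

lemma lookup_Var_mult:
 "lookup (Var x * f) (Poly_Mapping.single x 1 + m) = lookup f m"
proof -
 have "(\<lambda>f. lookup (Var x * f) (Poly_Mapping.single x 1 + m)) = (\<lambda>f. lookup f m)"
 proof (rule linf_eqI)
  fix m'
  have "Poly_Mapping.single x 1 + m' = Poly_Mapping.single x (1::nat) + m \<longleftrightarrow> m' = m" by simp
  then show "lookup (Var x * basis_vec m') (Poly_Mapping.single x 1 + m) = lookup (basis_vec m') m"
   unfolding Var_def basis_mult by (simp add: lookup_single when_def)
 qed (auto simp: linf_def distrib_left lookup_add smul_mult_right)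
 then show ?thesis by metis
qed

lemma lookup_Var_mult_0:
 assumes "lookup m x = 0"
 shows "lookup (Var x * f) m = 0"
proof -
 have "(\<lambda>f. lookup (Var x * f) m) = (\<lambda>f. 0)"
 proof (rule linf_eqI)
  fix m'
  have "Poly_Mapping.single x 1 + m' \<noteq> m" using assms by (auto simp: lookup_add)
  then show "lookup (Var x * basis_vec m') m = 0"
   unfolding Var_def basis_mult by (simp add: lookup_single when_def)
 qed (auto simp: linf_def distrib_left lookup_add smul_mult_right)
 then show ?thesis by metis
qed

text \<open>In the application \<open>Y\<close> is the set of blocks of $d^\omega$, \<open>\<sigma>\<close> is the permutation induced by
  $d^{\omega+1}$ and \<open>w\<close> is the size of a block.\<close>

locale wperm =
 fixes Y :: "'a set" and \<sigma> :: "'a => 'a" and w :: "'a => nat"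
 assumes fY: "finite Y" and perm: "\<sigma> permutes Y" and w_inv: "\<And>y. y \<in> Y ==> w (\<sigma> y) = w y"
  and w_pos: "\<And>y. y \<in> Y ==> w y > 0"
begin

definition Inv :: "'a set => bool" where "Inv Z \<longleftrightarrow> Z \<subseteq> Y \<and> \<sigma> ` Z = Z"

text \<open>A cycle of length \<open>a\<close> on elements of weight \<open>b\<close> contributes the variable $p_a[X_b]$; \<open>mon Z\<close> is the
  monomial of all cycles on \<open>Z\<close>. \<open>phi f Z\<close> is the scalar product of \<open>f\<close> with this monomial, and
  \<open>conv\<close> is the convolution over the splittings of \<open>Z\<close> into two invariant sets.\<close>

definition orbs :: "'a set => 'a set set" where "orbs Z = orbit \<sigma> ` Z"
definition color :: "'a set => nat \<times> nat" where "color Q = (card Q, w (SOME y. y \<in> Q))"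
definition mon :: "'a set => (nat \<times> nat \<Rightarrow>\<^sub>0 nat)" where
 "mon Z = (\<Sum>Q\<in>orbs Z. Poly_Mapping.single (color Q) 1)"
definition phi :: "symX => 'a set => complex" where
 "phi f Z = lookup f (mon Z) * of_nat (zz (mon Z))"
definition conv :: "('a set => complex) => ('a set => complex) => 'a set => complex" where
 "conv F H Z = (\<Sum>Z1 | Z1 \<subseteq> Z \<and> \<sigma> ` Z1 = Z1. F Z1 * H (Z - Z1))"

lemma perm': "permutation \<sigma>" using fY perm by (auto simp: permutation_permutes)

lemma inj: "inj \<sigma>" using perm by (rule permutes_inj)

lemma self_orbit: "y \<in> orbit \<sigma> y" by (rule permutation_self_in_orbit[OF perm'])

lemma orbit_eq: "x \<in> orbit \<sigma> y ==> orbit \<sigma> x = orbit \<sigma> y"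
 using orbit_cyclic_eq3[OF cyclic_on_orbit'[OF perm']] by metis

lemma Inv_finite: "Inv Z ==> finite Z" using fY finite_subset by (auto simp: Inv_def)

lemma Inv_iff: assumes "Inv Z" shows "\<sigma> x \<in> Z \<longleftrightarrow> x \<in> Z"
 using assms inj unfolding Inv_def by (metis inj_image_mem_iff)

lemma Inv_orbit_sub: assumes "Inv Z" "y \<in> Z" shows "orbit \<sigma> y \<subseteq> Z"
proof
 fix x assume "x \<in> orbit \<sigma> y"
 then show "x \<in> Z" by induction (use assms Inv_iff in auto)
qed

lemma InvI: assumes "Z \<subseteq> Y" "\<And>x. x \<in> Z ==> \<sigma> x \<in> Z" shows "Inv Z"
 unfolding Inv_def
proof
 show "\<sigma> ` Z = Z"
  by (rule endo_inj_surj) (use assms fY inj in "auto intro: finite_subset inj_on_subset")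
qed fact

lemma Inv_Y: "Inv Y" using perm by (simp add: Inv_def permutes_image)

lemma Inv_orbit: "y \<in> Y ==> Inv (orbit \<sigma> y)"
 by (rule InvI) (use Inv_orbit_sub[OF Inv_Y] in "auto intro: orbit.step")

lemma Inv_Diff: "Inv Z ==> Inv Z1 ==> Inv (Z - Z1)"
 by (rule InvI) (auto simp: Inv_iff, auto simp: Inv_def)

lemma Inv_Un: "Inv Z ==> Inv Z1 ==> Inv (Z \<union> Z1)"
 by (rule InvI) (auto simp: Inv_iff, auto simp: Inv_def)

lemma Inv_empty: "Inv {}" by (simp add: Inv_def)

lemma sub_Inv: "Inv Z ==> {Z1. Z1 \<subseteq> Z \<and> \<sigma> ` Z1 = Z1} = {Z1. Z1 \<subseteq> Z \<and> Inv Z1}"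
 by (auto simp: Inv_def)

lemma conv_Inv: "Inv Z ==> conv F H Z = (\<Sum>Z1 | Z1 \<subseteq> Z \<and> Inv Z1. F Z1 * H (Z - Z1))"
 by (simp add: conv_def sub_Inv)

lemma fin_sub: "Inv Z ==> finite {Z1. Z1 \<subseteq> Z \<and> P Z1}"
 using Inv_finite by (auto intro: finite_subset[of _ "Pow Z"])

lemma orbsE: assumes "Inv Z" "Q \<in> orbs Z"
 obtains y where "y \<in> Z" "Q = orbit \<sigma> y" "Inv Q" "Q \<subseteq> Z" "Q \<noteq> {}"
proof -
 obtain y where y: "y \<in> Z" "Q = orbit \<sigma> y" using assms(2) by (auto simp: orbs_def)
 then show ?thesis using that Inv_orbit Inv_orbit_sub assms(1) self_orbit Inv_def by blast
qed

lemma orbs_finite: "Inv Z ==> finite (orbs Z)" by (simp add: orbs_def Inv_finite)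

lemma orbs_Diff: assumes "Inv Z" "Q \<in> orbs Z"
 shows "orbs (Z - Q) = orbs Z - {Q}"
proof -
 obtain y where y: "y \<in> Z" "Q = orbit \<sigma> y" using assms(2) by (auto simp: orbs_def)
 have "orbit \<sigma> x = Q \<longleftrightarrow> x \<in> Q" for x unfolding y(2) using orbit_eq self_orbit by blast
 then show ?thesis by (auto simp: orbs_def)
qed

lemma mon_remove: assumes "Inv Z" "Q \<in> orbs Z"
 shows "mon Z = Poly_Mapping.single (color Q) 1 + mon (Z - Q)"
 unfolding mon_def orbs_Diff[OF assms] using assms orbs_finite by (simp add: sum.remove)

lemma lookup_mon: assumes "Inv Z" shows "lookup (mon Z) x = card {Q \<in> orbs Z. color Q = x}"
proof -
 have "lookup (mon Z) x = (\<Sum>Q\<in>orbs Z. if color Q = x then 1 else 0)"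
  unfolding mon_def lookup_sum by (intro sum.cong refl) (simp add: lookup_single when_def)
 also have "... = (\<Sum>Q\<in>{Q \<in> orbs Z. color Q = x}. 1)"
  by (rule sum.inter_filter[symmetric]) (rule orbs_finite[OF assms])
 finally show ?thesis by simp
qed

text \<open>The variable $p_a[X_b]$ marks one cycle of length \<open>a\<close> and weight \<open>b\<close>. The factor \<open>a\<close> and the number of
  such cycles make up the quotient of the norms of the two monomials (\<open>zz_single_add\<close>).\<close>

lemma phi_Var: assumes Z: "Inv Z"
 shows "phi (Var x * f) Z = (\<Sum>Q | Q \<in> orbs Z \<and> color Q = x. of_nat (fst x) * phi f (Z - Q))"
proof -
 let ?C = "{Q \<in> orbs Z. color Q = x}"
 have fC: "finite ?C" using orbs_finite[OF Z] by simp
 have "of_nat (card ?C) * (of_nat (fst x) * phi f (Z - Q)) = phi (Var x * f) Z" if Q: "Q \<in> ?C" for Q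
 proof -
  have m: "mon Z = Poly_Mapping.single x 1 + mon (Z - Q)" using mon_remove[OF Z] Q by auto
  then have "card ?C = Suc (lookup (mon (Z - Q)) x)"
   using lookup_mon[OF Z, of x] by (simp add: lookup_add)
  then show ?thesis unfolding phi_def m lookup_Var_mult zz_single_add by (simp add: algebra_simps)
 qed
 then have *: "of_nat (card ?C) * (of_nat (fst x) * phi f (Z - Q)) = phi (Var x * f) Z" if "Q \<in> ?C" for Q using that by blast
 show ?thesis
 proof (cases "?C = {}")
  case True
  have "lookup (mon Z) x = 0" unfolding lookup_mon[OF Z] by (simp only: True card.empty)
  then show ?thesis unfolding phi_def True by (simp add: lookup_Var_mult_0)
 next
  case False
  define n where "n = (of_nat (card ?C) :: complex)"
  have n0: "n \<noteq> 0" using False fC by (simp add: n_def card_eq_0_iff)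
  have "(\<Sum>Q\<in>?C. of_nat (fst x) * phi f (Z - Q)) = (\<Sum>Q\<in>?C. phi (Var x * f) Z / n)"
   using * n0 by (intro sum.cong refl) (auto simp: n_def field_simps)
  also have "... = phi (Var x * f) Z" using n0 by (simp add: n_def)
  finally show ?thesis by simp
 qed
qed

lemma phi_add: "phi (f + g) Z = phi f Z + phi g Z" by (simp add: phi_def lookup_add distrib_right)
lemma phi_smul: "phi (smul c f) Z = c * phi f Z" by (simp add: phi_def)
lemma phi_sum: "phi (sum f A) Z = (\<Sum>x\<in>A. phi (f x) Z)"
 by (simp add: phi_def lookup_sum sum_distrib_right)

lemma mon_empty: "mon {} = 0" by (simp add: mon_def orbs_def)

lemma phi_one: assumes "Inv Z" shows "phi 1 Z = (if Z = {} then 1 else 0)"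
proof (cases "Z = {}")
 case True
 then show ?thesis by (simp add: phi_def mon_empty zz_def)
next
 case False
 then obtain y where "orbit \<sigma> y \<in> orbs Z" by (auto simp: orbs_def)
 then have "mon Z = Poly_Mapping.single (color (orbit \<sigma> y)) 1 + mon (Z - orbit \<sigma> y)" by (rule mon_remove[OF assms])
 then have "lookup (mon Z) (color (orbit \<sigma> y)) \<noteq> 0" by (simp add: lookup_add)
 then have "mon Z \<noteq> 0" by auto
 then show ?thesis using False by (simp add: phi_def lookup_one)
qed

text \<open>By induction on \<open>f\<close> with \<open>phi_Var\<close>: a cycle marked in the product is a cycle marked in the first part.\<close>

lemma phi_mult: "Inv Z ==> phi (f * g) Z = conv (phi f) (phi g) Z"
proof (induction f arbitrary: Z rule: cpoly_induct)
 case (add f g')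
 then show ?case by (simp add: distrib_right phi_add conv_def sum.distrib)
next
 case (smul c f)
 then show ?case by (simp add: smul_mult_left phi_smul conv_def sum_distrib_left mult.assoc)
next
 case one
 have "(\<Sum>Z1 | Z1 \<subseteq> Z \<and> Inv Z1. phi 1 Z1 * phi g (Z - Z1)) = (\<Sum>Z1\<in>{{}}. phi 1 Z1 * phi g (Z - Z1))"
  by (rule sum.mono_neutral_right) (use fin_sub[OF one] in "auto simp: phi_one Inv_empty")
 then show ?case using one by (simp add: conv_Inv phi_one Inv_empty)
next
 case (Var x f)
 let ?S1 = "SIGMA Q:{Q \<in> orbs Z. color Q = x}. {Z1. Z1 \<subseteq> Z - Q \<and> Inv Z1}"
 let ?S2 = "SIGMA Z1:{Z1. Z1 \<subseteq> Z \<and> Inv Z1}. {Q \<in> orbs Z1. color Q = x}"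
 have ID: "Inv (Z - Q)" if "Q \<in> orbs Z" for Q
  using that Var.prems Inv_Diff by (auto elim!: orbsE[OF Var.prems])
 have "phi (Var x * f * g) Z = (\<Sum>Q | Q \<in> orbs Z \<and> color Q = x. of_nat (fst x) * phi (f * g) (Z - Q))"
  unfolding mult.assoc by (rule phi_Var[OF Var.prems])
 also have "... = (\<Sum>Q | Q \<in> orbs Z \<and> color Q = x. \<Sum>Z1 | Z1 \<subseteq> Z - Q \<and> Inv Z1. of_nat (fst x) * (phi f Z1 * phi g (Z - Q - Z1)))"
 proof (intro sum.cong refl)
  fix Q assume "Q \<in> {Q. Q \<in> orbs Z \<and> color Q = x}"
  then have "Inv (Z - Q)" using ID by blast
  then show "of_nat (fst x) * phi (f * g) (Z - Q) = (\<Sum>Z1 | Z1 \<subseteq> Z - Q \<and> Inv Z1. of_nat (fst x) * (phi f Z1 * phi g (Z - Q - Z1)))"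
   by (simp only: Var.IH conv_Inv sum_distrib_left)
 qed
 also have "... = (\<Sum>(Q, Z1)\<in>?S1. of_nat (fst x) * (phi f Z1 * phi g (Z - Q - Z1)))"
  by (rule sum.Sigma) (use Var.prems orbs_finite ID fin_sub in auto)
 also have "... = (\<Sum>(Z1, Q)\<in>?S2. of_nat (fst x) * (phi f (Z1 - Q) * phi g (Z - Z1)))"
 proof (rule sum.reindex_bij_witness[where j = "\<lambda>(Q, Z1). (Z1 \<union> Q, Q)" and i = "\<lambda>(Z1, Q). (Q, Z1 - Q)"])
  fix p assume "p \<in> ?S1"
  then obtain Q Z1 where p: "p = (Q, Z1)" "Q \<in> orbs Z" "color Q = x" "Z1 \<subseteq> Z - Q" "Inv Z1" by auto
  obtain y where y: "y \<in> Z" "Q = orbit \<sigma> y" "Inv Q" "Q \<subseteq> Z" "Q \<noteq> {}" using orbsE[OF Var.prems p(2)] .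
  have e: "Z1 \<union> Q - Q = Z1" "Z - Q - Z1 = Z - (Z1 \<union> Q)" using p by auto
  have "Q \<in> orbs (Z1 \<union> Q)" using y self_orbit by (auto simp: orbs_def)
  moreover have "Inv (Z1 \<union> Q)" using p y Inv_Un by blast
  ultimately show "(case p of (Q, Z1) => (Z1 \<union> Q, Q)) \<in> ?S2" using p y by auto
  show "(case (case p of (Q, Z1) => (Z1 \<union> Q, Q)) of (Z1, Q) => (Q, Z1 - Q)) = p" using p e by simp
  show "(case (case p of (Q, Z1) => (Z1 \<union> Q, Q)) of (Z1, Q) => of_nat (fst x) * (phi f (Z1 - Q) * phi g (Z - Z1))) =
    (case p of (Q, Z1) => of_nat (fst x) * (phi f Z1 * phi g (Z - Q - Z1)))" using p e by simp
 next
  fix p assume "p \<in> ?S2"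
  then obtain Q Z1 where p: "p = (Z1, Q)" "Q \<in> orbs Z1" "color Q = x" "Z1 \<subseteq> Z" "Inv Z1" by auto
  obtain y where y: "y \<in> Z1" "Q = orbit \<sigma> y" "Inv Q" "Q \<subseteq> Z1" "Q \<noteq> {}" using orbsE[OF p(5,2)] .
  have "Q \<in> orbs Z" using y p by (auto simp: orbs_def)
  then show "(case p of (Z1, Q) => (Q, Z1 - Q)) \<in> ?S1" using p y Inv_Diff by auto
  show "(case (case p of (Z1, Q) => (Q, Z1 - Q)) of (Q, Z1) => (Z1 \<union> Q, Q)) = p" using p y by auto
 qed
 also have "... = (\<Sum>Z1 | Z1 \<subseteq> Z \<and> Inv Z1. \<Sum>Q | Q \<in> orbs Z1 \<and> color Q = x. of_nat (fst x) * (phi f (Z1 - Q) * phi g (Z - Z1)))"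
  by (rule sum.Sigma[symmetric]) (use Var.prems orbs_finite fin_sub in auto)
 also have "... = (\<Sum>Z1 | Z1 \<subseteq> Z \<and> Inv Z1. phi (Var x * f) Z1 * phi g (Z - Z1))"
  by (intro sum.cong refl) (simp add: phi_Var sum_distrib_right mult.assoc)
 finally show ?case by (simp add: conv_Inv Var.prems)
qed

definition W :: "'a set => nat" where "W Z = (\<Sum>y\<in>Z. w y)"

lemma W_image: "A \<subseteq> Y ==> W (\<sigma> ` A) = W A"
 unfolding W_def using inj by (subst sum.reindex) (auto intro: inj_on_subset simp: w_inv subset_iff intro!: sum.cong)

end

section \<open>Stable set partitions\<close>

lemma partition_on_sub:
 assumes "partition_on Z \<rho>" "\<rho>1 \<subseteq> \<rho>"
 shows "partition_on (\<Union>\<rho>1) \<rho>1" "partition_on (Z - \<Union>\<rho>1) (\<rho> - \<rho>1)"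
proof -
 show "partition_on (\<Union>\<rho>1) \<rho>1"
  using assms by (auto simp: partition_on_def intro: pairwise_subset)
 have dj: "A \<inter> B = {}" if "A \<in> \<rho>" "B \<in> \<rho>" "A \<noteq> B" for A B
  using partition_onD2[OF assms(1)] that by (rule disjointD)
 have "\<Union>(\<rho> - \<rho>1) = Z - \<Union>\<rho>1"
 proof (rule subset_antisym; rule subsetI)
  fix x assume "x \<in> \<Union>(\<rho> - \<rho>1)"
  then obtain A where A: "A \<in> \<rho>" "A \<notin> \<rho>1" "x \<in> A" by blast
  have "x \<notin> B" if "B \<in> \<rho>1" for B
  proof -
   have "A \<inter> B = {}" using dj[OF A(1)] that A(2) assms(2) by blast
   then show ?thesis using A(3) by blast
  qed
  moreover have "x \<in> Z" using A partition_onD1[OF assms(1)] by blast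
  ultimately show "x \<in> Z - \<Union>\<rho>1" by blast
 next
  fix x assume "x \<in> Z - \<Union>\<rho>1"
  then show "x \<in> \<Union>(\<rho> - \<rho>1)" using partition_onD1[OF assms(1)] by blast
 qed
 then show "partition_on (Z - \<Union>\<rho>1) (\<rho> - \<rho>1)"
  using assms by (auto simp: partition_on_def intro: pairwise_subset)
qed

lemma partition_on_union:
 assumes "partition_on Z1 \<rho>1" "partition_on (Z - Z1) \<rho>2" "Z1 \<subseteq> Z"
 shows "partition_on Z (\<rho>1 \<union> \<rho>2)" "\<rho>1 \<inter> \<rho>2 = {}"
proof -
 have sub: "A \<subseteq> Z1" if "A \<in> \<rho>1" for A using that partition_onD1[OF assms(1)] by blast
 have sub2: "A \<subseteq> Z - Z1" if "A \<in> \<rho>2" for A using that partition_onD1[OF assms(2)] by blast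
 have ne: "{} \<notin> \<rho>1" "{} \<notin> \<rho>2" using assms partition_onD3 by blast+
 show "partition_on Z (\<rho>1 \<union> \<rho>2)"
 proof (rule partition_onI)
  show "\<Union>(\<rho>1 \<union> \<rho>2) = Z" using partition_onD1[OF assms(1)] partition_onD1[OF assms(2)] assms(3) by blast
  show "{} \<notin> \<rho>1 \<union> \<rho>2" using ne by blast
  fix p q assume pq: "p \<in> \<rho>1 \<union> \<rho>2" "q \<in> \<rho>1 \<union> \<rho>2" "p \<noteq> q"
  have d1: "disjnt p q" if "p \<in> \<rho>1" "q \<in> \<rho>1"
   using partition_onD2[OF assms(1)] that pq by (auto simp: pairwise_def)
  have d2: "disjnt p q" if "p \<in> \<rho>2" "q \<in> \<rho>2"
   using partition_onD2[OF assms(2)] that pq by (auto simp: pairwise_def)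
  have d3: "disjnt p q" if "p \<in> \<rho>1" "q \<in> \<rho>2" using sub[OF that(1)] sub2[OF that(2)] by (auto simp: disjnt_def)
  have d4: "disjnt p q" if "q \<in> \<rho>1" "p \<in> \<rho>2" using sub[OF that(1)] sub2[OF that(2)] by (auto simp: disjnt_def)
  show "disjnt p q" using pq d1 d2 d3 d4 by blast
 qed
 show "\<rho>1 \<inter> \<rho>2 = {}"
 proof (rule ccontr)
  assume "\<rho>1 \<inter> \<rho>2 \<noteq> {}"
  then obtain A where "A \<in> \<rho>1" "A \<in> \<rho>2" by blast
  then have "A \<subseteq> Z1 \<inter> (Z - Z1)" using sub sub2 by blast
  then show False using `A \<in> \<rho>1` ne by auto
 qed
qed

context wperm
begin

text \<open>\<open>IP Z\<close> is the set of the set partitions of \<open>Z\<close> that are stable under \<open>\<sigma>\<close>, \<open>sm F Z\<close> is the sum of \<open>F\<close> over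
  them, and \<open>cv\<close> is the convolution over the splittings of the set of parts into two stable subsets.\<close>

definition IP :: "'a set => 'a set set set" where
 "IP Z = {\<rho>. partition_on Z \<rho> \<and> (`) \<sigma> ` \<rho> = \<rho>}"
definition sm :: "('a set set => complex) => 'a set => complex" where
 "sm F Z = (\<Sum>\<rho>\<in>IP Z. F \<rho>)"
definition cv :: "('a set set => complex) => ('a set set => complex) => 'a set set => complex" where
 "cv F H \<rho> = (\<Sum>\<rho>1 | \<rho>1 \<subseteq> \<rho> \<and> (`) \<sigma> ` \<rho>1 = \<rho>1. F \<rho>1 * H (\<rho> - \<rho>1))"

lemma injim: "inj ((`) \<sigma>)" using inj by (auto intro!: injI simp: inj_image_eq_iff)

lemma IPD: "\<rho> \<in> IP Z ==> partition_on Z \<rho>" "\<rho> \<in> IP Z ==> (`) \<sigma> ` \<rho> = \<rho>" by (auto simp: IP_def)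

lemma finite_IP: "Inv Z ==> finite (IP Z)"
 by (rule finite_subset[OF _ finitely_many_partition_on[OF Inv_finite]]) (auto simp: IP_def)

lemma finite_rho: "Inv Z ==> \<rho> \<in> IP Z ==> finite \<rho>"
 using finite_elements Inv_finite IPD by blast

lemma IP_sub:
 assumes Z: "Inv Z" and \<rho>: "\<rho> \<in> IP Z" and s: "\<rho>1 \<subseteq> \<rho>" and i: "(`) \<sigma> ` \<rho>1 = \<rho>1"
 shows "\<Union>\<rho>1 \<subseteq> Z" "Inv (\<Union>\<rho>1)" "\<rho>1 \<in> IP (\<Union>\<rho>1)" "\<rho> - \<rho>1 \<in> IP (Z - \<Union>\<rho>1)"
proof -
 note p = IPD[OF \<rho>]
 show sub: "\<Union>\<rho>1 \<subseteq> Z" using s partition_onD1[OF p(1)] by blast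
 have "\<sigma> ` \<Union>\<rho>1 = \<Union>((`) \<sigma> ` \<rho>1)" by blast
 then have "\<sigma> ` \<Union>\<rho>1 = \<Union>\<rho>1" using i by simp
 moreover have "Z \<subseteq> Y" using Z by (simp add: Inv_def)
 then have "\<Union>\<rho>1 \<subseteq> Y" by (rule subset_trans[OF sub])
 ultimately show "Inv (\<Union>\<rho>1)" unfolding Inv_def by (rule conjI[rotated])
 show "\<rho>1 \<in> IP (\<Union>\<rho>1)" using partition_on_sub(1)[OF p(1) s] i by (simp add: IP_def)
 have "(`) \<sigma> ` (\<rho> - \<rho>1) = \<rho> - \<rho>1" using i p(2) by (simp add: image_set_diff[OF injim])
 then show "\<rho> - \<rho>1 \<in> IP (Z - \<Union>\<rho>1)" using partition_on_sub(2)[OF p(1) s] by (simp add: IP_def)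
qed

lemma IP_union:
 assumes "\<rho>1 \<in> IP Z1" "\<rho>2 \<in> IP (Z - Z1)" "Z1 \<subseteq> Z"
 shows "\<rho>1 \<union> \<rho>2 \<in> IP Z" "\<rho>1 \<inter> \<rho>2 = {}" "\<rho>1 \<union> \<rho>2 - \<rho>1 = \<rho>2" "\<Union>\<rho>1 = Z1"
proof -
 note u = partition_on_union[OF IPD(1)[OF assms(1)] IPD(1)[OF assms(2)] assms(3)]
 show "\<rho>1 \<union> \<rho>2 \<in> IP Z" using u(1) IPD(2)[OF assms(1)] IPD(2)[OF assms(2)] by (simp add: IP_def image_Un)
 show "\<rho>1 \<inter> \<rho>2 = {}" by (rule u(2))
 then show "\<rho>1 \<union> \<rho>2 - \<rho>1 = \<rho>2" by blast
 show "\<Union>\<rho>1 = Z1" using partition_onD1[OF IPD(1)[OF assms(1)]] by simp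
qed

text \<open>A stable set partition of \<open>Z\<close> with a stable subset of its parts is the same as a splitting of \<open>Z\<close> with a
  stable set partition of both pieces.\<close>

lemma sm_cv: assumes Z: "Inv Z" shows "sm (cv F H) Z = conv (sm F) (sm H) Z"
proof -
 let ?S1 = "SIGMA \<rho>:IP Z. {\<rho>1. \<rho>1 \<subseteq> \<rho> \<and> (`) \<sigma> ` \<rho>1 = \<rho>1}"
 let ?S2 = "SIGMA Z1:{Z1. Z1 \<subseteq> Z \<and> Inv Z1}. IP Z1 \<times> IP (Z - Z1)"
 have "sm (cv F H) Z = (\<Sum>(\<rho>, \<rho>1)\<in>?S1. F \<rho>1 * H (\<rho> - \<rho>1))"
  unfolding sm_def cv_def
  by (rule sum.Sigma) (use finite_IP[OF Z] finite_rho[OF Z] in \<open>auto intro: finite_subset[of _ "Pow _"]\<close>)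
 also have "... = (\<Sum>(Z1, \<rho>1, \<rho>2)\<in>?S2. F \<rho>1 * H \<rho>2)"
 proof (rule sum.reindex_bij_witness[where j = "\<lambda>(\<rho>, \<rho>1). (\<Union>\<rho>1, \<rho>1, \<rho> - \<rho>1)" and i = "\<lambda>(Z1, \<rho>1, \<rho>2). (\<rho>1 \<union> \<rho>2, \<rho>1)"])
  fix p assume "p \<in> ?S1"
  then obtain \<rho> \<rho>1 where p: "p = (\<rho>, \<rho>1)" "\<rho> \<in> IP Z" "\<rho>1 \<subseteq> \<rho>" "(`) \<sigma> ` \<rho>1 = \<rho>1" by blast
  note q = IP_sub[OF Z p(2-4)]
  have e: "\<rho>1 \<union> (\<rho> - \<rho>1) = \<rho>" using p(3) by blast
  show "(case (case p of (\<rho>, \<rho>1) => (\<Union>\<rho>1, \<rho>1, \<rho> - \<rho>1)) of (Z1, \<rho>1, \<rho>2) => (\<rho>1 \<union> \<rho>2, \<rho>1)) = p"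
   unfolding p(1) prod.case e ..
  show "(case p of (\<rho>, \<rho>1) => (\<Union>\<rho>1, \<rho>1, \<rho> - \<rho>1)) \<in> ?S2"
   unfolding p(1) prod.case using q by blast
  show "(case (case p of (\<rho>, \<rho>1) => (\<Union>\<rho>1, \<rho>1, \<rho> - \<rho>1)) of (Z1, \<rho>1, \<rho>2) => F \<rho>1 * H \<rho>2) = (case p of (\<rho>, \<rho>1) => F \<rho>1 * H (\<rho> - \<rho>1))"
   unfolding p(1) prod.case ..
 next
  fix p assume "p \<in> ?S2"
  then obtain Z1 \<rho>1 \<rho>2 where p: "p = (Z1, \<rho>1, \<rho>2)" "Z1 \<subseteq> Z" "Inv Z1" "\<rho>1 \<in> IP Z1" "\<rho>2 \<in> IP (Z - Z1)" by blast
  note q = IP_union[OF p(4,5,2)]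
  show "(case (case p of (Z1, \<rho>1, \<rho>2) => (\<rho>1 \<union> \<rho>2, \<rho>1)) of (\<rho>, \<rho>1) => (\<Union>\<rho>1, \<rho>1, \<rho> - \<rho>1)) = p"
   unfolding p(1) prod.case q(3,4) ..
  show "(case p of (Z1, \<rho>1, \<rho>2) => (\<rho>1 \<union> \<rho>2, \<rho>1)) \<in> ?S1"
   unfolding p(1) prod.case using q(1) IPD(2)[OF p(4)] by blast
 qed
 also have "... = (\<Sum>Z1 | Z1 \<subseteq> Z \<and> Inv Z1. \<Sum>(\<rho>1, \<rho>2)\<in>IP Z1 \<times> IP (Z - Z1). F \<rho>1 * H \<rho>2)"
  by (rule sum.Sigma[symmetric]) (use fin_sub[OF Z] finite_IP Inv_Diff[OF Z] in auto)
 also have "... = conv (sm F) (sm H) Z"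
  unfolding conv_Inv[OF Z] sm_def sum_product by (simp add: sum.cartesian_product)
 finally show ?thesis .
qed

lemma im_funpow: "((`) \<sigma> ^^ n) A = (\<sigma> ^^ n) ` A"
 by (induction n arbitrary: A) (auto simp: image_image)

lemma set_self_orbit: "A \<in> orbit ((`) \<sigma>) A"
proof -
 obtain n where n: "\<sigma> ^^ n = id" "n > 0" using permutation_is_nilpotent[OF perm'] by blast
 then have "((`) \<sigma> ^^ n) A = A" by (simp add: im_funpow)
 then show ?thesis using n(2) unfolding orbit_altdef by force
qed

lemma set_orbit_finite: "finite (orbit ((`) \<sigma>) A)" by (rule finite_orbit[OF set_self_orbit])

lemma set_orbit_image: "(`) \<sigma> ` orbit ((`) \<sigma>) A = orbit ((`) \<sigma>) A"
 by (rule endo_inj_surj[OF set_orbit_finite]) (auto intro: orbit.step inj_on_subset[OF injim])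

lemma set_orbit_sub: "\<rho> \<in> IP Z ==> A \<in> \<rho> ==> orbit ((`) \<sigma>) A \<subseteq> \<rho>"
proof
 fix B assume r: "\<rho> \<in> IP Z" "A \<in> \<rho>" and "B \<in> orbit ((`) \<sigma>) A"
 from this(3) show "B \<in> \<rho>" by induction (use r IPD(2)[OF r(1)] in blast)+
qed

lemma set_orbit_W: assumes "A \<subseteq> Y" "B \<in> orbit ((`) \<sigma>) A" shows "W B = W A"
proof -
 from assms(2) have "B \<subseteq> Y \<and> W B = W A"
 proof induction
  case base
  then show ?case using assms(1) Inv_Y by (auto simp: W_image Inv_def)
 next
  case (step B)
  then show ?case using Inv_Y by (auto simp: W_image Inv_def)
 qed
 then show ?thesis by simp
qed

text \<open>\<open>A\<close> is a part of weight \<open>i\<close> of a stable set partition of \<open>Z\<close> whose \<open>m\<close> parts form one cycle.\<close>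

definition good :: "nat => nat => 'a set => 'a set => bool" where
 "good m i Z A \<longleftrightarrow> partition_on Z (orbit ((`) \<sigma>) A) \<and> card (orbit ((`) \<sigma>) A) = m \<and> W A = i"

text \<open>The indicator function of having \<open>n\<close> parts, all of weight \<open>i\<close>.\<close>

definition hF :: "nat => int => 'a set set => complex" where
 "hF i n \<rho> = (if (\<forall>A\<in>\<rho>. W A = i) \<and> int (card \<rho>) = n then 1 else 0)"

lemma good_sub: "good m i Z A ==> A \<subseteq> Z"
 using set_self_orbit[of A] partition_onD1 unfolding good_def by blast

lemma fin_good: "Inv Z ==> finite {A. good m i Z A}"
 by (rule finite_subset[of _ "Pow Z"]) (auto dest: good_sub simp: Inv_finite)

text \<open>The recursion \<open>n h\<^sub>n = \<Sum> p\<^sub>m h\<^sub>n\<^sub>-\<^sub>m\<close>, combinatorially: mark one of the \<open>n\<close> parts and split off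
  its cycle, of length \<open>m\<close>.\<close>

lemma h_recursion:
 assumes Z: "Inv Z"
 shows "of_nat n * sm (hF i (int n)) Z = (\<Sum>m=1..n. conv (\<lambda>Z1. of_nat (card {A. good m i Z1 A})) (sm (hF i (int n - int m))) Z)"
proof -
 let ?c = "\<lambda>n \<rho>. (\<forall>A\<in>\<rho>. W A = i) \<and> int (card \<rho>) = n"
 let ?S1 = "SIGMA \<rho>:{\<rho> \<in> IP Z. ?c (int n) \<rho>}. \<rho>"
 let ?R = "\<lambda>m Z1. {A. good m i Z1 A} \<times> {\<rho> \<in> IP (Z - Z1). ?c (int n - int m) \<rho>}"
 let ?S2 = "SIGMA m:{1..n}. SIGMA Z1:{Z1. Z1 \<subseteq> Z \<and> Inv Z1}. ?R m Z1"
 have hsum: "sm (hF i n) Z = of_nat (card {\<rho> \<in> IP Z. ?c n \<rho>})" if "Inv Z" for n Z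
 proof -
  have "sm (hF i n) Z = (\<Sum>\<rho>\<in>{\<rho> \<in> IP Z. ?c n \<rho>}. 1)"
   unfolding sm_def hF_def by (rule sum.inter_filter[symmetric]) (rule finite_IP[OF that])
  then show ?thesis by simp
 qed
 have fR: "finite (?R m Z1)" if "Inv Z1" for m Z1
  using fin_good[OF that] finite_IP[OF Inv_Diff[OF Z that]] by simp
 \<comment> \<open>a marked part \<open>A\<close> corresponds to its cycle, the set that the cycle covers, and the remaining parts\<close>
 have "bij_betw (\<lambda>(\<rho>, A). (card (orbit ((`) \<sigma>) A), \<Union>(orbit ((`) \<sigma>) A), A, \<rho> - orbit ((`) \<sigma>) A)) ?S1 ?S2"
 proof (rule bij_betw_byWitness[where f' = "\<lambda>(m, Z1, A, \<rho>2). (orbit ((`) \<sigma>) A \<union> \<rho>2, A)"])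
  have key1: "(card Q, \<Union>Q, A, \<rho> - Q) \<in> ?S2 \<and> Q \<union> (\<rho> - Q) = \<rho>"
   if p: "\<rho> \<in> IP Z" "?c (int n) \<rho>" "A \<in> \<rho>" and Q: "Q = orbit ((`) \<sigma>) A" for \<rho> A Q
  proof -
   have Qs: "Q \<subseteq> \<rho>" unfolding Q by (rule set_orbit_sub[OF p(1,3)])
   have Qi: "(`) \<sigma> ` Q = Q" unfolding Q by (rule set_orbit_image)
   note q = IP_sub[OF Z p(1) Qs Qi]
   have fr: "finite \<rho>" by (rule finite_rho[OF Z p(1)])
   have fQ: "finite Q" using Qs fr finite_subset by blast
   have "Q \<noteq> {}" using set_self_orbit[of A] Q by blast
   then have c1: "1 \<le> card Q" using fQ by (simp add: Suc_le_eq card_gt_0_iff)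
   have cr: "card \<rho> = n" using p(2) by simp
   have c2: "card Q \<le> n" using card_mono[OF fr Qs] cr by simp
   have "int (card (\<rho> - Q)) = int n - int (card Q)" using card_Diff_subset[OF fQ Qs] cr c2 by simp
   moreover have "good (card Q) i (\<Union>Q) A"
    unfolding good_def Q[symmetric] using IPD(1)[OF q(3)] p by blast
   ultimately have "(card Q, \<Union>Q, A, \<rho> - Q) \<in> ?S2" using c1 c2 q p(2) by auto
   then show ?thesis using Qs by blast
  qed
  have key2: "(Q \<union> \<rho>2, A) \<in> ?S1 \<and> card Q = m \<and> \<Union>Q = Z1 \<and> Q \<union> \<rho>2 - Q = \<rho>2"
   if p: "m \<in> {1..n}" "Z1 \<subseteq> Z" "Inv Z1" "good m i Z1 A" "\<rho>2 \<in> IP (Z - Z1)" "?c (int n - int m) \<rho>2"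
    and Q: "Q = orbit ((`) \<sigma>) A" for m Z1 A \<rho>2 Q
  proof -
   have Q1: "Q \<in> IP Z1" using p(4) set_orbit_image by (simp add: good_def IP_def Q)
   note q = IP_union[OF Q1 p(5,2)]
   have cQ: "card Q = m" using p(4) by (simp add: good_def Q)
   have fin: "finite Q" "finite \<rho>2" using finite_rho[OF p(3) Q1] finite_rho[OF Inv_Diff[OF Z p(3)] p(5)] by auto
   have "card (Q \<union> \<rho>2) = card Q + card \<rho>2" by (rule card_Un_disjoint[OF fin q(2)])
   then have cc: "int (card (Q \<union> \<rho>2)) = int n" using p(1,6) cQ by simp
   have "A \<subseteq> Y" using good_sub[OF p(4)] p(3) by (auto simp: Inv_def)
   then have "W B = i" if "B \<in> Q" for B using set_orbit_W that p(4) by (simp add: Q good_def)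
   then have "?c (int n) (Q \<union> \<rho>2)" using p(6) cc by blast
   moreover have "A \<in> Q \<union> \<rho>2" using set_self_orbit Q by blast
   ultimately show ?thesis using q cQ by blast
  qed
  show "\<forall>a\<in>?S1. (case (case a of (\<rho>, A) => (card (orbit ((`) \<sigma>) A), \<Union>(orbit ((`) \<sigma>) A), A, \<rho> - orbit ((`) \<sigma>) A)) of (m, Z1, A, \<rho>2) => (orbit ((`) \<sigma>) A \<union> \<rho>2, A)) = a"
  proof
   fix a assume "a \<in> ?S1"
   then obtain \<rho> A where a: "a = (\<rho>, A)" "\<rho> \<in> IP Z" "?c (int n) \<rho>" "A \<in> \<rho>" by blast
   show "(case (case a of (\<rho>, A) => (card (orbit ((`) \<sigma>) A), \<Union>(orbit ((`) \<sigma>) A), A, \<rho> - orbit ((`) \<sigma>) A)) of (m, Z1, A, \<rho>2) => (orbit ((`) \<sigma>) A \<union> \<rho>2, A)) = a"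
    unfolding a(1) prod.case using key1[OF a(2-4) refl] by simp
  qed
  show "\<forall>a\<in>?S2. (case (case a of (m, Z1, A, \<rho>2) => (orbit ((`) \<sigma>) A \<union> \<rho>2, A)) of (\<rho>, A) => (card (orbit ((`) \<sigma>) A), \<Union>(orbit ((`) \<sigma>) A), A, \<rho> - orbit ((`) \<sigma>) A)) = a"
  proof
   fix a assume "a \<in> ?S2"
   then obtain m Z1 A \<rho>2 where a: "a = (m, Z1, A, \<rho>2)" "m \<in> {1..n}" "Z1 \<subseteq> Z" "Inv Z1" "good m i Z1 A" "\<rho>2 \<in> IP (Z - Z1)" "?c (int n - int m) \<rho>2" by blast
   show "(case (case a of (m, Z1, A, \<rho>2) => (orbit ((`) \<sigma>) A \<union> \<rho>2, A)) of (\<rho>, A) => (card (orbit ((`) \<sigma>) A), \<Union>(orbit ((`) \<sigma>) A), A, \<rho> - orbit ((`) \<sigma>) A)) = a"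
    unfolding a(1) prod.case using key2[OF a(2-7) refl] by simp
  qed
  show "(\<lambda>(\<rho>, A). (card (orbit ((`) \<sigma>) A), \<Union>(orbit ((`) \<sigma>) A), A, \<rho> - orbit ((`) \<sigma>) A)) ` ?S1 \<subseteq> ?S2"
  proof (rule image_subsetI)
   fix a assume "a \<in> ?S1"
   then obtain \<rho> A where a: "a = (\<rho>, A)" "\<rho> \<in> IP Z" "?c (int n) \<rho>" "A \<in> \<rho>" by blast
   show "(case a of (\<rho>, A) => (card (orbit ((`) \<sigma>) A), \<Union>(orbit ((`) \<sigma>) A), A, \<rho> - orbit ((`) \<sigma>) A)) \<in> ?S2"
    unfolding a(1) prod.case using key1[OF a(2-4) refl] by (rule conjunct1)
  qed
  show "(\<lambda>(m, Z1, A, \<rho>2). (orbit ((`) \<sigma>) A \<union> \<rho>2, A)) ` ?S2 \<subseteq> ?S1"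
  proof (rule image_subsetI)
   fix a assume "a \<in> ?S2"
   then obtain m Z1 A \<rho>2 where a: "a = (m, Z1, A, \<rho>2)" "m \<in> {1..n}" "Z1 \<subseteq> Z" "Inv Z1" "good m i Z1 A" "\<rho>2 \<in> IP (Z - Z1)" "?c (int n - int m) \<rho>2" by blast
   show "(case a of (m, Z1, A, \<rho>2) => (orbit ((`) \<sigma>) A \<union> \<rho>2, A)) \<in> ?S1"
    unfolding a(1) prod.case using key2[OF a(2-7) refl] by (rule conjunct1)
  qed
 qed
 then have "card ?S1 = card ?S2" by (rule bij_betw_same_card)
 moreover have "card ?S1 = (\<Sum>\<rho>\<in>{\<rho> \<in> IP Z. ?c (int n) \<rho>}. card \<rho>)"
  by (rule card_SigmaI) (use finite_IP[OF Z] finite_rho[OF Z] in auto)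
 moreover have "(\<Sum>\<rho>\<in>{\<rho> \<in> IP Z. ?c (int n) \<rho>}. card \<rho>) = n * card {\<rho> \<in> IP Z. ?c (int n) \<rho>}" by simp
 moreover have "card ?S2 = (\<Sum>m=1..n. \<Sum>Z1 | Z1 \<subseteq> Z \<and> Inv Z1. card {A. good m i Z1 A} * card {\<rho> \<in> IP (Z - Z1). ?c (int n - int m) \<rho>})"
  by (subst card_SigmaI) (use fin_sub[OF Z] fR in "auto intro!: sum.cong simp: card_SigmaI card_cartesian_product")
 ultimately have eq: "n * card {\<rho> \<in> IP Z. ?c (int n) \<rho>} = (\<Sum>m=1..n. \<Sum>Z1 | Z1 \<subseteq> Z \<and> Inv Z1. card {A. good m i Z1 A} * card {\<rho> \<in> IP (Z - Z1). ?c (int n - int m) \<rho>})"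
  by linarith
 have "of_nat n * sm (hF i (int n)) Z = of_nat (n * card {\<rho> \<in> IP Z. ?c (int n) \<rho>})" by (simp add: hsum[OF Z])
 also have "... = (\<Sum>m=1..n. \<Sum>Z1 | Z1 \<subseteq> Z \<and> Inv Z1. of_nat (card {A. good m i Z1 A}) * sm (hF i (int n - int m)) (Z - Z1))"
  unfolding eq by (simp add: hsum Inv_Diff[OF Z])
 finally show ?thesis by (simp add: conv_Inv[OF Z])
qed

end

section \<open>Plethysm with the generators E\<close>

text \<open>\<open>wt\<close> is the degree for which $p_i[X_j]$ has degree \<open>ij\<close>, and \<open>dg\<close> is the degree as a polynomial. A monomial
  is \<open>posm\<close> if it does not contain a variable with an index 0.\<close>

definition msum :: "('v => nat) => ('v \<Rightarrow>\<^sub>0 nat) => nat" where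
 "msum c M = (\<Sum>x\<in>keys M. c x * lookup M x)"

lemma msum_superset:
 assumes "finite A" "keys M \<subseteq> A"
 shows "msum c M = (\<Sum>x\<in>A. c x * lookup M x)"
 unfolding msum_def by (rule sum.mono_neutral_left) (use assms in "auto simp: in_keys_iff")

lemma msum_add: "msum c (M + M') = msum c M + msum c M'"
proof -
 let ?A = "keys M \<union> keys M'"
 have k: "keys (M + M') \<subseteq> ?A" by (rule keys_add)
 show ?thesis
  by (subst (1 2 3) msum_superset[of ?A]) (use k in "auto simp: lookup_add algebra_simps sum.distrib")
qed

lemma msum_0: "msum c 0 = 0" by (simp add: msum_def)

lemma msum_single: "msum c (Poly_Mapping.single x n) = c x * n"
 by (subst msum_superset[of "{x}"]) auto

lemma msum_sum: "msum c (sum f A) = (\<Sum>x\<in>A. msum c (f x))"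
 by (induction A rule: infinite_finite_induct) (auto simp: msum_0 msum_add)

abbreviation wt :: "(nat \<times> nat \<Rightarrow>\<^sub>0 nat) => nat" where "wt \<equiv> msum (\<lambda>x. fst x * snd x)"
abbreviation dg :: "(nat \<times> nat \<Rightarrow>\<^sub>0 nat) => nat" where "dg \<equiv> msum (\<lambda>x. 1)"

definition posm :: "(nat \<times> nat \<Rightarrow>\<^sub>0 nat) => bool" where
 "posm M \<longleftrightarrow> (\<forall>x\<in>keys M. fst x > 0 \<and> snd x > 0)"

lemma zz_pos: "posm M ==> zz M > 0"
 unfolding zz_def posm_def by (intro prod_pos) (auto split: prod.splits)

text \<open>The monomial of $\mathbf{p}_{\vec\mu}$. These are exactly the monomials with \<open>posm\<close> and \<open>wt M = k\<close>
  (\<open>mexp_inj\<close>, \<open>mexp_props\<close>, \<open>mexp_surj\<close>).\<close>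

definition mexp :: "nat => (nat => nat multiset) => (nat \<times> nat \<Rightarrow>\<^sub>0 nat)" where
 "mexp k \<mu> = (\<Sum>j\<in>{1..k}. \<Sum>i\<in>#\<mu> j. Poly_Mapping.single (i, j) 1)"

lemma pX_mexp: "pX k \<mu> = basis_vec (mexp k \<mu>)"
 unfolding pX_def mexp_def by (rule prod_Var) simp

lemma lookup_mexp: "lookup (mexp k \<mu>) (a, b) = (if b \<in> {1..k} then count (\<mu> b) a else 0)"
proof -
 have inner: "lookup (\<Sum>i\<in>#N. Poly_Mapping.single (i, j) (1::nat)) (a, b) =
   (if b = j then count N a else 0)" for N j
  by (induction N) (auto simp: lookup_add lookup_single when_def)
 show ?thesis unfolding mexp_def lookup_sum inner by simp
qed

lemma lookup_mexp': "\<mu> \<in> mparts k ==> lookup (mexp k \<mu>) (a, b) = count (\<mu> b) a"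
 by (auto simp: lookup_mexp mparts_def)

lemma mexp_inj: assumes "\<mu> \<in> mparts k" "\<nu> \<in> mparts k" "mexp k \<mu> = mexp k \<nu>" shows "\<mu> = \<nu>"
proof (intro ext multiset_eqI)
 fix b a
 show "count (\<mu> b) a = count (\<nu> b) a" using lookup_mexp'[OF assms(1), of a b] lookup_mexp'[OF assms(2), of a b] assms(3) by simp
qed

lemma z_vec_zz: "\<mu> \<in> mparts k ==> z_vec k \<mu> = zz (mexp k \<mu>)"
proof -
 assume m: "\<mu> \<in> mparts k"
 have "(of_nat (z_vec k \<mu>) :: complex) = of_nat (zz (mexp k \<mu>))"
  using scalar_pX[OF m m] by (simp add: scalar_def pX_mexp zz_def)
 then show ?thesis by (simp only: of_nat_eq_iff)
qed

lemma mexp_props: assumes "\<mu> \<in> mparts k" shows "posm (mexp k \<mu>)" "wt (mexp k \<mu>) = k"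
proof -
 show "posm (mexp k \<mu>)"
  unfolding posm_def
 proof
  fix x assume "x \<in> keys (mexp k \<mu>)"
  then have "(if snd x \<in> {1..k} then count (\<mu> (snd x)) (fst x) else 0) \<noteq> 0"
   using lookup_mexp[of k \<mu> "fst x" "snd x"] by (simp add: in_keys_iff)
  then have "snd x \<in> {1..k}" "fst x \<in># \<mu> (snd x)" by (auto split: if_splits)
  moreover have "0 \<notin># \<mu> (snd x)" using assms by (simp add: mparts_def is_partition_def)
  ultimately show "fst x > 0 \<and> snd x > 0" by (metis atLeastAtMost_iff gr0I not_one_le_zero)
 qed
 have inner: "wt (\<Sum>i\<in>#N. Poly_Mapping.single (i, j) (1::nat)) = j * \<Sum>\<^sub># N" for N j
  by (induction N) (auto simp: msum_0 msum_add msum_single algebra_simps)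
 show "wt (mexp k \<mu>) = k"
  unfolding mexp_def msum_sum inner using assms by (simp add: mparts_def del: sum_mset_distrib_left)
qed

lemma mexp_surj: assumes "posm M" "wt M = k" obtains \<mu> where "\<mu> \<in> mparts k" "mexp k \<mu> = M"
proof -
 define \<mu> where "\<mu> b = (\<Sum>x\<in>{x \<in> keys M. snd x = b}. replicate_mset (lookup M x) (fst x))" for b
 have cnt: "count (\<mu> b) a = lookup M (a, b)" for a b
 proof -
  have "count (\<mu> b) a = (\<Sum>x\<in>{x \<in> keys M. snd x = b}. if x = (a, b) then lookup M x else 0)"
   unfolding \<mu>_def count_sum by (intro sum.cong refl) auto
  also have "... = lookup M (a, b)" by (auto simp: in_keys_iff)
  finally show ?thesis .
 qed
 have sm: "\<Sum>\<^sub># (\<mu> b) = (\<Sum>x\<in>{x \<in> keys M. snd x = b}. fst x * lookup M x)" for b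
 proof -
  have "\<Sum>\<^sub># (\<Sum>x\<in>A. replicate_mset (f x) (g x)) = (\<Sum>x\<in>A. g x * f x)" for A and f g :: "nat \<times> nat => nat"
   by (induction A rule: infinite_finite_induct) auto
  then show ?thesis by (simp add: \<mu>_def)
 qed
 have le: "snd x \<in> {1..k}" if x: "x \<in> keys M" for x
 proof -
  have p: "fst x > 0" "snd x > 0" "lookup M x > 0" using assms(1) x by (auto simp: posm_def in_keys_iff)
  have "fst x * snd x * lookup M x \<le> k"
   unfolding assms(2)[symmetric] msum_def by (rule member_le_sum) (use x in auto)
  moreover have "snd x * 1 \<le> snd x * (fst x * lookup M x)"
   using p by (intro mult_le_mono2) (simp add: Suc_le_eq)
  moreover have "snd x * (fst x * lookup M x) = fst x * snd x * lookup M x" by (simp only: ac_simps)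
  ultimately have "snd x \<le> k" by linarith
  then show ?thesis using p by simp
 qed
 have "\<mu> \<in> mparts k"
  unfolding mparts_def
 proof (intro CollectI conjI allI impI)
  fix b
  have "lookup M (0, b) = 0" using assms(1) by (force simp: posm_def in_keys_iff)
  then have "count (\<mu> b) 0 = 0" by (simp add: cnt)
  then show "is_partition (\<mu> b)" by (simp add: is_partition_def not_in_iff)
 next
  fix b assume b: "b \<notin> {1..k}"
  then have "{x \<in> keys M. snd x = b} = {}" using le by blast
  then show "\<mu> b = {#}" unfolding \<mu>_def by (simp only: sum.empty)
 next
  have "(\<Sum>i = 1..k. i * \<Sum>\<^sub># (\<mu> i)) = (\<Sum>b\<in>{1..k}. \<Sum>x\<in>{x \<in> keys M. snd x = b}. fst x * snd x * lookup M x)"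
   unfolding sm sum_distrib_left by (intro sum.cong refl) auto
  also have "... = wt M"
   unfolding msum_def by (rule sum.group) (use le in auto)
  finally show "(\<Sum>i = 1..k. i * \<Sum>\<^sub># (\<mu> i)) = k" using assms(2) by simp
 qed
 moreover have "mexp k \<mu> = M"
 proof (rule poly_mapping_eqI)
  fix x :: "nat \<times> nat"
  show "lookup (mexp k \<mu>) x = lookup M x"
   using lookup_mexp'[OF calculation, of "fst x" "snd x"] by (simp add: cnt)
 qed
 ultimately show ?thesis by (rule that)
qed

text \<open>All monomials of degree \<open>r\<close> occur in $E_r$, with the inverse of their norm; so pairing with $E_r$ maps
  each of them to 1.\<close>

lemma lookup_E: "lookup (E_fun r) M = (if posm M \<and> wt M = r then 1 / of_nat (zz M) else 0)"
proof -
 have 1: "lookup (E_fun r) M = (\<Sum>\<mu>\<in>mparts r. if mexp r \<mu> = M then 1 / of_nat (zz M) else 0)"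
  unfolding E_fun_def lookup_sum
  by (intro sum.cong refl) (auto simp: pX_mexp lookup_single when_def z_vec_zz)
 show ?thesis
 proof (cases "posm M \<and> wt M = r")
  case True
  then obtain \<mu> where \<mu>: "\<mu> \<in> mparts r" "mexp r \<mu> = M" using mexp_surj by metis
  have "(\<Sum>\<mu>\<in>mparts r. if mexp r \<mu> = M then 1 / of_nat (zz M) else 0) = (\<Sum>\<nu>\<in>mparts r. if \<nu> = \<mu> then 1 / of_nat (zz M) else (0::complex))"
   by (intro sum.cong refl) (use \<mu> mexp_inj in auto)
  also have "... = 1 / of_nat (zz M)" using \<mu>(1) finite_mparts by simp
  finally show ?thesis using 1 True by simp
 next
  case False
  then have "mexp r \<mu> \<noteq> M" if "\<mu> \<in> mparts r" for \<mu> using mexp_props[OF that] by auto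
  then show ?thesis using 1 False by (auto intro!: sum.neutral)
 qed
qed

text \<open>The effect of $p_m[\cdot]$ on monomials: each cycle length is multiplied by \<open>m\<close>.\<close>

definition dil :: "nat => (nat \<times> nat \<Rightarrow>\<^sub>0 nat) => (nat \<times> nat \<Rightarrow>\<^sub>0 nat)" where
 "dil m M = (\<Sum>x\<in>keys M. Poly_Mapping.single (m * fst x, snd x) (lookup M x))"

lemma lookup_dil: assumes "m > 0"
 shows "lookup (dil m M) (c, b) = (if m dvd c then lookup M (c div m, b) else 0)"
proof -
 have "lookup (dil m M) (c, b) = (\<Sum>x\<in>keys M. if m dvd c \<and> x = (c div m, b) then lookup M x else 0)"
  unfolding dil_def lookup_sum
  by (intro sum.cong refl) (use assms in "auto simp: lookup_single when_def")
 also have "... = (if m dvd c then lookup M (c div m, b) else 0)"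
  by (auto simp: in_keys_iff)
 finally show ?thesis .
qed

lemma dil_inj: "m > 0 ==> dil m M = dil m M' ==> M = M'"
proof (rule poly_mapping_eqI)
 fix x assume m: "m > 0" and eq: "dil m M = dil m M'"
 have "lookup (dil m M) (m * fst x, snd x) = lookup (dil m M') (m * fst x, snd x)" by (simp only: eq)
 then show "lookup M x = lookup M' x" using m by (simp add: lookup_dil)
qed

lemma dil_add: "m > 0 ==> dil m (M + M') = dil m M + dil m M'"
proof (rule poly_mapping_eqI)
 fix x assume m: "m > 0"
 show "lookup (dil m (M + M')) x = lookup (dil m M + dil m M') x"
  using m by (cases x) (simp add: lookup_dil lookup_add)
qed

lemma dil_0: "dil m 0 = 0" by (simp add: dil_def)

lemma dil_single: "dil m (Poly_Mapping.single x 1) = Poly_Mapping.single (m * fst x, snd x) 1"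
 by (simp add: dil_def)

lemma dil_sum: "m > 0 ==> dil m (sum f A) = (\<Sum>x\<in>A. dil m (f x))"
 by (induction A rule: infinite_finite_induct) (auto simp: dil_0 dil_add)

text \<open>Dilation multiplies each of the \<open>dg M\<close> factors by \<open>m\<close> and keeps the multiplicities.\<close>

lemma zz_dil: assumes m: "m > 0" shows "zz (dil m M) = m ^ dg M * zz M"
proof -
 let ?h = "\<lambda>x. (m * fst x, snd x)"
 have k: "keys (dil m M) \<subseteq> ?h ` keys M"
 proof
  fix x assume "x \<in> keys (dil m M)"
  then have "m dvd fst x" "(fst x div m, snd x) \<in> keys M"
   using m lookup_dil[OF m, of M "fst x" "snd x"] by (auto simp: in_keys_iff split: if_splits)
  then show "x \<in> ?h ` keys M" by (intro image_eqI[of _ _ "(fst x div m, snd x)"]) auto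
 qed
 have "inj_on ?h (keys M)" using m by (auto simp: inj_on_def prod_eq_iff)
 then have "zz (dil m M) = (\<Prod>x\<in>keys M. (m * fst x) ^ lookup M x * fact (lookup M x))"
  by (subst zz_superset[OF _ k]) (use m in "simp_all add: prod.reindex lookup_dil")
 also have "... = m ^ dg M * zz M"
  by (subst zz_superset[of "keys M"]) (simp_all add: power_mult_distrib prod.distrib msum_def power_sum mult.assoc)
 finally show ?thesis .
qed

lemma Var_power: "Var x ^ n = basis_vec (Poly_Mapping.single x n)"
 by (induction n) (auto simp: Var_def basis_mult single_add[symmetric])

lemma basis_prod: "(\<Prod>x\<in>A. basis_vec (f x)) = (basis_vec (sum f A) :: 'v cpoly)"
 by (induction A rule: infinite_finite_induct) (auto simp: basis_mult)

lemma pleth_p_basis: "pleth_p m (basis_vec M) = basis_vec (dil m M)"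
proof -
 have "pleth_p m (basis_vec M) = monval (\<lambda>(r, i). Var (m * r, i)) M"
  by (simp add: pleth_p_def subst_lin_ext)
 also have "... = basis_vec (dil m M)"
  unfolding monval_def dil_def basis_prod[symmetric] by (intro prod.cong refl) (simp add: Var_power case_prod_beta)
 finally show ?thesis .
qed

lemma lin_pleth_p: "lin (pleth_p m)"
proof -
 have "pleth_p m = subst (\<lambda>(r, i). Var (m * r, i))" by (rule ext) (simp add: pleth_p_def)
 then show ?thesis using lin_subst by metis
qed

lemma linf_lookup: "linf (\<lambda>v. lookup v x)" by (simp add: linf_def lookup_add)

lemma lookup_pleth_p: assumes "m > 0"
 shows "lookup (pleth_p m f) (dil m M) = lookup f M"
proof -
 have "(\<lambda>f. lookup (pleth_p m f) (dil m M)) = (\<lambda>f. lookup f M)"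
 proof (rule linf_eqI)
  show "linf (\<lambda>f. lookup (pleth_p m f) (dil m M))" by (rule linf_comp[OF linf_lookup lin_pleth_p])
  show "linf (\<lambda>f :: symX. lookup f M)" by (rule linf_lookup)
  fix M'
  show "lookup (pleth_p m (basis_vec M')) (dil m M) = lookup (basis_vec M') M"
   using dil_inj[OF assms] by (auto simp: pleth_p_basis lookup_single when_def)
 qed
 then show ?thesis by metis
qed

lemma lookup_pleth_p_0: assumes "\<And>M. N \<noteq> dil m M"
 shows "lookup (pleth_p m f) N = 0"
proof -
 have "(\<lambda>f. lookup (pleth_p m f) N) = (\<lambda>f. 0)"
 proof (rule linf_eqI)
  show "linf (\<lambda>f. lookup (pleth_p m f) N)" by (rule linf_comp[OF linf_lookup lin_pleth_p])
  show "linf (\<lambda>f :: symX. 0)" by (simp add: linf_def)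
  fix M'
  show "lookup (pleth_p m (basis_vec M')) N = 0"
   using assms[of M'] by (auto simp: pleth_p_basis lookup_single when_def)
 qed
 then show ?thesis by metis
qed

context wperm
begin

lemma w_orbit: assumes "y \<in> Y" "x \<in> orbit \<sigma> y" shows "w x = w y"
proof -
 from assms(2) have "x \<in> Y \<and> w x = w y"
  by induction (use assms(1) w_inv Inv_iff[OF Inv_Y] in auto)
 then show ?thesis by simp
qed

lemma color_orbit: assumes "y \<in> Y" shows "color (orbit \<sigma> y) = (card (orbit \<sigma> y), w y)"
proof -
 have "(SOME x. x \<in> orbit \<sigma> y) \<in> orbit \<sigma> y" by (rule someI) (rule self_orbit)
 then show ?thesis using w_orbit[OF assms] by (simp add: color_def)
qed

lemma orbit_pos: "y \<in> Y ==> card (orbit \<sigma> y) > 0"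
 using self_orbit Inv_finite[OF Inv_orbit] by (auto simp: card_gt_0_iff)

lemma partition_orbs: "Inv Z ==> partition_on Z (orbs Z)"
proof (rule partition_onI)
 assume Z: "Inv Z"
 show "\<Union>(orbs Z) = Z" using Inv_orbit_sub[OF Z] self_orbit by (auto simp: orbs_def)
 show "{} \<notin> orbs Z" using self_orbit by (auto simp: orbs_def)
 fix p q assume "p \<in> orbs Z" "q \<in> orbs Z" "p \<noteq> q"
 then show "disjnt p q" unfolding orbs_def disjnt_def using orbit_eq by blast
qed

lemma W_partition: assumes "Inv Z" "partition_on Z P" shows "W Z = (\<Sum>A\<in>P. W A)"
proof -
 have "W (\<Union>P) = (\<Sum>A\<in>P. W A)"
  unfolding W_def
 proof (subst sum.Union_disjoint)
  show "\<forall>A\<in>P. finite A" using Inv_finite[OF assms(1)] partition_onD1[OF assms(2)] by (auto intro: finite_subset)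
  show "\<forall>A\<in>P. \<forall>B\<in>P. A \<noteq> B \<longrightarrow> A \<inter> B = {}" using partition_onD2[OF assms(2)] by (auto simp: disjoint_def)
 qed simp
 then show ?thesis using partition_onD1[OF assms(2)] by simp
qed

lemma W_orbs: assumes Z: "Inv Z" shows "W Z = (\<Sum>Q\<in>orbs Z. fst (color Q) * snd (color Q))"
proof -
 have "W Q = fst (color Q) * snd (color Q)" if Q: "Q \<in> orbs Z" for Q
 proof -
  obtain y where y: "y \<in> Z" "Q = orbit \<sigma> y" using Q by (auto simp: orbs_def)
  have yY: "y \<in> Y" using y(1) Z by (auto simp: Inv_def)
  have "W Q = (\<Sum>x\<in>Q. w y)" unfolding W_def y(2) by (intro sum.cong refl w_orbit[OF yY])
  then show ?thesis using color_orbit[OF yY] y(2) by simp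
 qed
 then show ?thesis using W_partition[OF Z partition_orbs[OF Z]] by simp
qed

text \<open>The sets \<open>A\<close> for which \<open>A\<close>, \<open>\<sigma> A\<close>, ..., \<open>\<sigma>\<^sup>m\<^sup>-\<^sup>1 A\<close> are disjoint with union \<open>Z\<close> and \<open>\<sigma>\<^sup>m A = A\<close>, in a form
  that can be checked for each cycle of \<open>\<sigma>\<close> on \<open>Z\<close> separately (see \<open>good_QQ\<close>).\<close>

definition QQ :: "nat => 'a set => 'a set set" where
 "QQ m Z = {A. A \<subseteq> Z \<and> (\<forall>x\<in>Z. (\<exists>!j. j < m \<and> (\<sigma> ^^ j) x \<in> A) \<and> ((\<sigma> ^^ m) x \<in> A \<longleftrightarrow> x \<in> A))}"

lemma Inv_pow: "Inv Z ==> (\<sigma> ^^ j) x \<in> Z \<longleftrightarrow> x \<in> Z"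
 by (induction j) (auto simp: Inv_iff)

lemma QQ_union:
 assumes "Inv Z1" "Inv Z2" "Z1 \<inter> Z2 = {}"
 shows "card (QQ m (Z1 \<union> Z2)) = card (QQ m Z1) * card (QQ m Z2)"
proof -
 have int: "(\<sigma> ^^ j) x \<in> A \<inter> Z \<longleftrightarrow> (\<sigma> ^^ j) x \<in> A" if "Inv Z" "x \<in> Z" for j x A Z
  using Inv_pow[OF that(1)] that(2) by auto
 have un1: "(\<sigma> ^^ j) x \<in> A \<union> B \<longleftrightarrow> (\<sigma> ^^ j) x \<in> A" if "x \<in> Z1" "B \<subseteq> Z2" for j x A B
  using Inv_pow[OF assms(1), of j x] that assms(3) by auto
 have un2: "(\<sigma> ^^ j) x \<in> A \<union> B \<longleftrightarrow> (\<sigma> ^^ j) x \<in> B" if "x \<in> Z2" "A \<subseteq> Z1" for j x A B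
  using Inv_pow[OF assms(2), of j x] that assms(3) by auto
 have "bij_betw (\<lambda>A. (A \<inter> Z1, A \<inter> Z2)) (QQ m (Z1 \<union> Z2)) (QQ m Z1 \<times> QQ m Z2)"
 proof (rule bij_betw_byWitness[where f' = "\<lambda>(A, B). A \<union> B"])
  show "\<forall>a\<in>QQ m (Z1 \<union> Z2). (case (a \<inter> Z1, a \<inter> Z2) of (A, B) => A \<union> B) = a" by (auto simp: QQ_def)
  show "\<forall>a'\<in>QQ m Z1 \<times> QQ m Z2. ((case a' of (A, B) => A \<union> B) \<inter> Z1, (case a' of (A, B) => A \<union> B) \<inter> Z2) = a'"
   using assms(3) unfolding QQ_def by auto
  show "(\<lambda>A. (A \<inter> Z1, A \<inter> Z2)) ` QQ m (Z1 \<union> Z2) \<subseteq> QQ m Z1 \<times> QQ m Z2"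
  proof (rule image_subsetI)
   fix A assume A: "A \<in> QQ m (Z1 \<union> Z2)"
   have "A \<inter> Z \<in> QQ m Z" if "Inv Z" "Z \<subseteq> Z1 \<union> Z2" for Z
    unfolding QQ_def
   proof (intro CollectI conjI ballI)
    fix x assume x: "x \<in> Z"
    then have P: "(\<exists>!j. j < m \<and> (\<sigma> ^^ j) x \<in> A) \<and> ((\<sigma> ^^ m) x \<in> A \<longleftrightarrow> x \<in> A)"
     using A that(2) unfolding QQ_def by blast
    show "\<exists>!j. j < m \<and> (\<sigma> ^^ j) x \<in> A \<inter> Z" unfolding int[OF that(1) x] using P by (rule conjunct1)
    show "((\<sigma> ^^ m) x \<in> A \<inter> Z) = (x \<in> A \<inter> Z)" unfolding int[OF that(1) x] using P x by blast
   qed simp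
   then show "(A \<inter> Z1, A \<inter> Z2) \<in> QQ m Z1 \<times> QQ m Z2" using assms by simp
  qed
  show "(\<lambda>(A, B). A \<union> B) ` (QQ m Z1 \<times> QQ m Z2) \<subseteq> QQ m (Z1 \<union> Z2)"
  proof (rule image_subsetI)
   fix p assume "p \<in> QQ m Z1 \<times> QQ m Z2"
   then obtain A B where p: "p = (A, B)" "A \<in> QQ m Z1" "B \<in> QQ m Z2" by blast
   have s: "A \<subseteq> Z1" "B \<subseteq> Z2" using p by (auto simp: QQ_def)
   have "A \<union> B \<in> QQ m (Z1 \<union> Z2)"
    unfolding QQ_def
   proof (intro CollectI conjI ballI)
    show "A \<union> B \<subseteq> Z1 \<union> Z2" using s by blast
    fix x assume "x \<in> Z1 \<union> Z2"
    then consider "x \<in> Z1" | "x \<in> Z2" by blast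
    then have "(\<exists>!j. j < m \<and> (\<sigma> ^^ j) x \<in> A \<union> B) \<and> (((\<sigma> ^^ m) x \<in> A \<union> B) = (x \<in> A \<union> B))"
    proof cases
     case 1
     have x0: "(x \<in> A \<union> B) = (x \<in> A)" using un1[OF 1 s(2), of 0] by simp
     show ?thesis unfolding un1[OF 1 s(2)] x0 using p(2) 1 unfolding QQ_def by blast
    next
     case 2
     have x0: "(x \<in> A \<union> B) = (x \<in> B)" using un2[OF 2 s(1), of 0] by simp
     show ?thesis unfolding un2[OF 2 s(1)] x0 using p(3) 2 unfolding QQ_def by blast
    qed
    then show "\<exists>!j. j < m \<and> (\<sigma> ^^ j) x \<in> A \<union> B" "((\<sigma> ^^ m) x \<in> A \<union> B) = (x \<in> A \<union> B)" by blast+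
   qed
   then show "(case p of (A, B) => A \<union> B) \<in> QQ m (Z1 \<union> Z2)" using p(1) by simp
  qed
 qed
 then show ?thesis by (simp add: bij_betw_same_card card_cartesian_product)
qed

text \<open>On a single cycle, \<open>A\<close> consists of every \<open>m\<close>-th element; this requires that \<open>m\<close> divides the length, and the
  \<open>m\<close> choices are the shifts.\<close>

lemma QQ_orbit:
 assumes y: "y \<in> Y" and m: "m > 0"
 shows "card (QQ m (orbit \<sigma> y)) = (if m dvd card (orbit \<sigma> y) then m else 0)"
proof -
 define a where "a = funpow_dist1 \<sigma> y y"
 let ?Z = "orbit \<sigma> y"
 have a0: "a > 0" by (simp add: a_def)
 have ya: "(\<sigma> ^^ a) y = y" unfolding a_def by (rule funpow_dist1_prop[OF self_orbit])
 have inja: "inj_on (\<lambda>n. (\<sigma> ^^ n) y) {0..<a}" unfolding a_def by (rule inj_on_funpow_dist1[OF self_orbit])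
 have orb: "?Z = (\<lambda>n. (\<sigma> ^^ n) y) ` {0..<a}" unfolding a_def by (rule orbit_conv_funpow_dist1[OF self_orbit])
 have ca: "card ?Z = a" unfolding orb using card_image[OF inja] by simp
 have md: "(\<sigma> ^^ n) y = (\<sigma> ^^ (n mod a)) y" for n using funpow_mod_eq[OF ya] by simp
 have eq_iff: "(\<sigma> ^^ n) y = (\<sigma> ^^ n') y \<longleftrightarrow> n mod a = n' mod a" for n n'
  using md[of n] md[of n'] inj_onD[OF inja, of "n mod a" "n' mod a"] a0 by auto
 have inZ: "(\<sigma> ^^ n) y \<in> ?Z" for n using Inv_pow[OF Inv_orbit[OF y]] self_orbit by simp
 have Zex: "\<exists>n. x = (\<sigma> ^^ n) y" if "x \<in> ?Z" for x using that orb by blast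
 have pp: "(\<sigma> ^^ j) ((\<sigma> ^^ n) y) = (\<sigma> ^^ (n + j)) y" for j n by (simp add: funpow_add add.commute)
 define As where "As r = {x. \<exists>n. x = (\<sigma> ^^ n) y \<and> n mod m = r}" for r
 have form: "\<exists>r<m. A = As r \<and> (\<forall>n. (\<sigma> ^^ n) y \<in> A \<longleftrightarrow> n mod m = r)" if A: "A \<in> QQ m ?Z" for A
 proof -
  have A1: "A \<subseteq> ?Z" and A2: "\<And>x. x \<in> ?Z ==> \<exists>!j. j < m \<and> (\<sigma> ^^ j) x \<in> A"
   and A3: "\<And>x. x \<in> ?Z ==> (\<sigma> ^^ m) x \<in> A \<longleftrightarrow> x \<in> A" using A unfolding QQ_def by blast+
  obtain r where r: "r < m" "(\<sigma> ^^ r) y \<in> A" using A2[OF self_orbit] by blast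
  have ru: "j = r" if "j < m" "(\<sigma> ^^ j) y \<in> A" for j using A2[OF self_orbit] r that by blast
  have per: "(\<sigma> ^^ (s + t * m)) y \<in> A \<longleftrightarrow> (\<sigma> ^^ s) y \<in> A" for s t
  proof (induction t)
   case (Suc t)
   have "(\<sigma> ^^ (s + Suc t * m)) y = (\<sigma> ^^ m) ((\<sigma> ^^ (s + t * m)) y)" by (simp add: pp algebra_simps)
   then show ?case using A3[OF inZ] Suc by simp
  qed simp
  have mem: "(\<sigma> ^^ n) y \<in> A \<longleftrightarrow> n mod m = r" for n
  proof -
   have "(\<sigma> ^^ n) y \<in> A \<longleftrightarrow> (\<sigma> ^^ (n mod m)) y \<in> A" using per[of "n mod m" "n div m"] by simp
   also have "... \<longleftrightarrow> n mod m = r" using ru[of "n mod m"] r m by auto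
   finally show ?thesis .
  qed
  moreover have "A = As r" unfolding As_def using A1 Zex mem by blast
  ultimately show ?thesis using r(1) by blast
 qed
 show ?thesis
 proof (cases "m dvd a")
  case True
  have mem: "(\<sigma> ^^ n) y \<in> As r \<longleftrightarrow> n mod m = r" for n r
  proof
   assume "(\<sigma> ^^ n) y \<in> As r"
   then obtain n' where n': "(\<sigma> ^^ n) y = (\<sigma> ^^ n') y" "n' mod m = r" unfolding As_def by blast
   then have "n mod a = n' mod a" using eq_iff by blast
   then have "n mod m = n' mod m" using True by (metis mod_mod_cancel)
   then show "n mod m = r" using n' by simp
  qed (auto simp: As_def)
  have As_in: "As r \<in> QQ m ?Z" if r: "r < m" for r
   unfolding QQ_def
  proof (intro CollectI conjI ballI)
   show "As r \<subseteq> ?Z" using inZ by (auto simp: As_def)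
   fix x assume "x \<in> ?Z"
   then obtain n where x: "x = (\<sigma> ^^ n) y" using Zex by blast
   show "((\<sigma> ^^ m) x \<in> As r) = (x \<in> As r)" unfolding x pp mem by simp
   show "\<exists>!j. j < m \<and> (\<sigma> ^^ j) x \<in> As r"
    unfolding x pp mem
   proof (rule ex1I[of _ "(r + (m - n mod m)) mod m"])
    have "(n + (r + (m - n mod m)) mod m) mod m = (n mod m + (r + (m - n mod m))) mod m" by (simp add: mod_simps)
    also have "n mod m + (r + (m - n mod m)) = r + m" using m mod_less_divisor[OF m, of n] by simp
    finally show "(r + (m - n mod m)) mod m < m \<and> (n + (r + (m - n mod m)) mod m) mod m = r" using r m by simp
    fix j assume j: "j < m \<and> (n + j) mod m = r"
    have "(r + (m - n mod m)) mod m = ((n mod m + j) + (m - n mod m)) mod m" using j by (metis mod_add_left_eq)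
    also have "(n mod m + j) + (m - n mod m) = j + m" using mod_less_divisor[OF m, of n] by simp
    finally show "j = (r + (m - n mod m)) mod m" using j by simp
   qed
  qed
  have "inj_on As {..<m}"
  proof (rule inj_onI)
   fix r r' assume "r \<in> {..<m}" "r' \<in> {..<m}" "As r = As r'"
   then show "r = r'" using mem[of r r] mem[of r r'] by simp
  qed
  moreover have "QQ m ?Z = As ` {..<m}" using form As_in by blast
  ultimately show ?thesis using True ca by (simp add: card_image)
 next
  case False
  have "QQ m ?Z = {}"
  proof (rule ccontr)
   assume "QQ m ?Z \<noteq> {}"
   then obtain A where "A \<in> QQ m ?Z" by blast
   then obtain r where r: "r < m" "\<And>n. (\<sigma> ^^ n) y \<in> A \<longleftrightarrow> n mod m = r" using form by blast
   have "(\<sigma> ^^ (r + a)) y = (\<sigma> ^^ r) y" unfolding eq_iff by simp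
   then have "(r + a) mod m = r" using r(2)[of "r + a"] r(2)[of r] r(1) by simp
   then have "(r + a) mod m = (r + 0) mod m" using r(1) by simp
   then have "m dvd a" by (metis add_diff_cancel_left' add.right_neutral mod_eq_dvd_iff_nat le_add1)
   then show False using False by simp
  qed
  then show ?thesis using False ca by simp
 qed
qed

lemma card_QQ:
 assumes "Inv Z" "m > 0"
 shows "card (QQ m Z) = (\<Prod>Q\<in>orbs Z. if m dvd card Q then m else 0)"
 using assms(1)
proof (induction "card (orbs Z)" arbitrary: Z)
 case 0
 then have "orbs Z = {}" using orbs_finite by simp
 then have "Z = {}" by (simp add: orbs_def)
 then show ?case by (simp add: QQ_def orbs_def)
next
 case (Suc n)
 then obtain Q where Q: "Q \<in> orbs Z" by (metis card.empty ex_in_conv nat.distinct(1))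
 obtain y where y: "y \<in> Z" "Q = orbit \<sigma> y" "Inv Q" "Q \<subseteq> Z" using orbsE[OF Suc.prems Q] by metis
 have yY: "y \<in> Y" using y(1) Suc.prems by (auto simp: Inv_def)
 note od = orbs_Diff[OF Suc.prems Q]
 have I: "Inv (Z - Q)" by (rule Inv_Diff[OF Suc.prems y(3)])
 have "n = card (orbs (Z - Q))" using Suc(2) Q orbs_finite[OF Suc.prems] by (simp add: od)
 then have IH: "card (QQ m (Z - Q)) = (\<Prod>Q\<in>orbs Z - {Q}. if m dvd card Q then m else 0)" using Suc.hyps(1)[OF _ I] od by simp
 have "Z = Q \<union> (Z - Q)" using y by blast
 then have "card (QQ m Z) = card (QQ m Q) * card (QQ m (Z - Q))" using QQ_union[OF y(3) I] by (metis Diff_disjoint)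
 also have "card (QQ m Q) = (if m dvd card Q then m else 0)" using QQ_orbit[OF yY assms(2)] y(2) by simp
 also have "... * card (QQ m (Z - Q)) = (\<Prod>Q\<in>orbs Z. if m dvd card Q then m else 0)"
  unfolding IH by (rule prod.remove[symmetric]) (use orbs_finite[OF Suc.prems] Q in auto)
 finally show ?case .
qed

lemma good_QQ:
 assumes Z: "Inv Z" "Z \<noteq> {}" and m: "m > 0"
 shows "partition_on Z (orbit ((`) \<sigma>) A) \<and> card (orbit ((`) \<sigma>) A) = m \<longleftrightarrow> A \<in> QQ m Z" (is "?L \<longleftrightarrow> _")
proof
 let ?Q = "orbit ((`) \<sigma>) A"
 define a where "a = funpow_dist1 ((`) \<sigma>) A A"
 have a0: "a > 0" by (simp add: a_def)
 have Aa: "(\<sigma> ^^ a) ` A = A" unfolding a_def im_funpow[symmetric] by (rule funpow_dist1_prop[OF set_self_orbit])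
 have inja: "inj_on (\<lambda>n. (\<sigma> ^^ n) ` A) {0..<a}" using inj_on_funpow_dist1[OF set_self_orbit] unfolding a_def im_funpow .
 have orb: "?Q = (\<lambda>n. (\<sigma> ^^ n) ` A) ` {0..<a}" using orbit_conv_funpow_dist1[OF set_self_orbit] unfolding a_def im_funpow .
 have injp: "inj (\<sigma> ^^ n)" for n by (rule inj_fn[OF inj])
 have pp: "(\<sigma> ^^ j) ((\<sigma> ^^ n) y) = (\<sigma> ^^ (n + j)) y" for j n y by (simp add: funpow_add add.commute)
 assume L: ?L
 then have am: "a = m" using card_image[OF inja] orb by simp
 have sub: "A \<subseteq> Z" using L set_self_orbit[of A] partition_onD1 by blast
 show "A \<in> QQ m Z"
  unfolding QQ_def
 proof (intro CollectI conjI ballI)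
  show "A \<subseteq> Z" by (rule sub)
  fix x assume x: "x \<in> Z"
  show "((\<sigma> ^^ m) x \<in> A) = (x \<in> A)" using inj_image_mem_iff[OF injp, of m x A] Aa am by simp
  obtain n where n: "n < m" "x \<in> (\<sigma> ^^ n) ` A" using x L orb partition_onD1[of Z ?Q] am by auto
  have ex: "\<exists>j<m. (\<sigma> ^^ j) x \<in> A"
  proof (cases "n = 0")
   case True
   then show ?thesis using n m by (intro exI[of _ 0]) simp
  next
   case False
   obtain y where y: "y \<in> A" "x = (\<sigma> ^^ n) y" using n by blast
   have "(\<sigma> ^^ (m - n)) x = (\<sigma> ^^ m) y" using n(1) by (simp add: y(2) pp)
   then have "(\<sigma> ^^ (m - n)) x \<in> A" using y(1) Aa am by blast
   moreover have "m - n < m" using False n(1) by simp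
   ultimately show ?thesis by blast
  qed
  have uq: False if "j < j'" "j' < m" "(\<sigma> ^^ j) x \<in> A" "(\<sigma> ^^ j') x \<in> A" for j j'
  proof -
   let ?d = "j' - j"
   have "(\<sigma> ^^ j') x = (\<sigma> ^^ ?d) ((\<sigma> ^^ j) x)" using that(1) by (simp add: pp)
   then have "(\<sigma> ^^ j') x \<in> (\<sigma> ^^ ?d) ` A" using that(3) by blast
   moreover have "(\<sigma> ^^ ?d) ` A \<in> ?Q" unfolding orb using that am by auto
   moreover have "A \<in> ?Q" by (rule set_self_orbit)
   moreover have "disjoint ?Q" using L partition_onD2 by blast
   ultimately have "(\<sigma> ^^ ?d) ` A = A" using that(4) by (metis disjointD disjoint_iff)
   then have "(\<sigma> ^^ ?d) ` A = (\<sigma> ^^ 0) ` A" by simp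
   then have "?d = 0" by (rule inj_onD[OF inja]) (use that am in auto)
   then show False using that(1) by simp
  qed
  show "\<exists>!j. j < m \<and> (\<sigma> ^^ j) x \<in> A" using ex uq by (metis nat_neq_iff)
 qed
next
 let ?Q = "orbit ((`) \<sigma>) A"
 have pp: "(\<sigma> ^^ j) ((\<sigma> ^^ n) y) = (\<sigma> ^^ (n + j)) y" for j n y by (simp add: funpow_add add.commute)
 have injp: "inj (\<sigma> ^^ n)" for n by (rule inj_fn[OF inj])
 assume A: "A \<in> QQ m Z"
 then have A1: "A \<subseteq> Z" and A2: "\<And>x. x \<in> Z ==> \<exists>!j. j < m \<and> (\<sigma> ^^ j) x \<in> A"
  and A3: "\<And>x. x \<in> Z ==> (\<sigma> ^^ m) x \<in> A \<longleftrightarrow> x \<in> A" unfolding QQ_def by blast+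
 have fA: "finite A" using A1 Inv_finite[OF Z(1)] finite_subset by blast
 have mA: "(\<sigma> ^^ m) ` A = A"
  by (rule endo_inj_surj[OF fA]) (use A1 A3 injp in "auto intro: inj_on_subset")
 have ne: "A \<noteq> {}" using A2 Z(2) by blast
 have orb: "?Q = (\<lambda>n. (\<sigma> ^^ n) ` A) ` {..<m}"
 proof -
  have "((`) \<sigma> ^^ m) A = A" by (simp add: im_funpow mA)
  from orbit_altdef_bounded[OF this m] show ?thesis by (auto simp: im_funpow)
 qed
 have dj: "(\<sigma> ^^ n) ` A \<inter> (\<sigma> ^^ n') ` A = {}" if n: "n < n'" "n' < m" for n n'
 proof (rule ccontr)
  assume "(\<sigma> ^^ n) ` A \<inter> (\<sigma> ^^ n') ` A \<noteq> {}"
  then obtain x y where xy: "x \<in> A" "y \<in> A" "(\<sigma> ^^ n) x = (\<sigma> ^^ n') y" by blast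
  have "(\<sigma> ^^ n') y = (\<sigma> ^^ n) ((\<sigma> ^^ (n' - n)) y)" using n by (simp add: pp)
  then have "x = (\<sigma> ^^ (n' - n)) y" using xy(3) injp[of n] by (simp add: inj_eq)
  then have "(\<sigma> ^^ (n' - n)) y \<in> A \<and> n' - n < m" using xy n by simp
  moreover have "(\<sigma> ^^ 0) y \<in> A \<and> 0 < m" using xy m by simp
  ultimately have "n' - n = 0" using A2[of y] xy(2) A1 by blast
  then show False using n by simp
 qed
 have ine: "(\<sigma> ^^ n) ` A \<noteq> {}" for n using ne by simp
 have inj': "inj_on (\<lambda>n. (\<sigma> ^^ n) ` A) {..<m}"
 proof (rule inj_onI)
  fix n n' assume h: "n \<in> {..<m}" "n' \<in> {..<m}" "(\<sigma> ^^ n) ` A = (\<sigma> ^^ n') ` A"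
  show "n = n'"
  proof (rule ccontr)
   assume "n \<noteq> n'"
   then consider "n < n'" | "n' < n" by linarith
   then show False
   proof cases
    case 1
    then show False using dj[OF 1] h ine[of n'] by (metis Int_absorb lessThan_iff)
   next
    case 2
    then show False using dj[OF 2] h ine[of n'] by (metis Int_absorb lessThan_iff)
   qed
  qed
 qed
 have "partition_on Z ?Q"
 proof (rule partition_onI)
  show "{} \<notin> ?Q" unfolding orb using ine by blast
  show "disjnt p q" if "p \<in> ?Q" "q \<in> ?Q" "p \<noteq> q" for p q
  proof -
   obtain n n' where nn: "n < m" "n' < m" "p = (\<sigma> ^^ n) ` A" "q = (\<sigma> ^^ n') ` A" using `p \<in> ?Q` `q \<in> ?Q` orb by auto
   then consider "n < n'" | "n' < n" using `p \<noteq> q` by (metis nat_neq_iff)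
   then show ?thesis
   proof cases
    case 1
    then show ?thesis using dj[OF 1 nn(2)] nn by (simp add: disjnt_def)
   next
    case 2
    then show ?thesis using dj[OF 2 nn(1)] nn by (simp add: disjnt_def Int_commute)
   qed
  qed
  show "\<Union>?Q = Z"
  proof (rule subset_antisym; rule subsetI)
   fix x assume "x \<in> \<Union>?Q"
   then obtain n y where "y \<in> A" "x = (\<sigma> ^^ n) y" unfolding orb by blast
   then show "x \<in> Z" using A1 Inv_pow[OF Z(1)] by blast
  next
   fix x assume x: "x \<in> Z"
   have "(\<sigma> ^^ m) ` Z = Z"
    by (rule endo_inj_surj) (use Inv_finite[OF Z(1)] Inv_pow[OF Z(1)] injp in "auto intro: inj_on_subset")
   then obtain z where z: "z \<in> Z" "x = (\<sigma> ^^ m) z" using x by blast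
   obtain j where j: "j < m" "(\<sigma> ^^ j) z \<in> A" using A2[OF z(1)] by blast
   have "x = (\<sigma> ^^ (m - j)) ((\<sigma> ^^ j) z)" using j z by (simp add: pp)
   then have "x \<in> ((`) \<sigma> ^^ (m - j)) A" using j(2) by (auto simp: im_funpow)
   moreover have "((`) \<sigma> ^^ (m - j)) A \<in> ?Q" using j(1) unfolding orbit_altdef by auto
   ultimately show "x \<in> \<Union>?Q" by blast
  qed
 qed
 moreover have "card ?Q = m" unfolding orb using card_image[OF inj'] by simp
 ultimately show ?L by blast
qed

text \<open>For \<open>Z = {}\<close> the set \<open>QQ m Z\<close> contains the empty set but there is no part; this case is excluded by
  \<open>W Z = m * i\<close>.\<close>

lemma card_good:
 assumes Z: "Inv Z" and m: "m > 0" and i: "i > 0"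
 shows "card {A. good m i Z A} = (if W Z = m * i then card (QQ m Z) else 0)"
proof (cases "Z = {}")
 case True
 have "{A. good m i Z A} = {}"
  using set_self_orbit unfolding good_def True partition_on_empty by blast
 moreover have "W Z = 0" by (simp add: W_def True)
 ultimately show ?thesis using m i by simp
next
 case False
 have wq: "W Z = m * W A" if "A \<in> QQ m Z" for A
 proof -
  have p: "partition_on Z (orbit ((`) \<sigma>) A)" "card (orbit ((`) \<sigma>) A) = m" using good_QQ[OF Z False m] that by blast+
  have "A \<subseteq> Y" using that Z by (auto simp: QQ_def Inv_def)
  then have "W Z = (\<Sum>B\<in>orbit ((`) \<sigma>) A. W A)" unfolding W_partition[OF Z p(1)] by (intro sum.cong refl set_orbit_W)
  then show ?thesis using p(2) by simp
 qed
 have "{A. good m i Z A} = {A \<in> QQ m Z. W A = i}" using good_QQ[OF Z False m] unfolding good_def by blast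
 also have "... = (if W Z = m * i then QQ m Z else {})" using wq m by auto
 finally show ?thesis by simp
qed

text \<open>If the length of each cycle on \<open>Z\<close> is divisible by \<open>m\<close>, the monomial of \<open>Z\<close> is the dilation of a monomial
  \<open>M\<close>, and the pairing is the quotient of norms \<open>zz (dil m M) / zz M = m ^ dg M\<close>: one factor \<open>m\<close> for each
  cycle, as in \<open>card_QQ\<close>. Otherwise both sides are 0.\<close>

lemma phi_pleth_p_E:
 assumes Z: "Inv Z" and m: "m > 0" and i: "i > 0"
 shows "phi (pleth_p m (E_fun i)) Z = of_nat (card {A. good m i Z A})"
proof (cases "\<forall>Q\<in>orbs Z. m dvd card Q")
 case True
 define M0 where "M0 = (\<Sum>Q\<in>orbs Z. Poly_Mapping.single (card Q div m, snd (color Q)) (1::nat))"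
 have fo: "finite (orbs Z)" by (rule orbs_finite[OF Z])
 have fc: "fst (color Q) = card Q" for Q by (simp add: color_def)
 have d: "dil m M0 = mon Z"
  unfolding M0_def dil_sum[OF m] dil_single mon_def using True by (intro sum.cong refl) (simp add: color_def)
 have dgM: "dg M0 = card (orbs Z)" by (simp add: M0_def msum_sum msum_single)
 have "m * wt M0 = (\<Sum>Q\<in>orbs Z. m * (card Q div m * snd (color Q)))" by (simp add: M0_def msum_sum msum_single sum_distrib_left)
 also have "... = W Z" unfolding W_orbs[OF Z] using True by (intro sum.cong refl) (simp add: fc mult.assoc[symmetric])
 finally have wtM: "m * wt M0 = W Z" .
 have pos: "posm M0"
  unfolding posm_def
 proof
  fix x assume "x \<in> keys M0"
  then obtain Q where Q0: "Q \<in> orbs Z" "lookup (Poly_Mapping.single (card Q div m, snd (color Q)) (1::nat)) x \<noteq> 0"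
   unfolding M0_def in_keys_iff lookup_sum by (meson sum.neutral)
  then have Q: "Q \<in> orbs Z" "x = (card Q div m, snd (color Q))" by (auto simp: lookup_single when_def split: if_splits)
  obtain y where y: "y \<in> Z" "Q = orbit \<sigma> y" using Q by (auto simp: orbs_def)
  have yY: "y \<in> Y" using y(1) Z by (auto simp: Inv_def)
  have "card Q > 0" using orbit_pos[OF yY] y by simp
  then have "card Q div m > 0" using True Q(1) m by (metis dvd_div_eq_0_iff gr0I less_numeral_extra(3))
  then show "fst x > 0 \<and> snd x > 0" using Q(2) color_orbit[OF yY] y(2) w_pos[OF yY] by simp
 qed
 have zz0: "zz M0 > 0" by (rule zz_pos[OF pos])
 have cq: "card (QQ m Z) = m ^ card (orbs Z)" using card_QQ[OF Z m] True by simp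
 have "phi (pleth_p m (E_fun i)) Z = lookup (E_fun i) M0 * of_nat (m ^ card (orbs Z) * zz M0)"
  unfolding phi_def d[symmetric] lookup_pleth_p[OF m] zz_dil[OF m] dgM ..
 also have "... = (if wt M0 = i then of_nat (m ^ card (orbs Z)) else 0)" using pos zz0 by (simp add: lookup_E)
 also have "wt M0 = i \<longleftrightarrow> W Z = m * i" using wtM m by auto
 finally show ?thesis unfolding card_good[OF Z m i] cq by simp
next
 case False
 then obtain Q where Q: "Q \<in> orbs Z" "\<not> m dvd card Q" by blast
 have "mon Z \<noteq> dil m M" for M
 proof
  assume eq: "mon Z = dil m M"
  have "lookup (mon Z) (color Q) = 0" unfolding eq color_def lookup_dil[OF m] using Q(2) by simp
  then have "{P \<in> orbs Z. color P = color Q} = {}" using lookup_mon[OF Z] orbs_finite[OF Z] by simp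
  then show False using Q(1) by blast
 qed
 then have "phi (pleth_p m (E_fun i)) Z = 0" unfolding phi_def by (simp add: lookup_pleth_p_0)
 moreover have "card (QQ m Z) = 0" using card_QQ[OF Z m] Q orbs_finite[OF Z] by auto
 ultimately show ?thesis by (simp add: card_good[OF Z m i])
qed

end

section \<open>Schur functions of the generators E\<close>

lemma z_part_superset:
 assumes "finite A" "set_mset \<mu> \<subseteq> A"
 shows "z_part \<mu> = (\<Prod>i\<in>A. i ^ count \<mu> i * fact (count \<mu> i))"
 unfolding z_part_def by (rule prod.mono_neutral_left) (use assms in "auto simp: not_in_iff")

lemma z_part_add: "z_part (add_mset m \<mu>) = m * Suc (count \<mu> m) * z_part \<mu>"
proof -
 let ?A = "insert m (set_mset \<mu>)"
 let ?t = "\<lambda>\<mu> i. i ^ count \<mu> i * fact (count \<mu> i) :: nat"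
 have e: "?A = insert m (set_mset \<mu> - {m})" by auto
 have "z_part (add_mset m \<mu>) = ?t (add_mset m \<mu>) m * (\<Prod>i\<in>set_mset \<mu> - {m}. ?t (add_mset m \<mu>) i)"
  by (subst z_part_superset[of ?A], simp, simp, subst e, subst prod.insert) auto
 also have "(\<Prod>i\<in>set_mset \<mu> - {m}. ?t (add_mset m \<mu>) i) = (\<Prod>i\<in>set_mset \<mu> - {m}. ?t \<mu> i)"
  by (intro prod.cong refl) auto
 also have "?t (add_mset m \<mu>) m = m * Suc (count \<mu> m) * ?t \<mu> m" by (simp add: algebra_simps)
 also have "m * Suc (count \<mu> m) * ?t \<mu> m * (\<Prod>i\<in>set_mset \<mu> - {m}. ?t \<mu> i) = m * Suc (count \<mu> m) * z_part \<mu>"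
 proof -
  have "z_part \<mu> = ?t \<mu> m * (\<Prod>i\<in>set_mset \<mu> - {m}. ?t \<mu> i)"
   by (subst z_part_superset[of ?A], simp, blast, subst e, subst prod.insert) auto
  then show ?thesis by simp
 qed
 finally show ?thesis .
qed

lemma z_part_pos: "0 \<notin># \<mu> ==> z_part \<mu> > 0"
 unfolding z_part_def by (intro prod_pos) (metis fact_gt_zero gr0I mult_pos_pos zero_less_power)

lemma sum_mset_count: "(\<Sum>m\<in>set_mset \<mu>. m * count \<mu> m) = \<Sum>\<^sub># (\<mu> :: nat multiset)"
proof (induction \<mu>)
 case (add x \<mu>)
 have sup: "(\<Sum>m\<in>set_mset \<nu>. m * count \<nu> m) = (\<Sum>m\<in>A. m * count \<nu> m)" if "finite A" "set_mset \<nu> \<subseteq> A" for A and \<nu> :: "nat multiset"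
  by (rule sum.mono_neutral_left) (use that in "auto simp: not_in_iff")
 let ?A = "insert x (set_mset \<mu>)"
 have "(\<Sum>m\<in>?A. m * count (add_mset x \<mu>) m) = (\<Sum>m\<in>?A. m * count \<mu> m + (if m = x then x else 0))"
  by (intro sum.cong refl) auto
 also have "... = (\<Sum>m\<in>?A. m * count \<mu> m) + x" by (simp add: sum.distrib)
 also have "(\<Sum>m\<in>?A. m * count \<mu> m) = (\<Sum>m\<in>set_mset \<mu>. m * count \<mu> m)" by (rule sup[symmetric]) auto
 finally show ?case using add by (simp add: sup[of ?A "add_mset x \<mu>"])
qed simp

text \<open>The Newton identity, with \<open>h\<^sub>n = \<Sum> p\<^sub>\<mu> / z\<^sub>\<mu>\<close> as the definition: mark a part of \<open>\<mu>\<close>, weighted by its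
  size. The weights sum up to \<open>n\<close>, and removing the part \<open>m\<close> divides \<open>z\<^sub>\<mu>\<close> by \<open>m\<close> times its multiplicity.\<close>

lemma complete_hom_rec:
 "smul (of_nat n) (complete_hom (int n)) = (\<Sum>m=1..n. Var m * complete_hom (int n - int m))"
proof -
 let ?t = "\<lambda>\<mu>. smul (1 / of_nat (z_part \<mu>)) (power_sum \<mu>)"
 have ps: "power_sum (add_mset m \<mu>) = Var m * power_sum \<mu>" for m \<mu> by (simp add: power_sum_def)
 have "(\<Sum>m=1..n. Var m * complete_hom (int n - int m)) = (\<Sum>m\<in>{1..n}. \<Sum>\<mu>\<in>partitions (n - m). smul (1 / of_nat (z_part \<mu>)) (power_sum (add_mset m \<mu>)))"
 proof (rule sum.cong[OF refl])
  fix m assume "m \<in> {1..n}"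
  then have e: "int n - int m = int (n - m)" by auto
  show "Var m * complete_hom (int n - int m) = (\<Sum>\<mu>\<in>partitions (n - m). smul (1 / of_nat (z_part \<mu>)) (power_sum (add_mset m \<mu>)))"
   unfolding e by (simp add: complete_hom_def sum_distrib_left smul_mult_right ps)
 qed
 also have "... = (\<Sum>(m, \<mu>)\<in>(SIGMA m:{1..n}. partitions (n - m)). smul (1 / of_nat (z_part \<mu>)) (power_sum (add_mset m \<mu>)))"
  by (rule sum.Sigma) (auto simp: finite_partitions)
 also have "... = (\<Sum>(\<mu>, m)\<in>(SIGMA \<mu>:partitions n. set_mset \<mu>). smul (of_nat (m * count \<mu> m)) (?t \<mu>))"
 proof (rule sum.reindex_bij_witness[where j = "\<lambda>(m, \<mu>). (add_mset m \<mu>, m)" and i = "\<lambda>(\<mu>, m). (m, \<mu> - {#m#})"])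
  fix p assume "p \<in> (SIGMA m:{1..n}. partitions (n - m))"
  then obtain m \<mu> where p: "p = (m, \<mu>)" "m \<in> {1..n}" "\<mu> \<in> partitions (n - m)" by blast
  show "(case (case p of (m, \<mu>) => (add_mset m \<mu>, m)) of (\<mu>, m) => (m, \<mu> - {#m#})) = p" by (simp add: p)
  show "(case p of (m, \<mu>) => (add_mset m \<mu>, m)) \<in> (SIGMA \<mu>:partitions n. set_mset \<mu>)"
   using p by (auto simp: partitions_def is_partition_def)
  have "z_part \<mu> > 0" using p by (intro z_part_pos) (auto simp: partitions_def is_partition_def)
  then have "of_nat (m * Suc (count \<mu> m)) * (1 / of_nat (z_part (add_mset m \<mu>))) = (1 / of_nat (z_part \<mu>) :: complex)"
   using p(2) unfolding z_part_add of_nat_mult by (simp add: field_simps del: of_nat_Suc)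
  then have "smul (of_nat (m * count (add_mset m \<mu>) m)) (?t (add_mset m \<mu>)) = smul (1 / of_nat (z_part \<mu>)) (power_sum (add_mset m \<mu>))"
   by (simp only: free.scale_scale count_add_mset simp_thms if_True)
  then show "(case (case p of (m, \<mu>) => (add_mset m \<mu>, m)) of (\<mu>, m) => smul (of_nat (m * count \<mu> m)) (?t \<mu>)) =
    (case p of (m, \<mu>) => smul (1 / of_nat (z_part \<mu>)) (power_sum (add_mset m \<mu>)))" by (simp only: p(1) prod.case)
 next
  fix p assume "p \<in> (SIGMA \<mu>:partitions n. set_mset \<mu>)"
  then obtain m \<mu> where p: "p = (\<mu>, m)" "\<mu> \<in> partitions n" "m \<in># \<mu>" by blast
  obtain \<nu> where n: "\<mu> = add_mset m \<nu>" using p(3) by (metis insert_DiffM)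
  show "(case (case p of (\<mu>, m) => (m, \<mu> - {#m#})) of (m, \<mu>) => (add_mset m \<mu>, m)) = p" using p(3) by (simp add: p(1))
  show "(case p of (\<mu>, m) => (m, \<mu> - {#m#})) \<in> (SIGMA m:{1..n}. partitions (n - m))"
   using p(2) unfolding p(1) n by (auto simp: partitions_def is_partition_def)
 qed
 also have "... = (\<Sum>\<mu>\<in>partitions n. \<Sum>m\<in>set_mset \<mu>. smul (of_nat (m * count \<mu> m)) (?t \<mu>))"
  by (rule sum.Sigma[symmetric]) (auto simp: finite_partitions)
 also have "... = (\<Sum>\<mu>\<in>partitions n. smul (of_nat n) (?t \<mu>))"
 proof (rule sum.cong[OF refl])
  fix \<mu> assume \<mu>: "\<mu> \<in> partitions n"
  have "(\<Sum>m\<in>set_mset \<mu>. smul (of_nat (m * count \<mu> m)) (?t \<mu>)) = smul (of_nat (\<Sum>m\<in>set_mset \<mu>. m * count \<mu> m)) (?t \<mu>)"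
   by (simp only: free.scale_sum_left of_nat_sum)
  then show "(\<Sum>m\<in>set_mset \<mu>. smul (of_nat (m * count \<mu> m)) (?t \<mu>)) = smul (of_nat n) (?t \<mu>)"
   using \<mu> by (simp only: sum_mset_count) (simp add: partitions_def)
 qed
 also have "... = smul (of_nat n) (\<Sum>\<mu>\<in>partitions n. ?t \<mu>)" by (rule free.scale_sum_right[symmetric])
 also have "(\<Sum>\<mu>\<in>partitions n. ?t \<mu>) = complete_hom (int n)" by (simp add: complete_hom_def)
 finally show ?thesis by (rule sym)
qed

lemma complete_hom_0: "complete_hom 0 = 1"
proof -
 have "\<mu> = {#}" if "0 \<notin># \<mu>" "\<Sum>\<^sub># \<mu> = 0" for \<mu> :: "nat multiset"
  using that by (cases \<mu>) auto
 then have "partitions 0 = {{#}}"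
  unfolding partitions_def is_partition_def by fastforce
 then show ?thesis by (simp add: complete_hom_def power_sum_def z_part_def)
qed

lemma pleth_complete_rec:
 "smul (of_nat n) (pleth (complete_hom (int n)) A) = (\<Sum>m=1..n. pleth_p m A * pleth (complete_hom (int n - int m)) A)"
proof -
 have "smul (of_nat n) (pleth (complete_hom (int n)) A) = subst (\<lambda>m. pleth_p m A) (smul (of_nat n) (complete_hom (int n)))"
  by (simp add: pleth_def linD[OF lin_subst])
 also have "... = (\<Sum>m=1..n. pleth_p m A * pleth (complete_hom (int n - int m)) A)"
  unfolding complete_hom_rec lin_sum[OF lin_subst] subst_mult subst_Var pleth_def ..
 finally show ?thesis .
qed

text \<open>\<open>psi\<close> for a partition given as a multiset.\<close>

definition psi' :: "nat multiset => 'a set => ('a => 'a) => int" where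
 "psi' \<alpha> X g = psi (length (parts \<alpha>)) (\<lambda>i. if i < length (parts \<alpha>) then parts \<alpha> ! i else 0) X g"

lemma psi'_eq:
 "psi' \<alpha> X g = (\<Sum>w | w permutes {0..<length (parts \<alpha>)}. sign w *
   mchar (map (\<lambda>i. int (parts \<alpha> ! i) - int i + int (w i)) [0..<length (parts \<alpha>)]) X g)"
proof -
 have "map (\<lambda>i. int (if i < length (parts \<alpha>) then parts \<alpha> ! i else 0) - int i + int (w i)) [0..<length (parts \<alpha>)] =
  map (\<lambda>i. int (parts \<alpha> ! i) - int i + int (w i)) [0..<length (parts \<alpha>)]" for w by simp
 then show ?thesis unfolding psi'_def psi_def by (simp only:)
qed

text \<open>The Leibniz expansion of the Jacobi--Trudi determinant, which plethysm respects.\<close>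

lemma pleth_schur:
 "pleth (schur \<alpha>) A = (\<Sum>w | w permutes {0..<length (parts \<alpha>)}. smul (of_int (sign w))
   (\<Prod>a\<leftarrow>map (\<lambda>i. int (parts \<alpha> ! i) - int i + int (w i)) [0..<length (parts \<alpha>)]. pleth (complete_hom a) A))"
proof -
 let ?l = "length (parts \<alpha>)"
 let ?S = "subst (\<lambda>m. pleth_p m A)"
 have "schur \<alpha> = (\<Sum>w | w permutes {0..<?l}. smul (of_int (sign w)) (\<Prod>i=0..<?l. complete_hom (int (parts \<alpha> ! i) - int i + int (w i))))"
  unfolding schur_def Let_def det_def'[OF mat_carrier]
 proof (rule sum.cong[OF refl])
  fix w assume "w \<in> {w. w permutes {0..<?l}}"
  then have w: "w i < ?l" if "i < ?l" for i using permutes_in_image[of w "{0..<?l}" i] that by simp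
  have "(\<Prod>i = 0..<?l. mat ?l ?l (\<lambda>(i, j). complete_hom (int (parts \<alpha> ! i) - int i + int j)) $$ (i, w i)) = (\<Prod>i=0..<?l. complete_hom (int (parts \<alpha> ! i) - int i + int (w i)))"
   by (intro prod.cong refl) (simp add: w)
  then show "of_int (sign w) * (\<Prod>i = 0..<?l. mat ?l ?l (\<lambda>(i, j). complete_hom (int (parts \<alpha> ! i) - int i + int j)) $$ (i, w i)) =
   smul (of_int (sign w)) (\<Prod>i=0..<?l. complete_hom (int (parts \<alpha> ! i) - int i + int (w i)))"
   by (simp only: of_int_smul)
 qed
 then have "pleth (schur \<alpha>) A = (\<Sum>w | w permutes {0..<?l}. smul (of_int (sign w)) (\<Prod>i=0..<?l. ?S (complete_hom (int (parts \<alpha> ! i) - int i + int (w i)))))"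
  by (simp add: pleth_def lin_sum[OF lin_subst] linD[OF lin_subst] subst_prod)
 also have "... = (\<Sum>w | w permutes {0..<?l}. smul (of_int (sign w))
   (\<Prod>a\<leftarrow>map (\<lambda>i. int (parts \<alpha> ! i) - int i + int (w i)) [0..<?l]. pleth (complete_hom a) A))"
 proof (intro sum.cong refl arg_cong[of _ _ "smul _"])
  fix w :: "nat => nat"
  show "(\<Prod>i=0..<?l. ?S (complete_hom (int (parts \<alpha> ! i) - int i + int (w i)))) =
   (\<Prod>a\<leftarrow>map (\<lambda>i. int (parts \<alpha> ! i) - int i + int (w i)) [0..<?l]. pleth (complete_hom a) A)"
   using prod.distinct_set_conv_list[of "[0..<?l]" "\<lambda>i. ?S (complete_hom (int (parts \<alpha> ! i) - int i + int (w i)))"]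
   by (simp add: comp_def pleth_def)
 qed
 finally show ?thesis .
qed

context wperm
begin

lemma IP_empty: "{} \<in> IP Z \<longleftrightarrow> Z = {}" by (auto simp: IP_def partition_on_def)

text \<open>Both sides satisfy the same recursion (\<open>pleth_complete_rec\<close>, \<open>h_recursion\<close>), by \<open>phi_mult\<close> and
  \<open>phi_pleth_p_E\<close>.\<close>

lemma phi_h:
 assumes i: "i > 0"
 shows "Inv Z ==> phi (pleth (complete_hom n) (E_fun i)) Z = sm (hF i n) Z"
proof -
 have nat: "phi (pleth (complete_hom (int n)) (E_fun i)) Z = sm (hF i (int n)) Z" if "Inv Z" for n Z
  using that
 proof (induction n arbitrary: Z rule: less_induct)
  case (less n)
  note Z = less.prems
  show ?case
  proof (cases "n = 0")
   case True
   have "sm (hF i 0) Z = (\<Sum>\<rho>\<in>IP Z. if \<rho> = {} then 1 else 0)"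
    unfolding sm_def hF_def using finite_rho[OF Z] by (intro sum.cong refl) auto
   also have "... = (if Z = {} then 1 else 0)" using finite_IP[OF Z] IP_empty by simp
   finally show ?thesis using True phi_one[OF Z] by (simp add: complete_hom_0 pleth_def subst_one)
  next
   case False
   have "of_nat n * phi (pleth (complete_hom (int n)) (E_fun i)) Z = phi (smul (of_nat n) (pleth (complete_hom (int n)) (E_fun i))) Z"
    by (simp add: phi_smul)
   also have "... = (\<Sum>m=1..n. conv (phi (pleth_p m (E_fun i))) (phi (pleth (complete_hom (int n - int m)) (E_fun i))) Z)"
    by (simp only: pleth_complete_rec phi_sum phi_mult[OF Z])
   also have "... = (\<Sum>m=1..n. conv (\<lambda>Z1. of_nat (card {A. good m i Z1 A})) (sm (hF i (int n - int m))) Z)"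
    unfolding conv_Inv[OF Z]
   proof (intro sum.cong refl arg_cong2[of _ _ _ _ "(*)"])
    fix m Z1 assume m: "m \<in> {1..n}" and Z1: "Z1 \<in> {Z1. Z1 \<subseteq> Z \<and> Inv Z1}"
    then show "phi (pleth_p m (E_fun i)) Z1 = of_nat (card {A. good m i Z1 A})" using i by (intro phi_pleth_p_E) auto
    have e: "int n - int m = int (n - m)" "n - m < n" using m by auto
    have "Inv (Z - Z1)" using Z1 Inv_Diff[OF Z] by blast
    from less.IH[OF e(2) this]
    show "phi (pleth (complete_hom (int n - int m)) (E_fun i)) (Z - Z1) = sm (hF i (int n - int m)) (Z - Z1)"
     unfolding e(1) .
   qed
   also have "... = of_nat n * sm (hF i (int n)) Z" by (rule h_recursion[OF Z, symmetric])
   finally show ?thesis using False by simp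
  qed
 qed
 assume Z: "Inv Z"
 show ?thesis
 proof (cases "n < 0")
  case True
  have "pleth (0 :: sym) (E_fun i) = 0" by (simp add: pleth_def linD[OF lin_subst])
  then have "phi (pleth (complete_hom n) (E_fun i)) Z = 0" using True by (simp add: complete_hom_def phi_def)
  moreover have "sm (hF i n) Z = 0" unfolding sm_def hF_def using True by (intro sum.neutral) auto
  ultimately show ?thesis by simp
 next
  case False
  then show ?thesis using nat[OF Z, of "nat n"] by simp
 qed
qed

text \<open>The function on stable set partitions for a product of complete functions $h_a[E_i]$ with the same \<open>i\<close>:
  the number of ways to distribute the parts to the factors compatibly with \<open>\<sigma>\<close>.\<close>

definition hM :: "nat => int list => 'a set set => complex" where
 "hM i as \<rho> = (if \<forall>A\<in>\<rho>. W A = i then of_int (mchar as \<rho> ((`) \<sigma>)) else 0)"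

lemma hM_Cons: assumes "finite \<rho>" shows "hM i (a # as) \<rho> = cv (hF i a) (hM i as) \<rho>"
proof -
 let ?I = "{\<rho>1. \<rho>1 \<subseteq> \<rho> \<and> (`) \<sigma> ` \<rho>1 = \<rho>1}"
 have fI: "finite ?I" using assms by (auto intro: finite_subset[of _ "Pow \<rho>"])
 show ?thesis
 proof (cases "\<forall>A\<in>\<rho>. W A = i")
  case True
  have eq: "{Z. Z \<subseteq> \<rho> \<and> (`) \<sigma> ` Z = Z \<and> int (card Z) = a} = {\<rho>1 \<in> ?I. int (card \<rho>1) = a}" by blast
  have "hM i (a # as) \<rho> = of_int (mchar (a # as) \<rho> ((`) \<sigma>))"
   unfolding hM_def using True by (rule if_P)
  also have "... = (\<Sum>\<rho>1\<in>{\<rho>1 \<in> ?I. int (card \<rho>1) = a}. of_int (mchar as (\<rho> - \<rho>1) ((`) \<sigma>)))"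
   unfolding mchar.simps eq of_int_sum ..
  also have "... = (\<Sum>\<rho>1\<in>?I. if int (card \<rho>1) = a then of_int (mchar as (\<rho> - \<rho>1) ((`) \<sigma>)) else 0)"
   by (rule sum.inter_filter[OF fI])
  also have "... = cv (hF i a) (hM i as) \<rho>"
   unfolding cv_def
  proof (rule sum.cong[OF refl])
   fix \<rho>1 assume "\<rho>1 \<in> ?I"
   then have "\<forall>A\<in>\<rho>1. W A = i" "\<forall>A\<in>\<rho> - \<rho>1. W A = i" using True by blast+
   then show "(if int (card \<rho>1) = a then of_int (mchar as (\<rho> - \<rho>1) ((`) \<sigma>)) else 0) = hF i a \<rho>1 * hM i as (\<rho> - \<rho>1)"
    by (simp add: hF_def hM_def)
  qed
  finally show ?thesis .
 next
  case False
  have "hF i a \<rho>1 * hM i as (\<rho> - \<rho>1) = 0" for \<rho>1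
  proof (cases "\<forall>A\<in>\<rho>1. W A = i")
   case True
   then have "\<not> (\<forall>A\<in>\<rho> - \<rho>1. W A = i)" using False by blast
   then show ?thesis by (simp only: hM_def if_False mult_zero_right)
  next
   case False
   then have "\<not> ((\<forall>A\<in>\<rho>1. W A = i) \<and> int (card \<rho>1) = a)" by blast
   then show ?thesis by (simp only: hF_def if_False mult_zero_left)
  qed
  then have "cv (hF i a) (hM i as) \<rho> = 0" unfolding cv_def by (intro sum.neutral ballI)
  moreover have "hM i (a # as) \<rho> = 0" unfolding hM_def using False by (rule if_not_P)
  ultimately show ?thesis by simp
 qed
qed

lemma conv_cong:
 assumes "Inv Z" "\<And>Z1. Z1 \<subseteq> Z ==> Inv Z1 ==> F Z1 = F' Z1" "\<And>Z1. Z1 \<subseteq> Z ==> Inv Z1 ==> H Z1 = H' Z1"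
 shows "conv F H Z = conv F' H' Z"
 unfolding conv_Inv[OF assms(1)]
proof (intro sum.cong refl arg_cong2[of _ _ _ _ "(*)"])
 fix Z1 assume Z1: "Z1 \<in> {Z1. Z1 \<subseteq> Z \<and> Inv Z1}"
 then show "F Z1 = F' Z1" using assms by blast
 show "H (Z - Z1) = H' (Z - Z1)" using Z1 by (intro assms(3)) (auto intro: Inv_Diff[OF assms(1)])
qed

lemma phi_hs:
 assumes i: "i > 0"
 shows "Inv Z ==> phi (\<Prod>a\<leftarrow>as. pleth (complete_hom a) (E_fun i)) Z = sm (hM i as) Z"
proof (induction as arbitrary: Z)
 case Nil
 have "sm (hM i []) Z = (\<Sum>\<rho>\<in>IP Z. if \<rho> = {} then 1 else 0)"
  unfolding sm_def hM_def by (intro sum.cong refl) auto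
 then show ?case using phi_one[OF Nil] finite_IP[OF Nil] IP_empty by simp
next
 case (Cons a as)
 have "phi (\<Prod>a\<leftarrow>a # as. pleth (complete_hom a) (E_fun i)) Z = conv (phi (pleth (complete_hom a) (E_fun i))) (phi (\<Prod>a\<leftarrow>as. pleth (complete_hom a) (E_fun i))) Z"
  by (simp add: phi_mult[OF Cons.prems])
 also have "... = conv (sm (hF i a)) (sm (hM i as)) Z"
  by (rule conv_cong[OF Cons.prems]) (simp_all add: phi_h[OF i] Cons.IH)
 also have "... = sm (cv (hF i a) (hM i as)) Z" by (rule sm_cv[OF Cons.prems, symmetric])
 also have "... = sm (hM i (a # as)) Z"
  unfolding sm_def by (intro sum.cong refl) (simp add: hM_Cons finite_rho[OF Cons.prems])
 finally show ?case .
qed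

text \<open>The same for the Schur function of \<open>\<alpha>\<close> at $E_i$.\<close>

definition hS :: "nat => nat multiset => 'a set set => complex" where
 "hS i \<alpha> \<rho> = (if \<forall>A\<in>\<rho>. W A = i then of_int (psi' \<alpha> \<rho> ((`) \<sigma>)) else 0)"

lemma phi_schur:
 assumes i: "i > 0" and Z: "Inv Z"
 shows "phi (pleth (schur \<alpha>) (E_fun i)) Z = sm (hS i \<alpha>) Z"
proof -
 let ?as = "\<lambda>w. map (\<lambda>i. int (parts \<alpha> ! i) - int i + int (w i)) [0..<length (parts \<alpha>)]"
 have "phi (pleth (schur \<alpha>) (E_fun i)) Z = (\<Sum>w | w permutes {0..<length (parts \<alpha>)}. of_int (sign w) * sm (hM i (?as w)) Z)"
  by (simp only: pleth_schur phi_sum phi_smul phi_hs[OF i Z])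
 also have "... = (\<Sum>\<rho>\<in>IP Z. \<Sum>w | w permutes {0..<length (parts \<alpha>)}. of_int (sign w) * hM i (?as w) \<rho>)"
  unfolding sm_def sum_distrib_left by (rule sum.swap)
 also have "... = sm (hS i \<alpha>) Z"
  unfolding sm_def
 proof (rule sum.cong[OF refl])
  fix \<rho> assume "\<rho> \<in> IP Z"
  show "(\<Sum>w | w permutes {0..<length (parts \<alpha>)}. of_int (sign w) * hM i (?as w) \<rho>) = hS i \<alpha> \<rho>"
  proof (cases "\<forall>A\<in>\<rho>. W A = i")
   case True
   then have "hM i as \<rho> = of_int (mchar as \<rho> ((`) \<sigma>))" for as unfolding hM_def by (rule if_P)
   moreover have "hS i \<alpha> \<rho> = of_int (psi' \<alpha> \<rho> ((`) \<sigma>))" unfolding hS_def using True by (rule if_P)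
   ultimately show ?thesis by (simp only: psi'_eq of_int_sum of_int_mult)
  next
   case False
   then have "hM i as \<rho> = 0" for as unfolding hM_def by (rule if_not_P)
   moreover have "hS i \<alpha> \<rho> = 0" unfolding hS_def using False by (rule if_not_P)
   ultimately show ?thesis by simp
  qed
 qed
 finally show ?thesis .
qed

text \<open>The same for the product over \<open>i \<in> I\<close>; the weight of a part determines the factor to which it belongs.\<close>

definition hP :: "(nat => nat multiset) => nat set => 'a set set => complex" where
 "hP \<Lambda> I \<rho> = (if \<forall>A\<in>\<rho>. W A \<in> I then \<Prod>i\<in>I. of_int (psi' (\<Lambda> i) {A \<in> \<rho>. W A = i} ((`) \<sigma>)) else 0)"

lemma hP_insert:
 assumes I: "finite I" "i \<notin> I" and r: "finite \<rho>" "\<rho> \<in> IP Z" and Z: "Inv Z"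
 shows "cv (hS i (\<Lambda> i)) (hP \<Lambda> I) \<rho> = hP \<Lambda> (insert i I) \<rho>"
proof -
 let ?I = "{\<rho>1. \<rho>1 \<subseteq> \<rho> \<and> (`) \<sigma> ` \<rho>1 = \<rho>1}"
 let ?r = "{A \<in> \<rho>. W A = i}"
 have "A \<subseteq> Y" if "A \<in> \<rho>" for A
  using partition_onD1[OF IPD(1)[OF r(2)]] that Z unfolding Inv_def by blast
 then have WA: "W (\<sigma> ` A) = W A" if "A \<in> \<rho>" for A using W_image that by blast
 have inr: "?r \<in> ?I"
 proof -
  have "(`) \<sigma> ` ?r = ?r"
  proof (rule endo_inj_surj)
   show "finite ?r" using r by simp
   show "(`) \<sigma> ` ?r \<subseteq> ?r" using WA IPD(2)[OF r(2)] by blast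
   show "inj_on ((`) \<sigma>) ?r" using injim by (rule inj_on_subset) simp
  qed
  then show ?thesis by blast
 qed
 have fI: "finite ?I" using r(1) by (auto intro: finite_subset[of _ "Pow \<rho>"])
 have zero: "hS i (\<Lambda> i) \<rho>1 * hP \<Lambda> I (\<rho> - \<rho>1) = 0" if "\<rho>1 \<in> ?I - {?r}" for \<rho>1
 proof (cases "\<forall>A\<in>\<rho>1. W A = i")
  case True
  then have "\<rho>1 \<subseteq> ?r" "\<rho>1 \<noteq> ?r" using that by blast+
  then obtain A where "A \<in> ?r" "A \<notin> \<rho>1" by blast
  then have "\<not> (\<forall>A\<in>\<rho> - \<rho>1. W A \<in> I)" using I(2) by blast
  then show ?thesis by (simp only: hP_def if_False mult_zero_right)
 next
  case False
  then show ?thesis by (simp only: hS_def if_False mult_zero_left)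
 qed
 have "cv (hS i (\<Lambda> i)) (hP \<Lambda> I) \<rho> = (\<Sum>\<rho>1\<in>{?r}. hS i (\<Lambda> i) \<rho>1 * hP \<Lambda> I (\<rho> - \<rho>1))"
  unfolding cv_def
 proof (rule sum.mono_neutral_right[OF fI])
  show "{?r} \<subseteq> ?I" by (rule insert_subsetI[OF inr empty_subsetI])
  show "\<forall>\<rho>1\<in>?I - {?r}. hS i (\<Lambda> i) \<rho>1 * hP \<Lambda> I (\<rho> - \<rho>1) = 0" by (rule ballI) (rule zero)
 qed
 also have "... = hS i (\<Lambda> i) ?r * hP \<Lambda> I (\<rho> - ?r)" by simp
 also have "... = hP \<Lambda> (insert i I) \<rho>"
 proof (cases "\<forall>A\<in>\<rho>. W A \<in> insert i I")
  case True
  then have 1: "\<forall>A\<in>\<rho> - ?r. W A \<in> I" by blast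
  have "{A \<in> \<rho> - ?r. W A = j} = {A \<in> \<rho>. W A = j}" if "j \<in> I" for j using that I(2) by blast
  then have "(\<Prod>j\<in>I. of_int (psi' (\<Lambda> j) {A \<in> \<rho> - ?r. W A = j} ((`) \<sigma>))) = (\<Prod>j\<in>I. of_int (psi' (\<Lambda> j) {A \<in> \<rho>. W A = j} ((`) \<sigma>)) :: complex)"
   by (intro prod.cong refl) simp
  then show ?thesis using True 1 I by (simp add: hS_def hP_def)
 next
  case False
  then have 1: "\<not> (\<forall>A\<in>\<rho> - ?r. W A \<in> I)" by blast
  show ?thesis unfolding hP_def using 1 False by (simp only: if_False mult_zero_right)
 qed
 finally show ?thesis .
qed

text \<open>For different \<open>i\<close> the convolution has only one nonzero term: the parts of weight \<open>i\<close> go to the factor \<open>i\<close>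
  (\<open>hP_insert\<close>).\<close>

lemma phi_prod:
 assumes "finite I" "0 \<notin> I" "Inv Z"
 shows "phi (\<Prod>i\<in>I. pleth (schur (\<Lambda> i)) (E_fun i)) Z = sm (hP \<Lambda> I) Z"
 using assms
proof (induction I arbitrary: Z rule: finite_induct)
 case empty
 have "sm (hP \<Lambda> {}) Z = (\<Sum>\<rho>\<in>IP Z. if \<rho> = {} then 1 else 0)"
  unfolding sm_def hP_def by (intro sum.cong refl) auto
 then show ?case using phi_one empty finite_IP IP_empty by simp
next
 case (insert i I)
 note Z = `Inv Z`
 have i: "i > 0" using insert.prems by auto
 have "phi (\<Prod>i\<in>insert i I. pleth (schur (\<Lambda> i)) (E_fun i)) Z = conv (phi (pleth (schur (\<Lambda> i)) (E_fun i))) (phi (\<Prod>i\<in>I. pleth (schur (\<Lambda> i)) (E_fun i))) Z"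
  using insert.hyps by (simp add: phi_mult[OF Z])
 also have "... = conv (sm (hS i (\<Lambda> i))) (sm (hP \<Lambda> I)) Z"
  by (rule conv_cong[OF Z]) (use insert i in "simp_all add: phi_schur")
 also have "... = sm (cv (hS i (\<Lambda> i)) (hP \<Lambda> I)) Z" by (rule sm_cv[OF Z, symmetric])
 also have "... = sm (hP \<Lambda> (insert i I)) Z"
  unfolding sm_def by (intro sum.cong refl hP_insert) (use insert.hyps finite_rho[OF Z] Z in auto)
 finally show ?case .
qed

lemma scalar_basis: "scalar f (basis_vec M) = lookup f M * of_nat (zz M)"
proof -
 have "keys f \<inter> keys (basis_vec M) = (if M \<in> keys f then {M} else {})" by auto
 then show ?thesis by (auto simp: scalar_def zz_def in_keys_iff)
qed

theorem scalar_schur_E: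
 "scalar (schur_E k \<Lambda>) (basis_vec (mon Y)) = sm (hP \<Lambda> {1..k}) Y"
 unfolding scalar_basis schur_E_def phi_def[symmetric]
 by (rule phi_prod) (auto simp: Inv_Y)

end

subsection \<open>Homogeneity\<close>

text \<open>Homogeneous of degree \<open>d\<close> and free of the variables with an index 0. The degree is an integer since the
  complete functions in the determinant may have a negative index; those are 0.\<close>

definition homg :: "int => symX => bool" where
 "homg d f \<longleftrightarrow> (\<forall>M. lookup f M \<noteq> 0 \<longrightarrow> posm M \<and> int (wt M) = d)"

lemma posm_add: "posm M ==> posm M' ==> posm (M + M')"
 using keys_add[of M M'] unfolding posm_def by blast

lemma homg_0: "homg d 0" by (simp add: homg_def)
lemma homg_1: "homg 0 1" by (auto simp: homg_def lookup_one when_def posm_def msum_0)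
lemma homg_add: "homg d f ==> homg d g ==> homg d (f + g)" unfolding homg_def lookup_add by (metis add.right_neutral)
lemma homg_smul: "homg d f ==> homg d (smul c f)" by (auto simp: homg_def)
lemma homg_sum: "(\<And>x. x \<in> A ==> homg d (f x)) ==> homg d (sum f A)"
 by (induction A rule: infinite_finite_induct) (auto simp: homg_0 homg_add)

lemma homg_mult: assumes "homg d f" "homg d' g" shows "homg (d + d') (f * g)"
 unfolding homg_def
proof (intro allI impI)
 fix M assume "lookup (f * g) M \<noteq> 0"
 then have "M \<in> keys (f * g)" by (simp add: in_keys_iff)
 then obtain a b where "M = a + b" "a \<in> keys f" "b \<in> keys g" using keys_mult[of f g] by blast
 then show "posm M \<and> int (wt M) = d + d'"
  using assms by (auto simp: homg_def in_keys_iff posm_add msum_add)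
qed

lemma homg_prod: "finite A ==> (\<And>x. x \<in> A ==> homg (d x) (f x)) ==> homg (\<Sum>x\<in>A. d x) (\<Prod>x\<in>A. f x)"
 by (induction A rule: finite_induct) (auto simp: homg_1 homg_mult)

lemma homg_prod_list: "(\<And>x. x \<in> set xs ==> homg (d x) (f x)) ==> homg (\<Sum>x\<leftarrow>xs. d x) (\<Prod>x\<leftarrow>xs. f x)"
 by (induction xs) (auto simp: homg_1 homg_mult)

lemma homg_E: "homg (int r) (E_fun r)" by (auto simp: homg_def lookup_E)

lemma homg_pleth_p: assumes "m > 0" "homg d f" shows "homg (int m * d) (pleth_p m f)"
 unfolding homg_def
proof (intro allI impI)
 fix N assume N: "lookup (pleth_p m f) N \<noteq> 0"
 then obtain M where M: "N = dil m M" using lookup_pleth_p_0 by metis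
 then have h: "posm M" "int (wt M) = d" using N assms by (auto simp: lookup_pleth_p homg_def)
 have "posm N"
  unfolding posm_def
 proof
  fix x assume "x \<in> keys N"
  then have x: "m dvd fst x" "(fst x div m, snd x) \<in> keys M"
   using lookup_dil[OF assms(1), of M "fst x" "snd x"] M by (auto simp: in_keys_iff split: if_splits)
  then have "fst x div m > 0" "snd x > 0" using h(1) by (auto simp: posm_def)
  then show "fst x > 0 \<and> snd x > 0" by (cases "fst x") auto
 qed
 moreover have "wt N = m * wt M"
  unfolding M dil_def msum_sum msum_single by (simp add: msum_def sum_distrib_left mult.assoc)
 ultimately show "posm N \<and> int (wt N) = int m * d" using h(2) by simp
qed

lemma homg_complete: "homg (int i * n) (pleth (complete_hom n) (E_fun i))"
proof (cases "n < 0")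
 case True
 then show ?thesis by (simp add: complete_hom_def pleth_def linD[OF lin_subst] homg_0)
next
 case False
 have ps: "homg (int i * int (\<Sum>\<^sub># \<mu>)) (subst (\<lambda>m. pleth_p m (E_fun i)) (power_sum \<mu>))" if "0 \<notin># \<mu>" for \<mu>
  using that
 proof (induction \<mu>)
  case (add m \<mu>)
  then have "homg (int m * int i + int i * int (\<Sum>\<^sub># \<mu>)) (pleth_p m (E_fun i) * subst (\<lambda>m. pleth_p m (E_fun i)) (power_sum \<mu>))"
   by (intro homg_mult homg_pleth_p homg_E) auto
  then show ?case by (simp add: power_sum_def subst_mult subst_Var algebra_simps del: sum_mset_distrib_left)
 qed (simp add: power_sum_def subst_one homg_1)
 have "homg (int i * n) (\<Sum>\<mu>\<in>partitions (nat n). smul (1 / of_nat (z_part \<mu>)) (subst (\<lambda>m. pleth_p m (E_fun i)) (power_sum \<mu>)))"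
 proof (intro homg_sum homg_smul)
  fix \<mu> assume "\<mu> \<in> partitions (nat n)"
  then have "0 \<notin># \<mu>" "int (\<Sum>\<^sub># \<mu>) = n" using False by (auto simp: partitions_def is_partition_def)
  then show "homg (int i * n) (subst (\<lambda>m. pleth_p m (E_fun i)) (power_sum \<mu>))" using ps by metis
 qed
 then show ?thesis using False by (simp add: complete_hom_def pleth_def lin_sum[OF lin_subst] linD[OF lin_subst])
qed

lemma sum_parts: "sum_list (parts \<alpha>) = \<Sum>\<^sub># \<alpha>"
 by (metis mset_rev mset_sorted_list_of_multiset parts_def sum_mset_sum_list)

lemma homg_schur: "homg (int i * int (\<Sum>\<^sub># \<alpha>)) (pleth (schur \<alpha>) (E_fun i))"
 unfolding pleth_schur
proof (intro homg_sum homg_smul)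
 let ?l = "length (parts \<alpha>)"
 fix w assume "w \<in> {w. w permutes {0..<?l}}"
 then have w: "w permutes {0..<?l}" by simp
 let ?as = "map (\<lambda>i. int (parts \<alpha> ! i) - int i + int (w i)) [0..<?l]"
 have s0: "(\<Sum>i = 0..<?l. int (w i)) = (\<Sum>i = 0..<?l. int i)"
  using sum.permute[OF w, of int] by (simp add: comp_def)
 have "(\<Sum>a\<leftarrow>?as. int i * a) = int i * sum_list ?as" using sum_list_const_mult[of "int i" "\<lambda>x. x" ?as] by simp
 also have "sum_list ?as = (\<Sum>j = 0..<?l. int (parts \<alpha> ! j) - int j + int (w j))"
  by (simp add: interv_sum_list_conv_sum_set_nat)
 also have "... = int (\<Sum>j = 0..<?l. parts \<alpha> ! j)" using s0 by (simp add: sum.distrib sum_subtractf)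
 also have "(\<Sum>j = 0..<?l. parts \<alpha> ! j) = \<Sum>\<^sub># \<alpha>" by (simp only: sum_parts[symmetric] sum_list_sum_nth)
 finally have "(\<Sum>a\<leftarrow>?as. int i * a) = int i * int (\<Sum>\<^sub># \<alpha>)" .
 moreover have "homg (\<Sum>a\<leftarrow>?as. int i * a) (\<Prod>a\<leftarrow>?as. pleth (complete_hom a) (E_fun i))"
  by (rule homg_prod_list) (rule homg_complete)
 ultimately show "homg (int i * int (\<Sum>\<^sub># \<alpha>)) (\<Prod>a\<leftarrow>?as. pleth (complete_hom a) (E_fun i))" by simp
qed

lemma homg_schur_E: assumes "\<Lambda> \<in> mparts k" shows "homg (int k) (schur_E k \<Lambda>)"
proof -
 have "homg (\<Sum>i\<in>{1..k}. int i * int (\<Sum>\<^sub># (\<Lambda> i))) (schur_E k \<Lambda>)"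
  unfolding schur_E_def by (intro homg_prod homg_schur) simp
 moreover have "(\<Sum>i\<in>{1..k}. int i * int (\<Sum>\<^sub># (\<Lambda> i))) = int (\<Sum>i=1..k. i * \<Sum>\<^sub># (\<Lambda> i))"
  by (simp only: of_nat_sum of_nat_mult)
 moreover have "(\<Sum>i=1..k. i * \<Sum>\<^sub># (\<Lambda> i)) = k" using assms by (simp only: mparts_def mem_Collect_eq)
 ultimately show ?thesis by (simp only:)
qed

text \<open>The monomials of degree \<open>k\<close> are orthogonal and are exactly the $\mathbf{p}_{\vec\mu}$, so a homogeneous
  element of degree \<open>k\<close> is the sum of its projections.\<close>

lemma schur_E_expand:
 assumes "\<Lambda> \<in> mparts k"
 shows "(\<Sum>\<mu>\<in>mparts k. smul (scalar (schur_E k \<Lambda>) (pX k \<mu>) / of_nat (z_vec k \<mu>)) (pX k \<mu>)) = schur_E k \<Lambda>"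
proof (rule poly_mapping_eqI)
 fix M
 let ?f = "schur_E k \<Lambda>"
 have "scalar ?f (pX k \<mu>) / of_nat (z_vec k \<mu>) = lookup ?f (mexp k \<mu>)" if "\<mu> \<in> mparts k" for \<mu>
  using zz_pos[OF mexp_props(1)[OF that]] by (simp add: pX_mexp wperm.scalar_basis[of "{}" id "\<lambda>_. 0"] wperm_def z_vec_zz[OF that])
 then have 1: "lookup (\<Sum>\<mu>\<in>mparts k. smul (scalar ?f (pX k \<mu>) / of_nat (z_vec k \<mu>)) (pX k \<mu>)) M
   = (\<Sum>\<mu>\<in>mparts k. if mexp k \<mu> = M then lookup ?f M else 0)"
  unfolding lookup_sum by (intro sum.cong refl) (simp add: pX_mexp lookup_single when_def)
 also have "... = lookup ?f M"
 proof (cases "lookup ?f M = 0")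
  case False
  then have "posm M" "wt M = k" using homg_schur_E[OF assms] by (auto simp: homg_def)
  then obtain \<mu> where \<mu>: "\<mu> \<in> mparts k" "mexp k \<mu> = M" using mexp_surj by metis
  have "(\<Sum>\<nu>\<in>mparts k. if mexp k \<nu> = M then lookup ?f M else 0) = (\<Sum>\<nu>\<in>mparts k. if \<nu> = \<mu> then lookup ?f M else 0)"
   by (intro sum.cong refl) (use \<mu> mexp_inj in auto)
  then show ?thesis using \<mu>(1) finite_mparts by simp
 qed (simp add: if_distrib cong: if_cong)
 finally show "lookup (\<Sum>\<mu>\<in>mparts k. smul (scalar ?f (pX k \<mu>) / of_nat (z_vec k \<mu>)) (pX k \<mu>)) M = lookup ?f M" .
qed

section \<open>Diagrams as partial bijections\<close>

text \<open>A set is saturated if it is a union of blocks.\<close>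

definition sat :: "'a set set => 'a set => bool" where
 "sat d U \<longleftrightarrow> (\<exists>D\<subseteq>d. U = \<Union>D)"

text \<open>\<open>(P, Q) \<in> Rd d\<close> means that a union of blocks of \<open>d\<close> has the vertices \<open>P\<close> in the top row and \<open>Q\<close> in the
  bottom row. The relation is single-valued and injective because both rows of a block have the same
  size (\<open>Rd_fun\<close>, \<open>Rd_inv\<close>), it determines \<open>d\<close> (\<open>Rd_inj\<close>), and it turns the product of diagrams, which is
  defined by connected components, into composition (\<open>Rd_mult\<close>).\<close>

definition Rd :: "diagram => (nat set \<times> nat set) set" where
 "Rd d = {(P, Q). sat d (P <+> Q)}"

lemma sat_iff: assumes "partition_on V d"
 shows "sat d U \<longleftrightarrow> U \<subseteq> V \<and> (\<forall>B\<in>d. B \<subseteq> U \<or> B \<inter> U = {})"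
proof
 assume "sat d U"
 then obtain D where D: "D \<subseteq> d" "U = \<Union>D" by (auto simp: sat_def)
 have "B \<subseteq> U \<or> B \<inter> U = {}" if B: "B \<in> d" for B
 proof (cases "B \<in> D")
  case False
  then have "B \<inter> B' = {}" if "B' \<in> D" for B' using partition_onD2[OF assms] B that D(1) by (metis disjointD subsetD)
  then show ?thesis using D(2) by blast
 qed (use D in blast)
 then show "U \<subseteq> V \<and> (\<forall>B\<in>d. B \<subseteq> U \<or> B \<inter> U = {})" using D partition_onD1[OF assms] by blast
next
 assume U: "U \<subseteq> V \<and> (\<forall>B\<in>d. B \<subseteq> U \<or> B \<inter> U = {})"
 have "U = \<Union>{B \<in> d. B \<subseteq> U}"
 proof (rule subset_antisym; rule subsetI)
  fix x assume x: "x \<in> U"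
  then obtain B where "B \<in> d" "x \<in> B" using U partition_onD1[OF assms] by blast
  then show "x \<in> \<Union>{B \<in> d. B \<subseteq> U}" using U x by blast
 qed blast
 then show "sat d U" unfolding sat_def by (intro exI[of _ "{B \<in> d. B \<subseteq> U}"] conjI) blast
qed

lemma sat_Union: assumes "\<And>U. U \<in> \<U> ==> sat d U" shows "sat d (\<Union>\<U>)"
proof -
 obtain D where D: "\<And>U. U \<in> \<U> ==> D U \<subseteq> d \<and> U = \<Union>(D U)" using assms unfolding sat_def by metis
 have "\<Union>\<U> = (\<Union>U\<in>\<U>. \<Union>(D U))" using D by simp
 also have "... = \<Union>(\<Union>U\<in>\<U>. D U)" by blast
 finally have "\<Union>\<U> = \<Union>(\<Union>U\<in>\<U>. D U)" .
 moreover have "(\<Union>U\<in>\<U>. D U) \<subseteq> d" using D by blast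
 ultimately show ?thesis unfolding sat_def by (intro exI[of _ "\<Union>U\<in>\<U>. D U"] conjI)
qed

lemma sat_Diff: assumes "partition_on V d" "sat d U" "sat d U'" shows "sat d (U - U')"
 using assms(2,3) unfolding sat_iff[OF assms(1)] by blast

lemma sat_block: "B \<in> d ==> sat d B" unfolding sat_def by (intro exI[of _ "{B}"]) auto

lemma sat_inj:
 assumes "partition_on V d" "partition_on V d'" "\<And>U. sat d U \<longleftrightarrow> sat d' U"
 shows "d \<subseteq> d'"
proof
 fix B assume B: "B \<in> d"
 then have "sat d' B" using assms(3) sat_block by blast
 then obtain D where D: "D \<subseteq> d'" "B = \<Union>D" by (auto simp: sat_def)
 have "B \<noteq> {}" using B partition_onD3[OF assms(1)] by blast
 then obtain B' where B': "B' \<in> D" using D by blast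
 have "B' \<noteq> {}" using B' D partition_onD3[OF assms(2)] by blast
 moreover have "sat d B'" using assms(3) sat_block B' D by blast
 moreover have "B' \<subseteq> B" using B' D by blast
 ultimately have "B' = B" using B unfolding sat_iff[OF assms(1)] by blast
 then show "B \<in> d'" using B' D by blast
qed

lemma Plus_eq: "Inl -` U <+> Inr -` U = U"
proof (rule Set.set_eqI)
 fix x :: "'a + 'b" show "x \<in> Inl -` U <+> Inr -` U \<longleftrightarrow> x \<in> U" by (cases x) auto
qed

lemma Plus_vimage [simp]: "Inl -` (P <+> Q) = P" "Inr -` (P <+> Q) = Q" by auto

lemma Plus_inj: "P <+> Q = P' <+> Q' \<longleftrightarrow> P = P' \<and> Q = Q'" by (metis Plus_vimage)

lemma Plus_sub: "P <+> Q \<subseteq> P' <+> Q' \<longleftrightarrow> P \<subseteq> P' \<and> Q \<subseteq> Q'"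
proof
 assume "P <+> Q \<subseteq> P' <+> Q'"
 from vimage_mono[OF this, of Inl] vimage_mono[OF this, of Inr] show "P \<subseteq> P' \<and> Q \<subseteq> Q'" by simp
qed blast

lemma Plus_Union: "\<Union>((\<lambda>A. f A <+> g A) ` S) = \<Union>(f ` S) <+> \<Union>(g ` S)" by auto

lemma Plus_ops: "(P <+> Q) - (P' <+> Q') = (P - P') <+> (Q - Q')" "(P <+> Q) \<inter> (P' <+> Q') = (P \<inter> P') <+> (Q \<inter> Q')" by auto

lemma ubpD: "d \<in> ubp k ==> partition_on ({1..k} <+> {1..k}) d" "d \<in> ubp k ==> B \<in> d ==> card (Inl -` B) = card (Inr -` B)"
 by (auto simp: ubp_def)

lemma Rd_sub: "d \<in> ubp k ==> (P, Q) \<in> Rd d ==> P \<subseteq> {1..k} \<and> Q \<subseteq> {1..k}"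
proof -
 assume d: "d \<in> ubp k" and r: "(P, Q) \<in> Rd d"
 have "P <+> Q \<subseteq> {1..k} <+> {1..k}" using r sat_iff[OF ubpD(1)[OF d], of "P <+> Q"] by (simp add: Rd_def)
 then show ?thesis by (simp only: Plus_sub)
qed

lemma Rd_card: assumes d: "d \<in> ubp k" and r: "(P, Q) \<in> Rd d" shows "card P = card Q"
proof -
 obtain D where D: "D \<subseteq> d" "P <+> Q = \<Union>D" using r by (auto simp: Rd_def sat_def)
 have fV: "finite ({1..k} <+> {1..k} :: (nat + nat) set)" by simp
 have fD: "finite D" using finite_elements[OF fV ubpD(1)[OF d]] D(1) finite_subset by blast
 have sub: "B \<subseteq> {1..k} <+> {1..k}" if "B \<in> D" for B using that D(1) partition_onD1[OF ubpD(1)[OF d]] by blast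
 have fin: "finite (Inl -` B)" "finite (Inr -` B)" if "B \<in> D" for B
  using sub[OF that] by (auto intro!: finite_subset[of _ "{1..k}"])
 have dj: "B \<inter> B' = {}" if "B \<in> D" "B' \<in> D" "B \<noteq> B'" for B B'
  using partition_onD2[OF ubpD(1)[OF d]] that D(1) by (meson disjointD subsetD)
 have "P = (\<Union>B\<in>D. Inl -` B)" using D(2) by (metis Plus_vimage(1) vimage_Union)
 then have "card P = (\<Sum>B\<in>D. card (Inl -` B))"
  using card_UN_disjoint[OF fD, of "\<lambda>B. Inl -` B"] fin(1) dj by fastforce
 also have "... = (\<Sum>B\<in>D. card (Inr -` B))" using ubpD(2)[OF d] D(1) by (intro sum.cong) auto
 also have "... = card Q"
 proof -
  have "Q = (\<Union>B\<in>D. Inr -` B)" using D(2) by (metis Plus_vimage(2) vimage_Union)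
  then show ?thesis using card_UN_disjoint[OF fD, of "\<lambda>B. Inr -` B"] fin(2) dj by fastforce
 qed
 finally show ?thesis .
qed

lemma Rd_Diff: "d \<in> ubp k ==> (P, Q) \<in> Rd d ==> (P', Q') \<in> Rd d ==> (P - P', Q - Q') \<in> Rd d"
 using sat_Diff[OF ubpD(1)[of d k], of "P <+> Q" "P' <+> Q'"] by (simp add: Rd_def Plus_ops)

lemma Rd_Union: assumes "\<And>x. x \<in> S ==> (f x, g x) \<in> Rd d" shows "(\<Union>(f ` S), \<Union>(g ` S)) \<in> Rd d"
proof -
 have "sat d (\<Union>((\<lambda>x. f x <+> g x) ` S))" by (rule sat_Union) (use assms in "auto simp: Rd_def")
 then show ?thesis by (simp add: Rd_def Plus_Union)
qed

text \<open>A union of blocks has as many vertices in the top row as in the bottom row; apply this to the difference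
  of two such unions.\<close>

lemma Rd_mono: assumes "d \<in> ubp k" "(P, Q) \<in> Rd d" "(P', Q') \<in> Rd d" shows "P \<subseteq> P' \<longleftrightarrow> Q \<subseteq> Q'"
proof -
 note r = Rd_Diff[OF assms]
 have "finite (P - P')" "finite (Q - Q')" using Rd_sub[OF assms(1) r] finite_subset by blast+
 then have "P - P' = {} \<longleftrightarrow> Q - Q' = {}" using Rd_card[OF assms(1) r] by (metis card_0_eq)
 then show ?thesis by blast
qed

lemma Rd_fun: assumes "d \<in> ubp k" "(P, Q) \<in> Rd d" "(P, Q') \<in> Rd d" shows "Q = Q'"
 using Rd_mono[OF assms] Rd_mono[OF assms(1,3,2)] by blast

lemma Rd_inv: assumes "d \<in> ubp k" "(P, Q) \<in> Rd d" "(P', Q) \<in> Rd d" shows "P = P'"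
 using Rd_mono[OF assms] Rd_mono[OF assms(1,3,2)] by blast

lemma Rd_inj: assumes "d \<in> ubp k" "d' \<in> ubp k" "Rd d = Rd d'" shows "d = d'"
proof -
 have "sat d U \<longleftrightarrow> sat d' U" for U
 proof -
  have "(Inl -` U, Inr -` U) \<in> Rd d \<longleftrightarrow> (Inl -` U, Inr -` U) \<in> Rd d'" by (simp only: assms(3))
  then show ?thesis by (simp add: Rd_def Plus_eq)
 qed
 then show ?thesis using sat_inj[OF ubpD(1)[OF assms(1)] ubpD(1)[OF assms(2)]] sat_inj[OF ubpD(1)[OF assms(2)] ubpD(1)[OF assms(1)]] by blast
qed

context
 fixes k d d' assumes d: "d \<in> ubp k" and d': "d' \<in> ubp k"
begin

abbreviation (input) "SE \<equiv> stack_edges d d'"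
abbreviation (input) "VV \<equiv> {0, 1, 2::nat} \<times> {1..k}"

lemma blocks_V: "\<Union>d = {1..k} <+> {1..k}" "\<Union>d' = {1..k} <+> {1..k}"
 using partition_onD1[OF ubpD(1)[OF d]] partition_onD1[OF ubpD(1)[OF d']] by simp_all

lemma SE_sub: "SE \<subseteq> VV \<times> VV"
proof -
 have "upper_pos ` B \<subseteq> VV" if "B \<in> d" for B
 proof -
  have "B \<subseteq> {1..k} <+> {1..k}" using that blocks_V by blast
  then show ?thesis by (fastforce simp: upper_pos_def)
 qed
 moreover have "lower_pos ` B \<subseteq> VV" if "B \<in> d'" for B
 proof -
  have "B \<subseteq> {1..k} <+> {1..k}" using that blocks_V by blast
  then show ?thesis by (fastforce simp: lower_pos_def)
 qed
 ultimately show ?thesis unfolding stack_edges_def by blast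
qed

lemma SE_refl: assumes "x \<in> VV" shows "(x, x) \<in> SE"
proof -
 obtain r i where x: "x = (r, i)" "r \<in> {0,1,2}" "i \<in> {1..k}" using assms by blast
 have u: "\<exists>B\<in>d. Inl i \<in> B" "\<exists>B\<in>d. Inr i \<in> B" "\<exists>B\<in>d'. Inr i \<in> B"
  using blocks_V x(3) by blast+
 from x(2) consider "r = 0" | "r = 1" | "r = 2" by blast
 then show ?thesis
 proof cases
  case 1
  obtain B where B: "B \<in> d" "Inl i \<in> B" using u by blast
  have "x = upper_pos (Inl i)" using 1 x by (simp add: upper_pos_def)
  then show ?thesis using B unfolding stack_edges_def by blast
 next
  case 2
  obtain B where B: "B \<in> d" "Inr i \<in> B" using u by blast
  have "x = upper_pos (Inr i)" using 2 x by (simp add: upper_pos_def)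
  then show ?thesis using B unfolding stack_edges_def by blast
 next
  case 3
  obtain B where B: "B \<in> d'" "Inr i \<in> B" using u by blast
  have "x = lower_pos (Inr i)" using 3 x by (simp add: lower_pos_def)
  then show ?thesis using B unfolding stack_edges_def by blast
 qed
qed

lemma Field_SE: "Field SE = VV"
 using SE_sub SE_refl unfolding Field_def by blast

lemma sym_SE: "sym SE" unfolding stack_edges_def by (auto intro!: symI)

lemma sym_r: "(x, y) \<in> SE\<^sup>* ==> (y, x) \<in> SE\<^sup>*" using sym_rtrancl[OF sym_SE] by (rule symD)

lemma class_sub: "x \<in> VV ==> SE\<^sup>* `` {x} \<subseteq> VV"
proof
 fix y assume x: "x \<in> VV" and "y \<in> SE\<^sup>* `` {x}"
 then have "(x, y) \<in> SE\<^sup>*" by blast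
 then show "y \<in> VV" by induction (use x SE_sub in blast)+
qed

lemma mult_eq: "ubp_mult d d' = (\<lambda>x. outer_pos -` (SE\<^sup>* `` {x})) ` VV - {{}}"
 unfolding ubp_mult_def Field_SE quotient_def by blast

lemma class_eq: assumes "y \<in> SE\<^sup>* `` {x}" shows "SE\<^sup>* `` {x} = SE\<^sup>* `` {y}"
 using assms sym_r by (blast intro: rtrancl_trans)

lemma outer_VV: "outer_pos v \<in> VV \<longleftrightarrow> v \<in> {1..k} <+> {1..k}"
 by (cases v) (auto simp: outer_pos_def)

lemma blk_char: assumes "B \<in> ubp_mult d d'" "v \<in> B"
 shows "B = outer_pos -` (SE\<^sup>* `` {outer_pos v})"
proof -
 have "B \<in> (\<lambda>x. outer_pos -` (SE\<^sup>* `` {x})) ` VV" using assms(1) unfolding mult_eq by (rule DiffD1)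
 then obtain x where x: "B = outer_pos -` (SE\<^sup>* `` {x})" by (rule imageE)
 have "outer_pos v \<in> SE\<^sup>* `` {x}" using assms(2) unfolding x by (rule vimageD)
 then show ?thesis unfolding x by (rule arg_cong[OF class_eq])
qed

lemma mult_partition: "partition_on ({1..k} <+> {1..k}) (ubp_mult d d')"
proof (rule partition_onI)
 show "{} \<notin> ubp_mult d d'" by (simp add: mult_eq)
 show "disjnt B B'" if B: "B \<in> ubp_mult d d'" "B' \<in> ubp_mult d d'" "B \<noteq> B'" for B B'
 proof (rule ccontr)
  assume "\<not> disjnt B B'"
  then obtain v where v: "v \<in> B" "v \<in> B'" by (auto simp: disjnt_def)
  from trans[OF blk_char[OF B(1) v(1)] sym[OF blk_char[OF B(2) v(2)]]] show False using B(3) by contradiction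
 qed
 show "\<Union>(ubp_mult d d') = {1..k} <+> {1..k}"
 proof (rule subset_antisym; rule subsetI)
  fix v assume "v \<in> \<Union>(ubp_mult d d')"
  then obtain B where B: "B \<in> (\<lambda>x. outer_pos -` (SE\<^sup>* `` {x})) ` VV" "v \<in> B" unfolding mult_eq by (meson DiffD1 UnionE)
  from B(1) obtain x where "B = outer_pos -` (SE\<^sup>* `` {x})" "x \<in> VV" by (rule imageE)
  then have x: "x \<in> VV" "outer_pos v \<in> SE\<^sup>* `` {x}" using vimageD[of v outer_pos] B(2) by (simp_all only:)
  then have "outer_pos v \<in> VV" using class_sub[OF x(1)] by blast
  then show "v \<in> {1..k} <+> {1..k}" by (rule outer_VV[THEN iffD1])
 next
  fix v :: "nat + nat" assume "v \<in> {1..k} <+> {1..k}"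
  then have "outer_pos v \<in> VV" by (rule outer_VV[THEN iffD2])
  moreover have "v \<in> outer_pos -` (SE\<^sup>* `` {outer_pos v})" by simp
  ultimately have "outer_pos -` (SE\<^sup>* `` {outer_pos v}) \<in> ubp_mult d d'" unfolding mult_eq by (intro DiffI imageI) auto
  then show "v \<in> \<Union>(ubp_mult d d')" by (rule UnionI) simp
 qed
qed

text \<open>Let \<open>U\<close> be the union of the components that meet \<open>P\<close> in the top row or \<open>S\<close> in the bottom row of the stack.
  The vertices of \<open>U\<close> in the middle row form the required set.\<close>

lemma Rd_mult_1: assumes "(P, S) \<in> Rd (ubp_mult d d')" shows "\<exists>Q. (P, Q) \<in> Rd d \<and> (Q, S) \<in> Rd d'"
proof -
 have st: "sat (ubp_mult d d') (P <+> S)" using assms by (simp add: Rd_def)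
 note s = st[unfolded sat_iff[OF mult_partition]]
 define U where "U = SE\<^sup>* `` (outer_pos ` (P <+> S))"
 have outU: "outer_pos v \<in> U \<longleftrightarrow> v \<in> P <+> S" for v
 proof
  assume "outer_pos v \<in> U"
  then obtain u where u: "u \<in> P <+> S" "(outer_pos u, outer_pos v) \<in> SE\<^sup>*" unfolding U_def by blast
  have "u \<in> {1..k} <+> {1..k}" using s u(1) by (rule subsetD[OF conjunct1])
  then have "u \<in> \<Union>(ubp_mult d d')" using partition_onD1[OF mult_partition] by simp
  then obtain B where B: "B \<in> ubp_mult d d'" "u \<in> B" by (rule UnionE)
  have "v \<in> outer_pos -` (SE\<^sup>* `` {outer_pos u})" using u(2) by simp
  then have "v \<in> B" unfolding blk_char[OF B, symmetric] .
  then show "v \<in> P <+> S" using s B u(1) by blast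
 qed (auto simp: U_def)
 have Ucl: "y \<in> U" if "x \<in> U" "(x, y) \<in> SE" for x y
  using that unfolding U_def by (blast intro: rtrancl_into_rtrancl)
 have UV: "U \<subseteq> VV"
 proof
  fix y assume "y \<in> U"
  then obtain u where u: "u \<in> P <+> S" "y \<in> SE\<^sup>* `` {outer_pos u}" unfolding U_def by blast
  have "u \<in> {1..k} <+> {1..k}" using s u(1) by (rule subsetD[OF conjunct1])
  then have "outer_pos u \<in> VV" by (rule outer_VV[THEN iffD2])
  from class_sub[OF this] u(2) show "y \<in> VV" by (rule subsetD)
 qed
 define Q where "Q = {i. (1, i) \<in> U}"
 have up: "upper_pos v \<in> U \<longleftrightarrow> v \<in> P <+> Q" for v
 proof (cases v)
  case (Inl i)
  have "upper_pos (Inl i) = outer_pos (Inl i)" by (simp add: upper_pos_def outer_pos_def)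
  then show ?thesis using outU[of "Inl i"] Inl by auto
 qed (auto simp: upper_pos_def Q_def)
 have lo: "lower_pos v \<in> U \<longleftrightarrow> v \<in> Q <+> S" for v
 proof (cases v)
  case (Inr i)
  have "lower_pos (Inr i) = outer_pos (Inr i)" by (simp add: lower_pos_def outer_pos_def)
  then show ?thesis using outU[of "Inr i"] Inr by auto
 qed (auto simp: lower_pos_def Q_def)
 have PS: "P \<subseteq> {1..k}" "S \<subseteq> {1..k}" using conjunct1[OF s] by (simp_all only: Plus_sub)
 have Qk: "Q \<subseteq> {1..k}" using UV by (auto simp: Q_def)
 have "sat d (P <+> Q)"
  unfolding sat_iff[OF ubpD(1)[OF d]]
 proof (intro conjI ballI)
  show "P <+> Q \<subseteq> {1..k} <+> {1..k}" using PS Qk by (simp only: Plus_sub)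
  fix B assume B: "B \<in> d"
  have "v' \<in> P <+> Q" if "v \<in> B" "v' \<in> B" "v \<in> P <+> Q" for v v'
  proof -
   have "(upper_pos v, upper_pos v') \<in> SE" using B that unfolding stack_edges_def by blast
   then show ?thesis using Ucl up that by blast
  qed
  then show "B \<subseteq> P <+> Q \<or> B \<inter> (P <+> Q) = {}" by blast
 qed
 moreover have "sat d' (Q <+> S)"
  unfolding sat_iff[OF ubpD(1)[OF d']]
 proof (intro conjI ballI)
  show "Q <+> S \<subseteq> {1..k} <+> {1..k}" using PS Qk by (simp only: Plus_sub)
  fix B assume B: "B \<in> d'"
  have "v' \<in> Q <+> S" if "v \<in> B" "v' \<in> B" "v \<in> Q <+> S" for v v'
  proof -
   have "(lower_pos v, lower_pos v') \<in> SE" using B that unfolding stack_edges_def by blast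
   then show ?thesis using Ucl lo that by blast
  qed
  then show "B \<subseteq> Q <+> S \<or> B \<inter> (Q <+> S) = {}" by blast
 qed
 ultimately show ?thesis unfolding Rd_def by blast
qed

text \<open>The union of both saturated sets is closed under the edges of the stack, hence is a union of components.\<close>

lemma Rd_mult_2: assumes "(P, Q) \<in> Rd d" "(Q, S) \<in> Rd d'" shows "(P, S) \<in> Rd (ubp_mult d d')"
proof -
 have s1: "sat d (P <+> Q)" and s2: "sat d' (Q <+> S)" using assms by (auto simp: Rd_def)
 note t1 = s1[unfolded sat_iff[OF ubpD(1)[OF d]]] and t2 = s2[unfolded sat_iff[OF ubpD(1)[OF d']]]
 define U where "U = upper_pos ` (P <+> Q) \<union> lower_pos ` (Q <+> S)"
 have up: "upper_pos v \<in> U \<longleftrightarrow> v \<in> P <+> Q" for v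
  by (cases v) (auto simp: U_def upper_pos_def lower_pos_def image_iff Bex_def)
 have lo: "lower_pos v \<in> U \<longleftrightarrow> v \<in> Q <+> S" for v
  by (cases v) (auto simp: U_def upper_pos_def lower_pos_def image_iff Bex_def)
 have ou: "outer_pos v \<in> U \<longleftrightarrow> v \<in> P <+> S" for v
  by (cases v) (auto simp: U_def upper_pos_def lower_pos_def outer_pos_def image_iff Bex_def)
 have cl: "y \<in> U" if "(x, y) \<in> SE" "x \<in> U" for x y
 proof -
  from that(1) consider B v v' where "B \<in> d" "v \<in> B" "v' \<in> B" "x = upper_pos v" "y = upper_pos v'"
   | B v v' where "B \<in> d'" "v \<in> B" "v' \<in> B" "x = lower_pos v" "y = lower_pos v'"
   unfolding stack_edges_def by blast
  then show ?thesis
  proof cases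
   case 1
   then show ?thesis using that(2) up t1 by blast
  next
   case 2
   then show ?thesis using that(2) lo t2 by blast
  qed
 qed
 have cl': "y \<in> U" if "(x, y) \<in> SE\<^sup>*" "x \<in> U" for x y
  using that by induction (use cl in blast)+
 have "sat (ubp_mult d d') (P <+> S)"
  unfolding sat_iff[OF mult_partition]
 proof (intro conjI ballI)
  show "P <+> S \<subseteq> {1..k} <+> {1..k}" using conjunct1[OF t1] conjunct1[OF t2] by (simp only: Plus_sub)
  fix B assume B: "B \<in> ubp_mult d d'"
  have "v' \<in> P <+> S" if "v \<in> B" "v' \<in> B" "v \<in> P <+> S" for v v'
  proof -
   have "v' \<in> outer_pos -` (SE\<^sup>* `` {outer_pos v})" using that(2) unfolding blk_char[OF B that(1), symmetric] .
   then have "(outer_pos v, outer_pos v') \<in> SE\<^sup>*" by simp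
   then show ?thesis using cl' ou that(3) by blast
  qed
  then show "B \<subseteq> P <+> S \<or> B \<inter> (P <+> S) = {}" by blast
 qed
 then show ?thesis by (simp add: Rd_def)
qed

lemma Rd_mult: "Rd (ubp_mult d d') = Rd d O Rd d'"
proof (rule subset_antisym)
 show "Rd (ubp_mult d d') \<subseteq> Rd d O Rd d'" using Rd_mult_1 by fast
 show "Rd d O Rd d' \<subseteq> Rd (ubp_mult d d')" using Rd_mult_2 by fast
qed

lemma ubp_mult_closed: "ubp_mult d d' \<in> ubp k"
 unfolding ubp_def
proof (intro CollectI conjI ballI)
 show "partition_on ({1..k} <+> {1..k}) (ubp_mult d d')" by (rule mult_partition)
 fix B assume "B \<in> ubp_mult d d'"
 then have "(Inl -` B, Inr -` B) \<in> Rd (ubp_mult d d')" using sat_block by (simp add: Rd_def Plus_eq)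
 then obtain Q where "(Inl -` B, Q) \<in> Rd d" "(Q, Inr -` B) \<in> Rd d'" using Rd_mult_1 by blast
 then show "card (Inl -` B) = card (Inr -` B)" using Rd_card[OF d] Rd_card[OF d'] by metis
qed

end

text \<open>The diagram with top \<open>\<rho>\<close> and top-to-bottom map \<open>\<phi>\<close>; each diagram has this form (\<open>ubp_diag\<close>).\<close>

definition diag :: "nat set set => (nat set => nat set) => diagram" where
 "diag \<rho> \<phi> = (\<lambda>A. A <+> \<phi> A) ` \<rho>"

lemma diag_ubp:
 assumes \<rho>: "partition_on {1..k} \<rho>" and \<rho>': "partition_on {1..k} \<rho>'" and b: "bij_betw \<phi> \<rho> \<rho>'"
  and c: "\<And>A. A \<in> \<rho> ==> card (\<phi> A) = card A"
 shows "diag \<rho> \<phi> \<in> ubp k" "ubp_top (diag \<rho> \<phi>) = \<rho>" "ubp_bot (diag \<rho> \<phi>) = \<rho>'"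
  "\<And>A. A \<in> \<rho> ==> block_map (diag \<rho> \<phi>) A = \<phi> A"
proof -
 have im: "\<phi> ` \<rho> = \<rho>'" and inj: "inj_on \<phi> \<rho>" using b by (auto simp: bij_betw_def)
 show "diag \<rho> \<phi> \<in> ubp k"
  unfolding ubp_def
 proof (intro CollectI conjI ballI partition_onI)
  have "\<Union>(diag \<rho> \<phi>) = \<Union>\<rho> <+> \<Union>(\<phi> ` \<rho>)" unfolding diag_def using Plus_Union[of "\<lambda>A. A" \<phi> \<rho>] by simp
  then show "\<Union>(diag \<rho> \<phi>) = {1..k} <+> {1..k}" using partition_onD1[OF \<rho>] partition_onD1[OF \<rho>'] im by simp
  show "{} \<notin> diag \<rho> \<phi>"
  proof
   assume "{} \<in> diag \<rho> \<phi>"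
   then obtain A where A: "{} = A <+> \<phi> A" "A \<in> \<rho>" unfolding diag_def by (rule imageE)
   from arg_cong[OF A(1), of "vimage Inl"] have "A = {}" by simp
   then show False using A(2) partition_onD3[OF \<rho>] by simp
  qed
  fix p q assume "p \<in> diag \<rho> \<phi>" "q \<in> diag \<rho> \<phi>" "p \<noteq> q"
  then obtain A A' where A: "A \<in> \<rho>" "A' \<in> \<rho>" "p = A <+> \<phi> A" "q = A' <+> \<phi> A'" "A \<noteq> A'" by (auto simp: diag_def)
  have "A \<inter> A' = {}" using partition_onD2[OF \<rho>] A by (meson disjointD)
  moreover have "\<phi> A \<noteq> \<phi> A'" using inj A by (meson inj_onD)
  then have "\<phi> A \<inter> \<phi> A' = {}" using partition_onD2[OF \<rho>'] A im by (meson disjointD imageI)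
  ultimately show "disjnt p q" using A by (auto simp: disjnt_def)
 next
  fix B assume "B \<in> diag \<rho> \<phi>"
  then show "card (Inl -` B) = card (Inr -` B)" using c by (auto simp: diag_def)
 qed
 show "ubp_top (diag \<rho> \<phi>) = \<rho>" by (simp add: ubp_top_def diag_def image_image)
 show "ubp_bot (diag \<rho> \<phi>) = \<rho>'" using im by (simp add: ubp_bot_def diag_def image_image)
 show "block_map (diag \<rho> \<phi>) A = \<phi> A" if "A \<in> \<rho>" for A
  unfolding block_map_def
 proof (rule the_equality)
  show "A <+> \<phi> A \<in> diag \<rho> \<phi>" using that by (simp add: diag_def)
  fix C assume "A <+> C \<in> diag \<rho> \<phi>"
  then obtain A' where "A <+> C = A' <+> \<phi> A'" unfolding diag_def by (rule imageE)
  then show "C = \<phi> A" by (simp add: Plus_inj)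
 qed
qed

lemma ubp_diag:
 assumes d: "d \<in> ubp k"
 shows "partition_on {1..k} (ubp_top d)" "partition_on {1..k} (ubp_bot d)"
  "bij_betw (block_map d) (ubp_top d) (ubp_bot d)"
  "\<And>A. A \<in> ubp_top d ==> card (block_map d A) = card A"
  "diag (ubp_top d) (block_map d) = d"
  "\<And>A. A \<in> ubp_top d ==> (A, block_map d A) \<in> Rd d"
  "\<And>B. B \<in> d ==> block_map d (Inl -` B) = Inr -` B"
proof -
 note p = ubpD(1)[OF d]
 have R: "(Inl -` B, Inr -` B) \<in> Rd d" if "B \<in> d" for B using sat_block[OF that] by (simp add: Rd_def Plus_eq)
 have sub: "Inl -` B \<subseteq> {1..k}" "Inr -` B \<subseteq> {1..k}" if "B \<in> d" for B using Rd_sub[OF d R[OF that]] by auto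
 have fin: "finite (Inl -` B)" "finite (Inr -` B)" if "B \<in> d" for B using sub[OF that] finite_subset by blast+
 have ne: "Inl -` B \<noteq> {}" "Inr -` B \<noteq> {}" if B: "B \<in> d" for B
 proof -
  have "B \<noteq> {}" using partition_onD3[OF p] B by blast
  then have "\<not> (Inl -` B = {} \<and> Inr -` B = {})" using Plus_eq[of B] by auto
  moreover have "Inl -` B = {} \<longleftrightarrow> Inr -` B = {}" using ubpD(2)[OF d B] fin[OF B] by (metis card_0_eq)
  ultimately show "Inl -` B \<noteq> {}" "Inr -` B \<noteq> {}" by auto
 qed
 have dj: "B \<inter> B' = {}" if "B \<in> d" "B' \<in> d" "B \<noteq> B'" for B B'
  using partition_onD2[OF p] that by (meson disjointD)
 have injL: "B = B'" if B: "B \<in> d" "B' \<in> d" "Inl -` B = Inl -` B'" for B B'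
 proof (rule ccontr)
  assume "B \<noteq> B'"
  then have "Inl -` B \<inter> Inl -` B' = {}" using dj[OF B(1,2)] by blast
  then show False using ne(1) B by simp
 qed
 have injR: "B = B'" if B: "B \<in> d" "B' \<in> d" "Inr -` B = Inr -` B'" for B B'
 proof (rule ccontr)
  assume "B \<noteq> B'"
  then have "Inr -` B \<inter> Inr -` B' = {}" using dj[OF B(1,2)] by blast
  then show False using ne(2) B by simp
 qed
 show pt: "partition_on {1..k} (ubp_top d)"
 proof (rule partition_onI)
  have "\<Union>(ubp_top d) = Inl -` \<Union>d" by (auto simp: ubp_top_def)
  then show "\<Union>(ubp_top d) = {1..k}" unfolding partition_onD1[OF p, symmetric] by simp
  show "{} \<notin> ubp_top d" using ne by (auto simp: ubp_top_def)
  show "disjnt A A'" if "A \<in> ubp_top d" "A' \<in> ubp_top d" "A \<noteq> A'" for A A'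
   using that dj unfolding ubp_top_def disjnt_def by blast
 qed
 show pb: "partition_on {1..k} (ubp_bot d)"
 proof (rule partition_onI)
  have "\<Union>(ubp_bot d) = Inr -` \<Union>d" by (auto simp: ubp_bot_def)
  then show "\<Union>(ubp_bot d) = {1..k}" unfolding partition_onD1[OF p, symmetric] by simp
  show "{} \<notin> ubp_bot d" using ne by (auto simp: ubp_bot_def)
  show "disjnt A A'" if "A \<in> ubp_bot d" "A' \<in> ubp_bot d" "A \<noteq> A'" for A A'
   using that dj unfolding ubp_bot_def disjnt_def by blast
 qed
 show bm: "block_map d (Inl -` B) = Inr -` B" if B: "B \<in> d" for B
  unfolding block_map_def
 proof (rule the_equality)
  show "Inl -` B <+> Inr -` B \<in> d" using B by (simp add: Plus_eq)
  fix C assume C: "Inl -` B <+> C \<in> d"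
  have "Inl -` B <+> C = B" using injL[OF C B] by simp
  then show "C = Inr -` B" by (metis Plus_vimage(2))
 qed
 show "bij_betw (block_map d) (ubp_top d) (ubp_bot d)"
  unfolding bij_betw_def
 proof
  show "block_map d ` ubp_top d = ubp_bot d" unfolding ubp_top_def ubp_bot_def image_image by (intro image_cong refl bm)
  show "inj_on (block_map d) (ubp_top d)"
  proof (rule inj_onI)
   fix A A' assume "A \<in> ubp_top d" "A' \<in> ubp_top d" and e: "block_map d A = block_map d A'"
   then obtain B B' where B: "B \<in> d" "B' \<in> d" "A = Inl -` B" "A' = Inl -` B'" by (auto simp: ubp_top_def)
   then show "A = A'" using e bm injR[OF B(1,2)] by simp
  qed
 qed
 show "card (block_map d A) = card A" if "A \<in> ubp_top d" for A
  using that bm ubpD(2)[OF d] by (auto simp: ubp_top_def)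
 show "diag (ubp_top d) (block_map d) = d"
  unfolding diag_def ubp_top_def image_image using bm by (simp add: Plus_eq cong: image_cong)
 show "(A, block_map d A) \<in> Rd d" if "A \<in> ubp_top d" for A
  using that bm R by (auto simp: ubp_top_def)
qed

lemma Rd_top:
 assumes d: "d \<in> ubp k" and r: "(P, Q) \<in> Rd d"
 shows "\<exists>\<sigma>\<subseteq>ubp_top d. P = \<Union>\<sigma> \<and> Q = \<Union>(block_map d ` \<sigma>)"
proof -
 obtain D where D: "D \<subseteq> d" "P <+> Q = \<Union>D" using r by (auto simp: Rd_def sat_def)
 let ?s = "(\<lambda>B. Inl -` B) ` D"
 have "P = \<Union>?s" using D(2) by (metis Plus_vimage(1) vimage_Union)
 moreover have "Q = \<Union>(block_map d ` ?s)"
 proof -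
  have "block_map d ` ?s = (\<lambda>B. Inr -` B) ` D" unfolding image_image using ubp_diag(7)[OF d] D(1) by (intro image_cong) auto
  then show ?thesis using D(2) by (metis Plus_vimage(2) vimage_Union)
 qed
 moreover have "?s \<subseteq> ubp_top d" using D(1) by (auto simp: ubp_top_def)
 ultimately show ?thesis by blast
qed

lemma Rd_bot:
 assumes d: "d \<in> ubp k" and C: "C \<in> ubp_bot d"
 shows "\<exists>A\<in>ubp_top d. block_map d A = C \<and> (A, C) \<in> Rd d"
proof -
 have "C \<in> block_map d ` ubp_top d" using C ubp_diag(3)[OF d] by (simp add: bij_betw_def)
 then obtain A where A: "C = block_map d A" "A \<in> ubp_top d" by (rule imageE)
 then show ?thesis using ubp_diag(6)[OF d A(2)] by (intro bexI[of _ A]) simp_all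
qed

text \<open>If the parts of a set partition \<open>\<rho>\<close> are mapped by \<open>d\<close> onto the parts of the top of \<open>d'\<close>, nothing gets merged
  further, and the product is the composition of the two maps.\<close>

lemma mult_diag:
 assumes d: "d \<in> ubp k" and d': "d' \<in> ubp k" and \<rho>: "partition_on {1..k} \<rho>"
  and \<tau>: "\<And>A. A \<in> \<rho> ==> (A, \<tau> A) \<in> Rd d" and im: "\<tau> ` \<rho> = ubp_top d'"
 shows "ubp_mult d d' = diag \<rho> (\<lambda>A. block_map d' (\<tau> A))"
proof -
 let ?f = "\<lambda>A. block_map d' (\<tau> A)"
 note u' = ubp_diag[OF d']
 have injt: "inj_on \<tau> \<rho>" using Rd_inv[OF d] \<tau> by (intro inj_onI) metis
 have b: "bij_betw ?f \<rho> (ubp_bot d')"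
  using bij_betw_trans[of \<tau> \<rho> "ubp_top d'" "block_map d'"] injt im u'(3) by (simp add: bij_betw_def comp_def)
 have c: "card (?f A) = card A" if "A \<in> \<rho>" for A
  using u'(4)[of "\<tau> A"] Rd_card[OF d \<tau>[OF that]] im that by auto
 have D: "diag \<rho> ?f \<in> ubp k" "ubp_top (diag \<rho> ?f) = \<rho>" "\<And>A. A \<in> \<rho> ==> block_map (diag \<rho> ?f) A = ?f A"
  using diag_ubp[OF \<rho> u'(2) b] c by blast+
 show ?thesis
 proof (rule Rd_inj[OF ubp_mult_closed[OF d d'] D(1)], rule subset_antisym)
  show "Rd (ubp_mult d d') \<subseteq> Rd (diag \<rho> ?f)"
  proof (rule subrelI)
   fix P S assume "(P, S) \<in> Rd (ubp_mult d d')"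
   then obtain Q where Q: "(P, Q) \<in> Rd d" "(Q, S) \<in> Rd d'" using Rd_mult_1[OF d d'] by blast
   obtain s' where s': "s' \<subseteq> ubp_top d'" "Q = \<Union>s'" "S = \<Union>(block_map d' ` s')" using Rd_top[OF d' Q(2)] by blast
   define s where "s = {A \<in> \<rho>. \<tau> A \<in> s'}"
   have "s' \<subseteq> \<tau> ` \<rho>" using s'(1) im by simp
   then have ts: "\<tau> ` s = s'" unfolding s_def by blast
   have "(\<Union>((\<lambda>A. A) ` s), \<Union>(\<tau> ` s)) \<in> Rd d" by (rule Rd_Union) (simp add: s_def \<tau>)
   then have "(\<Union>s, Q) \<in> Rd d" using ts s' by simp
   then have P: "P = \<Union>s" using Rd_inv[OF d Q(1)] by blast
   have "(\<Union>((\<lambda>A. A) ` s), \<Union>(?f ` s)) \<in> Rd (diag \<rho> ?f)"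
   proof (rule Rd_Union)
    fix A assume "A \<in> s"
    then show "(A, ?f A) \<in> Rd (diag \<rho> ?f)" by (auto simp: s_def Rd_def diag_def intro!: sat_block)
   qed
   moreover have "?f ` s = block_map d' ` s'" using ts by (auto simp: image_image[symmetric])
   ultimately show "(P, S) \<in> Rd (diag \<rho> ?f)" using P s'(3) by simp
  qed
  show "Rd (diag \<rho> ?f) \<subseteq> Rd (ubp_mult d d')"
  proof (rule subrelI)
   fix P S assume "(P, S) \<in> Rd (diag \<rho> ?f)"
   from Rd_top[OF D(1) this] obtain s where s0: "s \<subseteq> ubp_top (diag \<rho> ?f)" "P = \<Union>s" "S = \<Union>(block_map (diag \<rho> ?f) ` s)" by blast
   have s1: "s \<subseteq> \<rho>" using s0(1) by (simp only: D(2))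
   have "block_map (diag \<rho> ?f) ` s = ?f ` s" by (rule image_cong[OF refl D(3)]) (rule subsetD[OF s1])
   then have s: "s \<subseteq> \<rho>" "P = \<Union>s" "S = \<Union>(?f ` s)" using s0 s1 by (simp_all only:)
   have "(\<Union>((\<lambda>A. A) ` s), \<Union>(\<tau> ` s)) \<in> Rd d" by (rule Rd_Union) (use s \<tau> in auto)
   moreover have "(\<Union>(\<tau> ` s), \<Union>(?f ` s)) \<in> Rd d'"
   proof (rule Rd_Union)
    fix A assume "A \<in> s"
    then show "(\<tau> A, ?f A) \<in> Rd d'" using u'(6) im s(1) by blast
   qed
   ultimately show "(P, S) \<in> Rd (ubp_mult d d')" using Rd_mult_2[OF d d'] s by simp
  qed
 qed
qed

lemma diag_cong: "(\<And>A. A \<in> \<rho> ==> \<phi> A = \<phi>' A) ==> diag \<rho> \<phi> = diag \<rho> \<phi>'"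
 unfolding diag_def by (rule image_cong) auto

section \<open>Tensor products of Specht modules\<close>

text \<open>Two maps that have corresponding invariant sets have the same permutation characters. The
  hypothesis is a condition on subsets, not on points, so that it also applies to maps \<open>g\<close> that are not
  bijective outside of \<open>X\<close>.\<close>

lemma mchar_reindex:
 assumes "inj_on \<phi> X" "\<And>Z. Z \<subseteq> X ==> h ` \<phi> ` Z = \<phi> ` Z \<longleftrightarrow> g ` Z = Z"
 shows "mchar as (\<phi> ` X) h = mchar as X g"
 using assms
proof (induction as arbitrary: X)
 case (Cons a as)
 let ?I = "\<lambda>X g. {Z. Z \<subseteq> X \<and> g ` Z = Z \<and> int (card Z) = a}"
 have crd: "card (\<phi> ` Z) = card Z" if "Z \<subseteq> X" for Z
  using Cons.prems(1) that by (intro card_image) (rule inj_on_subset)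
 have bij: "bij_betw (\<lambda>Z. \<phi> ` Z) (?I X g) (?I (\<phi> ` X) h)"
 proof (rule bij_betwI')
  fix Z Z' assume "Z \<in> ?I X g" "Z' \<in> ?I X g"
  then show "(\<phi> ` Z = \<phi> ` Z') = (Z = Z')" using inj_on_image_eq_iff[OF Cons.prems(1), of Z Z'] by blast
 next
  fix Z assume Z: "Z \<in> ?I X g"
  then have "Z \<subseteq> X" "g ` Z = Z" "int (card Z) = a" by blast+
  then show "\<phi> ` Z \<in> ?I (\<phi> ` X) h" using Cons.prems(2)[of Z] crd[of Z] by (simp add: image_mono)
 next
  fix W assume "W \<in> ?I (\<phi> ` X) h"
  then have W: "W \<subseteq> \<phi> ` X" "h ` W = W" "int (card W) = a" by blast+
  obtain Z where Z: "Z \<subseteq> X" "W = \<phi> ` Z" using W(1) by (auto simp: subset_image_iff)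
  have "g ` Z = Z" using Cons.prems(2)[OF Z(1)] W(2) unfolding Z(2) by blast
  then have "Z \<in> ?I X g" using Z W(3) crd[OF Z(1)] by simp
  then show "\<exists>Z\<in>?I X g. W = \<phi> ` Z" using Z(2) by (rule bexI[rotated])
 qed
 have "mchar (a # as) (\<phi> ` X) h = (\<Sum>Z\<in>?I X g. mchar as (\<phi> ` X - \<phi> ` Z) h)"
  unfolding mchar.simps by (rule sum.reindex_bij_betw[OF bij, symmetric])
 also have "... = (\<Sum>Z\<in>?I X g. mchar as (X - Z) g)"
 proof (intro sum.cong refl)
  fix Z assume Z: "Z \<in> ?I X g"
  have "\<phi> ` X - \<phi> ` Z = \<phi> ` (X - Z)" using Z Cons.prems(1) inj_on_image_set_diff[of \<phi> X X Z] by blast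
  moreover have "mchar as (\<phi> ` (X - Z)) h = mchar as (X - Z) g"
  proof (rule Cons.IH)
   show "inj_on \<phi> (X - Z)" using Cons.prems(1) by (rule inj_on_diff)
   fix Z' assume "Z' \<subseteq> X - Z"
   then have "Z' \<subseteq> X" by blast
   then show "(h ` \<phi> ` Z' = \<phi> ` Z') = (g ` Z' = Z')" by (rule Cons.prems(2))
  qed
  ultimately show "mchar as (\<phi> ` X - \<phi> ` Z) h = mchar as (X - Z) g" by simp
 qed
 finally show ?case by simp
qed simp

lemma psi'_reindex:
 assumes "inj_on \<phi> X" "\<And>Z. Z \<subseteq> X ==> h ` \<phi> ` Z = \<phi> ` Z \<longleftrightarrow> g ` Z = Z"
 shows "psi' \<alpha> (\<phi> ` X) h = psi' \<alpha> X g"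
 unfolding psi'_eq by (intro sum.cong refl arg_cong2[of _ _ _ _ "(*)"] mchar_reindex assms)

text \<open>All terms of the determinant ask for blocks of total size \<open>\<Sum>\<^sub># \<alpha>\<close>.\<close>

lemma psi'_zero: assumes "finite X" "card X \<noteq> \<Sum>\<^sub># \<alpha>" shows "psi' \<alpha> X g = 0"
 unfolding psi'_eq
proof (intro sum.neutral ballI)
 let ?l = "length (parts \<alpha>)"
 fix w assume "w \<in> {w. w permutes {0..<?l}}"
 then have w: "w permutes {0..<?l}" by simp
 have s0: "(\<Sum>i = 0..<?l. int (w i)) = (\<Sum>i = 0..<?l. int i)"
  using sum.permute[OF w, of int] by (simp add: comp_def)
 have "sum_list (map (\<lambda>i. int (parts \<alpha> ! i) - int i + int (w i)) [0..<?l]) = (\<Sum>j = 0..<?l. int (parts \<alpha> ! j) - int j + int (w j))"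
  by (simp add: interv_sum_list_conv_sum_set_nat)
 also have "... = int (\<Sum>j = 0..<?l. parts \<alpha> ! j)" using s0 by (simp add: sum.distrib sum_subtractf)
 also have "(\<Sum>j = 0..<?l. parts \<alpha> ! j) = \<Sum>\<^sub># \<alpha>" by (simp only: sum_parts[symmetric] sum_list_sum_nth)
 finally have "sum_list (map (\<lambda>i. int (parts \<alpha> ! i) - int i + int (w i)) [0..<?l]) = int (\<Sum>\<^sub># \<alpha>)" .
 then have "mchar (map (\<lambda>i. int (parts \<alpha> ! i) - int i + int (w i)) [0..<?l]) X g = 0"
  by (intro mchar_zero[OF assms(1)]) (use assms(2) in "simp only: of_nat_eq_iff not_False_eq_True")
 then show "sign w * mchar (map (\<lambda>i. int (parts \<alpha> ! i) - int i + int (w i)) [0..<?l]) X g = 0" by simp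
qed

lemma smul_basis: "smul c (basis_vec x) = Poly_Mapping.single x c"
 by (rule poly_mapping_eqI) (simp add: lookup_single when_def)

lemma tensor_basis: "tensor (basis_vec l) v = lin_ext (\<lambda>y. basis_vec (l, y)) v"
 unfolding tensor_def lin_ext_def by (simp add: smul_basis)

lemma lin_tensor: "lin (tensor (basis_vec l))"
proof -
 have "tensor (basis_vec l) = lin_ext (\<lambda>y. basis_vec (l, y))" by (rule ext) (rule tensor_basis)
 then show ?thesis using lin_lin_ext by metis
qed

lemma tensor_basis_basis [simp]: "tensor (basis_vec l) (basis_vec T) = basis_vec (l, T)"
 unfolding tensor_basis by simp

lemma lookup_tensor_fam:
 "lookup (tensor_fam k v) T = (if T \<in> extensional {1..k} then \<Prod>i=1..k. lookup (v i) (T i) else 0)"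
proof -
 let ?P = "Pi\<^sub>E {1..k} (\<lambda>i. keys (v i))"
 let ?c = "\<Prod>i=1..k. lookup (v i) (T i)"
 have fP: "finite ?P" by (intro finite_PiE) auto
 have "lookup (tensor_fam k v) T = (\<Sum>T'\<in>?P. if T' = T then ?c else 0)"
  unfolding tensor_fam_def lookup_sum by (intro sum.cong refl) (simp add: lookup_single when_def)
 also have "... = (if T \<in> ?P then ?c else 0)" using fP by simp
 also have "... = (if T \<in> extensional {1..k} then ?c else 0)"
 proof (cases "T \<in> extensional {1..k} \<and> T \<notin> ?P")
  case True
  then obtain i where "i \<in> {1..k}" "T i \<notin> keys (v i)" by (auto simp: PiE_def Pi_def)
  then have "?c = 0" by (intro prod_zero) (auto simp: in_keys_iff)
  then show ?thesis by simp
 qed (auto simp: PiE_def)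
 finally show ?thesis .
qed

lemma tensor_fam_smul: "tensor_fam k v =
  (\<Sum>T\<in>Pi\<^sub>E {1..k} (\<lambda>i. keys (v i)). smul (\<Prod>i=1..k. lookup (v i) (T i)) (basis_vec T))"
 unfolding tensor_fam_def smul_basis ..

lemma tensor_fam_cong: "(\<And>i. i \<in> {1..k} ==> v i = v' i) ==> tensor_fam k v = tensor_fam k v'"
 by (rule poly_mapping_eqI) (simp add: lookup_tensor_fam)

lemma tensor_fam_multilinear:
 assumes "\<And>i. i \<in> {1..k} ==> finite (A i)"
 shows "tensor_fam k (\<lambda>i. \<Sum>x\<in>A i. smul (c i x) (u i x)) =
  (\<Sum>T\<in>Pi\<^sub>E {1..k} A. smul (\<Prod>i=1..k. c i (T i)) (tensor_fam k (\<lambda>i. u i (T i))))"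
proof (rule poly_mapping_eqI)
 fix S
 show "lookup (tensor_fam k (\<lambda>i. \<Sum>x\<in>A i. smul (c i x) (u i x))) S =
  lookup (\<Sum>T\<in>Pi\<^sub>E {1..k} A. smul (\<Prod>i=1..k. c i (T i)) (tensor_fam k (\<lambda>i. u i (T i)))) S"
 proof (cases "S \<in> extensional {1..k}")
  case True
  have "(\<Prod>i=1..k. \<Sum>x\<in>A i. c i x * lookup (u i x) (S i)) = (\<Sum>T\<in>Pi\<^sub>E {1..k} A. \<Prod>i=1..k. c i (T i) * lookup (u i (T i)) (S i))"
   by (rule prod_sum_PiE) (use assms in auto)
  then show ?thesis using True by (simp add: lookup_tensor_fam lookup_sum prod.distrib)
 qed (simp add: lookup_tensor_fam lookup_sum)
qed

lemma tensor_fam_basis: "tensor_fam k (\<lambda>i. basis_vec (t i)) = basis_vec (restrict t {1..k})"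
proof (rule poly_mapping_eqI)
 fix S
 have "(\<Prod>i=1..k. if t i = S i then 1 else (0::complex)) = (if \<forall>i\<in>{1..k}. t i = S i then 1 else 0)"
  by (auto intro!: prod.neutral prod_zero)
 moreover have "restrict t {1..k} = S \<longleftrightarrow> S \<in> extensional {1..k} \<and> (\<forall>i\<in>{1..k}. t i = S i)"
  by (auto simp: extensional_def restrict_def fun_eq_iff)
 ultimately show "lookup (tensor_fam k (\<lambda>i. basis_vec (t i))) S = lookup (basis_vec (restrict t {1..k})) S"
  by (simp add: lookup_tensor_fam lookup_single when_def)
qed

text \<open>The map \<open>\<gamma>\<close> applied to all entries of a tuple of tabloids; \<open>G_act\<close> is the special case where \<open>\<gamma>\<close> is the
  inverse of the top-to-bottom bijection of a diagram.\<close>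

definition AV :: "nat => ('a => 'a) => ((nat => 'a set list) \<Rightarrow>\<^sub>0 complex) => ((nat => 'a set list) \<Rightarrow>\<^sub>0 complex)" where
 "AV k \<gamma> = lin_ext (\<lambda>T. basis_vec (\<lambda>i\<in>{1..k}. map ((`) \<gamma>) (T i)))"

lemma lin_AV: "lin (AV k \<gamma>)" by (simp add: AV_def lin_lin_ext)

lemma G_act_AV: "G_act k g = AV k (inv_into (ubp_top g) (block_map g))"
 unfolding G_act_def AV_def ..

lemma AV_AV: "AV k \<gamma> (AV k \<gamma>' v) = AV k (\<gamma> \<circ> \<gamma>') v"
proof -
 have im: "(`) \<gamma> \<circ> (`) \<gamma>' = (`) (\<gamma> \<circ> \<gamma>')" by (auto simp: fun_eq_iff)
 have "(\<lambda>v. AV k \<gamma> (AV k \<gamma>' v)) = AV k (\<gamma> \<circ> \<gamma>')"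
 proof (rule lin_eqI[OF lin_comp[OF lin_AV lin_AV] lin_AV])
  fix T
  have "(\<lambda>i\<in>{1..k}. map ((`) \<gamma>) ((\<lambda>i\<in>{1..k}. map ((`) \<gamma>') (T i)) i)) = (\<lambda>i\<in>{1..k}. map ((`) (\<gamma> \<circ> \<gamma>')) (T i))"
   by (rule restrict_ext) (simp add: im)
  then show "AV k \<gamma> (AV k \<gamma>' (basis_vec T)) = AV k (\<gamma> \<circ> \<gamma>') (basis_vec T)"
   by (simp only: AV_def lin_ext_basis)
 qed
 then show ?thesis by metis
qed

lemma AV_tensor_fam: "AV k \<gamma> (tensor_fam k v) = tensor_fam k (\<lambda>i. act \<gamma> (v i))"
proof -
 let ?P = "Pi\<^sub>E {1..k} (\<lambda>i. keys (v i))"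
 have ac: "act \<gamma> (v i) = (\<Sum>x\<in>keys (v i). smul (lookup (v i) x) (basis_vec (map ((`) \<gamma>) x)))" for i
  unfolding act_def lin_ext_def ..
 have "AV k \<gamma> (tensor_fam k v) = (\<Sum>T\<in>?P. smul (\<Prod>i=1..k. lookup (v i) (T i)) (basis_vec (\<lambda>i\<in>{1..k}. map ((`) \<gamma>) (T i))))"
  unfolding tensor_fam_smul lin_sum[OF lin_AV] linD(2)[OF lin_AV] by (simp only: AV_def lin_ext_basis)
 also have "... = (\<Sum>T\<in>?P. smul (\<Prod>i=1..k. lookup (v i) (T i)) (tensor_fam k (\<lambda>i. basis_vec (map ((`) \<gamma>) (T i)))))"
  unfolding tensor_fam_basis ..
 also have "... = tensor_fam k (\<lambda>i. act \<gamma> (v i))"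
  unfolding ac by (rule tensor_fam_multilinear[symmetric]) simp
 finally show ?thesis .
qed

lemma (in shape) specht_span: "specht \<alpha> X \<subseteq> free.span (basis_vec ` OT)"
 unfolding specht_def by (rule free.span_minimal[OF tabs_span free.subspace_span])

lemma (in shape) act_cong:
 assumes "v \<in> specht \<alpha> X" "\<And>x. x \<in> X ==> g x = h x"
 shows "act g v = act h v"
proof (rule lin_eq_on_span[OF lin_act lin_act])
 show "v \<in> free.span (basis_vec ` OT)" using assms(1) specht_span by blast
 fix u :: "'a set list \<Rightarrow>\<^sub>0 complex" assume "u \<in> basis_vec ` OT"
 then obtain T where T: "T \<in> OT" "u = basis_vec T" by blast
 have m: "map ((`) g) T = map ((`) h) T"
 proof (rule map_cong[OF refl])
  fix W assume "W \<in> set T"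
  then have "W \<subseteq> X" by (rule row_sub[OF T(1)])
  then show "g ` W = h ` W" using assms(2) by (intro image_cong) auto
 qed
 show "act g u = act h u" by (simp only: T(2) act_basis m)
qed

text \<open>Dual bases of all the tensor factors. \<open>J\<close> indexes the resulting basis of \<open>V_mod\<close> and \<open>fV\<close> is the dual family.\<close>

locale Vloc =
 fixes k :: nat and \<Lambda> :: "nat => nat multiset" and Bs :: "nat => (nat set set list \<Rightarrow>\<^sub>0 complex) set" and fs
 assumes sb: "\<And>i. i \<in> {1..k} ==> shape_basis (\<Lambda> i) {A \<in> std_pi k \<Lambda>. card A = i} (Bs i) (fs i)"
begin

abbreviation "\<pi> \<equiv> std_pi k \<Lambda>"
definition Xs :: "nat => nat set set" where "Xs i = {A \<in> \<pi>. card A = i}"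
definition J where "J = Pi\<^sub>E {1..k} Bs"
definition fV :: "(nat => (nat set set list \<Rightarrow>\<^sub>0 complex)) => ((nat => nat set set list) \<Rightarrow>\<^sub>0 complex) => complex" where
 "fV b = fun_ext (\<lambda>T. \<Prod>i=1..k. fs i (b i) (basis_vec (T i)))"
definition nice :: "(nat set => nat set) => bool" where
 "nice \<gamma> \<longleftrightarrow> (\<forall>i\<in>{1..k}. bij_betw \<gamma> (Xs i) (Xs i))"

lemma sb': "i \<in> {1..k} ==> shape_basis (\<Lambda> i) (Xs i) (Bs i) (fs i)" using sb by (simp add: Xs_def)
lemma sh: "i \<in> {1..k} ==> shape (\<Lambda> i) (Xs i)" using sb' shape_basis.axioms(1) by blast

lemma linf_fV: "linf (fV b)" by (simp add: fV_def linf_fun_ext)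

lemma finite_J: "finite J" unfolding J_def by (intro finite_PiE) (auto intro: shape_basis.fB[OF sb'])

lemma fV_tensor_fam: "fV b (tensor_fam k v) = (\<Prod>i=1..k. fs i (b i) (v i))"
proof -
 let ?K = "\<lambda>i. keys (v i)"
 have 1: "fs i (b i) (v i) = (\<Sum>x\<in>?K i. lookup (v i) x * fs i (b i) (basis_vec x))" if "i \<in> {1..k}" for i
 proof -
  note lf = shape_basis.lf[OF sb'[OF that]]
  have "fs i (b i) (v i) = fs i (b i) (\<Sum>x\<in>?K i. smul (lookup (v i) x) (basis_vec x))"
   by (rule arg_cong[OF poly_mapping_expand])
  then show ?thesis by (simp only: linf_sum[OF lf] linfD[OF lf])
 qed
 have "fV b (tensor_fam k v) = (\<Sum>T\<in>Pi\<^sub>E {1..k} ?K. (\<Prod>i=1..k. lookup (v i) (T i)) * (\<Prod>i=1..k. fs i (b i) (basis_vec (T i))))"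
  unfolding tensor_fam_smul linf_sum[OF linf_fV] linfD(2)[OF linf_fV] by (simp only: fV_def fun_ext_basis)
 also have "... = (\<Sum>T\<in>Pi\<^sub>E {1..k} ?K. \<Prod>i=1..k. lookup (v i) (T i) * fs i (b i) (basis_vec (T i)))"
  by (simp add: prod.distrib)
 also have "... = (\<Prod>i=1..k. \<Sum>x\<in>?K i. lookup (v i) x * fs i (b i) (basis_vec x))"
  by (rule prod_sum_PiE[symmetric]) auto
 also have "... = (\<Prod>i=1..k. fs i (b i) (v i))" by (intro prod.cong refl) (simp add: 1)
 finally show ?thesis .
qed

definition SV :: "(nat => (nat set set list \<Rightarrow>\<^sub>0 complex)) set" where
 "SV = {v. \<forall>i\<in>{1..k}. v i \<in> specht (\<Lambda> i) (Xs i)}"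

lemma V_mod_eq: "V_mod k \<Lambda> = free.span (tensor_fam k ` SV)"
 by (simp add: V_mod_def SV_def Xs_def)

lemma J_SV: "b \<in> J ==> b \<in> SV"
 unfolding J_def SV_def using shape_basis.BS[OF sb'] by (auto simp: PiE_def Pi_def)

lemma V_tensor: "v \<in> SV ==> tensor_fam k v \<in> V_mod k \<Lambda>"
 unfolding V_mod_eq by (intro free.span_base imageI)

lemma subspace_V: "free.subspace (V_mod k \<Lambda>)" by (simp add: V_mod_eq)

lemma V_expand: assumes "u \<in> V_mod k \<Lambda>" shows "u = (\<Sum>b\<in>J. smul (fV b u) (tensor_fam k b))"
proof (rule lin_eq_on_span[where A = "tensor_fam k ` SV" and f = "\<lambda>u. u"])
 show "lin (\<lambda>u :: (nat => nat set set list) \<Rightarrow>\<^sub>0 complex. u)" by (simp add: lin_def)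
 show "lin (\<lambda>u. \<Sum>b\<in>J. smul (fV b u) (tensor_fam k b))" by (intro lin_sum_fun lin_rank1 linf_fV)
 show "u \<in> free.span (tensor_fam k ` SV)" using assms by (simp add: V_mod_eq)
 fix x assume "x \<in> tensor_fam k ` SV"
 then obtain v where v: "v \<in> SV" "x = tensor_fam k v" by blast
 have "x = tensor_fam k (\<lambda>i. \<Sum>b\<in>Bs i. smul (fs i b (v i)) b)"
  unfolding v(2)
 proof (rule tensor_fam_cong)
  fix i assume i: "i \<in> {1..k}"
  show "v i = (\<Sum>b\<in>Bs i. smul (fs i b (v i)) b)"
   by (rule shape_basis.expand[OF sb'[OF i]]) (use v(1) i in "simp add: SV_def")
 qed
 also have "... = (\<Sum>b\<in>J. smul (\<Prod>i=1..k. fs i (b i) (v i)) (tensor_fam k b))"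
  unfolding J_def by (rule tensor_fam_multilinear) (rule shape_basis.fB[OF sb'])
 finally show "x = (\<Sum>b\<in>J. smul (fV b x) (tensor_fam k b))" unfolding v(2) fV_tensor_fam .
qed

lemma fV_delta: assumes "b \<in> J" "b' \<in> J" shows "fV b (tensor_fam k b') = (if b = b' then 1 else 0)"
proof -
 have "fV b (tensor_fam k b') = (\<Prod>i=1..k. if b i = b' i then 1 else 0)"
  unfolding fV_tensor_fam
 proof (intro prod.cong refl)
  fix i assume i: "i \<in> {1..k}"
  show "fs i (b i) (b' i) = (if b i = b' i then 1 else 0)"
   by (rule shape_basis.delta[OF sb'[OF i]]) (use assms i in "auto simp: J_def")
 qed
 also have "... = (if \<forall>i\<in>{1..k}. b i = b' i then 1 else 0)" by (auto intro!: prod.neutral prod_zero)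
 also have "(\<forall>i\<in>{1..k}. b i = b' i) \<longleftrightarrow> b = b'"
  using PiE_ext[of b "{1..k}" Bs b'] assms unfolding J_def by metis
 finally show ?thesis .
qed

lemma perm_G: assumes "nice \<gamma>" "i \<in> {1..k}"
 shows "perm_restrict \<gamma> (Xs i) \<in> shape.G (Xs i)"
proof -
 have "bij_betw \<gamma> (Xs i) (Xs i)" using assms by (simp add: nice_def)
 then have "bij_betw (perm_restrict \<gamma> (Xs i)) (Xs i) (Xs i)"
  by (subst bij_betw_cong[of _ _ \<gamma>]) (auto simp: perm_restrict_def)
 then have "perm_restrict \<gamma> (Xs i) permutes Xs i"
  by (rule bij_imp_permutes) (simp add: perm_restrict_def)
 then show ?thesis using shape.G_def[OF sh[OF assms(2)]] by simp
qed

lemma act_restrict: assumes "i \<in> {1..k}" "v \<in> specht (\<Lambda> i) (Xs i)"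
 shows "act \<gamma> v = act (perm_restrict \<gamma> (Xs i)) v"
 by (rule shape.act_cong[OF sh[OF assms(1)] assms(2)]) (simp add: perm_restrict_def)

lemma nice_SV: assumes "nice \<gamma>" "v \<in> SV" shows "(\<lambda>i. act \<gamma> (v i)) \<in> SV"
 unfolding SV_def
proof (intro CollectI ballI)
 fix i assume i: "i \<in> {1..k}"
 then have v: "v i \<in> specht (\<Lambda> i) (Xs i)" using assms(2) by (simp add: SV_def)
 show "act \<gamma> (v i) \<in> specht (\<Lambda> i) (Xs i)"
  unfolding act_restrict[OF i v, of \<gamma>] by (rule shape.act_tabs[OF sh[OF i] perm_G[OF assms(1) i] v])
qed

lemma AV_V: assumes "nice \<gamma>" "u \<in> V_mod k \<Lambda>" shows "AV k \<gamma> u \<in> V_mod k \<Lambda>"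
proof (rule lin_span[OF lin_AV subspace_V])
 show "u \<in> free.span (tensor_fam k ` SV)" using assms(2) by (simp add: V_mod_eq)
 fix x assume "x \<in> tensor_fam k ` SV"
 then obtain v where v: "v \<in> SV" "x = tensor_fam k v" by blast
 show "AV k \<gamma> x \<in> V_mod k \<Lambda>" unfolding v(2) AV_tensor_fam by (rule V_tensor[OF nice_SV[OF assms(1) v(1)]])
qed

lemma AV_cong: assumes "\<And>C. C \<in> \<pi> ==> \<gamma> C = \<gamma>' C" "u \<in> V_mod k \<Lambda>" shows "AV k \<gamma> u = AV k \<gamma>' u"
proof (rule lin_eq_on_span[OF lin_AV lin_AV])
 show "u \<in> free.span (tensor_fam k ` SV)" using assms(2) by (simp add: V_mod_eq)
 fix x assume "x \<in> tensor_fam k ` SV"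
 then obtain v where v: "v \<in> SV" "x = tensor_fam k v" by blast
 show "AV k \<gamma> x = AV k \<gamma>' x"
  unfolding v(2) AV_tensor_fam
 proof (rule tensor_fam_cong)
  fix i assume i: "i \<in> {1..k}"
  show "act \<gamma> (v i) = act \<gamma>' (v i)"
   by (rule shape.act_cong[OF sh[OF i]]) (use v(1) i assms(1) in "auto simp: SV_def Xs_def")
 qed
qed

lemma AV_ident: assumes "\<And>C. C \<in> \<pi> ==> \<gamma> C = C" "u \<in> V_mod k \<Lambda>" shows "AV k \<gamma> u = u"
proof -
 have "AV k \<gamma> u = AV k id u" by (rule AV_cong) (use assms in auto)
 also have "AV k id u = u"
 proof (rule lin_eq_on_span[OF lin_AV, where g = "\<lambda>u. u"])
  show "lin (\<lambda>u :: (nat => nat set set list) \<Rightarrow>\<^sub>0 complex. u)" by (simp add: lin_def)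
  show "u \<in> free.span (tensor_fam k ` SV)" using assms(2) by (simp add: V_mod_eq)
  fix x assume "x \<in> tensor_fam k ` SV"
  then obtain v where v: "v \<in> SV" "x = tensor_fam k v" by blast
  show "AV k id x = x" unfolding v(2) AV_tensor_fam act_id ..
 qed
 finally show ?thesis .
qed

text \<open>The trace on a tensor product is the product of the traces, and these are the Specht characters.\<close>

lemma V_trace: assumes "nice \<gamma>"
 shows "(\<Sum>b\<in>J. fV b (AV k \<gamma> (tensor_fam k b))) = (\<Prod>i=1..k. of_int (psi' (\<Lambda> i) (Xs i) \<gamma>))"
proof -
 have "(\<Sum>b\<in>J. fV b (AV k \<gamma> (tensor_fam k b))) = (\<Sum>b\<in>J. \<Prod>i=1..k. fs i (b i) (act \<gamma> (b i)))"
  unfolding AV_tensor_fam fV_tensor_fam ..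
 also have "... = (\<Prod>i=1..k. \<Sum>b\<in>Bs i. fs i b (act \<gamma> b))"
  unfolding J_def by (rule prod_sum_PiE[symmetric]) (use shape_basis.fB[OF sb'] in auto)
 also have "... = (\<Prod>i=1..k. of_int (psi' (\<Lambda> i) (Xs i) \<gamma>))"
 proof (rule prod.cong[OF refl])
  fix i assume i: "i \<in> {1..k}"
  let ?g = "perm_restrict \<gamma> (Xs i)"
  have "(\<Sum>b\<in>Bs i. fs i b (act \<gamma> b)) = (\<Sum>b\<in>Bs i. fs i b (act ?g b))"
   by (intro sum.cong refl arg_cong[of _ _ "fs i _"] act_restrict[OF i] shape_basis.BS[OF sb'[OF i]])
  also have "... = shape_basis.chi (Bs i) (fs i) ?g"
   by (simp add: shape_basis.chi_def[OF sb'[OF i]] shape_basis.tr_def[OF sb'[OF i]])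
  also have "... = of_int (psi (shape.l (\<Lambda> i)) (shape.nu (\<Lambda> i)) (Xs i) ?g)"
   by (rule shape_basis.chi_psi[OF sb'[OF i] perm_G[OF assms i]])
  also have "psi (shape.l (\<Lambda> i)) (shape.nu (\<Lambda> i)) (Xs i) ?g = psi' (\<Lambda> i) (Xs i) ?g"
  proof -
   have l: "shape.l (\<Lambda> i) = length (parts (\<Lambda> i))" by (rule shape.l_def[OF sh[OF i]])
   have "shape.nu (\<Lambda> i) = (\<lambda>j. if j < length (parts (\<Lambda> i)) then parts (\<Lambda> i) ! j else 0)"
    by (rule ext) (simp add: shape.nu_def[OF sh[OF i]] l)
   then show ?thesis unfolding psi'_def l by simp
  qed
  also have "... = psi' (\<Lambda> i) (Xs i) \<gamma>"
   unfolding psi'_eq by (intro sum.cong refl arg_cong2[of _ _ _ _ "(*)"] mchar_cong) (simp add: perm_restrict_def)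
  finally show "(\<Sum>b\<in>Bs i. fs i b (act \<gamma> b)) = of_int (psi' (\<Lambda> i) (Xs i) \<gamma>)" .
 qed
 finally show ?thesis .
qed

end

section \<open>The induced module\<close>

text \<open>The body of \<open>std_set_partition\<close>, for an arbitrary list of lengths.\<close>

definition intervals :: "nat list => nat set set" where
 "intervals xs = (\<lambda>j. {sum_list (take j xs) <.. sum_list (take (Suc j) xs)}) ` {..<length xs}"

lemma intervals_snoc: "intervals (xs @ [x]) = insert {sum_list xs <.. sum_list xs + x} (intervals xs)"
proof -
 have "intervals (xs @ [x]) = (\<lambda>j. {sum_list (take j (xs @ [x])) <.. sum_list (take (Suc j) (xs @ [x]))}) ` insert (length xs) {..<length xs}"
  by (simp add: intervals_def lessThan_Suc)
 also have "... = insert {sum_list xs <.. sum_list xs + x} (intervals xs)"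
  unfolding image_insert intervals_def by (intro arg_cong2[of _ _ _ _ insert] image_cong refl) auto
 finally show ?thesis .
qed

lemma intervals_partition:
 "(\<And>x. x \<in> set xs ==> x > 0) ==>
  partition_on {1..sum_list xs} (intervals xs) \<and> (\<forall>i. card {A \<in> intervals xs. card A = i} = count (mset xs) i)"
proof (induction xs rule: rev_induct)
 case Nil
 then show ?case by (simp add: intervals_def partition_on_def)
next
 case (snoc x xs)
 let ?B = "{sum_list xs <.. sum_list xs + x}"
 let ?S = "\<lambda>i. {A \<in> intervals xs. card A = i}"
 have p: "partition_on {1..sum_list xs} (intervals xs)" and c: "\<And>i. card (?S i) = count (mset xs) i"
  using snoc by auto
 have U: "\<Union>(intervals xs) = {1..sum_list xs}" using partition_onD1[OF p] by simp
 have x: "x > 0" using snoc.prems by simp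
 have ne: "?B \<noteq> {}" using x by simp
 have dj: "disjnt ?B (\<Union>(intervals xs))" unfolding U by (auto simp: disjnt_def)
 have "{1..sum_list (xs @ [x])} - ?B = {1..sum_list xs}" by auto
 then have "partition_on {1..sum_list (xs @ [x])} (intervals (xs @ [x]))"
  unfolding intervals_snoc partition_on_insert[OF dj] using p ne by auto
 moreover have "card {A \<in> intervals (xs @ [x]). card A = i} = count (mset (xs @ [x])) i" for i
 proof (cases "x = i")
  case True
  have "{A \<in> intervals (xs @ [x]). card A = i} = insert ?B (?S i)"
   unfolding intervals_snoc using True by auto
  moreover have "?B \<notin> ?S i"
  proof
   assume "?B \<in> ?S i"
   then have "?B \<subseteq> \<Union>(intervals xs)" by blast
   then show False using dj ne unfolding disjnt_def by blast
  qed
  moreover have "finite (?S i)" by (simp add: intervals_def)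
  ultimately show ?thesis using c[of i] True by simp
 next
  case False
  then have "{A \<in> intervals (xs @ [x]). card A = i} = ?S i" unfolding intervals_snoc by auto
  then show ?thesis using c[of i] False by simp
 qed
 ultimately show ?case by blast
qed

lemma sum_mset_sum: "finite A ==> \<Sum>\<^sub># (\<Sum>i\<in>A. f i) = (\<Sum>i\<in>A. \<Sum>\<^sub># (f i))"
 by (induction A rule: finite_induct) simp_all

lemma count_vec_type: "count (vec_type k \<Lambda>) i = (if i \<in> {1..k} then \<Sum>\<^sub># (\<Lambda> i) else 0)"
proof -
 have "count (vec_type k \<Lambda>) i = (\<Sum>j=1..k. if j = i then \<Sum>\<^sub># (\<Lambda> j) else 0)"
  unfolding vec_type_def count_sum by (intro sum.cong refl) simp
 then show ?thesis by (simp only: sum.delta' sum.delta finite_atLeastAtMost)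
qed

lemma std_pi:
 assumes "\<Lambda> \<in> mparts k"
 shows "partition_on {1..k} (std_pi k \<Lambda>)" "i \<in> {1..k} ==> card {A \<in> std_pi k \<Lambda>. card A = i} = \<Sum>\<^sub># (\<Lambda> i)"
proof -
 let ?v = "vec_type k \<Lambda>"
 let ?xs = "sorted_list_of_multiset ?v"
 have e: "std_pi k \<Lambda> = intervals ?xs" by (simp add: std_pi_def std_set_partition_def intervals_def Let_def)
 have "\<Sum>\<^sub># ?v = (\<Sum>i=1..k. i * \<Sum>\<^sub># (\<Lambda> i))"
  unfolding vec_type_def sum_mset_sum[OF finite_atLeastAtMost] sum_mset_replicate_mset by (intro sum.cong refl) (simp only: mult.commute of_nat_id)
 also have "... = k" using assms by (simp only: mparts_def mem_Collect_eq)
 finally have s: "sum_list ?xs = k" by (metis sum_mset_sum_list mset_sorted_list_of_multiset)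
 have pos: "x > 0" if "x \<in> set ?xs" for x
 proof (rule ccontr)
  assume "\<not> x > 0"
  then have "count ?v x = 0" unfolding count_vec_type by simp
  moreover have "x \<in># ?v" using that by simp
  ultimately show False by (metis not_in_iff)
 qed
 have ip: "partition_on {1..sum_list ?xs} (intervals ?xs) \<and> (\<forall>i. card {A \<in> intervals ?xs. card A = i} = count (mset ?xs) i)"
  by (rule intervals_partition) (rule pos)
 show "partition_on {1..k} (std_pi k \<Lambda>)" using conjunct1[OF ip] unfolding s e .
 show "i \<in> {1..k} ==> card {A \<in> std_pi k \<Lambda>. card A = i} = \<Sum>\<^sub># (\<Lambda> i)"
  using spec[OF conjunct2[OF ip], of i] unfolding e mset_sorted_list_of_multiset count_vec_type by (simp only: if_True)
qed

lemma ubp_mult_assoc: assumes "a \<in> ubp k" "b \<in> ubp k" "c \<in> ubp k"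
 shows "ubp_mult (ubp_mult a b) c = ubp_mult a (ubp_mult b c)"
proof (rule Rd_inj)
 note ab = ubp_mult_closed[OF assms(1,2)] and bc = ubp_mult_closed[OF assms(2,3)]
 show "ubp_mult (ubp_mult a b) c \<in> ubp k" by (rule ubp_mult_closed[OF ab assms(3)])
 show "ubp_mult a (ubp_mult b c) \<in> ubp k" by (rule ubp_mult_closed[OF assms(1) bc])
 show "Rd (ubp_mult (ubp_mult a b) c) = Rd (ubp_mult a (ubp_mult b c))"
  unfolding Rd_mult[OF ab assms(3)] Rd_mult[OF assms(1,2)] Rd_mult[OF assms(1) bc] Rd_mult[OF assms(2,3)] by (rule O_assoc)
qed

lemma finite_ubp: "finite (ubp k)"
proof (rule finite_subset)
 show "ubp k \<subseteq> Pow (Pow ({1..k} <+> {1..k}))" using ubpD(1) partition_onD1 by blast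
qed simp

lemma mult_match:
 assumes "l \<in> ubp k" "g \<in> ubp k" "ubp_bot l = ubp_top g"
 shows "ubp_mult l g = diag (ubp_top l) (\<lambda>A. block_map g (block_map l A))"
  "ubp_mult l g \<in> ubp k" "ubp_top (ubp_mult l g) = ubp_top l" "ubp_bot (ubp_mult l g) = ubp_bot g"
  "\<And>A. A \<in> ubp_top l ==> block_map (ubp_mult l g) A = block_map g (block_map l A)"
proof -
 note l = ubp_diag[OF assms(1)] and g = ubp_diag[OF assms(2)]
 show e: "ubp_mult l g = diag (ubp_top l) (\<lambda>A. block_map g (block_map l A))"
  by (rule mult_diag[OF assms(1,2) l(1) l(6)]) (use l(3) assms(3) in "simp_all add: bij_betw_def")
 have b: "bij_betw (\<lambda>A. block_map g (block_map l A)) (ubp_top l) (ubp_bot g)"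
  using bij_betw_trans[OF l(3)[unfolded assms(3)] g(3)] by (simp add: comp_def)
 have c: "card (block_map g (block_map l A)) = card A" if "A \<in> ubp_top l" for A
 proof -
  have "block_map l A \<in> ubp_top g" using bij_betwE[OF l(3)] that assms(3) by simp
  then show ?thesis using g(4) l(4)[OF that] by simp
 qed
 note D = diag_ubp[OF l(1) g(2) b c]
 show "ubp_mult l g \<in> ubp k" "ubp_top (ubp_mult l g) = ubp_top l" "ubp_bot (ubp_mult l g) = ubp_bot g"
  "\<And>A. A \<in> ubp_top l ==> block_map (ubp_mult l g) A = block_map g (block_map l A)"
  unfolding e using D by simp_all
qed

lemma diag_ubp':
 assumes "partition_on {1..k} \<rho>" "partition_on {1..k} \<rho>'" "bij_betw \<phi> \<rho> \<rho>'" "\<forall>A\<in>\<rho>. card (\<phi> A) = card A"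
 shows "diag \<rho> \<phi> \<in> ubp k" "ubp_top (diag \<rho> \<phi>) = \<rho>" "ubp_bot (diag \<rho> \<phi>) = \<rho>'"
  "\<And>A. A \<in> \<rho> ==> block_map (diag \<rho> \<phi>) A = \<phi> A"
 using diag_ubp[OF assms(1-3)] assms(4) by blast+

text \<open>The set partitions whose blocks are permuted by \<open>d\<close>; \<open>dmap d\<close> is this permutation.\<close>

definition fixparts :: "nat => diagram => nat set set set" where
 "fixparts k d = {\<rho>. partition_on {1..k} \<rho> \<and> (\<forall>A\<in>\<rho>. \<exists>A'\<in>\<rho>. (A, A') \<in> Rd d)}"

definition dmap :: "diagram => nat set => nat set" where "dmap d A = (THE A'. (A, A') \<in> Rd d)"

lemma dmap_eq: "d \<in> ubp k ==> (A, A') \<in> Rd d ==> dmap d A = A'"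
 unfolding dmap_def by (rule the_equality) (use Rd_fun in blast)+

lemma finite_partition: "partition_on {1..k::nat} \<rho> ==> finite \<rho>"
 by (rule finite_elements) simp_all

lemma fixparts_dmap:
 assumes d: "d \<in> ubp k" and \<rho>: "\<rho> \<in> fixparts k d"
 shows "\<And>A. A \<in> \<rho> ==> (A, dmap d A) \<in> Rd d" "bij_betw (dmap d) \<rho> \<rho>" "\<And>A. A \<in> \<rho> ==> card (dmap d A) = card A"
proof -
 have *: "(A, dmap d A) \<in> Rd d \<and> dmap d A \<in> \<rho>" if A: "A \<in> \<rho>" for A
 proof -
  obtain A' where "A' \<in> \<rho>" "(A, A') \<in> Rd d" using \<rho> A unfolding fixparts_def by blast
  then show ?thesis using dmap_eq[OF d, of A A'] by simp
 qed
 then show r: "\<And>A. A \<in> \<rho> ==> (A, dmap d A) \<in> Rd d" by blast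
 show "\<And>A. A \<in> \<rho> ==> card (dmap d A) = card A" using Rd_card[OF d r] by metis
 have i: "inj_on (dmap d) \<rho>" by (rule inj_onI) (metis Rd_inv[OF d] r)
 have "finite \<rho>" using finite_partition \<rho> unfolding fixparts_def by blast
 moreover have "dmap d ` \<rho> \<subseteq> \<rho>" using * by blast
 ultimately have "dmap d ` \<rho> = \<rho>" using i by (intro endo_inj_surj)
 then show "bij_betw (dmap d) \<rho> \<rho>" using i by (simp add: bij_betw_def)
qed

text \<open>\<open>W\<close> has a basis indexed by the tops \<open>\<rho>\<close> of the diagrams in \<open>L\<close> and by the basis \<open>J\<close> of \<open>V\<close>. For each
  \<open>\<rho>\<close> a representative \<open>lr \<rho> \<in> L\<close> is chosen. A diagram \<open>l \<in> L\<close> with top \<open>\<rho>\<close> is \<open>lr \<rho>\<close> times an element of the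
  group, which acts on \<open>V\<close> through the permutation \<open>gam l\<close> of the blocks of \<open>\<pi>\<close>. So the functional \<open>fW (\<rho>, b)\<close>
  has to map $l \otimes v$ to \<open>fV b\<close> of \<open>gam l\<close> applied to \<open>v\<close> if \<open>l\<close> has top \<open>\<rho>\<close>, and to 0 otherwise.\<close>

locale Wloc = Vloc +
 assumes pp: "partition_on {1..k} \<pi>"
begin

abbreviation "L \<equiv> L_class k \<pi>"
definition lr :: "nat set set => diagram" where "lr \<rho> = (SOME l. l \<in> L \<and> ubp_top l = \<rho>)"
definition gam :: "diagram => nat set => nat set" where
 "gam l C = block_map (lr (ubp_top l)) (inv_into (ubp_top l) (block_map l) C)"
definition fW where
 "fW p = fun_ext (\<lambda>(l, T). if ubp_top l = fst p then fV (snd p) (AV k (gam l) (basis_vec T)) else 0)"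
definition bW where "bW p = tensor (basis_vec (lr (fst p))) (tensor_fam k (snd p))"

lemma L_iff: "l \<in> L \<longleftrightarrow> l \<in> ubp k \<and> ubp_bot l = \<pi>" by (simp add: L_class_def)
lemma LD: "l \<in> L ==> l \<in> ubp k" "l \<in> L ==> ubp_bot l = \<pi>" by (simp_all add: L_iff)

lemma lr: assumes "\<rho> \<in> ubp_top ` L" shows "lr \<rho> \<in> L" "ubp_top (lr \<rho>) = \<rho>"
proof -
 have "\<exists>l. l \<in> L \<and> ubp_top l = \<rho>" using assms by blast
 from someI_ex[OF this] show "lr \<rho> \<in> L" "ubp_top (lr \<rho>) = \<rho>" unfolding lr_def by blast+
qed

lemma lrt: assumes "l \<in> L" shows "lr (ubp_top l) \<in> L" "ubp_top (lr (ubp_top l)) = ubp_top l"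
 using lr[of "ubp_top l"] assms by blast+

lemma bmL: assumes "l \<in> L" shows "bij_betw (block_map l) (ubp_top l) \<pi>"
 using ubp_diag(3)[OF LD(1)[OF assms]] LD(2)[OF assms] by simp

lemma bmL_onto: assumes "l \<in> L" "C \<in> \<pi>" obtains A where "A \<in> ubp_top l" "C = block_map l A"
 using bmL[OF assms(1)] assms(2) unfolding bij_betw_def by blast

lemma gam_bm: assumes "l \<in> L" "A \<in> ubp_top l" shows "gam l (block_map l A) = block_map (lr (ubp_top l)) A"
 unfolding gam_def using inv_into_f_f[of "block_map l" "ubp_top l" A] bmL[OF assms(1)] assms(2) by (simp add: bij_betw_def)

lemma nice_I: assumes "bij_betw \<gamma> \<pi> \<pi>" "\<And>C. C \<in> \<pi> ==> card (\<gamma> C) = card C" shows "nice \<gamma>"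
 unfolding nice_def
proof
 fix i
 show "bij_betw \<gamma> (Xs i) (Xs i)"
 proof (rule bij_betw_imageI)
  show "inj_on \<gamma> (Xs i)" using assms(1) by (auto simp: bij_betw_def Xs_def intro: inj_on_subset)
  show "\<gamma> ` Xs i = Xs i"
  proof (intro subset_antisym subsetI)
   fix C assume "C \<in> \<gamma> ` Xs i" then show "C \<in> Xs i" using bij_betwE[OF assms(1)] assms(2) by (auto simp: Xs_def)
  next
   fix C assume C: "C \<in> Xs i"
   then have "C \<in> \<gamma> ` \<pi>" using assms(1) by (simp add: bij_betw_def Xs_def)
   then obtain C' where "C' \<in> \<pi>" "C = \<gamma> C'" by blast
   then show "C \<in> \<gamma> ` Xs i" using C assms(2) by (auto simp: Xs_def)
  qed
 qed
qed

lemma gam_bij: assumes "l \<in> L" shows "bij_betw (gam l) \<pi> \<pi>"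
proof -
 have "bij_betw (block_map (lr (ubp_top l)) \<circ> inv_into (ubp_top l) (block_map l)) \<pi> \<pi>"
  using bij_betw_trans[OF bij_betw_inv_into[OF bmL[OF assms]] bmL[OF lrt(1)[OF assms], unfolded lrt(2)[OF assms]]] .
 then show ?thesis by (simp add: gam_def[abs_def] comp_def)
qed

lemma gam_nice: assumes "l \<in> L" shows "nice (gam l)"
proof (rule nice_I[OF gam_bij[OF assms]])
 fix C assume "C \<in> \<pi>"
 then obtain A where A: "A \<in> ubp_top l" "C = block_map l A" using bmL_onto[OF assms] by blast
 have "card (block_map (lr (ubp_top l)) A) = card A" 
  using ubp_diag(4)[OF LD(1)[OF lrt(1)[OF assms]]] A(1) lrt(2)[OF assms] by simp
 then show "card (gam l C) = card C"
  unfolding A(2) gam_bm[OF assms A(1)] using ubp_diag(4)[OF LD(1)[OF assms] A(1)] by simp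
qed

lemma G_D: assumes "g \<in> max_subgroup k \<pi>" shows "g \<in> ubp k" "ubp_top g = \<pi>" "ubp_bot g = \<pi>" "bij_betw (block_map g) \<pi> \<pi>"
 using assms ubp_diag(3)[of g k] by (simp_all add: max_subgroup_def)

lemma mult_LG: assumes "l \<in> L" "g \<in> max_subgroup k \<pi>"
 shows "ubp_mult l g \<in> L" "ubp_top (ubp_mult l g) = ubp_top l"
  "\<And>A. A \<in> ubp_top l ==> block_map (ubp_mult l g) A = block_map g (block_map l A)"
proof -
 have "ubp_bot l = ubp_top g" using LD[OF assms(1)] G_D[OF assms(2)] by simp
 note m = mult_match[OF LD(1)[OF assms(1)] G_D(1)[OF assms(2)] this]
 show "ubp_mult l g \<in> L" "ubp_top (ubp_mult l g) = ubp_top l"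
  "\<And>A. A \<in> ubp_top l ==> block_map (ubp_mult l g) A = block_map g (block_map l A)"
  using m G_D[OF assms(2)] by (simp_all add: L_iff)
qed

text \<open>This is the reason why \<open>fW\<close> vanishes on the relations (\<open>fW_rel\<close>).\<close>

lemma gam_mult: assumes "l \<in> L" "g \<in> max_subgroup k \<pi>" "C \<in> \<pi>"
 shows "gam (ubp_mult l g) C = gam l (inv_into \<pi> (block_map g) C)"
proof -
 note m = mult_LG[OF assms(1,2)]
 obtain A where A: "A \<in> ubp_top (ubp_mult l g)" "C = block_map (ubp_mult l g) A" using bmL_onto[OF m(1) assms(3)] by blast
 have A': "A \<in> ubp_top l" using A(1) m(2) by simp
 have C: "C = block_map g (block_map l A)" using A m(3)[OF A'] by simp
 have "block_map l A \<in> \<pi>" using bij_betwE[OF bmL[OF assms(1)]] A' by blast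
 then have "inv_into \<pi> (block_map g) C = block_map l A" unfolding C using G_D(4)[OF assms(2)] by (simp add: bij_betw_def inv_into_f_f)
 then have "gam l (inv_into \<pi> (block_map g) C) = block_map (lr (ubp_top l)) A" using gam_bm[OF assms(1) A'] by simp
 then show ?thesis using gam_bm[OF m(1) A(1)] A(2) m(2) by simp
qed

lemma linf_fW: "linf (fW p)" by (simp add: fW_def linf_fun_ext)

lemma fW_tensor: "fW (\<rho>, b) (tensor (basis_vec l) v) = (if ubp_top l = \<rho> then fV b (AV k (gam l) v) else 0)"
proof -
 have "(\<lambda>v. fW (\<rho>, b) (tensor (basis_vec l) v)) = (\<lambda>v. if ubp_top l = \<rho> then fV b (AV k (gam l) v) else 0)"
 proof (rule linf_eqI)
  show "linf (\<lambda>v. fW (\<rho>, b) (tensor (basis_vec l) v))" by (rule linf_comp[OF linf_fW lin_tensor])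
  show "linf (\<lambda>v. if ubp_top l = \<rho> then fV b (AV k (gam l) v) else 0)"
   using linf_comp[OF linf_fV lin_AV] by (cases "ubp_top l = \<rho>") (simp_all add: linf_def)
  fix T show "fW (\<rho>, b) (tensor (basis_vec l) (basis_vec T)) = (if ubp_top l = \<rho> then fV b (AV k (gam l) (basis_vec T)) else 0)"
   by (simp only: tensor_basis_basis fW_def fun_ext_basis prod.case fst_conv snd_conv)
 qed
 then show ?thesis by metis
qed

lemma W_rel_gen: assumes "l \<in> L" "g \<in> max_subgroup k \<pi>" "v \<in> V_mod k \<Lambda>"
 shows "tensor (basis_vec (ubp_mult l g)) v - tensor (basis_vec l) (G_act k g v) \<in> W_rel k \<Lambda>"
 unfolding W_rel_def by (rule free.span_base) (use assms in blast)

lemma W_num_gen: "l \<in> L ==> v \<in> V_mod k \<Lambda> ==> tensor (basis_vec l) v \<in> W_num k \<Lambda>"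
 unfolding W_num_def by (rule free.span_base) blast

lemma fW_rel: assumes "n \<in> W_rel k \<Lambda>" shows "fW (\<rho>, b) n = 0"
proof (rule linf_zero_on_span[OF linf_fW _ assms[unfolded W_rel_def]])
 fix x assume "x \<in> {tensor (basis_vec (ubp_mult l g)) v - tensor (basis_vec l) (G_act k g v) | l g v.
    l \<in> L \<and> g \<in> max_subgroup k \<pi> \<and> v \<in> V_mod k \<Lambda>}"
 then obtain l g v where x: "x = tensor (basis_vec (ubp_mult l g)) v - tensor (basis_vec l) (G_act k g v)"
  and h: "l \<in> L" "g \<in> max_subgroup k \<pi>" "v \<in> V_mod k \<Lambda>" by blast
 have "AV k (gam (ubp_mult l g)) v = AV k (gam l \<circ> inv_into \<pi> (block_map g)) v"
  by (rule AV_cong[OF _ h(3)]) (simp add: gam_mult[OF h(1,2)])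
 also have "... = AV k (gam l) (G_act k g v)" unfolding G_act_AV G_D(2)[OF h(2)] AV_AV ..
 finally have "AV k (gam (ubp_mult l g)) v = AV k (gam l) (G_act k g v)" .
 then show "fW (\<rho>, b) x = 0" unfolding x linfD(5)[OF linf_fW] fW_tensor mult_LG(2)[OF h(1,2)] by simp
qed

lemma fW_delta: assumes "\<rho> \<in> ubp_top ` L" "\<rho>' \<in> ubp_top ` L" "b \<in> J" "b' \<in> J"
 shows "fW (\<rho>, b) (bW (\<rho>', b')) = (if (\<rho>, b) = (\<rho>', b') then 1 else 0)"
proof -
 note l = lr[OF assms(2)]
 have e: "AV k (gam (lr \<rho>')) (tensor_fam k b') = tensor_fam k b'"
 proof (rule AV_ident[OF _ V_tensor[OF J_SV[OF assms(4)]]])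
  fix C assume "C \<in> \<pi>"
  then obtain A where A: "A \<in> ubp_top (lr \<rho>')" "C = block_map (lr \<rho>') A" using bmL_onto[OF l(1)] by blast
  show "gam (lr \<rho>') C = C" using gam_bm[OF l(1) A(1)] A(2) l(2) by simp
 qed
 show ?thesis unfolding bW_def fW_tensor fst_conv snd_conv l(2) e fV_delta[OF assms(3,4)] by simp
qed

text \<open>Modulo the relations, a tensor can be moved to the chosen representative; \<open>q\<close> is the group element with
  \<open>lr \<rho> q = l\<close>.\<close>

lemma reduce: assumes "l \<in> L" "u \<in> V_mod k \<Lambda>"
 shows "tensor (basis_vec l) u - tensor (basis_vec (lr (ubp_top l))) (AV k (gam l) u) \<in> W_rel k \<Lambda>"
proof -
 let ?r = "lr (ubp_top l)"
 let ?f = "\<lambda>C. block_map l (inv_into (ubp_top l) (block_map ?r) C)"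
 define q where "q = diag \<pi> ?f"
 note r = lrt[OF assms(1)]
 have br: "bij_betw (block_map ?r) (ubp_top l) \<pi>" using bmL[OF r(1)] r(2) by simp
 have f: "?f (block_map ?r A) = block_map l A" if "A \<in> ubp_top l" for A
  using inv_into_f_f[of "block_map ?r" "ubp_top l" A] br that by (simp add: bij_betw_def)
 have b: "bij_betw ?f \<pi> \<pi>"
  using bij_betw_trans[OF bij_betw_inv_into[OF br] bmL[OF assms(1)]] by (simp add: comp_def)
 have c: "card (?f C) = card C" if C: "C \<in> \<pi>" for C
 proof -
  obtain A where A: "A \<in> ubp_top ?r" "C = block_map ?r A" using bmL_onto[OF r(1) C] by blast
  have A': "A \<in> ubp_top l" using A r by simp
  show ?thesis unfolding A(2) f[OF A'] using ubp_diag(4)[OF LD(1)[OF assms(1)] A'] ubp_diag(4)[OF LD(1)[OF r(1)] A(1)] by simp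
 qed
 have "\<forall>C\<in>\<pi>. card (?f C) = card C" using c by blast
 note D = diag_ubp'[OF pp pp b this, folded q_def]
 have q: "q \<in> max_subgroup k \<pi>" using D(1-3) by (simp add: max_subgroup_def)
 have "ubp_bot ?r = ubp_top q" using LD(2)[OF r(1)] D(2) by simp
 note m = mult_match(1)[OF LD(1)[OF r(1)] D(1) this]
 have "ubp_mult ?r q = diag (ubp_top l) (block_map l)"
  unfolding m r(2)
 proof (rule diag_cong)
  fix A assume A: "A \<in> ubp_top l"
  then have "block_map ?r A \<in> \<pi>" using bij_betwE[OF br] by blast
  then show "block_map q (block_map ?r A) = block_map l A" using D(4) f[OF A] by simp
 qed
 then have rq: "ubp_mult ?r q = l" using ubp_diag(5)[OF LD(1)[OF assms(1)]] by simp
 have "G_act k q u = AV k (gam l) u"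
  unfolding G_act_AV D(2)
 proof (rule AV_cong[OF _ assms(2)])
  fix C assume "C \<in> \<pi>"
  then obtain A where A: "A \<in> ubp_top l" "C = block_map l A" using bmL_onto[OF assms(1)] by blast
  have rA: "block_map ?r A \<in> \<pi>" using bij_betwE[OF br] A by blast
  then have "C = block_map q (block_map ?r A)" using D(4) f[OF A(1)] A(2) by simp
  then have "inv_into \<pi> (block_map q) C = block_map ?r A"
   using G_D(4)[OF q] rA by (simp add: bij_betw_def inv_into_f_f)
  then show "inv_into \<pi> (block_map q) C = gam l C" using gam_bm[OF assms(1) A(1)] A(2) by simp
 qed
 then show ?thesis using W_rel_gen[OF r(1) q assms(2)] unfolding rq by simp
qed

lemma finite_L: "finite (ubp_top ` L)" using finite_ubp[of k] by (auto simp: L_class_def)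

lemma W_gen: assumes "v \<in> W_num k \<Lambda>"
 shows "v - (\<Sum>p\<in>ubp_top ` L \<times> J. smul (fW p v) (bW p)) \<in> W_rel k \<Lambda>"
proof (rule lin_span[where f = "\<lambda>v. v - (\<Sum>p\<in>ubp_top ` L \<times> J. smul (fW p v) (bW p))", OF _ _ _ assms[unfolded W_num_def]])
 have "lin (\<lambda>v. \<Sum>p\<in>ubp_top ` L \<times> J. smul (fW p v) (bW p))" by (intro lin_sum_fun lin_rank1 linf_fW)
 then show "lin (\<lambda>v. v - (\<Sum>p\<in>ubp_top ` L \<times> J. smul (fW p v) (bW p)))"
  unfolding lin_def by (simp add: free.scale_right_diff_distrib)
 show "free.subspace (W_rel k \<Lambda>)" by (simp add: W_rel_def)
 fix x assume "x \<in> {tensor (basis_vec l) v | l v. l \<in> L \<and> v \<in> V_mod k \<Lambda>}"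
 then obtain l u where x: "x = tensor (basis_vec l) u" and h: "l \<in> L" "u \<in> V_mod k \<Lambda>" by blast
 let ?r = "lr (ubp_top l)"
 let ?w = "AV k (gam l) u"
 have w: "?w \<in> V_mod k \<Lambda>" by (rule AV_V[OF gam_nice[OF h(1)] h(2)])
 have "(\<Sum>p\<in>ubp_top ` L \<times> J. smul (fW p x) (bW p)) = (\<Sum>\<rho>\<in>ubp_top ` L. \<Sum>b\<in>J. smul (fW (\<rho>, b) x) (bW (\<rho>, b)))"
  by (simp add: sum.cartesian_product)
 also have "... = (\<Sum>\<rho>\<in>ubp_top ` L. if ubp_top l = \<rho> then (\<Sum>b\<in>J. smul (fV b ?w) (bW (\<rho>, b))) else 0)"
  unfolding x fW_tensor by (intro sum.cong refl) simp
 also have "... = (\<Sum>b\<in>J. smul (fV b ?w) (bW (ubp_top l, b)))"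
  using finite_L h(1) by simp
 also have "... = tensor (basis_vec ?r) (\<Sum>b\<in>J. smul (fV b ?w) (tensor_fam k b))"
  unfolding bW_def lin_sum[OF lin_tensor] linD(2)[OF lin_tensor] fst_conv snd_conv ..
 also have "... = tensor (basis_vec ?r) ?w" by (simp only: V_expand[OF w, symmetric])
 finally show "x - (\<Sum>p\<in>ubp_top ` L \<times> J. smul (fW p x) (bW p)) \<in> W_rel k \<Lambda>"
  using reduce[OF h] unfolding x by simp
qed

lemma lin_W_act: "lin (W_act k \<Lambda> d)" by (simp add: W_act_def lin_lin_ext)

lemma W_act_tensor: "W_act k \<Lambda> d (tensor (basis_vec l) v) = (if ubp_mult d l \<in> L then tensor (basis_vec (ubp_mult d l)) v else 0)"
proof -
 have "(\<lambda>v. W_act k \<Lambda> d (tensor (basis_vec l) v)) = (\<lambda>v. if ubp_mult d l \<in> L then tensor (basis_vec (ubp_mult d l)) v else 0)"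
 proof (rule lin_eqI[OF lin_comp[OF lin_W_act lin_tensor]])
  show "lin (\<lambda>v. if ubp_mult d l \<in> L then tensor (basis_vec (ubp_mult d l)) v else 0)"
   using lin_tensor by (cases "ubp_mult d l \<in> L") (simp_all add: lin_def)
  fix T show "W_act k \<Lambda> d (tensor (basis_vec l) (basis_vec T)) = (if ubp_mult d l \<in> L then tensor (basis_vec (ubp_mult d l)) (basis_vec T) else 0)"
   by (simp only: tensor_basis_basis W_act_def lin_ext_basis prod.case)
 qed
 then show ?thesis by metis
qed

lemma W_act_num: assumes "v \<in> W_num k \<Lambda>" shows "W_act k \<Lambda> d v \<in> W_num k \<Lambda>"
proof (rule lin_span[OF lin_W_act _ _ assms[unfolded W_num_def]])
 show sub: "free.subspace (W_num k \<Lambda>)" by (simp add: W_num_def)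
 fix x assume "x \<in> {tensor (basis_vec l) v | l v. l \<in> L \<and> v \<in> V_mod k \<Lambda>}"
 then obtain l u where x: "x = tensor (basis_vec l) u" and h: "l \<in> L" "u \<in> V_mod k \<Lambda>" by blast
 show "W_act k \<Lambda> d x \<in> W_num k \<Lambda>"
  unfolding x W_act_tensor using W_num_gen[OF _ h(2)] free.subspace_0[OF sub] by (cases "ubp_mult d l \<in> L") simp_all
qed

text \<open>Whether \<open>d l\<close> stays in \<open>L\<close> does not change when \<open>l\<close> is multiplied by a group element, since that can be
  undone by its inverse \<open>g'\<close>. So the action of \<open>d\<close> respects the relations.\<close>

lemma mult_L_iff: assumes "d \<in> ubp k" "l \<in> L" "g \<in> max_subgroup k \<pi>"
 shows "ubp_mult d (ubp_mult l g) = ubp_mult (ubp_mult d l) g" "ubp_mult d (ubp_mult l g) \<in> L \<longleftrightarrow> ubp_mult d l \<in> L"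
proof -
 note l = LD(1)[OF assms(2)] and g = G_D[OF assms(3)]
 show e: "ubp_mult d (ubp_mult l g) = ubp_mult (ubp_mult d l) g" using ubp_mult_assoc[OF assms(1) l g(1)] by simp
 define g' where "g' = diag \<pi> (inv_into \<pi> (block_map g))"
 have b: "bij_betw (inv_into \<pi> (block_map g)) \<pi> \<pi>" by (rule bij_betw_inv_into[OF g(4)])
 have c: "card (inv_into \<pi> (block_map g) C) = card C" if "C \<in> \<pi>" for C
  using ubp_diag(4)[OF g(1), of "inv_into \<pi> (block_map g) C"] bij_betwE[OF b] that g(2,4) by (simp add: bij_betw_inv_into_right)
 have "\<forall>C\<in>\<pi>. card (inv_into \<pi> (block_map g) C) = card C" using c by blast
 note D = diag_ubp'[OF pp pp b this, folded g'_def]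
 have g': "g' \<in> max_subgroup k \<pi>" using D(1-3) by (simp add: max_subgroup_def)
 note m = mult_LG[OF assms(2,3)]
 have "ubp_bot (ubp_mult l g) = ubp_top g'" using LD(2)[OF m(1)] D(2) by simp
 note m' = mult_match(1)[OF LD(1)[OF m(1)] D(1) this]
 have "ubp_mult (ubp_mult l g) g' = diag (ubp_top l) (block_map l)"
  unfolding m' m(2)
 proof (rule diag_cong)
  fix A assume A: "A \<in> ubp_top l"
  have lA: "block_map l A \<in> \<pi>" using bij_betwE[OF bmL[OF assms(2)]] A by blast
  then have "block_map g (block_map l A) \<in> \<pi>" using bij_betwE[OF g(4)] by blast
  then show "block_map g' (block_map (ubp_mult l g) A) = block_map l A"
   using D(4) m(3)[OF A] lA g(4) by (simp add: bij_betw_def inv_into_f_f)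
 qed
 then have lgg: "ubp_mult (ubp_mult l g) g' = l" using ubp_diag(5)[OF l] by simp
 show "ubp_mult d (ubp_mult l g) \<in> L \<longleftrightarrow> ubp_mult d l \<in> L"
 proof
  assume "ubp_mult d (ubp_mult l g) \<in> L"
  from mult_LG(1)[OF this g'] have "ubp_mult (ubp_mult d (ubp_mult l g)) g' \<in> L" .
  then show "ubp_mult d l \<in> L" unfolding ubp_mult_assoc[OF assms(1) LD(1)[OF m(1)] D(1)] lgg .
 next
  assume "ubp_mult d l \<in> L"
  then show "ubp_mult d (ubp_mult l g) \<in> L" unfolding e by (rule mult_LG(1)[OF _ assms(3)])
 qed
qed

lemma W_act_rel: assumes "d \<in> ubp k" "v \<in> W_rel k \<Lambda>" shows "W_act k \<Lambda> d v \<in> W_rel k \<Lambda>"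
proof (rule lin_span[OF lin_W_act _ _ assms(2)[unfolded W_rel_def]])
 show sub: "free.subspace (W_rel k \<Lambda>)" by (simp add: W_rel_def)
 fix x assume "x \<in> {tensor (basis_vec (ubp_mult l g)) v - tensor (basis_vec l) (G_act k g v) | l g v.
    l \<in> L \<and> g \<in> max_subgroup k \<pi> \<and> v \<in> V_mod k \<Lambda>}"
 then obtain l g v where x: "x = tensor (basis_vec (ubp_mult l g)) v - tensor (basis_vec l) (G_act k g v)"
  and h: "l \<in> L" "g \<in> max_subgroup k \<pi>" "v \<in> V_mod k \<Lambda>" by blast
 note e = mult_L_iff[OF assms(1) h(1,2)]
 show "W_act k \<Lambda> d x \<in> W_rel k \<Lambda>"
 proof (cases "ubp_mult d l \<in> L")
  case True
  then have "ubp_mult (ubp_mult d l) g \<in> L" by (rule mult_LG(1)[OF _ h(2)])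
  then show ?thesis unfolding x linD(5)[OF lin_W_act] W_act_tensor e(1) if_P[OF True] using W_rel_gen[OF True h(2,3)] by simp
 next
  case False
  then have "ubp_mult d (ubp_mult l g) \<notin> L" using e(2) by blast
  then show ?thesis unfolding x linD(5)[OF lin_W_act] W_act_tensor using False free.subspace_0[OF sub] by simp
 qed
qed

text \<open>The diagonal block of the action of \<open>d\<close> at \<open>\<rho>\<close> is nonzero exactly if \<open>d\<close> permutes the blocks of \<open>\<rho>\<close>.\<close>

lemma fix_iff: assumes d: "d \<in> ubp k" and \<rho>: "\<rho> \<in> ubp_top ` L"
 shows "ubp_mult d (lr \<rho>) \<in> L \<and> ubp_top (ubp_mult d (lr \<rho>)) = \<rho> \<longleftrightarrow> \<rho> \<in> fixparts k d"
  "\<rho> \<in> fixparts k d ==> A \<in> \<rho> ==> block_map (ubp_mult d (lr \<rho>)) A = block_map (lr \<rho>) (dmap d A)"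
proof -
 note l = lr[OF \<rho>]
 note lu = LD(1)[OF l(1)]
 let ?m = "ubp_mult d (lr \<rho>)"
 have pr: "partition_on {1..k} \<rho>" using ubp_diag(1)[OF lu] l(2) by simp
 have *: "?m \<in> L \<and> ubp_top ?m = \<rho> \<and> (\<forall>A\<in>\<rho>. block_map ?m A = block_map (lr \<rho>) (dmap d A))" if fp: "\<rho> \<in> fixparts k d"
 proof -
  note f = fixparts_dmap[OF d fp]
  have im: "dmap d ` \<rho> = ubp_top (lr \<rho>)" using f(2) l(2) by (simp add: bij_betw_def)
  have e: "ubp_mult d (lr \<rho>) = diag \<rho> (\<lambda>A. block_map (lr \<rho>) (dmap d A))" by (rule mult_diag[OF d lu pr f(1) im])
  have b: "bij_betw (\<lambda>A. block_map (lr \<rho>) (dmap d A)) \<rho> \<pi>"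
   using bij_betw_trans[OF f(2) bmL[OF l(1), unfolded l(2)]] by (simp add: comp_def)
  have c: "card (block_map (lr \<rho>) (dmap d A)) = card A" if "A \<in> \<rho>" for A
   using ubp_diag(4)[OF lu, of "dmap d A"] f(3)[OF that] bij_betwE[OF f(2)] that l(2) by simp
  note D = diag_ubp[OF pr pp b c]
  show ?thesis unfolding e using D by (simp add: L_iff)
 qed
 then show "\<rho> \<in> fixparts k d ==> A \<in> \<rho> ==> block_map ?m A = block_map (lr \<rho>) (dmap d A)" by blast
 have "\<rho> \<in> fixparts k d" if m: "?m \<in> L" "ubp_top ?m = \<rho>"
  unfolding fixparts_def
 proof (intro CollectI conjI ballI pr)
  fix A assume A: "A \<in> \<rho>"
  then have "(A, block_map ?m A) \<in> Rd ?m" using ubp_diag(6)[OF LD(1)[OF m(1)]] m(2) by simp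
  then obtain Q where Q: "(A, Q) \<in> Rd d" "(Q, block_map ?m A) \<in> Rd (lr \<rho>)" using Rd_mult_1[OF d lu] by blast
  have "block_map ?m A \<in> ubp_bot (lr \<rho>)" using bij_betwE[OF bmL[OF m(1)]] A m(2) LD(2)[OF l(1)] by simp
  then obtain A' where A': "A' \<in> ubp_top (lr \<rho>)" "(A', block_map ?m A) \<in> Rd (lr \<rho>)" using Rd_bot[OF lu] by blast
  have "Q = A'" by (rule Rd_inv[OF lu Q(2) A'(2)])
  then show "\<exists>A'\<in>\<rho>. (A, A') \<in> Rd d" using Q(1) A'(1) l(2) by blast
 qed
 then show "?m \<in> L \<and> ubp_top ?m = \<rho> \<longleftrightarrow> \<rho> \<in> fixparts k d" using * by blast
qed

text \<open>With \<open>\<phi>\<close> the map of \<open>lr \<rho>\<close>, the permutation of the blocks of \<open>\<pi>\<close> is the inverse of the conjugate by \<open>\<phi>\<close> of the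
  permutation of \<open>\<rho>\<close>; both have the same invariant sets.\<close>

lemma psi_fix: assumes d: "d \<in> ubp k" and \<rho>: "\<rho> \<in> ubp_top ` L" and fp: "\<rho> \<in> fixparts k d"
 shows "psi' \<alpha> (Xs i) (gam (ubp_mult d (lr \<rho>))) = psi' \<alpha> {A \<in> \<rho>. card A = i} (dmap d)"
proof -
 note l = lr[OF \<rho>] and f = fixparts_dmap[OF d fp]
 let ?m = "ubp_mult d (lr \<rho>)" and ?X = "{A \<in> \<rho>. card A = i}" and ?\<phi> = "block_map (lr \<rho>)"
 have m: "?m \<in> L" "ubp_top ?m = \<rho>" using fix_iff(1)[OF d \<rho>] fp by blast+
 have b: "bij_betw ?\<phi> \<rho> \<pi>" using bmL[OF l(1)] l(2) by simp
 have key: "gam ?m (?\<phi> (dmap d A)) = ?\<phi> A" if "A \<in> \<rho>" for A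
  using gam_bm[OF m(1), of A] fix_iff(2)[OF d \<rho> fp that] m(2) that by simp
 have im: "?\<phi> ` ?X = Xs i"
 proof (intro subset_antisym subsetI)
  fix C assume "C \<in> ?\<phi> ` ?X"
  then show "C \<in> Xs i" using bij_betwE[OF b] ubp_diag(4)[OF LD(1)[OF l(1)]] l(2) by (auto simp: Xs_def)
 next
  fix C assume C: "C \<in> Xs i"
  then obtain A where "A \<in> \<rho>" "C = ?\<phi> A" using bmL_onto[OF l(1)] l(2) by (auto simp: Xs_def)
  then show "C \<in> ?\<phi> ` ?X" using C ubp_diag(4)[OF LD(1)[OF l(1)]] l(2) by (auto simp: Xs_def)
 qed
 have "psi' \<alpha> (?\<phi> ` ?X) (gam ?m) = psi' \<alpha> ?X (dmap d)"
 proof (rule psi'_reindex)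
  show "inj_on ?\<phi> ?X" using b by (auto simp: bij_betw_def intro: inj_on_subset)
  fix Z assume "Z \<subseteq> ?X"
  then have Z: "Z \<subseteq> \<rho>" by blast
  have tZ: "dmap d ` Z \<subseteq> \<rho>" using bij_betwE[OF f(2)] Z by blast
  have k: "gam ?m ` ?\<phi> ` dmap d ` Z = ?\<phi> ` Z"
   unfolding image_image by (rule image_cong[OF refl key]) (use Z in blast)
  have sub: "?\<phi> ` Z \<subseteq> \<pi>" "?\<phi> ` dmap d ` Z \<subseteq> \<pi>" using bij_betwE[OF b] Z tZ by blast+
  have ig: "inj_on (gam ?m) \<pi>" using gam_bij[OF m(1)] by (simp add: bij_betw_def)
  have ip: "inj_on ?\<phi> \<rho>" using b by (simp add: bij_betw_def)
  have "gam ?m ` ?\<phi> ` Z = ?\<phi> ` Z \<longleftrightarrow> gam ?m ` ?\<phi> ` Z = gam ?m ` ?\<phi> ` dmap d ` Z" by (simp only: k)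
  also have "... \<longleftrightarrow> ?\<phi> ` Z = ?\<phi> ` dmap d ` Z" by (rule inj_on_image_eq_iff[OF ig sub])
  also have "... \<longleftrightarrow> Z = dmap d ` Z" by (rule inj_on_image_eq_iff[OF ip Z tZ])
  also have "... \<longleftrightarrow> dmap d ` Z = Z" by (rule eq_commute)
  finally show "gam ?m ` ?\<phi> ` Z = ?\<phi> ` Z \<longleftrightarrow> dmap d ` Z = Z" .
 qed
 then show ?thesis unfolding im .
qed

lemma char_Rs: assumes d: "d \<in> ubp k"
 shows "ubp_char k \<Lambda> d = (\<Sum>\<rho>\<in>ubp_top ` L \<inter> fixparts k d. \<Prod>i=1..k. of_int (psi' (\<Lambda> i) {A \<in> \<rho>. card A = i} (dmap d)))"
proof -
 have "ubp_char k \<Lambda> d = (\<Sum>p\<in>ubp_top ` L \<times> J. fW p (W_act k \<Lambda> d (bW p)))"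
  unfolding ubp_char_def
 proof (rule trace_mod_dual)
  show "free.subspace (W_rel k \<Lambda>)" by (simp add: W_rel_def)
  show "finite (ubp_top ` L \<times> J)" using finite_L finite_J by simp
  show "bW p \<in> W_num k \<Lambda>" if p: "p \<in> ubp_top ` L \<times> J" for p
  proof -
   have "fst p \<in> ubp_top ` L" "snd p \<in> J" using p by auto
   then show ?thesis unfolding bW_def by (intro W_num_gen lr(1) V_tensor J_SV)
  qed
  show "linf (fW p)" for p by (rule linf_fW)
  show "fW p n = 0" if "n \<in> W_rel k \<Lambda>" for p n using fW_rel[OF that, of "fst p" "snd p"] by simp
  show "fW p (bW p') = (if p = p' then 1 else 0)" if "p \<in> ubp_top ` L \<times> J" "p' \<in> ubp_top ` L \<times> J" for p p'
   using fW_delta[of "fst p" "fst p'" "snd p" "snd p'"] that by (simp add: mem_Times_iff prod_eq_iff)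
  show "v - (\<Sum>p\<in>ubp_top ` L \<times> J. smul (fW p v) (bW p)) \<in> W_rel k \<Lambda>" if "v \<in> W_num k \<Lambda>" for v by (rule W_gen[OF that])
  show "lin (W_act k \<Lambda> d)" by (rule lin_W_act)
  show "W_act k \<Lambda> d v \<in> W_num k \<Lambda>" if "v \<in> W_num k \<Lambda>" for v by (rule W_act_num[OF that])
  show "W_act k \<Lambda> d v \<in> W_rel k \<Lambda>" if "v \<in> W_rel k \<Lambda>" for v by (rule W_act_rel[OF d that])
 qed
 also have "... = (\<Sum>\<rho>\<in>ubp_top ` L. \<Sum>b\<in>J. fW (\<rho>, b) (W_act k \<Lambda> d (bW (\<rho>, b))))"
  by (simp add: sum.cartesian_product)
 also have "... = (\<Sum>\<rho>\<in>ubp_top ` L. if \<rho> \<in> fixparts k d then \<Prod>i=1..k. of_int (psi' (\<Lambda> i) {A \<in> \<rho>. card A = i} (dmap d)) else 0)"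
 proof (rule sum.cong[OF refl])
  fix \<rho> assume \<rho>: "\<rho> \<in> ubp_top ` L"
  let ?m = "ubp_mult d (lr \<rho>)"
  have e: "fW (\<rho>, b) (W_act k \<Lambda> d (bW (\<rho>, b))) = (if \<rho> \<in> fixparts k d then fV b (AV k (gam ?m) (tensor_fam k b)) else 0)" for b
  proof (cases "?m \<in> L")
   case True
   then have "\<rho> \<in> fixparts k d \<longleftrightarrow> ubp_top ?m = \<rho>" using fix_iff(1)[OF d \<rho>] by blast
   then show ?thesis unfolding bW_def fst_conv snd_conv W_act_tensor if_P[OF True] fW_tensor by simp
  next
   case False
   then have "\<rho> \<notin> fixparts k d" using fix_iff(1)[OF d \<rho>] by blast
   then show ?thesis unfolding bW_def fst_conv snd_conv W_act_tensor using False by (simp add: linfD(3)[OF linf_fW])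
  qed
  show "(\<Sum>b\<in>J. fW (\<rho>, b) (W_act k \<Lambda> d (bW (\<rho>, b)))) = (if \<rho> \<in> fixparts k d then \<Prod>i=1..k. of_int (psi' (\<Lambda> i) {A \<in> \<rho>. card A = i} (dmap d)) else 0)"
  proof (cases "\<rho> \<in> fixparts k d")
   case True
   then have "?m \<in> L" using fix_iff(1)[OF d \<rho>] by blast
   from V_trace[OF gam_nice[OF this]] show ?thesis unfolding e if_P[OF True] psi_fix[OF d \<rho> True] .
  qed (simp add: e)
 qed
 also have "... = (\<Sum>\<rho>\<in>ubp_top ` L \<inter> fixparts k d. \<Prod>i=1..k. of_int (psi' (\<Lambda> i) {A \<in> \<rho>. card A = i} (dmap d)))"
  by (rule sum.inter_restrict[symmetric, OF finite_L])
 finally show ?thesis .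
qed

end

lemma finite_fixparts: "finite (fixparts k d)"
proof (rule finite_subset)
 show "fixparts k d \<subseteq> Pow (Pow {1..k})" unfolding fixparts_def using partition_onD1 by blast
qed simp

lemma block_card: assumes "partition_on {1..k::nat} \<rho>" "A \<in> \<rho>" shows "card A \<in> {1..k}"
proof -
 have s: "A \<subseteq> {1..k}" using partition_onD1[OF assms(1)] assms(2) by blast
 then have "finite A" by (rule finite_subset) simp
 moreover have "A \<noteq> {}" using partition_onD3[OF assms(1)] assms(2) by blast
 ultimately have "card A \<ge> 1" by (simp add: card_gt_0_iff Suc_le_eq)
 moreover have "card A \<le> k" using card_mono[OF _ s] by simp
 ultimately show ?thesis by simp
qed

lemma bij_by_card:
 assumes f: "\<And>i. i \<in> I ==> bij_betw (f i) {A \<in> \<rho>. card A = i} {A \<in> \<rho>'. card A = i}"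
  and c: "\<And>A. A \<in> \<rho> ==> card A \<in> I" "\<And>A. A \<in> \<rho>' ==> card A \<in> I"
 shows "bij_betw (\<lambda>A. f (card A) A) \<rho> \<rho>'" "\<And>A. A \<in> \<rho> ==> card (f (card A) A) = card A"
proof -
 let ?p = "\<lambda>A. f (card A) A"
 have v: "?p A \<in> \<rho>' \<and> card (?p A) = card A" if "A \<in> \<rho>" for A
  using bij_betwE[OF f[OF c(1)[OF that]]] that by blast
 then show "\<And>A. A \<in> \<rho> ==> card (?p A) = card A" by blast
 show "bij_betw ?p \<rho> \<rho>'"
 proof (rule bij_betw_imageI)
  show "inj_on ?p \<rho>"
  proof (rule inj_onI)
   fix A A' assume h: "A \<in> \<rho>" "A' \<in> \<rho>" "?p A = ?p A'"
   then have e: "card A = card A'" using v by metis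
   have "inj_on (f (card A)) {B \<in> \<rho>. card B = card A}" using f[OF c(1)[OF h(1)]] by (simp add: bij_betw_def)
   then show "A = A'" by (rule inj_onD) (use h e in auto)
  qed
  show "?p ` \<rho> = \<rho>'"
  proof (intro subset_antisym subsetI)
   fix B assume B: "B \<in> \<rho>'"
   have "B \<in> f (card B) ` {A \<in> \<rho>. card A = card B}" using f[OF c(2)[OF B]] B by (simp add: bij_betw_def)
   then show "B \<in> ?p ` \<rho>" by force
  qed (use v in blast)
 qed
qed

text \<open>A set partition that is not the top of a diagram in \<open>L\<close> does not have the right number of blocks of some
  size, and then \<open>psi'_zero\<close> applies; so the sum can be taken over all set partitions permuted by \<open>d\<close>.\<close>

lemma ubp_char_fixparts:
 assumes mp: "\<Lambda> \<in> mparts k" and d: "d \<in> ubp k"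
 shows "ubp_char k \<Lambda> d = (\<Sum>\<rho>\<in>fixparts k d. \<Prod>i=1..k. of_int (psi' (\<Lambda> i) {A \<in> \<rho>. card A = i} (dmap d)))"
proof -
 let ?X = "\<lambda>i. {A \<in> std_pi k \<Lambda>. card A = i}"
 note sp = std_pi[OF mp]
 have fin: "finite (std_pi k \<Lambda>)" by (rule finite_partition[OF sp(1)])
 have "\<exists>B f. shape_basis (\<Lambda> i) (?X i) B f" if i: "i \<in> {1..k}" for i
 proof -
  have "shape (\<Lambda> i) (?X i)"
   by unfold_locales (use mp sp(2)[OF i] fin in "auto simp: mparts_def")
  then show ?thesis using shape.ex_basis by blast
 qed
 then obtain Bs fs where sbs: "\<And>i. i \<in> {1..k} ==> shape_basis (\<Lambda> i) (?X i) (Bs i) (fs i)" by metis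
 have "Wloc k \<Lambda> Bs fs"
  by (intro Wloc.intro Vloc.intro Wloc_axioms.intro) (rule sbs, assumption, rule sp(1))
 then interpret W: Wloc k \<Lambda> Bs fs .
 let ?t = "\<lambda>\<rho>. \<Prod>i=1..k. of_int (psi' (\<Lambda> i) {A \<in> \<rho>. card A = i} (dmap d)) :: complex"
 have "?t \<rho> = 0" if \<rho>: "\<rho> \<in> fixparts k d" "\<rho> \<notin> ubp_top ` W.L" for \<rho>
 proof -
  have pr: "partition_on {1..k} \<rho>" using \<rho>(1) by (simp add: fixparts_def)
  have "\<exists>i\<in>{1..k}. card {A \<in> \<rho>. card A = i} \<noteq> \<Sum>\<^sub># (\<Lambda> i)"
  proof (rule ccontr)
   assume "\<not> (\<exists>i\<in>{1..k}. card {A \<in> \<rho>. card A = i} \<noteq> \<Sum>\<^sub># (\<Lambda> i))"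
   then have "\<forall>i\<in>{1..k}. \<exists>f. bij_betw f {A \<in> \<rho>. card A = i} (?X i)"
    using sp(2) finite_partition[OF pr] fin by (intro ballI finite_same_card_bij) simp_all
   from bchoice[OF this] obtain f where f: "\<forall>i\<in>{1..k}. bij_betw (f i) {A \<in> \<rho>. card A = i} (?X i)" ..
   define \<phi> where "\<phi> A = f (card A) A" for A
   have p: "bij_betw \<phi> \<rho> (std_pi k \<Lambda>)" "\<And>A. A \<in> \<rho> ==> card (\<phi> A) = card A"
    using bij_by_card[where f = f, OF bspec[OF f] block_card[OF pr] block_card[OF sp(1)]] unfolding \<phi>_def by blast+
   note D = diag_ubp[OF pr sp(1) p]
   have "diag \<rho> \<phi> \<in> W.L" using D by (simp add: W.L_iff)
   then have "\<rho> \<in> ubp_top ` W.L" using D(2) by (metis imageI)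
   then show False using \<rho>(2) by contradiction
  qed
  then obtain i where i: "i \<in> {1..k}" "card {A \<in> \<rho>. card A = i} \<noteq> \<Sum>\<^sub># (\<Lambda> i)" by blast
  have "psi' (\<Lambda> i) {A \<in> \<rho>. card A = i} (dmap d) = 0"
   by (rule psi'_zero[OF _ i(2)]) (use finite_partition[OF pr] in simp)
  then show ?thesis using i(1) by (intro prod_zero) auto
 qed
 then have "(\<Sum>\<rho>\<in>fixparts k d. ?t \<rho>) = (\<Sum>\<rho>\<in>ubp_top ` W.L \<inter> fixparts k d. ?t \<rho>)"
  by (intro sum.mono_neutral_right finite_fixparts) blast+
 then show ?thesis using W.char_Rs[OF d] by simp
qed

section \<open>The group element of a diagram\<close>

lemma orbit_agree: assumes "x \<in> A" "\<And>y. y \<in> A ==> f y \<in> A" "\<And>y. y \<in> A ==> f y = g y"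
 shows "orbit f x = orbit g x" "orbit f x \<subseteq> A"
proof -
 have 1: "y \<in> orbit g x \<and> y \<in> A" if "y \<in> orbit f x" for y
  using that
 proof induction
  case base then show ?case using assms orbit.base[of g x] by simp
 next
  case (step y) then show ?case using assms orbit.step[of y g x] by simp
 qed
 have 2: "y \<in> orbit f x" if "y \<in> orbit g x" for y
  using that
 proof induction
  case base then show ?case using assms orbit.base[of f x] by simp
 next
  case (step y)
  have "y \<in> A" using 1 step.IH by blast
  then show ?case using assms(3) orbit.step[OF step.IH] by simp
 qed
 show "orbit f x = orbit g x" using 1 2 by blast
 show "orbit f x \<subseteq> A" using 1 by blast
qed

lemma ubp_idem_diag: "ubp_idem \<rho> = diag \<rho> (\<lambda>A. A)" by (simp add: ubp_idem_def diag_def)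

lemma sat_top: assumes "d \<in> ubp k" shows "sat (ubp_top d) P \<longleftrightarrow> (\<exists>Q. (P, Q) \<in> Rd d)"
proof
 assume "sat (ubp_top d) P"
 then obtain s where s: "s \<subseteq> ubp_top d" "P = \<Union>s" by (auto simp: sat_def)
 have "(\<Union>((\<lambda>A. A) ` s), \<Union>(block_map d ` s)) \<in> Rd d" by (rule Rd_Union) (use s(1) ubp_diag(6)[OF assms] in blast)
 then show "\<exists>Q. (P, Q) \<in> Rd d" using s(2) by auto
next
 assume "\<exists>Q. (P, Q) \<in> Rd d"
 then show "sat (ubp_top d) P" using Rd_top[OF assms] unfolding sat_def by blast
qed

lemma sat_bot: assumes "d \<in> ubp k" shows "sat (ubp_bot d) Q \<longleftrightarrow> (\<exists>P. (P, Q) \<in> Rd d)"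
proof
 assume "sat (ubp_bot d) Q"
 then obtain s where s: "s \<subseteq> ubp_bot d" "Q = \<Union>s" by (auto simp: sat_def)
 have "\<exists>f. \<forall>C\<in>s. (f C, C) \<in> Rd d" using Rd_bot[OF assms] s(1) by (intro bchoice) blast
 then obtain f where f: "\<And>C. C \<in> s ==> (f C, C) \<in> Rd d" by blast
 have "(\<Union>(f ` s), \<Union>((\<lambda>C. C) ` s)) \<in> Rd d" by (rule Rd_Union) (rule f)
 then show "\<exists>P. (P, Q) \<in> Rd d" using s(2) by auto
next
 assume "\<exists>P. (P, Q) \<in> Rd d"
 then obtain P where "(P, Q) \<in> Rd d" ..
 from Rd_top[OF assms this] obtain s where s: "s \<subseteq> ubp_top d" "Q = \<Union>(block_map d ` s)" by blast
 have "block_map d ` s \<subseteq> ubp_bot d" using bij_betwE[OF ubp_diag(3)[OF assms]] s(1) by blast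
 then show "sat (ubp_bot d) Q" using s(2) unfolding sat_def by blast
qed

lemma sat_eq: assumes "partition_on V d" "partition_on V d'" "\<And>U. sat d U \<longleftrightarrow> sat d' U" shows "d = d'"
proof (rule subset_antisym)
 show "d \<subseteq> d'" by (rule sat_inj[OF assms(1,2)]) (rule assms(3))
 show "d' \<subseteq> d" by (rule sat_inj[OF assms(2,1)]) (rule assms(3)[symmetric])
qed

lemma ubp_idem: assumes "partition_on {1..k} \<rho>"
 shows "ubp_idem \<rho> \<in> ubp k" "ubp_top (ubp_idem \<rho>) = \<rho>" "(P, Q) \<in> Rd (ubp_idem \<rho>) \<longleftrightarrow> P = Q \<and> sat \<rho> P"
proof -
 have b: "bij_betw (\<lambda>A. A) \<rho> \<rho>" by (simp add: bij_betw_def inj_on_def)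
 note D = diag_ubp[OF assms assms b, simplified refl, folded ubp_idem_diag]
 show u: "ubp_idem \<rho> \<in> ubp k" and t: "ubp_top (ubp_idem \<rho>) = \<rho>" using D by simp_all
 have r: "(P, P) \<in> Rd (ubp_idem \<rho>)" if P: "sat \<rho> P" for P
 proof -
  obtain s where s: "s \<subseteq> \<rho>" "P = \<Union>s" using P by (auto simp: sat_def)
  have "(\<Union>((\<lambda>A. A) ` s), \<Union>((\<lambda>A. A) ` s)) \<in> Rd (ubp_idem \<rho>)"
   by (rule Rd_Union) (use s(1) in "auto simp: Rd_def ubp_idem_def intro!: sat_block")
  then show ?thesis using s(2) by simp
 qed
 show "(P, Q) \<in> Rd (ubp_idem \<rho>) \<longleftrightarrow> P = Q \<and> sat \<rho> P"
 proof
  assume a: "(P, Q) \<in> Rd (ubp_idem \<rho>)"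
  have s: "sat \<rho> P" using sat_top[OF u] a t by auto
  show "P = Q \<and> sat \<rho> P" using Rd_fun[OF u r[OF s] a] s by blast
 qed (use r in blast)
qed

lemma singletons_partition: "partition_on V ((\<lambda>i. {i}) ` V)"
 by (rule partition_onI) (auto simp: disjnt_def)

lemma sat_singletons: "sat ((\<lambda>i. {i}) ` V) P \<longleftrightarrow> P \<subseteq> V"
 unfolding sat_iff[OF singletons_partition] by auto

lemma ubp_one: "ubp_idem ((\<lambda>i. {i}) ` {1..k}) \<in> ubp k"
 "Rd (ubp_idem ((\<lambda>i. {i}) ` {1..k})) = {(P, P) | P. P \<subseteq> {1..k}}"
 using ubp_idem[OF singletons_partition[of "{1..k}"]] unfolding sat_singletons by auto

lemma monoid_ubp: "monoid (ubp_monoid k)"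
proof (rule monoidI)
 let ?M = "ubp_monoid k"
 note one = ubp_one[of k]
 show "\<one>\<^bsub>?M\<^esub> \<in> carrier ?M" using one(1) by (simp add: ubp_monoid_def)
 fix x assume "x \<in> carrier ?M"
 then have x: "x \<in> ubp k" by (simp add: ubp_monoid_def)
 have "ubp_mult (ubp_idem ((\<lambda>i. {i}) ` {1..k})) x = x"
 proof (rule Rd_inj[OF ubp_mult_closed[OF one(1) x] x])
  show "Rd (ubp_mult (ubp_idem ((\<lambda>i. {i}) ` {1..k})) x) = Rd x"
   unfolding Rd_mult[OF one(1) x] one(2) using Rd_sub[OF x] by fast
 qed
 then show "\<one>\<^bsub>?M\<^esub> \<otimes>\<^bsub>?M\<^esub> x = x" by (simp add: ubp_monoid_def)
 have "ubp_mult x (ubp_idem ((\<lambda>i. {i}) ` {1..k})) = x"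
 proof (rule Rd_inj[OF ubp_mult_closed[OF x one(1)] x])
  show "Rd (ubp_mult x (ubp_idem ((\<lambda>i. {i}) ` {1..k}))) = Rd x"
   unfolding Rd_mult[OF x one(1)] one(2) using Rd_sub[OF x] by fast
 qed
 then show "x \<otimes>\<^bsub>?M\<^esub> \<one>\<^bsub>?M\<^esub> = x" by (simp add: ubp_monoid_def)
qed (simp_all add: ubp_monoid_def ubp_mult_closed ubp_mult_assoc)

text \<open>If \<open>x\<^sup>i = x\<^sup>j\<close> with \<open>i < j\<close>, the powers from \<open>x\<^sup>i\<close> on are periodic with period \<open>q = j - i\<close>. The exponent
  \<open>i * q\<close> is a multiple of the period and is at least \<open>i\<close>.\<close>

lemma finite_monoid_idem:
 assumes M: "monoid M" and fin: "finite (carrier M)" and x: "x \<in> carrier M"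
 shows "\<exists>n::nat. n \<ge> 1 \<and> x [^]\<^bsub>M\<^esub> n \<otimes>\<^bsub>M\<^esub> x [^]\<^bsub>M\<^esub> n = x [^]\<^bsub>M\<^esub> n"
proof -
 interpret monoid M by (rule M)
 let ?p = "\<lambda>n::nat. x [^]\<^bsub>M\<^esub> n"
 have "?p ` {1..} \<subseteq> carrier M" using x by auto
 then have "finite (?p ` {1..})" using fin finite_subset by blast
 then have "\<not> inj_on ?p {1..}" using finite_imageD[of ?p "{1..}"] infinite_Ici[of "1::nat"] by blast
 then obtain i j where ij: "i \<ge> 1" "i < j" "?p i = ?p j"
  unfolding inj_on_def by (metis atLeast_iff nat_neq_iff)
 define q where "q = j - i"
 have q: "q \<ge> 1" "j = i + q" using ij by (simp_all add: q_def)
 have s: "?p (m + q) = ?p m" if "m \<ge> i" for m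
 proof -
  have "?p (m + q) = ?p (m - i) \<otimes>\<^bsub>M\<^esub> ?p j" using that q(2) x by (simp add: nat_pow_mult)
  also have "... = ?p (m - i) \<otimes>\<^bsub>M\<^esub> ?p i" using ij(3) by simp
  also have "... = ?p m" using that x by (simp add: nat_pow_mult)
  finally show ?thesis .
 qed
 have t: "?p (m + r * q) = ?p m" if "m \<ge> i" for m r
 proof (induction r)
  case (Suc r)
  have "?p (m + Suc r * q) = ?p ((m + r * q) + q)" by (simp add: algebra_simps)
  also have "... = ?p (m + r * q)" by (rule s) (use that in simp)
  finally show ?case using Suc by simp
 qed simp
 have "?p (i * q) \<otimes>\<^bsub>M\<^esub> ?p (i * q) = ?p (i * q + i * q)" using x by (simp add: nat_pow_mult)
 also have "... = ?p (i * q)" by (rule t) (use q in simp)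
 finally show ?thesis using ij q by (intro exI[of _ "i * q"]) simp
qed

text \<open>Both idempotents are equal to the power \<open>x\<^sup>n\<^sup>m\<close>.\<close>

lemma idem_powers_eq:
 assumes M: "monoid M" and x: "x \<in> carrier M" and "n \<ge> (1::nat)" "m \<ge> (1::nat)"
  and "x [^]\<^bsub>M\<^esub> n \<otimes>\<^bsub>M\<^esub> x [^]\<^bsub>M\<^esub> n = x [^]\<^bsub>M\<^esub> n" "x [^]\<^bsub>M\<^esub> m \<otimes>\<^bsub>M\<^esub> x [^]\<^bsub>M\<^esub> m = x [^]\<^bsub>M\<^esub> m"
 shows "x [^]\<^bsub>M\<^esub> n = x [^]\<^bsub>M\<^esub> m"
proof -
 interpret monoid M by (rule M)
 have p: "e [^]\<^bsub>M\<^esub> Suc r = e" if "e \<in> carrier M" "e \<otimes>\<^bsub>M\<^esub> e = e" for e and r :: nat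
  using that by (induction r) simp_all
 have p': "e [^]\<^bsub>M\<^esub> r = e" if "e \<in> carrier M" "e \<otimes>\<^bsub>M\<^esub> e = e" "r \<ge> 1" for e and r :: nat
  using p[OF that(1,2), of "r - 1"] that(3) by simp
 have "x [^]\<^bsub>M\<^esub> n = x [^]\<^bsub>M\<^esub> (n * m)" using p'[OF _ assms(5,4)] x by (simp add: nat_pow_pow)
 also have "... = x [^]\<^bsub>M\<^esub> m" using p'[OF _ assms(6,3)] x by (simp add: nat_pow_pow mult.commute)
 finally show ?thesis .
qed

lemma omega:
 assumes x: "x \<in> ubp k"
 obtains n :: nat where "omega_power k x = x [^]\<^bsub>ubp_monoid k\<^esub> Suc n"
  "ubp_mult (omega_power k x) (omega_power k x) = omega_power k x"
proof -
 let ?M = "ubp_monoid k"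
 have c: "x \<in> carrier ?M" "finite (carrier ?M)" using x finite_ubp by (simp_all add: ubp_monoid_def)
 have m: "a \<otimes>\<^bsub>?M\<^esub> b = ubp_mult a b" for a b by (simp add: ubp_monoid_def)
 note uniq = idem_powers_eq[OF monoid_ubp c(1), unfolded m]
 obtain n :: nat where n: "n \<ge> 1" "ubp_mult (x [^]\<^bsub>?M\<^esub> n) (x [^]\<^bsub>?M\<^esub> n) = x [^]\<^bsub>?M\<^esub> n"
  using finite_monoid_idem[OF monoid_ubp c(2,1), unfolded m] by blast
 have e: "omega_power k x = x [^]\<^bsub>?M\<^esub> n"
  unfolding omega_power_def
 proof (rule the_equality)
  show "(\<exists>n'::nat. n' \<ge> 1 \<and> x [^]\<^bsub>?M\<^esub> n = x [^]\<^bsub>?M\<^esub> n') \<and> ubp_mult (x [^]\<^bsub>?M\<^esub> n) (x [^]\<^bsub>?M\<^esub> n) = x [^]\<^bsub>?M\<^esub> n"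
   using n by blast
  fix e assume "(\<exists>n::nat. n \<ge> 1 \<and> e = x [^]\<^bsub>?M\<^esub> n) \<and> ubp_mult e e = e"
  then obtain m' :: nat where "m' \<ge> 1" "e = x [^]\<^bsub>?M\<^esub> m'" "ubp_mult e e = e" by blast
  then show "e = x [^]\<^bsub>?M\<^esub> n" using uniq[of m' n] n by simp
 qed
 obtain n' where n': "n = Suc n'" using n(1) by (cases n) simp_all
 show thesis by (rule that[of n']) (use e n(2) n' in "simp_all only:")
qed

lemma pow_ubp: "x \<in> ubp k ==> x [^]\<^bsub>ubp_monoid k\<^esub> (n::nat) \<in> ubp k"
 using monoid.nat_pow_closed[OF monoid_ubp, of x k n] by (simp add: ubp_monoid_def)

lemma idem_Rd: assumes e: "e \<in> ubp k" "ubp_mult e e = e" and r: "(P, Q) \<in> Rd e" shows "P = Q"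
proof -
 have "(P, Q) \<in> Rd (ubp_mult e e)" using r e(2) by simp
 then obtain R where R: "(P, R) \<in> Rd e" "(R, Q) \<in> Rd e" using Rd_mult_1[OF e(1) e(1)] by blast
 have "R = Q" by (rule Rd_fun[OF e(1) R(1) r])
 then show ?thesis using Rd_inv[OF e(1) r] R(2) by blast
qed

text \<open>\<open>e\<close> is $x^\omega$ and \<open>y\<close> is $x^{\omega+1}$, which is invertible with respect to \<open>e\<close>; \<open>Y\<close> is the set of
  blocks on which \<open>y\<close> acts, by the permutation \<open>\<sigma>\<close>.\<close>

locale omega_elt =
 fixes k :: nat and x :: diagram
 assumes x: "x \<in> ubp k"
begin

definition e where "e = omega_power k x"
definition y where "y = ubp_mult e x"
definition Y where "Y = ubp_top e"
definition \<sigma> where "\<sigma> = perm_restrict (block_map y) Y"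

lemma e_pow: "\<exists>n. e = x [^]\<^bsub>ubp_monoid k\<^esub> Suc n" using omega[OF x] unfolding e_def by metis

lemma e: "e \<in> ubp k" "ubp_mult e e = e"
proof -
 show "e \<in> ubp k" using e_pow pow_ubp[OF x] by metis
 show "ubp_mult e e = e" unfolding e_def by (rule omega[OF x])
qed

lemma e_inv: "\<exists>z. z \<in> ubp k \<and> ubp_mult z x = e \<and> ubp_mult x z = e"
proof -
 from e_pow obtain n where n: "e = x [^]\<^bsub>ubp_monoid k\<^esub> Suc n" ..
 let ?z = "x [^]\<^bsub>ubp_monoid k\<^esub> n"
 have c: "x \<in> carrier (ubp_monoid k)" using x by (simp add: ubp_monoid_def)
 have 1: "ubp_mult ?z x = e" unfolding n(1) nat_pow_Suc by (simp add: ubp_monoid_def)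
 have 2: "ubp_mult x ?z = e" unfolding n(1) monoid.nat_pow_Suc2[OF monoid_ubp c] by (simp add: ubp_monoid_def)
 show ?thesis by (intro exI[of _ ?z] conjI pow_ubp[OF x] 1 2)
qed

lemma y: "y \<in> ubp k" unfolding y_def by (rule ubp_mult_closed[OF e(1) x])
lemma Y: "partition_on {1..k} Y" unfolding Y_def by (rule ubp_diag(1)[OF e(1)])

lemma Rd_e: "(P, Q) \<in> Rd e \<longleftrightarrow> P = Q \<and> sat Y P"
 using idem_Rd[OF e] sat_top[OF e(1)] unfolding Y_def by blast

lemma Rd_y: "(P, Q) \<in> Rd y \<longleftrightarrow> sat Y P \<and> (P, Q) \<in> Rd x"
proof
 assume "(P, Q) \<in> Rd y"
 then obtain R where R: "(P, R) \<in> Rd e" "(R, Q) \<in> Rd x" using Rd_mult_1[OF e(1) x] unfolding y_def by blast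
 have h: "P = R" "sat Y P"
  by (rule conjunct1[OF iffD1[OF Rd_e R(1)]], rule conjunct2[OF iffD1[OF Rd_e R(1)]])
 have "(P, Q) \<in> Rd x" unfolding h(1) by (rule R(2))
 then show "sat Y P \<and> (P, Q) \<in> Rd x" using h(2) by (intro conjI)
next
 assume h: "sat Y P \<and> (P, Q) \<in> Rd x"
 then have "(P, P) \<in> Rd e" using Rd_e[of P P] by simp
 then show "(P, Q) \<in> Rd y" unfolding y_def using Rd_mult_2[OF e(1) x] h by simp
qed

lemma y_inverse: "\<exists>z. z \<in> ubp k \<and> ubp_mult y z = e \<and> ubp_mult z y = e"
proof -
 from e_inv obtain z where "z \<in> ubp k \<and> ubp_mult z x = e \<and> ubp_mult x z = e" ..
 then have z: "z \<in> ubp k" "ubp_mult z x = e" "ubp_mult x z = e" by simp_all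
 have xe: "ubp_mult x e = ubp_mult e x"
  using ubp_mult_assoc[OF x z(1) x] z(2,3) by simp
 have 1: "ubp_mult y z = e" unfolding y_def ubp_mult_assoc[OF e(1) x z(1)] z(3) by (rule e(2))
 have 2: "ubp_mult z y = e" unfolding y_def xe[symmetric] ubp_mult_assoc[OF z(1) x e(1), symmetric] z(2) by (rule e(2))
 show ?thesis by (intro exI[of _ z] conjI z(1) 1 2)
qed

lemma top_y: "ubp_top y = Y"
proof (rule sat_eq[OF ubp_diag(1)[OF y] Y])
 fix P
 from y_inverse obtain z where "z \<in> ubp k \<and> ubp_mult y z = e \<and> ubp_mult z y = e" ..
 then have z: "z \<in> ubp k" "ubp_mult y z = e" by simp_all
 have "\<exists>Q. (P, Q) \<in> Rd y" if P: "sat Y P"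
 proof -
  have "(P, P) \<in> Rd (ubp_mult y z)" unfolding z(2) Rd_e using P by blast
  then show ?thesis using Rd_mult_1[OF y z(1)] by blast
 qed
 then show "sat (ubp_top y) P \<longleftrightarrow> sat Y P" unfolding sat_top[OF y] using Rd_y by blast
qed

lemma bot_y: "ubp_bot y = Y"
proof (rule sat_eq[OF ubp_diag(2)[OF y] Y])
 fix Q
 from y_inverse obtain z where "z \<in> ubp k \<and> ubp_mult y z = e \<and> ubp_mult z y = e" ..
 then have z: "z \<in> ubp k" "ubp_mult y z = e" "ubp_mult z y = e" by simp_all
 have 1: "\<exists>P. (P, Q) \<in> Rd y" if Q: "sat Y Q"
 proof -
  have "(Q, Q) \<in> Rd (ubp_mult z y)" unfolding z(3) Rd_e using Q by blast
  then show ?thesis using Rd_mult_1[OF z(1) y] by blast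
 qed
 have 2: "sat Y Q" if r: "(P, Q) \<in> Rd y" for P
 proof -
  have "sat Y P" using r Rd_y by blast
  then have "(P, P) \<in> Rd (ubp_mult y z)" unfolding z(2) Rd_e by blast
  then obtain R where R: "(P, R) \<in> Rd y" "(R, P) \<in> Rd z" using Rd_mult_1[OF y z(1)] by blast
  have "R = Q" by (rule Rd_fun[OF y R(1) r])
  then have "(Q, Q) \<in> Rd (ubp_mult z y)" using Rd_mult_2[OF z(1) y R(2) r] by simp
  then show ?thesis unfolding z(3) Rd_e by blast
 qed
 show "sat (ubp_bot y) Q \<longleftrightarrow> sat Y Q" unfolding sat_bot[OF y] using 1 2 by blast
qed

lemma bm_y: "bij_betw (block_map y) Y Y" using ubp_diag(3)[OF y] unfolding top_y bot_y .

lemma \<sigma>_eq: "A \<in> Y ==> \<sigma> A = block_map y A" by (simp add: \<sigma>_def perm_restrict_def)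

lemma \<sigma>_perm: "\<sigma> permutes Y"
proof (rule bij_imp_permutes)
 show "bij_betw \<sigma> Y Y" using bij_betw_cong[of Y \<sigma> "block_map y" Y] \<sigma>_eq bm_y by blast
 show "\<And>A. A \<notin> Y ==> \<sigma> A = A" by (simp add: \<sigma>_def perm_restrict_def)
qed

lemma Rd_\<sigma>: assumes "s \<subseteq> Y" shows "(\<Union>s, \<Union>(\<sigma> ` s)) \<in> Rd y"
proof -
 have "(\<Union>((\<lambda>A. A) ` s), \<Union>(\<sigma> ` s)) \<in> Rd y"
  by (rule Rd_Union) (use assms ubp_diag(6)[OF y] \<sigma>_eq top_y in auto)
 then show ?thesis by simp
qed

lemma dmap_\<sigma>: "s \<subseteq> Y ==> dmap y (\<Union>s) = \<Union>(\<sigma> ` s)" by (rule dmap_eq[OF y Rd_\<sigma>])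

lemma fix_Rd_pow:
 assumes "\<rho> \<in> fixparts k x" shows "\<forall>A\<in>\<rho>. \<exists>A'\<in>\<rho>. (A, A') \<in> Rd (x [^]\<^bsub>ubp_monoid k\<^esub> (n::nat))"
proof (induction n)
 case 0
 show ?case
 proof
  fix A assume A: "A \<in> \<rho>"
  then have "A \<subseteq> {1..k}" using assms partition_onD1 unfolding fixparts_def by blast
  then have "(A, A) \<in> Rd (x [^]\<^bsub>ubp_monoid k\<^esub> (0::nat))"
   unfolding nat_pow_0 using ubp_one(2)[of k] by (simp add: ubp_monoid_def)
  then show "\<exists>A'\<in>\<rho>. (A, A') \<in> Rd (x [^]\<^bsub>ubp_monoid k\<^esub> (0::nat))" using A by blast
 qed
next
 case (Suc n)
 show ?case
 proof
  fix A assume "A \<in> \<rho>"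
  then obtain B where B: "B \<in> \<rho>" "(A, B) \<in> Rd (x [^]\<^bsub>ubp_monoid k\<^esub> n)" using Suc by blast
  obtain C where C: "C \<in> \<rho>" "(B, C) \<in> Rd x" using assms B(1) unfolding fixparts_def by blast
  have "x [^]\<^bsub>ubp_monoid k\<^esub> Suc n = ubp_mult (x [^]\<^bsub>ubp_monoid k\<^esub> n) x" unfolding nat_pow_Suc by (simp add: ubp_monoid_def)
  then have "(A, C) \<in> Rd (x [^]\<^bsub>ubp_monoid k\<^esub> Suc n)" using Rd_mult_2[OF pow_ubp[OF x] x B(2) C(2)] by simp
  then show "\<exists>A'\<in>\<rho>. (A, A') \<in> Rd (x [^]\<^bsub>ubp_monoid k\<^esub> Suc n)" using C(1) by blast
 qed
qed

text \<open>If \<open>x\<close> permutes the blocks of \<open>\<rho>\<close>, so does the power \<open>e\<close> of \<open>x\<close>; but \<open>Rd e\<close> is the identity on the unions of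
  parts of \<open>Y\<close>. So the blocks of \<open>\<rho>\<close> are such unions, and on these \<open>x\<close> and \<open>y\<close> agree.\<close>

lemma fixparts_y: "fixparts k x = fixparts k y"
proof (intro subset_antisym subsetI)
 fix \<rho> assume \<rho>: "\<rho> \<in> fixparts k x"
 from e_pow obtain n where n: "e = x [^]\<^bsub>ubp_monoid k\<^esub> Suc n" ..
 show "\<rho> \<in> fixparts k y"
  unfolding fixparts_def
 proof (intro CollectI conjI ballI)
  show "partition_on {1..k} \<rho>" using \<rho> unfolding fixparts_def by blast
  fix A assume A: "A \<in> \<rho>"
  then have "\<exists>A'. (A, A') \<in> Rd e" using fix_Rd_pow[OF \<rho>, of "Suc n"] unfolding n by blast
  then have "sat Y A" using Rd_e by blast
  moreover obtain A' where "A' \<in> \<rho>" "(A, A') \<in> Rd x" using \<rho> A unfolding fixparts_def by blast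
  ultimately show "\<exists>A'\<in>\<rho>. (A, A') \<in> Rd y" using Rd_y by blast
 qed
next
 fix \<rho> assume "\<rho> \<in> fixparts k y"
 then show "\<rho> \<in> fixparts k x" unfolding fixparts_def using Rd_y by blast
qed

lemma dmap_y: assumes "\<rho> \<in> fixparts k y" "A \<in> \<rho>" shows "dmap x A = dmap y A"
proof -
 have "(A, dmap y A) \<in> Rd y" by (rule fixparts_dmap(1)[OF y assms])
 then have "(A, dmap y A) \<in> Rd x" using Rd_y by blast
 then show ?thesis by (rule dmap_eq[OF x])
qed

lemma ubp_char_y: assumes "\<Lambda> \<in> mparts k"
 shows "ubp_char k \<Lambda> x = (\<Sum>\<rho>\<in>fixparts k y. \<Prod>i=1..k. of_int (psi' (\<Lambda> i) {A \<in> \<rho>. card A = i} (dmap y)))"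
 unfolding ubp_char_fixparts[OF assms x] fixparts_y
proof (intro sum.cong prod.cong refl arg_cong[of _ _ of_int])
 fix \<rho> i assume \<rho>: "\<rho> \<in> fixparts k y"
 show "psi' (\<Lambda> i) {A \<in> \<rho>. card A = i} (dmap x) = psi' (\<Lambda> i) {A \<in> \<rho>. card A = i} (dmap y)"
 proof -
  have "dmap x ` Z = dmap y ` Z" if "Z \<subseteq> {A \<in> \<rho>. card A = i}" for Z
   by (rule image_cong[OF refl dmap_y[OF \<rho>]]) (use that in blast)
  then have "psi' (\<Lambda> i) ((\<lambda>A. A) ` {A \<in> \<rho>. card A = i}) (dmap x) = psi' (\<Lambda> i) {A \<in> \<rho>. card A = i} (dmap y)"
   by (intro psi'_reindex) simp_all
  then show ?thesis by simp
 qed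
qed

sublocale wp: wperm Y \<sigma> card
proof
 show "finite Y" by (rule finite_partition[OF Y])
 show "\<sigma> permutes Y" by (rule \<sigma>_perm)
 show "card (\<sigma> A) = card A" if "A \<in> Y" for A unfolding \<sigma>_eq[OF that] by (rule ubp_diag(4)[OF y]) (use that top_y in simp)
 show "card A > 0" if "A \<in> Y" for A using block_card[OF Y that] by simp
qed

lemma Union_inv: assumes "s \<subseteq> Y" shows "{P \<in> Y. P \<subseteq> \<Union>s} = s"
proof (intro subset_antisym subsetI)
 fix P assume P: "P \<in> {P \<in> Y. P \<subseteq> \<Union>s}"
 then have "P \<noteq> {}" using partition_onD3[OF Y] by blast
 then obtain P' where P': "P' \<in> s" "P \<inter> P' \<noteq> {}" using P by blast
 then have "P = P'" using partition_onD2[OF Y] assms P by (metis (no_types, lifting) disjointD mem_Collect_eq subsetD)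
 then show "P \<in> s" using P'(1) by simp
qed (use assms in blast)

lemma Union_inj: "inj_on Union (Pow Y)"
 by (rule inj_on_inverseI[of _ "\<lambda>A. {P \<in> Y. P \<subseteq> A}"]) (rule Union_inv, blast)

lemma IP_sub: "\<rho> \<in> wp.IP Y ==> \<rho> \<subseteq> Pow Y" using wp.IPD(1) partition_onD1 by blast

lemma IP_fix: assumes "\<rho> \<in> wp.IP Y" shows "Union ` \<rho> \<in> fixparts k y"
 unfolding fixparts_def
proof (intro CollectI conjI partition_onI ballI)
 note p = wp.IPD(1)[OF assms] and i = wp.IPD(2)[OF assms] and s = IP_sub[OF assms]
 have "\<Union>(Union ` \<rho>) = \<Union>(\<Union>\<rho>)" by blast
 also have "... = \<Union>Y" using partition_onD1[OF p] by simp
 also have "... = {1..k}" using partition_onD1[OF Y] by simp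
 finally show "\<Union>(Union ` \<rho>) = {1..k}" .
 show "disjnt A A'" if h: "A \<in> Union ` \<rho>" "A' \<in> Union ` \<rho>" "A \<noteq> A'" for A A'
 proof -
  obtain t t' where t: "t \<in> \<rho>" "t' \<in> \<rho>" "A = \<Union>t" "A' = \<Union>t'" using h by blast
  then have "t \<noteq> t'" using h(3) by blast
  then have tt: "t \<inter> t' = {}" using partition_onD2[OF p] t by (meson disjointD)
  have "P \<inter> P' = {}" if P: "P \<in> t" "P' \<in> t'" for P P'
  proof -
   have "P \<in> Y" "P' \<in> Y" using P t(1,2) s by blast+
   moreover have "P \<noteq> P'" using P tt by blast
   ultimately show ?thesis by (rule disjointD[OF partition_onD2[OF Y]])
  qed
  then show ?thesis unfolding t disjnt_def by blast
 qed
 show "{} \<notin> Union ` \<rho>"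
 proof
  assume "{} \<in> Union ` \<rho>"
  then obtain t where t: "t \<in> \<rho>" "{} = \<Union>t" by (rule imageE)
  have "t \<noteq> {}" using partition_onD3[OF p] t(1) by blast
  then obtain P where P: "P \<in> t" by blast
  then have "P = {}" using t(2) by blast
  then show False using P t(1) s partition_onD3[OF Y] by blast
 qed
 fix A assume "A \<in> Union ` \<rho>"
 then obtain t where t: "t \<in> \<rho>" "A = \<Union>t" by blast
 have "\<sigma> ` t \<in> (`) \<sigma> ` \<rho>" using t(1) by (rule imageI)
 then have "\<sigma> ` t \<in> \<rho>" unfolding i .
 moreover have "(\<Union>t, \<Union>(\<sigma> ` t)) \<in> Rd y" using t(1) s by (intro Rd_\<sigma>) blast
 ultimately show "\<exists>A'\<in>Union ` \<rho>. (A, A') \<in> Rd y" unfolding t(2) by blast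
qed

lemma fix_IP: assumes \<rho>: "\<rho> \<in> fixparts k y" shows "\<exists>\<rho>'\<in>wp.IP Y. \<rho> = Union ` \<rho>'"
proof -
 let ?s = "\<lambda>A. {P \<in> Y. P \<subseteq> A}"
 have p: "partition_on {1..k} \<rho>" using \<rho> unfolding fixparts_def by blast
 have A: "\<Union>(?s A) = A" if A: "A \<in> \<rho>" for A
 proof -
  have "sat Y A" using fixparts_dmap(1)[OF y \<rho> A] Rd_y by blast
  then obtain t where "t \<subseteq> Y" "A = \<Union>t" by (auto simp: sat_def)
  then show ?thesis using Union_inv by simp
 qed
 have U: "Union ` ?s ` \<rho> = \<rho>" unfolding image_image using A by simp
 have fin: "finite (?s ` \<rho>)" using finite_partition[OF p] by simp
 have part: "partition_on Y (?s ` \<rho>)"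
 proof (rule partition_onI)
  show "\<Union>(?s ` \<rho>) = Y"
  proof (intro subset_antisym subsetI)
   fix P assume P: "P \<in> Y"
   have "P \<noteq> {}" using P partition_onD3[OF Y] by blast
   then obtain v where v: "v \<in> P" by blast
   then have "v \<in> \<Union>\<rho>" using P partition_onD1[OF Y] partition_onD1[OF p] by blast
   then obtain B where B: "B \<in> \<rho>" "v \<in> B" by blast
   then have "v \<in> \<Union>(?s B)" using A by simp
   then obtain P' where P': "P' \<in> Y" "P' \<subseteq> B" "v \<in> P'" by blast
   have "P = P'"
   proof (rule ccontr)
    assume "P \<noteq> P'"
    then have "P \<inter> P' = {}" by (rule disjointD[OF partition_onD2[OF Y] P P'(1)])
    then show False using v P'(3) by blast
   qed
   then show "P \<in> \<Union>(?s ` \<rho>)" using P P' B(1) by blast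
  qed blast
  show "{} \<notin> ?s ` \<rho>"
  proof
   assume "{} \<in> ?s ` \<rho>"
   then obtain B where B: "{} = ?s B" "B \<in> \<rho>" by (rule imageE)
   have "B = {}" using A[OF B(2)] unfolding B(1)[symmetric] by simp
   then show False using B(2) partition_onD3[OF p] by blast
  qed
  show "disjnt t t'" if h: "t \<in> ?s ` \<rho>" "t' \<in> ?s ` \<rho>" "t \<noteq> t'" for t t'
  proof -
   obtain B B' where B: "B \<in> \<rho>" "B' \<in> \<rho>" "t = ?s B" "t' = ?s B'" using h by blast
   then have "B \<noteq> B'" using h(3) by blast
   then have "B \<inter> B' = {}" using partition_onD2[OF p] B by (meson disjointD)
   then have "P = {}" if "P \<in> t" "P \<in> t'" for P using that B by blast
   moreover have "P \<noteq> {}" if "P \<in> t" for P using that B(3) partition_onD3[OF Y] by blast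
   ultimately show ?thesis unfolding disjnt_def by blast
  qed
 qed
 have "(`) \<sigma> ` ?s ` \<rho> = ?s ` \<rho>"
 proof (rule endo_inj_surj[OF fin])
  show "inj_on ((`) \<sigma>) (?s ` \<rho>)" by (rule inj_on_subset[OF wp.injim]) simp
  show "(`) \<sigma> ` ?s ` \<rho> \<subseteq> ?s ` \<rho>"
  proof
   fix t assume "t \<in> (`) \<sigma> ` ?s ` \<rho>"
   then obtain B where B: "B \<in> \<rho>" "t = \<sigma> ` ?s B" by blast
   have B': "dmap y B \<in> \<rho>" using bij_betwE[OF fixparts_dmap(2)[OF y \<rho>]] B(1) by blast
   have sub: "t \<subseteq> Y" unfolding B(2) using permutes_in_image[OF \<sigma>_perm] by blast
   have "dmap y (\<Union>(?s B)) = \<Union>t" unfolding B(2) by (rule dmap_\<sigma>) blast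
   then have "\<Union>t = dmap y B" unfolding A[OF B(1)] by simp
   then have "t = ?s (dmap y B)" using Union_inv[OF sub] by simp
   then show "t \<in> ?s ` \<rho>" using B' by blast
  qed
 qed
 then have "?s ` \<rho> \<in> wp.IP Y" using part unfolding wp.IP_def by blast
 then show ?thesis using U by (metis (no_types, lifting))
qed

text \<open>A coarsening of \<open>Y\<close> is a set partition of the set \<open>Y\<close>.\<close>

lemma IP_bij: "bij_betw (\<lambda>\<rho>. Union ` \<rho>) (wp.IP Y) (fixparts k y)"
proof (rule bij_betw_imageI)
 show "inj_on (\<lambda>\<rho>. Union ` \<rho>) (wp.IP Y)"
 proof (rule inj_onI)
  fix \<rho> \<rho>' assume h: "\<rho> \<in> wp.IP Y" "\<rho>' \<in> wp.IP Y" "Union ` \<rho> = Union ` \<rho>'"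
  show "\<rho> = \<rho>'" using inj_on_image_eq_iff[OF Union_inj IP_sub[OF h(1)] IP_sub[OF h(2)]] h(3) by blast
 qed
 show "(\<lambda>\<rho>. Union ` \<rho>) ` wp.IP Y = fixparts k y"
 proof (intro subset_antisym subsetI)
  fix \<rho> assume "\<rho> \<in> (\<lambda>\<rho>. Union ` \<rho>) ` wp.IP Y" then show "\<rho> \<in> fixparts k y" using IP_fix by blast
 next
  fix \<rho> assume "\<rho> \<in> fixparts k y" then show "\<rho> \<in> (\<lambda>\<rho>. Union ` \<rho>) ` wp.IP Y" using fix_IP by blast
 qed
qed

lemma W_card: assumes "s \<subseteq> Y" shows "wp.W s = card (\<Union>s)"
proof -
 have "card (\<Union>s) = sum card s"
 proof (rule card_Union_disjoint)
  show "pairwise disjnt s" using partition_onD2[OF Y] assms unfolding disjoint_def pairwise_def disjnt_def by blast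
  show "finite A" if "A \<in> s" for A using that assms wp.w_pos[of A] card_ge_0_finite by blast
 qed
 then show ?thesis by (simp add: wp.W_def)
qed

text \<open>The weight of a set of blocks is the size of its union, so \<open>psi'\<close> is transported along \<open>IP_bij\<close>.\<close>

theorem ubp_char_sm: assumes "\<Lambda> \<in> mparts k"
 shows "ubp_char k \<Lambda> x = wp.sm (wp.hP \<Lambda> {1..k}) Y"
proof -
 let ?t = "\<lambda>\<rho>. \<Prod>i=1..k. of_int (psi' (\<Lambda> i) {A \<in> \<rho>. card A = i} (dmap y)) :: complex"
 have "ubp_char k \<Lambda> x = (\<Sum>\<rho>\<in>wp.IP Y. ?t (Union ` \<rho>))"
  unfolding ubp_char_y[OF assms] by (rule sum.reindex_bij_betw[OF IP_bij, symmetric])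
 also have "... = (\<Sum>\<rho>\<in>wp.IP Y. wp.hP \<Lambda> {1..k} \<rho>)"
 proof (rule sum.cong[OF refl])
  fix \<rho> assume \<rho>: "\<rho> \<in> wp.IP Y"
  note s = IP_sub[OF \<rho>]
  have W: "wp.W t = card (\<Union>t)" if "t \<in> \<rho>" for t using that s W_card by blast
  have pU: "partition_on {1..k} (Union ` \<rho>)" using IP_fix[OF \<rho>] unfolding fixparts_def by blast
  have all: "\<forall>t\<in>\<rho>. wp.W t \<in> {1..k}" using W block_card[OF pU] by simp
  have "psi' (\<Lambda> i) {A \<in> Union ` \<rho>. card A = i} (dmap y) = psi' (\<Lambda> i) {t \<in> \<rho>. wp.W t = i} ((`) \<sigma>)" for i
  proof -
   let ?X = "{t \<in> \<rho>. wp.W t = i}"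
   have im: "{A \<in> Union ` \<rho>. card A = i} = Union ` ?X" using W by auto
   show ?thesis
    unfolding im
   proof (rule psi'_reindex)
    show "inj_on Union ?X" by (rule inj_on_subset[OF Union_inj]) (use s in blast)
    fix Z assume "Z \<subseteq> ?X"
    then have Z: "Z \<subseteq> Pow Y" using s by blast
    have gZ: "(`) \<sigma> ` Z \<subseteq> Pow Y" using Z permutes_in_image[OF \<sigma>_perm] by blast
    have "dmap y ` Union ` Z = Union ` (`) \<sigma> ` Z"
     unfolding image_image by (rule image_cong[OF refl dmap_\<sigma>]) (use Z in blast)
    then show "dmap y ` Union ` Z = Union ` Z \<longleftrightarrow> (`) \<sigma> ` Z = Z"
     using inj_on_image_eq_iff[OF Union_inj gZ Z] by (simp only:)
   qed
  qed
  then show "?t (Union ` \<rho>) = wp.hP \<Lambda> {1..k} \<rho>" unfolding wp.hP_def if_P[OF all] by (simp only:)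
 qed
 finally show ?thesis by (simp only: wp.sm_def)
qed

lemma orbit_\<sigma>: assumes "A \<in> Y" shows "orbit (block_map y) A = orbit \<sigma> A"
proof (rule orbit_agree(1)[OF assms])
 show "block_map y B \<in> Y" if "B \<in> Y" for B using bij_betwE[OF bm_y] that by blast
 show "block_map y B = \<sigma> B" if "B \<in> Y" for B by (rule \<sigma>_eq[OF that, symmetric])
qed

lemma lookup_mon_cycletype: "lookup (wp.mon Y) (a, b) = count (cycletype k x b) a"
proof -
 let ?X = "{A \<in> Y. card A = b}"
 have fin: "finite ?X" using wp.fY by simp
 have o: "orbit (block_map y) ` ?X = orbit \<sigma> ` ?X" by (rule image_cong[OF refl orbit_\<sigma>]) simp
 have "cycletype k x b = image_mset card (mset_set (orbit \<sigma> ` ?X))"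
  unfolding cycletype_def Let_def perm_cycle_type_def e_def[symmetric] y_def[symmetric] Y_def[symmetric] o ..
 then have "count (cycletype k x b) a = (\<Sum>Q | Q \<in># mset_set (orbit \<sigma> ` ?X) \<and> a = card Q. count (mset_set (orbit \<sigma> ` ?X)) Q)"
  by (simp only: count_image_mset')
 also have "... = (\<Sum>Q | Q \<in> orbit \<sigma> ` ?X \<and> a = card Q. 1)"
  by (rule sum.cong) (use fin in auto)
 also have "... = card {Q \<in> orbit \<sigma> ` ?X. a = card Q}" by simp
 also have "{Q \<in> orbit \<sigma> ` ?X. a = card Q} = {Q \<in> wp.orbs Y. wp.color Q = (a, b)}"
 proof (intro subset_antisym subsetI)
  fix Q assume "Q \<in> {Q \<in> orbit \<sigma> ` ?X. a = card Q}"
  then obtain A where "A \<in> Y" "card A = b" "Q = orbit \<sigma> A" "a = card Q" by blast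
  then show "Q \<in> {Q \<in> wp.orbs Y. wp.color Q = (a, b)}" using wp.color_orbit[of A] by (auto simp: wp.orbs_def)
 next
  fix Q assume "Q \<in> {Q \<in> wp.orbs Y. wp.color Q = (a, b)}"
  then obtain A where "A \<in> Y" "Q = orbit \<sigma> A" "wp.color Q = (a, b)" by (auto simp: wp.orbs_def)
  then show "Q \<in> {Q \<in> orbit \<sigma> ` ?X. a = card Q}" using wp.color_orbit[of A] by auto
 qed
 also have "card ... = lookup (wp.mon Y) (a, b)" by (rule wp.lookup_mon[OF wp.Inv_Y, symmetric])
 finally show ?thesis ..
qed

theorem ubp_char_scalar: assumes "\<Lambda> \<in> mparts k" "\<mu> \<in> mparts k" "cycletype k x = \<mu>"
 shows "ubp_char k \<Lambda> x = scalar (schur_E k \<Lambda>) (pX k \<mu>)"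
proof -
 have "wp.mon Y = mexp k \<mu>"
 proof (rule poly_mapping_eqI)
  fix ab :: "nat \<times> nat"
  obtain a b where ab: "ab = (a, b)" by (cases ab)
  show "lookup (wp.mon Y) ab = lookup (mexp k \<mu>) ab"
   unfolding ab lookup_mon_cycletype lookup_mexp'[OF assms(2)] assms(3) ..
 qed
 then show ?thesis unfolding ubp_char_sm[OF assms(1)] pX_mexp wp.scalar_schur_E[symmetric] by simp
qed

end

subsection \<open>Diagrams of given cycle type\<close>

text \<open>Enumerate \<open>Z\<close> by the residues modulo its size and add 1.\<close>

lemma ex_cycle: assumes "finite Z" "Z \<noteq> {}" shows "\<exists>c. bij_betw c Z Z \<and> (\<forall>z\<in>Z. orbit c z = Z)"
proof -
 let ?m = "card Z"
 have m: "?m > 0" using assms by (simp add: card_gt_0_iff)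
 obtain h where h: "bij_betw h {0..<?m} Z" using ex_bij_betw_nat_finite[OF assms(1)] by blast
 let ?i = "inv_into {0..<?m} h"
 define c where "c z = h (Suc (?i z) mod ?m)" for z
 have hz: "h j \<in> Z" if "j < ?m" for j using bij_betwE[OF h] that by simp
 have ch: "c (h j) = h (Suc j mod ?m)" if "j < ?m" for j
  unfolding c_def using inv_into_f_f[of h "{0..<?m}" j] h that by (simp add: bij_betw_def)
 have surj: "\<exists>j<?m. z = h j" if "z \<in> Z" for z
  using h that unfolding bij_betw_def by force
 have cZ: "c z \<in> Z" for z unfolding c_def using hz m by simp
 have fwd: "h ((j + Suc n) mod ?m) \<in> orbit c (h j)" if j: "j < ?m" for j n
 proof (induction n)
  case 0
  show ?case using orbit.base[of c "h j"] ch[OF j] by simp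
 next
  case (Suc n)
  have "c (h ((j + Suc n) mod ?m)) = h (Suc ((j + Suc n) mod ?m) mod ?m)" by (rule ch) (use m in simp)
  then have "c (h ((j + Suc n) mod ?m)) = h ((j + Suc (Suc n)) mod ?m)" by (simp add: mod_Suc_eq)
  then show ?case using orbit.step[OF Suc] by simp
 qed
 have orb: "orbit c z = Z" if z: "z \<in> Z" for z
 proof (intro subset_antisym subsetI)
  fix v assume "v \<in> orbit c z" then show "v \<in> Z" by (cases) (use cZ in auto)
 next
  fix v assume "v \<in> Z"
  then obtain i where i: "i < ?m" "v = h i" using surj by blast
  obtain j where j: "j < ?m" "z = h j" using surj[OF z] by blast
  \<comment> \<open>\<open>j + Suc n\<close> is congruent to \<open>i\<close>; adding \<open>?m\<close> avoids a negative difference\<close>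
  define n where "n = i + ?m - j - 1"
  have "j + Suc n = i + ?m" using i j by (simp add: n_def)
  then have "(j + Suc n) mod ?m = i" using i by simp
  then show "v \<in> orbit c z" using fwd[OF j(1), of n] i j by simp
 qed
 have im: "c ` Z = Z"
 proof (intro subset_antisym subsetI)
  fix v assume v: "v \<in> Z"
  then have "v \<in> orbit c v" using orb by simp
  then show "v \<in> c ` Z"
  proof cases
   case base then show ?thesis using v by (metis imageI)
  next
   case (step w)
   then have "w \<in> Z" using orb[OF v] by simp
   then show ?thesis using step by (metis imageI)
  qed
 qed (use cZ in blast)
 have "inj_on c Z" by (rule eq_card_imp_inj_on[OF assms(1)]) (simp only: im)
 then have "bij_betw c Z Z" using im by (rule bij_betw_imageI)
 then show ?thesis using orb by blast
qed

lemma ex_perm_cycle_type: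
 "0 \<notin># \<nu> ==> finite X ==> card X = \<Sum>\<^sub># \<nu> ==> \<exists>f. bij_betw f X X \<and> perm_cycle_type f X = \<nu>"
proof (induction \<nu> arbitrary: X)
 case empty
 then have "X = {}" by simp
 then show ?case by (auto simp: perm_cycle_type_def bij_betw_def)
next
 case (add m \<nu>)
 have m: "m > 0" using add.prems(1) by (cases m) auto
 have cX: "card X = m + \<Sum>\<^sub># \<nu>" using add.prems(3) by simp
 obtain Z where Z: "Z \<subseteq> X" "card Z = m" using obtain_subset_with_card_n[of m X] cX by auto
 have fZ: "finite Z" using Z(1) add.prems(2) by (rule finite_subset)
 have "Z \<noteq> {}" using Z(2) m by auto
 from ex_cycle[OF fZ this] obtain c where c: "bij_betw c Z Z" "\<And>z. z \<in> Z ==> orbit c z = Z" by blast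
 have "card (X - Z) = \<Sum>\<^sub># \<nu>" using card_Diff_subset[OF fZ Z(1)] cX Z(2) by simp
 then obtain f where f: "bij_betw f (X - Z) (X - Z)" "perm_cycle_type f (X - Z) = \<nu>"
  using add.IH[of "X - Z"] add.prems by auto
 let ?g = "\<lambda>x. if x \<in> Z then c x else f x"
 have gZ: "bij_betw ?g Z Z" using bij_betw_cong[of Z ?g c Z] c(1) by simp
 have gX: "bij_betw ?g (X - Z) (X - Z)" using bij_betw_cong[of "X - Z" ?g f "X - Z"] f(1) by simp
 have b: "bij_betw ?g X X"
 proof -
  have "bij_betw ?g (Z \<union> (X - Z)) (Z \<union> (X - Z))" by (rule bij_betw_combine[OF gZ gX]) blast
  then show ?thesis using Z(1) by (simp add: Un_absorb1)
 qed
 have oZ: "orbit ?g z = Z" if "z \<in> Z" for z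
  using orbit_agree(1)[of z Z ?g c] bij_betwE[OF gZ] c(2) that by simp
 have oX: "orbit ?g x = orbit f x" "orbit f x \<subseteq> X - Z" if "x \<in> X - Z" for x
  using orbit_agree[of x "X - Z" f ?g] bij_betwE[OF f(1)] that by simp_all
 have "orbit ?g ` X = orbit ?g ` Z \<union> orbit ?g ` (X - Z)" using Z(1) by blast
 also have "orbit ?g ` Z = {Z}" using oZ `Z \<noteq> {}` by auto
 also have "orbit ?g ` (X - Z) = orbit f ` (X - Z)" by (rule image_cong[OF refl oX(1)])
 finally have im: "orbit ?g ` X = insert Z (orbit f ` (X - Z))" by simp
 have "Z \<notin> orbit f ` (X - Z)" using oX(2) `Z \<noteq> {}` by blast
 moreover have "finite (orbit f ` (X - Z))" using add.prems(2) by simp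
 ultimately have "perm_cycle_type ?g X = add_mset m \<nu>"
  unfolding perm_cycle_type_def im using f(2) Z(2) by (simp add: perm_cycle_type_def)
 then show ?case using b by blast
qed

text \<open>Permute the blocks of each size of the standard set partition with the prescribed cycle type. All powers
  of the resulting diagram \<open>d\<close> have the same top, so $d^\omega$ is the identity of its group.\<close>

lemma ex_cycletype: assumes "\<mu> \<in> mparts k" shows "\<exists>d\<in>ubp k. cycletype k d = \<mu>"
proof -
 define \<pi> where "\<pi> = std_pi k \<mu>"
 let ?X = "\<lambda>i. {A \<in> \<pi>. card A = i}"
 note sp = std_pi[OF assms, folded \<pi>_def]
 have fin: "finite \<pi>" by (rule finite_partition[OF sp(1)])
 have "\<exists>f. bij_betw f (?X i) (?X i) \<and> perm_cycle_type f (?X i) = \<mu> i" for i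
 proof (rule ex_perm_cycle_type)
  show "0 \<notin># \<mu> i" using assms by (simp add: mparts_def is_partition_def)
  show "finite (?X i)" using fin by simp
  show "card (?X i) = \<Sum>\<^sub># (\<mu> i)"
  proof (cases "i \<in> {1..k}")
   case True then show ?thesis by (rule sp(2))
  next
   case False
   then have "?X i = {}" using block_card[OF sp(1)] by blast
   moreover have "\<mu> i = {#}" using False assms unfolding mparts_def by blast
   ultimately show ?thesis by (metis card.empty sum_mset.empty)
  qed
 qed
 then have "\<forall>i. \<exists>f. bij_betw f (?X i) (?X i) \<and> perm_cycle_type f (?X i) = \<mu> i" by (rule allI)
 from choice[OF this] obtain f where f0: "\<forall>i. bij_betw (f i) (?X i) (?X i) \<and> perm_cycle_type (f i) (?X i) = \<mu> i" ..
 have f: "bij_betw (f i) (?X i) (?X i)" "perm_cycle_type (f i) (?X i) = \<mu> i" for i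
  by (rule conjunct1[OF spec[OF f0]], rule conjunct2[OF spec[OF f0]])
 define \<phi> where "\<phi> A = f (card A) A" for A
 have b: "bij_betw \<phi> \<pi> \<pi>" and v: "\<And>A. A \<in> \<pi> ==> card (\<phi> A) = card A"
  using bij_by_card[of UNIV f \<pi> \<pi>, OF f(1)] unfolding \<phi>_def by simp_all
 have "\<forall>A\<in>\<pi>. card (\<phi> A) = card A" using v by blast
 note D = diag_ubp'[OF sp(1) sp(1) b this]
 define d where "d = diag \<pi> \<phi>"
 note D = D[folded d_def]
 interpret omega_elt k d by unfold_locales (rule D(1))
 have pw: "ubp_top (d [^]\<^bsub>ubp_monoid k\<^esub> Suc n) = \<pi> \<and> ubp_bot (d [^]\<^bsub>ubp_monoid k\<^esub> Suc n) = \<pi>" for n :: nat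
 proof (induction n)
  case 0
  have "d [^]\<^bsub>ubp_monoid k\<^esub> Suc 0 = d"
   unfolding nat_pow_Suc nat_pow_0 by (rule monoid.l_one[OF monoid_ubp]) (use D(1) in "simp add: ubp_monoid_def")
  then show ?case using D(2,3) by simp
 next
  case (Suc n)
  have e: "d [^]\<^bsub>ubp_monoid k\<^esub> Suc (Suc n) = ubp_mult (d [^]\<^bsub>ubp_monoid k\<^esub> Suc n) d"
   unfolding nat_pow_Suc[of _ d "Suc n"] by (simp add: ubp_monoid_def)
  have "ubp_bot (d [^]\<^bsub>ubp_monoid k\<^esub> Suc n) = ubp_top d" using Suc D(2) by simp
  note m = mult_match[OF pow_ubp[OF D(1)] D(1) this]
  show ?case unfolding e using m(3,4) Suc D(3) by simp
 qed
 from e_pow obtain n where n: "e = d [^]\<^bsub>ubp_monoid k\<^esub> Suc n" ..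
 have Y: "Y = \<pi>" unfolding Y_def n using pw by blast
 have bm: "block_map y A = \<phi> A" if A: "A \<in> \<pi>" for A
 proof -
  have "(A, block_map y A) \<in> Rd y" using ubp_diag(6)[OF y] A top_y Y by simp
  then have 1: "(A, block_map y A) \<in> Rd d" using Rd_y by blast
  have "(A, block_map d A) \<in> Rd d" using ubp_diag(6)[OF D(1)] A D(2) by simp
  then show ?thesis using Rd_fun[OF D(1) 1] D(4)[OF A] by simp
 qed
 have "cycletype k d i = \<mu> i" for i
 proof -
  have "orbit (block_map y) ` ?X i = orbit (f i) ` ?X i"
  proof (rule image_cong[OF refl])
   fix A assume A: "A \<in> ?X i"
   have m: "f i B \<in> ?X i" if "B \<in> ?X i" for B using bij_betwE[OF f(1)] that by blast
   show "orbit (block_map y) A = orbit (f i) A"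
    by (rule orbit_agree(1)[OF A m, symmetric]) (use bm in "auto simp: \<phi>_def")
  qed
  then show ?thesis
   unfolding cycletype_def Let_def e_def[symmetric] y_def[symmetric] Y_def[symmetric] Y
   using f(2)[of i] by (simp add: perm_cycle_type_def)
 qed
 then show ?thesis using D(1) by blast
qed

theorem theorem5p4:
  fixes k :: nat and \<Lambda> :: "nat \<Rightarrow> nat multiset"
  assumes "k \<ge> 1" and "\<Lambda> \<in> mparts k"
  shows "(\<forall>\<mu>\<in>mparts k. \<forall>d\<in>ubp k. cycletype k d = \<mu> \<longrightarrow>
            ubp_char k \<Lambda> d = scalar (schur_E k \<Lambda>) (pX k \<mu>))
       \<and> frobenius_map k (ubp_char k \<Lambda>) = schur_E k \<Lambda>"
proof
  have part1: "ubp_char k \<Lambda> d = scalar (schur_E k \<Lambda>) (pX k \<mu>)"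
    if "\<mu> \<in> mparts k" "d \<in> ubp k" "cycletype k d = \<mu>" for \<mu> d
    by (rule omega_elt.ubp_char_scalar[OF omega_elt.intro[OF that(2)] assms(2) that(1,3)])
  then show "\<forall>\<mu>\<in>mparts k. \<forall>d\<in>ubp k. cycletype k d = \<mu> \<longrightarrow> ubp_char k \<Lambda> d = scalar (schur_E k \<Lambda>) (pX k \<mu>)" by blast
  have "frobenius_map k (ubp_char k \<Lambda>) = (\<Sum>\<mu>\<in>mparts k. smul (scalar (schur_E k \<Lambda>) (pX k \<mu>) / of_nat (z_vec k \<mu>)) (pX k \<mu>))"
    unfolding frobenius_map_def
  proof (rule sum.cong[OF refl])
    fix \<mu> assume \<mu>: "\<mu> \<in> mparts k"
    let ?d = "SOME d. d \<in> ubp k \<and> cycletype k d = \<mu>"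
    have "\<exists>d. d \<in> ubp k \<and> cycletype k d = \<mu>" using ex_cycletype[OF \<mu>] by blast
    then have "?d \<in> ubp k \<and> cycletype k ?d = \<mu>" by (rule someI_ex)
    then have "ubp_char k \<Lambda> ?d = scalar (schur_E k \<Lambda>) (pX k \<mu>)" using part1[OF \<mu>] by blast
    then show "smul (ubp_char k \<Lambda> ?d / of_nat (z_vec k \<mu>)) (pX k \<mu>) =
      smul (scalar (schur_E k \<Lambda>) (pX k \<mu>) / of_nat (z_vec k \<mu>)) (pX k \<mu>)" by simp
  qed
  also have "\<dots> = schur_E k \<Lambda>" by (rule schur_E_expand[OF assms(2)])
  finally show "frobenius_map k (ubp_char k \<Lambda>) = schur_E k \<Lambda>" .
qed

end
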